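(* Let $p\in(1,\infty)$. Let $(\psi_\varepsilon)$ be a sequence of locally periodic transformations with limit transformation $\psi_0$ and $\Omega_\varepsilon=\psi_\varepsilon(\hat\Omega_\varepsilon)$. Let $u_\varepsilon$ be a bounded sequence in $L^p(\Omega_\varepsilon)$ (i.e. $\|u_\varepsilon\|_{L^p(\Omega_\varepsilon)}\le C$ with $C$ independent of $\varepsilon$). Then there exist $u_0\in L^p(\Omega;L^p(Y^*_x))$ and a subsequence $\varepsilon'$ such that $\widetilde{u_{\varepsilon'}}$ two-scale converges weakly in $L^p$ to $\widetilde{u_0}$.
   Context: Conventions. $(\varepsilon)=(\varepsilon_n)_{n\in\mathbb N}$ is a fixed sequence of positive numbers converging to $0$ (index suppressed); $\varepsilon'$ denotes a subsequence; constants $C,c_J>0$ are independent of $\varepsilon$. $Y=[0,1]^N$; the subscript $\#$ denotes $Y$-periodicity in $y$. Two-scale convergence. Let $U\subset\mathbb R^N$ be bounded and open and $p,q\in(1,\infty)$ with $1/p+1/q=1$. A sequence $v_\varepsilon\in L^p(U)$ two-scale converges weakly in $L^p$ to $v_0\in L^p(U\times Y)$ if $\lim_{\varepsilon\to0}\int_U v_\varepsilon(x)\varphi(x,x/\varepsilon)\,dx=\int_U\int_Y v_0(x,y)\varphi(x,y)\,dy\,dx$ for all $\varphi\in L^q(U;C_\#(Y))$. It converges strongly in $L^p$ if in addition $\lim_{\varepsilon\to0}\|v_\varepsilon\|_{L^p(U)}=\|v_0\|_{L^p(U\times Y)}$. Geometry. $Y^*\subset Y$ is open and $Y^*_\#:=\operatorname{int}\big(\bigcup_{k\in\mathbb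 Z^N}(k+\overline{Y^*})\big)$ has Lipschitz boundary. $\Omega\subset\mathbb R^N$ is bounded, open, with Lipschitz boundary, and $\hat\Omega_\varepsilon:=\Omega\cap\varepsilon Y^*_\#$. Extension by zero is denoted by $\widetilde{\cdot}$: functions on $\hat\Omega_\varepsilon$ are extended to $\Omega$, functions on $\Omega\times Y^*$ to $\Omega\times Y$. Locally periodic transformations. A sequence of $C^1$-diffeomorphisms $\psi_\varepsilon:\overline{\hat\Omega_\varepsilon}\to\overline{\Omega_\varepsilon}$, $\Omega_\varepsilon:=\psi_\varepsilon(\hat\Omega_\varepsilon)\subset\mathbb R^N$, is a sequence of locally periodic transformations if: (1) there is $c_J>0$ with $J_\varepsilon:=\det\Psi_\varepsilon\ge c_J$, where $\Psi_\varepsilon:=D\psi_\varepsilon$; (2) with $\check\psi_\varepsilon(x):=\psi_\varepsilon(x)-x$ there is $C>0$ with $\varepsilon^{-1}\|\check\psi_\varepsilon\|_{C(\overline{\hat\Omega_\varepsilon})}+\|\nabla\check\psi_\varepsilon\|_{C(\overline{\hat\Omega_\varepsilon})}\le C$; (3) there is $\psi_0\in L^\infty(\Omega;C^1(\overline{Y^*}))^N$ (the limit transformation) such that (a) for a.e. $x\in\Omega$, $\psi_0(x,\cdot):\overline{Y^*}\to\overline{Y^*_x}$ with $Y^*_x:=\psi_0(x,Y^* )\subset Y$ is a $C^1$-diffeomorphism, (b) $\check\psi_0(x,y):=\psi_0(x,y)-y$ can be extended $Y$-periodically such that $\check\psi_0\in L^\infty(\Omega;C^1_\#(\overline{Y^*}))^N$,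 (c) for every $q\in(1,\infty)$, $\varepsilon^{-1}\widetilde{\check\psi_\varepsilon}$ and $\widetilde{\nabla\check\psi_\varepsilon}$ two-scale converge strongly in $L^q$ (on $U=\Omega$) to $\widetilde{\check\psi_0}$ and $\widetilde{\nabla_y\check\psi_0}$, respectively. $\psi_0^{-1}(x,\cdot)$ denotes the inverse of $\psi_0(x,\cdot)$. Functions on $\Omega_\varepsilon$. Let $Q:=\{(x,y)\in\Omega\times Y: y\in Y^*_x\}$. A small $\delta>0$ is fixed and $\Omega^{(\delta)}:=\{x\in\mathbb R^N:\operatorname{dist}(x,\Omega)<\delta\}$; then $\Omega_\varepsilon\subset\Omega^{(\delta)}$ for $\varepsilon$ small enough. Functions on $\Omega_\varepsilon$ are extended by $0$ to $\Omega^{(\delta)}$ and functions on $Q$ by $0$ to $\Omega^{(\delta)}\times Y$ (also denoted $\widetilde{\cdot}$). Two-scale convergence of extended functions on $\Omega_\varepsilon$ is meant on $U=\Omega^{(\delta)}$. Function space. $L^p(\Omega;L^p(Y^*_x)):=\{(x,y)\mapsto f(x,\psi_0^{-1}(x,y)) : f\in L^p(\Omega;L^p(Y^* ))\}$, with norm $\|\cdot\|_{L^p(Q)}$.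
   Formalization: The formal theorem additionally assumes that the boundary of Y* has Lebesgue measure zero; without it the claim fails, e.g. for Y* open and dense in Y with measure below 1, all transformations the identity and u_ε = 1. *)

theory Defs
  imports "HOL-Analysis.Analysis"
begin

section \<open>Lebesgue spaces and extension by zero\<close>

text \<open>
  Elements of \<open>L\<^sup>p\<close> are represented by functions, not by classes of functions
  that agree almost everywhere.
\<close>

definition Lp :: "real \<Rightarrow> 'a::euclidean_space set \<Rightarrow> ('a \<Rightarrow> 'b::euclidean_space) set" where
  "Lp p S = {f. f \<in> borel_measurable (lebesgue_on S) \<and>
                integrable (lebesgue_on S) (\<lambda>x. norm (f x) powr p)}"

definition Lp_norm :: "real \<Rightarrow> 'a::euclidean_space set \<Rightarrow> ('a \<Rightarrow> 'b::euclidean_space) \<Rightarrow> real" where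
  "Lp_norm p S f = (LINT x|lebesgue_on S. norm (f x) powr p) powr (1 / p)"

definition ext0 :: "'a set \<Rightarrow> ('a \<Rightarrow> 'b::zero) \<Rightarrow> 'a \<Rightarrow> 'b" where
  "ext0 S f = (\<lambda>x. if x \<in> S then f x else 0)"


section \<open>Two-scale convergence\<close>

definition unit_cell :: "(real^'n) set" where
  "unit_cell = cbox 0 1"

definition int_lattice :: "(real^'n) set" where
  "int_lattice = {k. \<forall>i. k $ i \<in> \<int>}"

definition Y_periodic :: "(real^'n \<Rightarrow> 'b) \<Rightarrow> bool" where
  "Y_periodic f \<longleftrightarrow> (\<forall>k\<in>int_lattice. \<forall>y. f (y + k) = f y)"

text \<open>
  The space \<open>L\<^sup>q(U; C\<^sub>#(Y))\<close>: \<open>C\<^sub>#(Y)\<close> consists of the periodic elements of the Banach space of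
  bounded continuous functions on the whole space, with the supremum norm. As this subspace is
  separable, Borel measurability of \<open>\<phi>\<close> is the same as strong (Bochner) measurability.
\<close>

definition Lq_C_per :: "real \<Rightarrow> (real^'n) set \<Rightarrow> (real^'n \<Rightarrow> ((real^'n) \<Rightarrow>\<^sub>C real)) set" where
  "Lq_C_per q U = {\<phi>. \<phi> \<in> borel_measurable (lebesgue_on U) \<and>
                      (\<forall>x\<in>U. Y_periodic (apply_bcontfun (\<phi> x))) \<and>
                      integrable (lebesgue_on U) (\<lambda>x. norm (\<phi> x) powr q)}"

text \<open>
  The values may be scalars, vectors or matrices; test functions are always scalar, so that
  weak convergence is convergence of all components.
\<close>

definition two_scale_weak ::
  "real \<Rightarrow> (nat \<Rightarrow> real) \<Rightarrow> (real^'n) set \<Rightarrow> (nat \<Rightarrow> real^'n \<Rightarrow> 'b::euclidean_space)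
    \<Rightarrow> ((real^'n) \<times> (real^'n) \<Rightarrow> 'b) \<Rightarrow> bool" where
  "two_scale_weak p \<epsilon> U v v0 \<longleftrightarrow>
     (\<forall>n. v n \<in> Lp p U) \<and> v0 \<in> Lp p (U \<times> unit_cell) \<and>
     (\<forall>q \<phi>. 1 / p + 1 / q = 1 \<longrightarrow> \<phi> \<in> Lq_C_per q U \<longrightarrow>
        (\<lambda>n. LINT x|lebesgue_on U. apply_bcontfun (\<phi> x) (x /\<^sub>R \<epsilon> n) *\<^sub>R v n x)
        \<longlonglongrightarrow> (LINT x|lebesgue_on U. LINT y|lebesgue_on unit_cell.
                apply_bcontfun (\<phi> x) y *\<^sub>R v0 (x, y)))"

definition two_scale_strong ::
  "real \<Rightarrow> (nat \<Rightarrow> real) \<Rightarrow> (real^'n) set \<Rightarrow> (nat \<Rightarrow> real^'n \<Rightarrow> 'b::euclidean_space)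
    \<Rightarrow> ((real^'n) \<times> (real^'n) \<Rightarrow> 'b) \<Rightarrow> bool" where
  "two_scale_strong p \<epsilon> U v v0 \<longleftrightarrow>
     two_scale_weak p \<epsilon> U v v0 \<and>
     (\<lambda>n. Lp_norm p U (v n)) \<longlonglongrightarrow> Lp_norm p (U \<times> unit_cell) v0"


section \<open>Geometry\<close>

text \<open>
  Near each boundary point the set is the strict epigraph of a Lipschitz function over the
  hyperplane orthogonal to some unit vector \<open>e\<close>; \<open>z - (z \<bullet> e) *\<^sub>R e\<close> is the projection
  onto this hyperplane.
\<close>

definition lipschitz_boundary :: "'a::euclidean_space set \<Rightarrow> bool" where
  "lipschitz_boundary S \<longleftrightarrow>
     (\<forall>x0\<in>frontier S. \<exists>e r L \<gamma>. norm e = 1 \<and> r > 0 \<and> lipschitz_on L UNIV (\<gamma> :: 'a \<Rightarrow> real) \<and>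
        S \<inter> ball x0 r = {z \<in> ball x0 r. \<gamma> (z - (z \<bullet> e) *\<^sub>R e) < z \<bullet> e})"

definition periodic_cell :: "(real^'n) set \<Rightarrow> (real^'n) set" where
  "periodic_cell Ystar = interior (\<Union>k\<in>int_lattice. (\<lambda>y. k + y) ` closure Ystar)"

definition ref_domain :: "(real^'n) set \<Rightarrow> (real^'n) set \<Rightarrow> real \<Rightarrow> (real^'n) set" where
  "ref_domain \<Omega> Ystar e = \<Omega> \<inter> (\<lambda>y. e *\<^sub>R y) ` periodic_cell Ystar"

definition nbhd :: "real \<Rightarrow> 'a::metric_space set \<Rightarrow> 'a set" where
  "nbhd \<delta> \<Omega> = {x. \<exists>z\<in>\<Omega>. dist x z < \<delta>}"


section \<open>Continuously differentiable functions and diffeomorphisms on closures\<close>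

abbreviation jac :: "(real^'n \<Rightarrow> real^'n) \<Rightarrow> real^'n \<Rightarrow> real^'n^'n" where
  "jac f x \<equiv> jacobian f (at x)"

text \<open>
  For open \<open>U\<close>, membership in \<open>C\<^sup>1\<close> of the closure of \<open>U\<close> means that \<open>f\<close> is continuous on the
  closure, and its derivative on \<open>U\<close> extends continuously to the closure. Uniform bounds on \<open>f\<close> and
  \<open>jac f\<close> over the closure are therefore the same as those over \<open>U\<close>.
\<close>

definition C1_cl :: "(real^'n) set \<Rightarrow> (real^'n \<Rightarrow> real^'n) set" where
  "C1_cl U = {f. continuous_on (closure U) f \<and> (\<forall>x\<in>U. f differentiable (at x)) \<and>
                 (\<exists>D. continuous_on (closure U) D \<and> (\<forall>x\<in>U. D x = jac f x))}"

text \<open>\<open>C\<^sup>1\<^sub>#\<close> of the closure of \<open>Y\<^sup>*\<close>, each function being given by its periodic extension.\<close>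

definition C1_per :: "(real^'n) set \<Rightarrow> (real^'n \<Rightarrow> real^'n) set" where
  "C1_per Ystar = {f \<in> C1_cl (periodic_cell Ystar). Y_periodic f}"

text \<open>
  \<open>L\<^sup>\<infinity>(\<Omega>; X)\<close> for a subspace \<open>X\<close> of \<open>C1_cl U\<close> with the \<open>C\<^sup>1\<close> norm: strong measurability
  (almost everywhere limit of simple functions in the norm of \<open>X\<close>) and essential boundedness.
\<close>

definition Linf_C1 ::
  "(real^'n) set \<Rightarrow> (real^'n) set \<Rightarrow> (real^'n \<Rightarrow> real^'n) set
    \<Rightarrow> (real^'n \<Rightarrow> real^'n \<Rightarrow> real^'n) set" where
  "Linf_C1 \<Omega> U X = {f.
     (\<exists>s. (\<forall>k. simple_function (lebesgue_on \<Omega>) (s k) \<and> s k ` \<Omega> \<subseteq> X) \<and>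
          (AE x in lebesgue_on \<Omega>. f x \<in> X \<and>
             uniform_limit U (\<lambda>k. s k x) (f x) sequentially \<and>
             uniform_limit U (\<lambda>k. jac (s k x)) (jac (f x)) sequentially)) \<and>
     (\<exists>C. AE x in lebesgue_on \<Omega>. \<forall>y\<in>U. norm (f x y) \<le> C \<and> norm (jac (f x) y) \<le> C)}"

definition C1_diffeo_cl :: "(real^'n) set \<Rightarrow> (real^'n) set \<Rightarrow> (real^'n \<Rightarrow> real^'n) \<Rightarrow> bool" where
  "C1_diffeo_cl U V f \<longleftrightarrow>
     f ` U = V \<and> bij_betw f (closure U) (closure V) \<and>
     f \<in> C1_cl U \<and> inv_into (closure U) f \<in> C1_cl V"


section \<open>Locally periodic transformations\<close>

definition locally_periodic_transformations ::
  "(nat \<Rightarrow> real) \<Rightarrow> (real^'n) set \<Rightarrow> (real^'n) set \<Rightarrow> (nat \<Rightarrow> real^'n \<Rightarrow> real^'n)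
    \<Rightarrow> (real^'n \<Rightarrow> real^'n \<Rightarrow> real^'n) \<Rightarrow> bool" where
  "locally_periodic_transformations \<epsilon> \<Omega> Ystar \<psi> \<psi>0 \<longleftrightarrow>
     (\<forall>n. C1_diffeo_cl (ref_domain \<Omega> Ystar (\<epsilon> n)) (\<psi> n ` ref_domain \<Omega> Ystar (\<epsilon> n)) (\<psi> n)) \<and>
     (\<exists>cJ>0. \<forall>n. \<forall>x\<in>ref_domain \<Omega> Ystar (\<epsilon> n). det (jac (\<psi> n) x) \<ge> cJ) \<and>
     (\<exists>C>0. \<forall>n. \<forall>x\<in>ref_domain \<Omega> Ystar (\<epsilon> n).
        norm (\<psi> n x - x) / \<epsilon> n \<le> C \<and> norm (jac (\<lambda>z. \<psi> n z - z) x) \<le> C) \<and>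
     \<psi>0 \<in> Linf_C1 \<Omega> Ystar (C1_cl Ystar) \<and>
     (AE x in lebesgue_on \<Omega>.
        C1_diffeo_cl Ystar (\<psi>0 x ` Ystar) (\<psi>0 x) \<and> \<psi>0 x ` Ystar \<subseteq> unit_cell) \<and>
     (\<exists>g \<in> Linf_C1 \<Omega> (periodic_cell Ystar) (C1_per Ystar).
        AE x in lebesgue_on \<Omega>. \<forall>y\<in>closure Ystar. g x y = \<psi>0 x y - y) \<and>
     (\<forall>q>1.
        two_scale_strong q \<epsilon> \<Omega>
          (\<lambda>n. ext0 (ref_domain \<Omega> Ystar (\<epsilon> n)) (\<lambda>x. (\<psi> n x - x) /\<^sub>R \<epsilon> n))
          (ext0 (\<Omega> \<times> Ystar) (\<lambda>(x, y). \<psi>0 x y - y)) \<and>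
        two_scale_strong q \<epsilon> \<Omega>
          (\<lambda>n. ext0 (ref_domain \<Omega> Ystar (\<epsilon> n)) (jac (\<lambda>z. \<psi> n z - z)))
          (ext0 (\<Omega> \<times> Ystar) (\<lambda>(x, y). jac (\<lambda>z. \<psi>0 x z - z) y)))"

definition limit_domain ::
  "(real^'n) set \<Rightarrow> (real^'n) set \<Rightarrow> (real^'n \<Rightarrow> real^'n \<Rightarrow> real^'n) \<Rightarrow> ((real^'n) \<times> (real^'n)) set" where
  "limit_domain \<Omega> Ystar \<psi>0 = {(x, y). x \<in> \<Omega> \<and> y \<in> unit_cell \<and> y \<in> \<psi>0 x ` Ystar}"

text \<open>
  \<open>L\<^sup>p(\<Omega>; L\<^sup>p(Y\<^sup>*\<^sub>x))\<close>; the space \<open>L\<^sup>p(\<Omega>; L\<^sup>p(Y\<^sup>*))\<close> is identified with \<open>L\<^sup>p(\<Omega> \<times> Y\<^sup>*)\<close>. Values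
  outside \<open>limit_domain \<Omega> Ystar \<psi>0\<close> are irrelevant.
\<close>

definition Lp_limit_domain ::
  "real \<Rightarrow> (real^'n) set \<Rightarrow> (real^'n) set \<Rightarrow> (real^'n \<Rightarrow> real^'n \<Rightarrow> real^'n)
    \<Rightarrow> ((real^'n) \<times> (real^'n) \<Rightarrow> real) set" where
  "Lp_limit_domain p \<Omega> Ystar \<psi>0 =
     {u0. \<exists>f \<in> Lp p (\<Omega> \<times> Ystar). \<forall>(x, y)\<in>limit_domain \<Omega> Ystar \<psi>0.
        u0 (x, y) = f (x, inv_into (closure Ystar) (\<psi>0 x) y)}"

end

theory Submission
  imports Defs "HOL-Complex_Analysis.Great_Picard"
begin

text \<open>
  Let \<open>S\<^sub>\<epsilon>(x, y) = \<epsilon> (\<lfloor>x/\<epsilon>\<rfloor> + y)\<close>. This unfolding map carries Lebesgue measure on \<open>\<real>\<^sup>N \<times> Y\<close> to Lebesgue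
  measure on \<open>\<real>\<^sup>N\<close> (\<open>distr_unfold_map\<close>), so \<open>f \<mapsto> f \<circ> S\<^sub>\<epsilon>\<close> preserves all Lebesgue norms while the fast
  variable becomes a coordinate of its own. If \<open>F\<close> is periodic in its second argument, the unfolded
  function of \<open>x \<mapsto> F(x, x/\<epsilon>)\<close> is \<open>F(S\<^sub>\<epsilon>(x, y), y)\<close>, which is uniformly close to \<open>F(x, y)\<close>. Hence
  weak two-scale convergence of a bounded sequence \<open>f\<^sub>\<epsilon>\<close> is ordinary weak convergence of
  \<open>f\<^sub>\<epsilon> \<circ> S\<^sub>\<epsilon>\<close> in \<open>L\<^sup>p(K \<times> Y)\<close> for a bounded set \<open>K\<close> (\<open>two_scale_weak_of_unfolded\<close>), and bounded
  sequences have weakly convergent subsequences (\<open>weakly_convergent_subsequence\<close>). Applied to the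
  extensions of \<open>u\<^sub>\<epsilon>\<close> by zero, this gives a subsequence and a limit \<open>v\<close>. It remains to see that \<open>v\<close>
  vanishes outside \<open>Q\<close>, and that \<open>(x, y) \<mapsto> v(x, \<psi>\<^sub>0(x, y))\<close> belongs to \<open>L\<^sup>p(\<Omega> \<times> Y\<^sup>*)\<close>.

  Both statements come from a second weak limit, the limit \<open>\<theta>\<close> of the unfolded indicator functions of
  \<open>\<Omega>\<^sub>\<epsilon>\<close>. Write \<open>\<lambda>\<close> for Lebesgue measure on \<open>K \<times> Y\<close> and \<open>T\<close> for the image of Lebesgue measure on
  \<open>\<Omega> \<times> Y\<^sup>*\<close> under \<open>(x, y) \<mapsto> (x, \<psi>\<^sub>0(x, y))\<close>. The Jacobian determinants lie between \<open>c\<^sub>J\<close> and some \<open>d\<close>,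
  so a change of variables bounds \<open>\<integral>\<^sub>\<Omega>\<^sub>\<epsilon> F(x, x/\<epsilon>)\<close> from both sides by multiples of the integral of
  \<open>F(\<psi>\<^sub>\<epsilon>(x), \<psi>\<^sub>\<epsilon>(x)/\<epsilon>)\<close> over the reference domain. As the unfolded displacements
  \<open>(\<psi>\<^sub>\<epsilon>(x) - x)/\<epsilon>\<close> converge strongly, the limit of these bounds is \<open>c\<^sub>J T \<le> \<theta>\<lambda> \<le> d T\<close> on the interior
  of the cells (\<open>limit_density_bounds\<close>).
  Since \<open>\<theta> \<le> 1\<close>, the lower bound gives \<open>c\<^sub>J T \<le> \<lambda>\<close>, which is exactly what makes composition with
  \<open>(x, y) \<mapsto> (x, \<psi>\<^sub>0(x, y))\<close> bounded from \<open>L\<^sup>p(K \<times> Y)\<close> to \<open>L\<^sup>p(\<Omega> \<times> Y\<^sup>*)\<close>. Since \<open>T\<close> is carried by \<open>Q\<close>,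
  the upper bound gives \<open>\<theta> = 0\<close> almost everywhere outside \<open>Q\<close>; and \<open>v\<close> vanishes where \<open>\<theta>\<close> does, because
  the extended functions vanish where the indicator functions do
  (\<open>weak_limit_zero_where_density_zero\<close>).

  Two technical points need some care. The set \<open>Q\<close> must be measurable: strong measurability of
  \<open>x \<mapsto> \<psi>\<^sub>0(x, \<cdot>)\<close> makes it agree with a Borel set on almost every fibre (\<open>Linf_C1_Borel_range\<close>).
  And the test functions in \<open>L\<^sup>q(U; C\<^sub>#(Y))\<close> are only measurable in \<open>x\<close>; a periodic partition of unity
  reduces them to sums of products \<open>a(x) h(y)\<close>, and these to products of continuous functions
  (\<open>Lq_C_per_pairing\<close>).
\<close>

section \<open>The unfolding map\<close>

definition vfloor :: "real^'n \<Rightarrow> real^'n" where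
  "vfloor x = (\<chi> i. of_int \<lfloor>x $ i\<rfloor>)"

text \<open>
  The map sends \<open>x\<close> to the corner of its \<open>e\<close>-cell and then moves by \<open>e y\<close> inside this cell.
\<close>

definition unfold_map :: "real \<Rightarrow> (real^'n) \<times> (real^'n) \<Rightarrow> real^'n" where
  "unfold_map e z = e *\<^sub>R (vfloor (fst z /\<^sub>R e) + snd z)"

text \<open>
  Unlike the closed cell, the half-open one is a fundamental domain: its integer translates are
  disjoint and cover the space.
\<close>

definition half_open_cell :: "(real^'n) set" where
  "half_open_cell = {y. \<forall>i. 0 \<le> y $ i \<and> y $ i < 1}"

text \<open>
  For bounded \<open>K\<close> this measure is finite, so that bounded functions are integrable and weak limits
  can be tested with them.
\<close>

definition slab_measure :: "(real^'n) set \<Rightarrow> ((real^'n) \<times> (real^'n)) measure" where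
  "slab_measure K = density lborel (indicator (K \<times> unit_cell))"

lemma vfloor_in_int_lattice: "vfloor x \<in> int_lattice"
  by (simp add: vfloor_def int_lattice_def)

lemma unit_cell_iff: "y \<in> unit_cell \<longleftrightarrow> (\<forall>i. 0 \<le> y $ i \<and> y $ i \<le> 1)"
  by (auto simp: unit_cell_def cbox_def Basis_vec_def inner_axis)

lemma open_unit_cell_iff: "y \<in> box 0 (1::real^'n) \<longleftrightarrow> (\<forall>i. 0 < y $ i \<and> y $ i < 1)"
  by (auto simp: box_def Basis_vec_def inner_axis)

lemma vfloor_eq_iff: "vfloor x = vfloor z \<longleftrightarrow> x - vfloor z \<in> half_open_cell"
  unfolding vfloor_def half_open_cell_def vec_eq_iff
  by (simp add: floor_eq_iff algebra_simps)

lemma measurable_vfloor [measurable]: "vfloor \<in> borel_measurable (borel :: (real^'n) measure)"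
proof (subst borel_measurable_iff_halfspace_le, intro ballI allI)
  fix i :: "real^'n" and a :: real assume "i \<in> Basis"
  then obtain j where j: "i = axis j 1" by (auto simp: Basis_vec_def)
  have "{w \<in> space borel. vfloor w \<bullet> i \<le> a} = {w :: real^'n. of_int \<lfloor>w $ j\<rfloor> \<le> a}"
    by (auto simp: j vfloor_def inner_axis)
  also have "\<dots> \<in> sets borel" by measurable
  finally show "{w \<in> space borel. vfloor w \<bullet> i \<le> a} \<in> sets borel" .
qed

lemma measurable_unfold_map [measurable]:
  "unfold_map e \<in> borel_measurable (borel :: ((real^'n) \<times> (real^'n)) measure)"
  unfolding unfold_map_def borel_prod[symmetric] by measurable

lemma half_open_cell_borel [measurable]: "half_open_cell \<in> sets (borel :: (real^'n) measure)"
  unfolding half_open_cell_def by measurable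

lemma unit_cell_borel [measurable]: "unit_cell \<in> sets (borel :: (real^'n) measure)"
  unfolding unit_cell_def by simp

lemma slab_borel [measurable]:
  assumes "K \<in> sets borel"
  shows "K \<times> (unit_cell :: (real^'n) set) \<in> sets borel"
  using assms by (simp add: borel_Times)

lemma emeasure_unit_cell: "emeasure lborel (unit_cell :: (real^'n) set) = 1"
proof -
  have "\<And>b. b \<in> Basis \<Longrightarrow> (0::real^'n) \<bullet> b \<le> 1 \<bullet> b"
    by (auto simp: Basis_vec_def inner_axis)
  then have "emeasure lborel (cbox 0 (1 :: real^'n)) = ennreal (\<Prod>b\<in>Basis. (1 - 0 :: real^'n) \<bullet> b)"
    by (rule emeasure_lborel_cbox)
  also have "(\<Prod>b\<in>Basis. (1 - 0 :: real^'n) \<bullet> b) = (\<Prod>b\<in>(Basis::(real^'n) set). 1::real)"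
    by (rule prod.cong) (auto simp: Basis_vec_def inner_axis)
  finally show ?thesis by (simp add: unit_cell_def)
qed

lemma emeasure_open_unit_cell: "emeasure lborel (box 0 (1 :: real^'n)) = 1"
  using emeasure_unit_cell[where 'n='n] by (simp add: unit_cell_def emeasure_lborel_box_eq emeasure_lborel_cbox_eq)

lemma emeasure_half_open_cell: "emeasure lborel (half_open_cell :: (real^'n) set) = 1"
proof (rule antisym)
  show "emeasure lborel (half_open_cell :: (real^'n) set) \<le> 1"
    unfolding emeasure_unit_cell[where 'n='n, symmetric]
    by (rule emeasure_mono) (auto simp: half_open_cell_def unit_cell_iff less_imp_le)
  show "1 \<le> emeasure lborel (half_open_cell :: (real^'n) set)"
    unfolding emeasure_open_unit_cell[where 'n='n, symmetric]
    by (rule emeasure_mono) (auto simp: half_open_cell_def open_unit_cell_iff less_imp_le)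
qed

lemma AE_unit_cell_open: "AE y in lborel. y \<in> unit_cell \<longrightarrow> y \<in> box 0 (1 :: real^'n)"
proof -
  have "emeasure lborel (unit_cell - box 0 (1 :: real^'n)) = 1 - 1"
    by (subst emeasure_Diff)
      (auto simp: emeasure_open_unit_cell emeasure_unit_cell unit_cell_iff open_unit_cell_iff less_imp_le)
  then show ?thesis
    by (intro AE_I[where N = "unit_cell - box 0 1"]) auto
qed

lemma nn_integral_lborel_translate:
  fixes a :: "'a::euclidean_space"
  assumes [measurable]: "f \<in> borel_measurable borel"
  shows "(\<integral>\<^sup>+x. f (a + x) \<partial>lborel) = (\<integral>\<^sup>+x. f x \<partial>lborel)"
proof -
  have "(\<integral>\<^sup>+x. f x \<partial>lborel) = (\<integral>\<^sup>+x. f x \<partial>distr lborel borel ((+) a))"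
    by (simp add: lborel_distr_plus)
  then show ?thesis by (simp add: nn_integral_distr)
qed

lemma nn_integral_lborel_scale:
  fixes f :: "'a::euclidean_space \<Rightarrow> ennreal"
  assumes [measurable]: "f \<in> borel_measurable borel" and c: "c > 0"
  shows "(\<integral>\<^sup>+x. f x \<partial>lborel) = ennreal (c ^ DIM('a)) * (\<integral>\<^sup>+x. f (c *\<^sub>R x) \<partial>lborel)"
proof -
  have "(\<integral>\<^sup>+x. f x \<partial>lborel) = (\<integral>\<^sup>+x. f x \<partial>density (distr lborel borel (\<lambda>x::'a. 0 + c *\<^sub>R x)) (\<lambda>_. \<bar>c\<bar>^DIM('a)))"
    using lborel_affine[of c "0::'a"] c by simp
  also have "\<dots> = (\<integral>\<^sup>+x. ennreal (c ^ DIM('a)) * f (c *\<^sub>R x) \<partial>lborel)"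
    using c by (simp add: nn_integral_density nn_integral_distr)
  finally show ?thesis by (simp add: nn_integral_cmult)
qed

text \<open>
  In the integral over \<open>x\<close> and \<open>y\<close>, substitute \<open>z = vfloor x + y\<close> and exchange the order of
  integration. For fixed \<open>z\<close> the points \<open>x\<close> that occur are those in the same cell as \<open>z\<close>, a set of
  measure one.
\<close>

lemma nn_integral_unfold_unscaled:
  fixes f :: "real^'n \<Rightarrow> ennreal"
  assumes [measurable]: "f \<in> borel_measurable borel"
  shows "(\<integral>\<^sup>+x. \<integral>\<^sup>+y. f (vfloor x + y) * indicator half_open_cell y \<partial>lborel \<partial>lborel) = (\<integral>\<^sup>+x. f x \<partial>lborel)"
proof -
  have "(\<integral>\<^sup>+x. \<integral>\<^sup>+y. f (vfloor x + y) * indicator half_open_cell y \<partial>lborel \<partial>lborel)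
     = (\<integral>\<^sup>+x. \<integral>\<^sup>+z. f z * indicator {x. vfloor x = vfloor z} x \<partial>lborel \<partial>lborel)"
  proof (rule nn_integral_cong)
    fix x :: "real^'n"
    have "(\<integral>\<^sup>+y. f (vfloor x + y) * indicator half_open_cell y \<partial>lborel)
      = (\<integral>\<^sup>+y. f (vfloor x + y) * indicator half_open_cell ((vfloor x + y) - vfloor x) \<partial>lborel)" by simp
    also have "\<dots> = (\<integral>\<^sup>+z. f z * indicator half_open_cell (z - vfloor x) \<partial>lborel)"
      by (rule nn_integral_lborel_translate[of "\<lambda>z. f z * indicator half_open_cell (z - vfloor x)"]) measurable
    also have "\<dots> = (\<integral>\<^sup>+z. f z * indicator {x. vfloor x = vfloor z} x \<partial>lborel)"
      using vfloor_eq_iff[of _ x] by (intro nn_integral_cong) (auto simp: indicator_def, metis+)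
    finally show "(\<integral>\<^sup>+y. f (vfloor x + y) * indicator half_open_cell y \<partial>lborel)
      = (\<integral>\<^sup>+z. f z * indicator {x. vfloor x = vfloor z} x \<partial>lborel)" .
  qed
  also have "\<dots> = (\<integral>\<^sup>+z. \<integral>\<^sup>+x. f z * indicator {x. vfloor x = vfloor z} x \<partial>lborel \<partial>lborel)"
  proof (rule lborel_pair.Fubini')
    have "(\<lambda>(z, x). f z * indicator {x :: real^'n. vfloor x = vfloor z} x)
        = (\<lambda>w. f (fst w) * indicator half_open_cell (snd w - vfloor (fst w)))"
      by (auto simp: fun_eq_iff indicator_def vfloor_eq_iff)
    then show "(\<lambda>(z, x). f z * indicator {x. vfloor x = vfloor z} x) \<in> borel_measurable (lborel \<Otimes>\<^sub>M lborel)"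
      by simp
  qed
  also have "\<dots> = (\<integral>\<^sup>+z. f z \<partial>lborel)"
  proof (rule nn_integral_cong)
    fix z :: "real^'n"
    have "(\<integral>\<^sup>+x. f z * indicator {x. vfloor x = vfloor z} x \<partial>lborel)
        = f z * (\<integral>\<^sup>+x. indicator half_open_cell (- vfloor z + x) \<partial>lborel)"
      by (subst nn_integral_cmult[symmetric]) (auto simp: vfloor_eq_iff indicator_def intro!: nn_integral_cong)
    also have "(\<integral>\<^sup>+x. indicator half_open_cell (- vfloor z + x) \<partial>lborel)
        = (\<integral>\<^sup>+x. indicator (half_open_cell :: (real^'n) set) x \<partial>lborel)"
      by (rule nn_integral_lborel_translate) measurable
    finally show "(\<integral>\<^sup>+x. f z * indicator {x. vfloor x = vfloor z} x \<partial>lborel) = f z"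
      by (simp add: emeasure_half_open_cell)
  qed
  finally show ?thesis .
qed

lemma nn_integral_unfold:
  fixes f :: "real^'n \<Rightarrow> ennreal"
  assumes [measurable]: "f \<in> borel_measurable borel" and e: "e > 0"
  shows "(\<integral>\<^sup>+z. f (unfold_map e z) * indicator (UNIV \<times> unit_cell) z \<partial>lborel) = (\<integral>\<^sup>+x. f x \<partial>lborel)"
proof -
  define G where "G x = (\<integral>\<^sup>+y. f (e *\<^sub>R (vfloor x + y)) * indicator half_open_cell y \<partial>lborel)" for x :: "real^'n"
  have [measurable]: "G \<in> borel_measurable borel"
    unfolding G_def by measurable
  have m: "(\<lambda>z. f (unfold_map e z) * indicator (UNIV \<times> unit_cell) z) \<in> borel_measurable lborel"
    by measurable
  have "(\<integral>\<^sup>+z. f (unfold_map e z) * indicator (UNIV \<times> unit_cell) z \<partial>lborel)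
     = (\<integral>\<^sup>+z. f (unfold_map e z) * indicator (UNIV \<times> unit_cell) z \<partial>(lborel \<Otimes>\<^sub>M lborel))"
    by (simp add: lborel_prod)
  also have "\<dots> = (\<integral>\<^sup>+x. \<integral>\<^sup>+y. f (unfold_map e (x, y)) * indicator (UNIV \<times> unit_cell) (x, y) \<partial>lborel \<partial>lborel)"
    by (rule lborel.nn_integral_fst[symmetric]) (subst lborel_prod, rule m)
  also have "\<dots> = (\<integral>\<^sup>+x. G (x /\<^sub>R e) \<partial>lborel)"
  proof (rule nn_integral_cong)
    fix x :: "real^'n"
    have cells: "indicator unit_cell y = (indicator half_open_cell y :: ennreal)"
      if "y \<in> unit_cell \<longrightarrow> y \<in> box 0 1" for y :: "real^'n"
    proof -
      have "y \<in> unit_cell \<longleftrightarrow> y \<in> half_open_cell"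
        using that unfolding half_open_cell_def unit_cell_iff open_unit_cell_iff mem_Collect_eq
        by (meson less_imp_le)
      then show ?thesis by (simp add: indicator_def)
    qed
    have "AE y in lborel. f (unfold_map e (x, y)) * indicator (UNIV \<times> unit_cell) (x, y)
       = f (e *\<^sub>R (vfloor (x /\<^sub>R e) + y)) * indicator half_open_cell y"
      using AE_unit_cell_open
    proof eventually_elim
      case (elim y)
      then show ?case
        by (simp add: cells[symmetric] unfold_map_def indicator_times)
    qed
    then show "(\<integral>\<^sup>+y. f (unfold_map e (x, y)) * indicator (UNIV \<times> unit_cell) (x, y) \<partial>lborel) = G (x /\<^sub>R e)"
      unfolding G_def by (rule nn_integral_cong_AE)
  qed
  also have "\<dots> = ennreal (e ^ DIM(real^'n)) * (\<integral>\<^sup>+x. G x \<partial>lborel)"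
    by (subst nn_integral_lborel_scale[where c = e]) (use e in auto)
  also have "(\<integral>\<^sup>+x. G x \<partial>lborel) = (\<integral>\<^sup>+x. f (e *\<^sub>R x) \<partial>lborel)"
    unfolding G_def by (rule nn_integral_unfold_unscaled) measurable
  also have "ennreal (e ^ DIM(real^'n)) * \<dots> = (\<integral>\<^sup>+x. f x \<partial>lborel)"
    by (rule nn_integral_lborel_scale[symmetric]) (use e in auto)
  finally show ?thesis .
qed

lemma sets_slab_measure [simp, measurable_cong]: "sets (slab_measure K) = sets borel"
  and space_slab_measure [simp]: "space (slab_measure K) = UNIV"
  by (auto simp: slab_measure_def)

text \<open>
  The unfolding map preserves Lebesgue measure; this is the change of variables behind every
  unfolded integral below.
\<close>

lemma distr_unfold_map:
  assumes "e > 0"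
  shows "distr (slab_measure UNIV) borel (unfold_map e) = (lborel :: (real^'n) measure)"
proof (rule measure_eqI)
  fix A :: "(real^'n) set" assume "A \<in> sets (distr (slab_measure UNIV) borel (unfold_map e))"
  then have A[measurable]: "A \<in> sets borel" by simp
  have "emeasure (distr (slab_measure UNIV) borel (unfold_map e)) A
     = (\<integral>\<^sup>+z. indicator A (unfold_map e z) \<partial>slab_measure UNIV)"
    using nn_integral_distr[of "unfold_map e" "slab_measure UNIV" borel "indicator A"] by simp
  also have "\<dots> = (\<integral>\<^sup>+z. indicator A (unfold_map e z) * indicator (UNIV \<times> unit_cell) z \<partial>lborel)"
    unfolding slab_measure_def by (subst nn_integral_density) (auto simp: mult.commute)
  also have "\<dots> = emeasure lborel A"
    using nn_integral_unfold[of "indicator A" e] assms by simp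
  finally show "emeasure (distr (slab_measure UNIV) borel (unfold_map e)) A = emeasure lborel A" .
qed simp

lemma integral_slab_measure:
  fixes g :: "(real^'n) \<times> (real^'n) \<Rightarrow> 'b::{banach,second_countable_topology}"
  assumes [measurable]: "K \<in> sets borel" "g \<in> borel_measurable borel"
  shows "(LINT z|slab_measure K. g z) = (LINT z|lborel. indicator (K \<times> unit_cell) z *\<^sub>R g z)"
  unfolding slab_measure_def ennreal_indicator[symmetric]
  by (rule integral_density) auto

lemma integrable_slab_measure_iff:
  fixes g :: "(real^'n) \<times> (real^'n) \<Rightarrow> 'b::{banach,second_countable_topology}"
  assumes [measurable]: "K \<in> sets borel" "g \<in> borel_measurable borel"
  shows "integrable (slab_measure K) g \<longleftrightarrow> integrable lborel (\<lambda>z. indicator (K \<times> unit_cell) z *\<^sub>R g z)"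
  unfolding slab_measure_def ennreal_indicator[symmetric]
  by (rule integrable_density) auto

lemma AE_slab_measure_iff:
  fixes K :: "(real^'n) set"
  assumes [measurable]: "K \<in> sets borel"
  shows "(AE z in slab_measure K. P z) \<longleftrightarrow> (AE z in lborel. z \<in> K \<times> unit_cell \<longrightarrow> P z)"
  unfolding slab_measure_def by (subst AE_density) (auto simp: indicator_def)

lemma nn_integral_slab_measure:
  fixes K :: "(real^'n) set"
  assumes [measurable]: "K \<in> sets borel" "g \<in> borel_measurable borel"
  shows "(\<integral>\<^sup>+z. g z \<partial>slab_measure K) = (\<integral>\<^sup>+z. indicator (K \<times> unit_cell) z * g z \<partial>lborel)"
  unfolding slab_measure_def by (rule nn_integral_density) auto

lemma finite_slab_measure:
  fixes K :: "(real^'n) set"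
  assumes "K \<in> sets borel" "bounded K"
  shows "finite_measure (slab_measure K)"
proof
  have "bounded (K \<times> (unit_cell :: (real^'n) set))"
    using assms by (simp add: bounded_Times unit_cell_def)
  then have "emeasure lborel (K \<times> (unit_cell :: (real^'n) set)) < \<infinity>"
    by (rule emeasure_bounded_finite)
  then show "emeasure (slab_measure K) (space (slab_measure K)) \<noteq> \<infinity>"
    using assms by (simp add: slab_measure_def emeasure_density)
qed

text \<open>
  The faces of the cell are null sets. Sets inside the open cell are disjoint from their
  nonzero integer translates, so measures are compared there.
\<close>

lemma AE_slab_open_cell:
  fixes K :: "(real^'n) set"
  assumes [measurable]: "K \<in> sets borel"
  shows "AE z in slab_measure K. snd z \<in> box 0 1"
proof -
  have "AE x in lborel. AE y in lborel. snd (x :: real^'n, y) \<in> unit_cell \<longrightarrow> snd (x, y) \<in> box 0 (1 :: real^'n)"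
    by (rule AE_I2) (simp add: AE_unit_cell_open)
  then have "AE z in lborel \<Otimes>\<^sub>M lborel. snd z \<in> unit_cell \<longrightarrow> snd (z :: (real^'n) \<times> (real^'n)) \<in> box 0 1"
    by (rule lborel_pair.AE_pair_measure[rotated]) measurable
  then have "AE z in lborel. snd z \<in> unit_cell \<longrightarrow> snd (z :: (real^'n) \<times> (real^'n)) \<in> box 0 1"
    by (subst (asm) lborel_prod)
  then have "AE z in lborel. z \<in> K \<times> unit_cell \<longrightarrow> snd (z :: (real^'n) \<times> (real^'n)) \<in> box 0 1"
    by eventually_elim auto
  then show ?thesis by (simp add: AE_slab_measure_iff)
qed

lemma AE_slab_snd:
  fixes K :: "(real^'n) set"
  assumes P: "AE y in lborel. y \<in> unit_cell \<longrightarrow> P y" and [measurable]: "{y. P y} \<in> sets borel" "K \<in> sets borel"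
  shows "AE z in slab_measure K. P (snd z)"
proof -
  have "AE x in lborel. AE y in lborel. snd (x :: real^'n, y) \<in> unit_cell \<longrightarrow> P (snd (x, y))"
    by (rule AE_I2) (simp add: P)
  moreover have [measurable]: "Measurable.pred borel P" using assms(2) by (simp add: pred_def)
  have "{z \<in> space (lborel \<Otimes>\<^sub>M lborel). snd z \<in> unit_cell \<longrightarrow> P (snd (z :: (real^'n) \<times> (real^'n)))} \<in> sets (lborel \<Otimes>\<^sub>M lborel)"
    by measurable
  ultimately have "AE z in lborel \<Otimes>\<^sub>M lborel. snd z \<in> unit_cell \<longrightarrow> P (snd (z :: (real^'n) \<times> (real^'n)))"
    by (rule lborel_pair.AE_pair_measure[rotated])
  then have "AE z in lborel. snd z \<in> unit_cell \<longrightarrow> P (snd (z :: (real^'n) \<times> (real^'n)))"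
    by (subst (asm) lborel_prod)
  then have "AE z in lborel. z \<in> K \<times> unit_cell \<longrightarrow> P (snd (z :: (real^'n) \<times> (real^'n)))"
    by eventually_elim auto
  then show ?thesis by (simp add: AE_slab_measure_iff)
qed

lemma nn_integral_slab_fst:
  fixes g :: "real^'n \<Rightarrow> ennreal"
  assumes [measurable]: "g \<in> borel_measurable borel" "K \<in> sets borel"
  shows "(\<integral>\<^sup>+z. g (fst z) \<partial>slab_measure K) = (\<integral>\<^sup>+x. indicator K x * g x \<partial>lborel)"
proof -
  have gf: "(\<lambda>z. g (fst z)) \<in> borel_measurable (borel :: ((real^'n) \<times> (real^'n)) measure)"
    by (rule measurable_compose[OF _ assms(1)]) (intro borel_measurable_continuous_onI continuous_intros)
  have m: "(\<lambda>z. indicator (K \<times> (unit_cell :: (real^'n) set)) z * g (fst z)) \<in> borel_measurable (borel :: ((real^'n) \<times> (real^'n)) measure)"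
    using gf by (intro borel_measurable_times_ennreal borel_measurable_indicator) auto
  have "(\<integral>\<^sup>+z. g (fst z) \<partial>slab_measure K) = (\<integral>\<^sup>+z. indicator (K \<times> (unit_cell :: (real^'n) set)) z * g (fst z) \<partial>lborel)"
    by (rule nn_integral_slab_measure) (use gf in auto)
  also have "\<dots> = (\<integral>\<^sup>+z. indicator (K \<times> (unit_cell :: (real^'n) set)) z * g (fst z) \<partial>(lborel \<Otimes>\<^sub>M lborel))"
    by (subst lborel_prod) (rule refl)
  also have "\<dots> = (\<integral>\<^sup>+x. \<integral>\<^sup>+y. indicator (K \<times> (unit_cell :: (real^'n) set)) (x, y) * g (fst (x, y)) \<partial>lborel \<partial>lborel)"
    by (rule lborel.nn_integral_fst[symmetric]) (subst lborel_prod, use m in simp)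
  also have "\<dots> = (\<integral>\<^sup>+x. indicator K x * g x \<partial>lborel)"
  proof (rule nn_integral_cong)
    fix x
    have "(\<integral>\<^sup>+y. indicator (K \<times> (unit_cell :: (real^'n) set)) (x, y) * g (fst (x, y)) \<partial>lborel)
       = (\<integral>\<^sup>+y. (indicator K x * g x) * indicator (unit_cell :: (real^'n) set) y \<partial>lborel)"
      by (rule nn_integral_cong) (simp add: indicator_def)
    then show "(\<integral>\<^sup>+y. indicator (K \<times> (unit_cell :: (real^'n) set)) (x, y) * g (fst (x, y)) \<partial>lborel) = indicator K x * g x"
      by (simp add: nn_integral_cmult_indicator emeasure_unit_cell)
  qed
  finally show ?thesis .
qed

lemma AE_slab_fst:
  fixes K :: "(real^'n) set"
  assumes "AE x in lborel. P x" and K[measurable]: "K \<in> sets borel"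
  shows "AE z in slab_measure K. P (fst z)"
proof -
  obtain N where N: "N \<in> null_sets lborel" "{x. \<not> P x} \<subseteq> N"
    using assms(1) by (auto elim!: AE_E simp: null_sets_def)
  then have [measurable]: "N \<in> sets borel" by auto
  have "(\<integral>\<^sup>+z. indicator N (fst z) \<partial>slab_measure K) = (\<integral>\<^sup>+x. indicator K x * indicator N x \<partial>lborel)"
    by (rule nn_integral_slab_fst) auto
  also have "\<dots> \<le> (\<integral>\<^sup>+x. indicator N x \<partial>lborel)"
    by (rule nn_integral_mono) (auto simp: indicator_def)
  also have "\<dots> = 0" using N by auto
  finally have "(\<integral>\<^sup>+z. indicator N (fst z) \<partial>slab_measure K) = 0" by simp
  moreover have "(\<lambda>z. indicator N (fst z) :: ennreal) \<in> borel_measurable (slab_measure K)"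
  proof -
    have fm: "fst \<in> borel_measurable (borel :: ((real^'n) \<times> (real^'n)) measure)"
      by (intro borel_measurable_continuous_onI continuous_intros)
    have "(\<lambda>z :: (real^'n) \<times> (real^'n). indicator N (fst z) :: ennreal) \<in> borel_measurable borel"
      by (rule measurable_compose[OF fm]) measurable
    then show ?thesis by simp
  qed
  ultimately have "AE z in slab_measure K. indicator N (fst z) = (0 :: ennreal)"
    by (simp add: nn_integral_0_iff_AE)
  then show ?thesis by eventually_elim (use N(2) in \<open>auto simp: indicator_def split: if_splits\<close>)
qed

text \<open>
  Both points lie in the same closed \<open>e\<close>-cell, and the norm is at most the sum of the coordinates.
\<close>

lemma unfold_map_close:
  fixes z :: "(real^'n) \<times> (real^'n)"
  assumes "snd z \<in> unit_cell" "e > 0"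
  shows "norm (unfold_map e z - fst z) \<le> e * CARD('n)"
proof -
  have "norm ((unfold_map e z - fst z) /\<^sub>R e) \<le> (\<Sum>i\<in>UNIV. \<bar>((unfold_map e z - fst z) /\<^sub>R e) $ i\<bar>)"
    by (rule norm_le_l1_cart)
  also have "\<dots> \<le> (\<Sum>i\<in>(UNIV::'n set). 1)"
  proof (rule sum_mono)
    fix i :: 'n
    define t where "t = inverse e * fst z $ i"
    have x: "fst z $ i = e * t" using \<open>e > 0\<close> by (simp add: t_def)
    have "((unfold_map e z - fst z) /\<^sub>R e) $ i = of_int \<lfloor>t\<rfloor> + snd z $ i - t"
      using \<open>e > 0\<close>
      by (simp add: unfold_map_def vfloor_def x right_diff_distrib mult.assoc[symmetric])
    moreover have "0 \<le> snd z $ i" "snd z $ i \<le> 1" using assms(1) by (auto simp: unit_cell_iff)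
    moreover have "of_int \<lfloor>t\<rfloor> \<le> t" "t < of_int \<lfloor>t\<rfloor> + 1" by linarith+
    ultimately show "\<bar>((unfold_map e z - fst z) /\<^sub>R e) $ i\<bar> \<le> 1" by linarith
  qed
  also have "norm ((unfold_map e z - fst z) /\<^sub>R e) = norm (unfold_map e z - fst z) / e"
    using \<open>e > 0\<close> by (simp only: norm_scaleR) (simp add: field_simps)
  finally show ?thesis using \<open>e > 0\<close> by (simp add: field_simps)
qed

lemma Y_periodic_unfold_map:
  assumes "Y_periodic f" "e > 0"
  shows "f (unfold_map e z /\<^sub>R e) = f (snd z)"
proof -
  have "unfold_map e z /\<^sub>R e = snd z + vfloor (fst z /\<^sub>R e)"
    using \<open>e > 0\<close> by (simp add: unfold_map_def)
  then show ?thesis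
    using \<open>Y_periodic f\<close> vfloor_in_int_lattice unfolding Y_periodic_def by metis
qed

lemma integrable_unfold_slab:
  fixes f :: "real^'n \<Rightarrow> 'b::{banach,second_countable_topology}"
  assumes f: "integrable lborel f" and [measurable]: "f \<in> borel_measurable borel" "K \<in> sets borel" and e: "e > 0"
  shows "integrable (slab_measure K) (\<lambda>z. f (unfold_map e z))"
proof -
  have "integrable (distr (slab_measure UNIV) borel (unfold_map e)) f"
    by (simp add: distr_unfold_map e f)
  then have "integrable (slab_measure UNIV) (\<lambda>z. f (unfold_map e z))"
    by (subst (asm) integrable_distr_eq) auto
  then have *: "integrable lborel (\<lambda>z. indicator (UNIV \<times> unit_cell) z *\<^sub>R f (unfold_map e z))"
    by (subst (asm) integrable_slab_measure_iff) auto
  show ?thesis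
    by (subst integrable_slab_measure_iff)
      (auto intro!: Bochner_Integration.integrable_bound[OF *] simp: indicator_def)
qed

text \<open>
  The measure on the slab over \<open>K\<close> may replace the one over the whole space as soon as \<open>K\<close> contains
  the base points of all cells that meet the support of \<open>f\<close>.
\<close>

lemma integral_eq_slab:
  fixes f :: "real^'n \<Rightarrow> 'b::{banach,second_countable_topology}"
  assumes [measurable]: "f \<in> borel_measurable borel" "K \<in> sets borel" and e: "e > 0"
    and K: "\<And>z. snd z \<in> unit_cell \<Longrightarrow> f (unfold_map e z) \<noteq> 0 \<Longrightarrow> fst z \<in> K"
  shows "(LINT x|lborel. f x) = (LINT z|slab_measure K. f (unfold_map e z))"
proof -
  have "(LINT x|lborel. f x) = (LINT x|distr (slab_measure UNIV) borel (unfold_map e). f x)"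
    by (simp add: distr_unfold_map e)
  also have "\<dots> = (LINT z|slab_measure UNIV. f (unfold_map e z))"
    by (rule integral_distr) auto
  also have "\<dots> = (LINT z|lborel. indicator (UNIV \<times> unit_cell) z *\<^sub>R f (unfold_map e z))"
    by (rule integral_slab_measure) auto
  also have "\<dots> = (LINT z|lborel. indicator (K \<times> unit_cell) z *\<^sub>R f (unfold_map e z))"
    by (rule Bochner_Integration.integral_cong) (use K in \<open>force simp: indicator_def\<close>)+
  also have "\<dots> = (LINT z|slab_measure K. f (unfold_map e z))"
    by (rule integral_slab_measure[symmetric]) auto
  finally show ?thesis .
qed

lemma int_lattice_add: "k \<in> int_lattice \<Longrightarrow> l \<in> int_lattice \<Longrightarrow> k + l \<in> int_lattice"
  and int_lattice_uminus: "k \<in> int_lattice \<Longrightarrow> - k \<in> int_lattice"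
  and int_lattice_0: "0 \<in> int_lattice"
  by (auto simp: int_lattice_def)

lemma int_lattice_cell_shift:
  fixes k :: "real^'n"
  assumes "k \<in> int_lattice" "y \<in> unit_cell" "y + k \<in> box 0 1"
  shows "k = 0"
proof (rule vec_eq_iff[THEN iffD2], rule allI)
  fix i
  obtain m :: int where m: "k $ i = of_int m"
    using assms(1) unfolding int_lattice_def by (metis (no_types, lifting) Ints_cases mem_Collect_eq)
  have "0 \<le> y $ i" "y $ i \<le> 1" "0 < y $ i + k $ i" "y $ i + k $ i < 1"
    using assms by (auto simp: unit_cell_iff open_unit_cell_iff)
  then have "-1 < (of_int m :: real)" "(of_int m :: real) < 1" unfolding m by linarith+
  then have "m = 0" by linarith
  then show "k $ i = 0 $ i" by (simp add: m)
qed

section \<open>Weak sequential compactness\<close>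

text \<open>
  The index type is arbitrary, so that the differences of two families, indexed by pairs, form a family
  again.
\<close>

definition equi_integrable :: "'a measure \<Rightarrow> ('i \<Rightarrow> 'a \<Rightarrow> real) \<Rightarrow> bool" where
  "equi_integrable M d \<longleftrightarrow> (\<forall>i. integrable M (d i)) \<and>
     (\<forall>e>0. \<exists>\<eta>>0. \<forall>A\<in>sets M. measure M A < \<eta> \<longrightarrow> (\<forall>i. (LINT x|M. indicator A x * \<bar>d i x\<bar>) \<le> e))"

lemma equi_integrableD: "equi_integrable M d \<Longrightarrow> integrable M (d i)"
  by (simp add: equi_integrable_def)

lemma equi_integrableE:
  assumes "equi_integrable M d" "e > 0"
  obtains \<eta> where "\<eta> > 0"
    "\<And>A i. A \<in> sets M \<Longrightarrow> measure M A < \<eta> \<Longrightarrow> (LINT x|M. indicator A x * \<bar>d i x\<bar>) \<le> e"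
  using assms unfolding equi_integrable_def by blast

lemma integrable_indicator_mult:
  fixes f :: "'a \<Rightarrow> real"
  assumes "integrable M f" "A \<in> sets M"
  shows "integrable M (\<lambda>x. indicator A x * f x)"
  using integrable_mult_indicator[OF assms(2,1)] by simp

lemma abs_integral_indicator_le:
  fixes f :: "'a \<Rightarrow> real"
  assumes "integrable M f" "A \<in> sets M"
  shows "\<bar>LINT x|M. indicator A x * f x\<bar> \<le> (LINT x|M. indicator A x * \<bar>f x\<bar>)"
proof -
  have "\<bar>LINT x|M. indicator A x * f x\<bar> \<le> (LINT x|M. \<bar>indicator A x * f x\<bar>)"
    by (rule integral_abs_bound)
  then show ?thesis by (simp add: abs_mult)
qed

lemma equi_integrable_diff:
  fixes f :: "'i \<Rightarrow> 'a \<Rightarrow> real" and g :: "'j \<Rightarrow> 'a \<Rightarrow> real"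
  assumes f: "equi_integrable M f" and g: "equi_integrable M g"
  shows "equi_integrable M (\<lambda>(i, j) x. f i x - g j x)"
  unfolding equi_integrable_def
proof (intro conjI allI impI)
  note [simp] = equi_integrableD[OF f] equi_integrableD[OF g]
  show "integrable M (case i of (i, j) \<Rightarrow> \<lambda>x. f i x - g j x)" for i
    by (cases i) simp
  fix e :: real assume "e > 0"
  then have e2: "e/2 > 0" by simp
  obtain a where a: "a > 0"
    "\<And>A i. A \<in> sets M \<Longrightarrow> measure M A < a \<Longrightarrow> (LINT x|M. indicator A x * \<bar>f i x\<bar>) \<le> e/2"
    by (rule equi_integrableE[OF f e2]) blast
  obtain b where b: "b > 0"
    "\<And>A i. A \<in> sets M \<Longrightarrow> measure M A < b \<Longrightarrow> (LINT x|M. indicator A x * \<bar>g i x\<bar>) \<le> e/2"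
    by (rule equi_integrableE[OF g e2]) blast
  show "\<exists>\<eta>>0. \<forall>A\<in>sets M. measure M A < \<eta> \<longrightarrow>
     (\<forall>i. (LINT x|M. indicator A x * \<bar>(case i of (i, j) \<Rightarrow> \<lambda>x. f i x - g j x) x\<bar>) \<le> e)"
  proof (intro exI[of _ "min a b"] conjI ballI impI allI)
    fix A and ij :: "'i \<times> 'j" assume A: "A \<in> sets M" "measure M A < min a b"
    obtain i j where ij: "ij = (i, j)" by (cases ij)
    have "(LINT x|M. indicator A x * \<bar>f i x - g j x\<bar>)
       \<le> (LINT x|M. indicator A x * \<bar>f i x\<bar> + indicator A x * \<bar>g j x\<bar>)"
      by (rule integral_mono)
        (auto intro!: integrable_indicator_mult A Bochner_Integration.integrable_add split: split_indicator)
    also have "\<dots> = (LINT x|M. indicator A x * \<bar>f i x\<bar>) + (LINT x|M. indicator A x * \<bar>g j x\<bar>)"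
      by (rule Bochner_Integration.integral_add) (auto intro!: integrable_indicator_mult A)
    also have "\<dots> \<le> e" using a(2)[of A i] b(2)[of A j] A by simp
    finally show "(LINT x|M. indicator A x * \<bar>(case ij of (i, j) \<Rightarrow> \<lambda>x. f i x - g j x) x\<bar>) \<le> e"
      by (simp add: ij)
  qed (use a b in auto)
qed

text \<open>
  A Dynkin argument. The sets on which the integrals tend to zero are closed under complements, and
  under countable disjoint unions because equi-integrability makes the tail of the union
  uniformly negligible.
\<close>

lemma (in finite_measure) equi_integrable_tendsto_sets:
  assumes d: "equi_integrable M d"
    and G: "Int_stable G" "G \<subseteq> Pow (space M)" "sets M = sigma_sets (space M) G" "space M \<in> G"
    and lim: "\<And>A. A \<in> G \<Longrightarrow> ((\<lambda>i. LINT x|M. indicator A x * d i x) \<longlongrightarrow> 0) F"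
    and A: "A \<in> sets M"
  shows "((\<lambda>i. LINT x|M. indicator A x * d i x) \<longlongrightarrow> 0) F"
  using G(1,2) A[unfolded G(3)]
proof (induct rule: sigma_sets_induct_disjoint)
  note [simp] = equi_integrableD[OF d]
  case (basic A) then show ?case by (rule lim)
next
  case empty then show ?case by simp
next
  note [simp] = equi_integrableD[OF d]
  case (compl A)
  then have [measurable]: "A \<in> sets M" by (simp add: G)
  have eq: "(LINT x|M. indicator (space M - A) x * d i x)
     = (LINT x|M. indicator (space M) x * d i x) - (LINT x|M. indicator A x * d i x)" for i
    by (subst Bochner_Integration.integral_diff[symmetric])
      (auto intro!: Bochner_Integration.integral_cong integrable_indicator_mult simp: indicator_diff
         left_diff_distrib split: split_indicator)
  show ?case unfolding eq using tendsto_diff[OF lim[OF G(4)] compl(2)] by simp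
next
  note [simp] = equi_integrableD[OF d]
  case (union A)
  have Am[measurable]: "A i \<in> sets M" for i using union(2) by (auto simp: G)
  show ?case
  proof (rule tendstoI)
    fix e :: real assume e: "e > 0"
    then have "e/3 > 0" by simp
    then obtain \<eta> where \<eta>: "\<eta> > 0" "\<And>A i. A \<in> sets M \<Longrightarrow> measure M A < \<eta> \<Longrightarrow> (LINT x|M. indicator A x * \<bar>d i x\<bar>) \<le> e/3"
      by (rule equi_integrableE[OF d]) blast
    \<comment> \<open>The tails decrease to the empty set, so some tail is small enough for equi-integrability.\<close>
    define B where "B m = (\<Union>i\<in>{m..}. A i)" for m
    have Bm[measurable]: "B m \<in> sets M" for m unfolding B_def by auto
    have "(\<lambda>m. measure M (B m)) \<longlonglongrightarrow> measure M (\<Inter>m. B m)"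
      by (rule finite_Lim_measure_decseq) (auto simp: B_def decseq_def Bex_def intro: order_trans)
    also have "(\<Inter>m. B m) = {}"
      using union(1) unfolding B_def disjoint_family_on_def
      by auto (metis disjoint_iff atLeast_iff Suc_n_not_le_n UNIV_I)
    finally have "eventually (\<lambda>m. measure M (B m) < \<eta>) sequentially"
      using \<eta>(1) by (intro order_tendstoD(2)[where y = "measure M {}"]) auto
    then obtain m where m: "measure M (B m) < \<eta>" by (auto simp: eventually_sequentially)
    have ind: "indicator (\<Union>i. A i) x = (\<Sum>i<m. indicator (A i) x) + (indicator (B m) x :: real)" for x
    proof -
      have "(\<Union>i. A i) = (\<Union>i\<in>{..<m}. A i) \<union> B m"
        by (auto simp: B_def) (meson atLeast_iff lessThan_iff not_less)
      moreover have "(\<Union>i\<in>{..<m}. A i) \<inter> B m = {}"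
      proof (rule equals0I)
        fix y assume "y \<in> (\<Union>i\<in>{..<m}. A i) \<inter> B m"
        then obtain i j where ij: "i < m" "m \<le> j" "y \<in> A i" "y \<in> A j" by (auto simp: B_def)
        then have "i \<noteq> j" by simp
        then show False using disjoint_family_onD[OF union(1), of i j] ij by auto
      qed
      ultimately have "indicator (\<Union>i. A i) x = indicator (\<Union>i\<in>{..<m}. A i) x + (indicator (B m) x :: real)"
        by (auto simp: indicator_def)
      moreover have "indicator (\<Union>i\<in>{..<m}. A i) x = (\<Sum>i<m. indicator (A i) x :: real)"
        by (rule indicator_UN_disjoint) (use union(1) in \<open>auto simp: disjoint_family_on_def\<close>)
      ultimately show ?thesis by simp
    qed
    have eq: "(LINT x|M. indicator (\<Union>i. A i) x * d j x)
      = (\<Sum>i<m. LINT x|M. indicator (A i) x * d j x) + (LINT x|M. indicator (B m) x * d j x)" for j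
    proof -
      have iA: "integrable M (\<lambda>x. indicator (A i) x * d j x)" for i
        by (intro integrable_indicator_mult) auto
      have iB: "integrable M (\<lambda>x. indicator (B m) x * d j x)"
        by (intro integrable_indicator_mult) auto
      have si: "integrable M (\<lambda>x. \<Sum>i<m. indicator (A i) x * d j x)"
        by (intro Bochner_Integration.integrable_sum iA)
      show ?thesis
        by (simp only: ind distrib_right sum_distrib_right Bochner_Integration.integral_add[OF si iB]
          Bochner_Integration.integral_sum[OF iA])
    qed
    have "((\<lambda>j. \<Sum>i<m. LINT x|M. indicator (A i) x * d j x) \<longlongrightarrow> 0) F"
      by (rule tendsto_null_sum) (rule union(3))
    then have "\<forall>\<^sub>F j in F. dist (\<Sum>i<m. LINT x|M. indicator (A i) x * d j x) 0 < e/3"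
      using e by (intro tendstoD) auto
    then show "\<forall>\<^sub>F j in F. dist (LINT x|M. indicator (\<Union>i. A i) x * d j x) 0 < e"
    proof eventually_elim
      case (elim j)
      have "\<bar>LINT x|M. indicator (B m) x * d j x\<bar> \<le> e/3"
        using abs_integral_indicator_le[of M "d j" "B m"] \<eta>(2)[OF Bm m, of j] by simp
      then show ?case using elim e by (simp add: eq)
    qed
  qed
qed

text \<open>
  A bounded measurable \<open>s\<close> is a uniform limit of simple functions, and the \<open>L\<^sup>1\<close> bound on \<open>d\<close>
  controls the error.
\<close>

lemma (in finite_measure) tendsto_integral_bounded_mult:
  assumes d: "\<And>i. integrable M (d i)" and D: "\<And>i. (LINT x|M. \<bar>d i x\<bar>) \<le> D"
    and lim: "\<And>A. A \<in> sets M \<Longrightarrow> ((\<lambda>i. LINT x|M. indicator A x * d i x) \<longlongrightarrow> 0) F"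
    and s[measurable]: "s \<in> borel_measurable M" and C: "\<And>x. \<bar>s x\<bar> \<le> C"
  shows "((\<lambda>i. LINT x|M. s x * d i x) \<longlongrightarrow> (0::real)) F"
proof (rule tendstoI)
  note [measurable] = borel_measurable_integrable[OF d]
  fix e :: real assume e: "e > 0"
  obtain k :: nat where k: "k > 0" "\<bar>D\<bar> / k < e/2"
  proof -
    obtain k :: nat where k: "\<bar>D\<bar> / (e/2) < k" using reals_Archimedean2 by blast
    moreover have "0 \<le> \<bar>D\<bar> / (e/2)" using e by simp
    ultimately have "0 < real k" by linarith
    then have "k > 0 \<and> \<bar>D\<bar> / k < e/2" using e k by (simp add: field_simps)
    then show ?thesis using that by blast
  qed
  \<comment> \<open>The simple function \<open>t\<close> rounds \<open>s\<close> down to a multiple of \<open>1 / k\<close>; the indices in \<open>{-J..J}\<close> cover all its values.\<close>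
  define J where "J = \<lceil>k * \<bar>C\<bar>\<rceil> + 1"
  define t where "t x = (\<Sum>j\<in>{-J..J}. (of_int j / k) * indicator {x\<in>space M. \<lfloor>k * s x\<rfloor> = j} x)" for x
  have ts: "\<bar>s x - t x\<bar> \<le> 1 / k" if x: "x \<in> space M" for x
  proof -
    have "k * \<bar>s x\<bar> \<le> k * \<bar>C\<bar>" using C[of x] by (intro mult_left_mono) auto
    then have "\<bar>k * s x\<bar> \<le> k * \<bar>C\<bar>" by (simp add: abs_mult)
    then have "\<lfloor>k * s x\<rfloor> \<in> {-J..J}" unfolding J_def by (simp add: abs_le_iff) linarith
    then have "t x = of_int \<lfloor>k * s x\<rfloor> / k"
    proof -
      assume J: "\<lfloor>k * s x\<rfloor> \<in> {-J..J}"
      have "t x = (\<Sum>j\<in>{-J..J}. if \<lfloor>k * s x\<rfloor> = j then of_int j / k else 0)"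
        unfolding t_def using x by (intro sum.cong) (auto simp: indicator_def)
      then show ?thesis using J by (simp add: sum.delta')
    qed
    moreover have "of_int \<lfloor>k * s x\<rfloor> \<le> k * s x" "k * s x < of_int \<lfloor>k * s x\<rfloor> + 1" by linarith+
    ultimately show ?thesis using k(1) by (simp add: field_simps abs_le_iff) linarith
  qed
  have int_t: "integrable M (\<lambda>x. t x * d i x)" for i
    unfolding t_def sum_distrib_right mult.assoc
    by (intro Bochner_Integration.integrable_sum integrable_mult_right integrable_indicator_mult d) measurable
  have int_s: "integrable M (\<lambda>x. s x * d i x)" for i
    by (rule Bochner_Integration.integrable_bound[OF integrable_mult_right[OF d[of i], of C]])
      (use C in \<open>auto simp: abs_mult intro!: mult_right_mono order_trans[OF C abs_ge_self]\<close>)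
  have int_st: "integrable M (\<lambda>x. \<bar>s x - t x\<bar> * \<bar>d i x\<bar>)" for i
    unfolding abs_mult[symmetric] left_diff_distrib
    by (intro integrable_abs Bochner_Integration.integrable_diff int_s int_t)
  have "(LINT x|M. t x * d i x) = (\<Sum>j\<in>{-J..J}. (of_int j / k) * (LINT x|M. indicator {x\<in>space M. \<lfloor>k * s x\<rfloor> = j} x * d i x))" for i
    unfolding t_def sum_distrib_right mult.assoc
    by (subst Bochner_Integration.integral_sum)
      (auto intro!: integrable_mult_right integrable_indicator_mult d)
  then have "((\<lambda>i. LINT x|M. t x * d i x) \<longlongrightarrow> 0) F"
    by (simp only:) (intro tendsto_null_sum tendsto_mult_right_zero lim, measurable)
  then have "\<forall>\<^sub>F i in F. dist (LINT x|M. t x * d i x) 0 < e/2"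
    using e by (intro tendstoD) auto
  then show "\<forall>\<^sub>F i in F. dist (LINT x|M. s x * d i x) 0 < e"
  proof eventually_elim
    case (elim i)
    have "\<bar>(LINT x|M. s x * d i x) - (LINT x|M. t x * d i x)\<bar> = \<bar>LINT x|M. (s x - t x) * d i x\<bar>"
      by (simp add: left_diff_distrib int_s int_t)
    also have "\<dots> \<le> (LINT x|M. \<bar>(s x - t x) * d i x\<bar>)" by (rule integral_abs_bound)
    also have "\<dots> \<le> (LINT x|M. (1/k) * \<bar>d i x\<bar>)"
    proof (rule integral_mono)
      show "\<bar>(s x - t x) * d i x\<bar> \<le> (1/k) * \<bar>d i x\<bar>" if "x \<in> space M" for x
        unfolding abs_mult by (intro mult_right_mono ts that) simp
    qed (use int_st[of i] d[of i] in \<open>auto simp: abs_mult\<close>)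
    also have "\<dots> \<le> D / k" using D[of i] k(1) by (simp add: divide_right_mono)
    also have "\<dots> \<le> \<bar>D\<bar> / k" by (simp add: divide_right_mono)
    finally have "\<bar>(LINT x|M. s x * d i x) - (LINT x|M. t x * d i x)\<bar> \<le> \<bar>D\<bar> / k" .
    then show ?case using elim k(2) unfolding dist_real_def by linarith
  qed
qed

text \<open>
  Values below the level \<open>k\<close> are bounded by \<open>k\<close>; above it \<open>w = w powr (1 - p) * w powr p\<close>, where the
  first factor decreases in \<open>w\<close>. A large level \<open>k\<close> makes the second term small.
\<close>

lemma powr_split_bound:
  fixes w :: real
  assumes "0 \<le> w" "0 < k" "1 < p"
  shows "w \<le> k + k powr (1 - p) * w powr p"
proof (cases "w \<le> k")
  case False
  then have "w = w powr (1 - p) * w powr p" using assms by (simp add: powr_add[symmetric])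
  also have "\<dots> \<le> k powr (1 - p) * w powr p"
    using False assms by (intro mult_right_mono powr_mono2') auto
  finally show ?thesis using assms by linarith
qed (use assms in \<open>auto intro: add_increasing2\<close>)

lemma powr_neg_small:
  assumes "1 < (p::real)" "0 < e" "0 \<le> C"
  obtains k :: real where "k > 0" "k powr (1 - p) * C < e"
proof -
  have "((\<lambda>k. k powr (1 - p) * C) \<longlongrightarrow> 0 * C) at_top"
    by (intro tendsto_mult tendsto_neg_powr tendsto_const filterlim_ident) (use assms in auto)
  then have "eventually (\<lambda>k. k powr (1 - p) * C < e) at_top"
    using assms by (intro order_tendstoD(2)) auto
  then have "eventually (\<lambda>k::real. k > 0 \<and> k powr (1 - p) * C < e) at_top"
    using eventually_gt_at_top[of "0::real"] by eventually_elim simp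
  then show ?thesis using that by (auto simp: eventually_at_top_linorder)
qed

lemma (in finite_measure) integrable_of_powr:
  fixes w :: "'a \<Rightarrow> real"
  assumes [measurable]: "w \<in> borel_measurable M" and "1 < p" "integrable M (\<lambda>x. \<bar>w x\<bar> powr p)"
  shows "integrable M w"
proof (rule Bochner_Integration.integrable_bound)
  show "integrable M (\<lambda>x. 1 + \<bar>w x\<bar> powr p)" using assms by simp
  show "AE x in M. norm (w x) \<le> norm (1 + \<bar>w x\<bar> powr p)"
    using powr_split_bound[of "\<bar>w _\<bar>" 1 p] \<open>1 < p\<close> by (auto intro!: AE_I2)
qed simp

lemma (in finite_measure) integral_indicator_powr_bound:
  fixes w :: "'a \<Rightarrow> real"
  assumes [measurable]: "w \<in> borel_measurable M" "A \<in> sets M" and p: "1 < p" and i: "integrable M (\<lambda>x. \<bar>w x\<bar> powr p)"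
    and C: "(LINT x|M. \<bar>w x\<bar> powr p) \<le> C" and k: "0 < k"
  shows "(LINT x|M. indicator A x * \<bar>w x\<bar>) \<le> k * measure M A + k powr (1 - p) * C"
proof -
  have "(LINT x|M. indicator A x * \<bar>w x\<bar>) \<le> (LINT x|M. k * indicator A x + k powr (1 - p) * \<bar>w x\<bar> powr p)"
  proof (rule integral_mono)
    show "indicator A x * \<bar>w x\<bar> \<le> k * indicator A x + k powr (1 - p) * \<bar>w x\<bar> powr p" for x
      using powr_split_bound[of "\<bar>w x\<bar>" k p] k p by (auto simp: indicator_def)
    show "integrable M (\<lambda>x. indicator A x * \<bar>w x\<bar>)"
      by (intro integrable_indicator_mult integrable_abs integrable_of_powr[OF _ p i]) measurable
    show "integrable M (\<lambda>x. k * indicator A x + k powr (1 - p) * \<bar>w x\<bar> powr p)"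
      by (intro Bochner_Integration.integrable_add integrable_mult_right i) (simp add: emeasure_finite less_top[symmetric])
  qed
  also have "\<dots> = k * measure M A + k powr (1 - p) * (LINT x|M. \<bar>w x\<bar> powr p)"
    by (subst Bochner_Integration.integral_add) (auto simp: i emeasure_finite less_top[symmetric])
  also have "\<dots> \<le> k * measure M A + k powr (1 - p) * C"
    using C by (intro add_left_mono mult_left_mono) auto
  finally show ?thesis .
qed

text \<open>
  Boundedness in \<open>L\<^sup>p\<close> with \<open>p > 1\<close> implies equi-integrability: choose the level \<open>k\<close> first, then the
  measure of the set.
\<close>

lemma (in finite_measure) equi_integrable_powr:
  fixes w :: "'i \<Rightarrow> 'a \<Rightarrow> real"
  assumes [measurable]: "\<And>i. w i \<in> borel_measurable M" and p: "1 < p"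
    and i: "\<And>i. integrable M (\<lambda>x. \<bar>w i x\<bar> powr p)" and C: "\<And>i. (LINT x|M. \<bar>w i x\<bar> powr p) \<le> C"
  shows "equi_integrable M w"
  unfolding equi_integrable_def
proof (intro conjI allI impI)
  show "integrable M (w j)" for j by (rule integrable_of_powr[OF _ p i]) measurable
  fix e :: real assume e: "e > 0"
  have "0 \<le> (LINT x|M. \<bar>w undefined x\<bar> powr p)" by simp
  then have "0 \<le> C" using C[of undefined] by linarith
  then obtain k :: real where k: "k > 0" "k powr (1 - p) * C < e/2"
    using powr_neg_small[OF p, of "e/2" C] e by auto
  show "\<exists>\<eta>>0. \<forall>A\<in>sets M. measure M A < \<eta> \<longrightarrow> (\<forall>i. (LINT x|M. indicator A x * \<bar>w i x\<bar>) \<le> e)"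
  proof (intro exI[of _ "e / (2 * k)"] conjI ballI impI allI)
    fix A j assume A: "A \<in> sets M" "measure M A < e / (2 * k)"
    have "(LINT x|M. indicator A x * \<bar>w j x\<bar>) \<le> k * measure M A + k powr (1 - p) * C"
      by (rule integral_indicator_powr_bound) (use A p i C k in auto)
    also have "k * measure M A \<le> e/2" using A k by (simp add: field_simps)
    finally show "(LINT x|M. indicator A x * \<bar>w j x\<bar>) \<le> e" using k by linarith
  qed (use e k in auto)
qed

text \<open>
  Countability allows a diagonal subsequence, stability under intersections a Dynkin argument.
\<close>

lemma countable_Int_stable_borel_generator:
  obtains G :: "'a::second_countable_topology set set"
  where "countable G" "Int_stable G" "UNIV \<in> G" "sets borel = sigma_sets UNIV G"
proof -
  obtain B :: "'a set set" where B: "countable B" "topological_basis B"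
    using ex_countable_basis by blast
  define G where "G = Inter ` {F. finite F \<and> F \<subseteq> B}"
  have sB: "sets borel = sigma_sets UNIV B"
    unfolding borel_eq_countable_basis[OF B] by (rule sets_measure_of) auto
  have "countable G"
    unfolding G_def by (intro countable_image countable_Collect_finite_subset B)
  moreover have "Int_stable G"
  proof (rule Int_stableI)
    fix a b assume "a \<in> G" "b \<in> G"
    then obtain F F' where "a = \<Inter>F" "b = \<Inter>F'" "finite F" "F \<subseteq> B" "finite F'" "F' \<subseteq> B"
      by (auto simp: G_def)
    then show "a \<inter> b \<in> G"
      unfolding G_def by (intro image_eqI[of _ _ "F \<union> F'"]) auto
  qed
  moreover have "UNIV \<in> G"
    unfolding G_def by (intro image_eqI[of _ _ "{}"]) auto
  moreover have "sigma_sets UNIV B = sigma_sets UNIV G"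
  proof (rule sigma_sets_eqI)
    show "b \<in> sigma_sets UNIV G" if "b \<in> B" for b
      using that unfolding G_def by (intro sigma_sets.Basic image_eqI[of _ _ "{b}"]) auto
    show "g \<in> sigma_sets UNIV B" if g: "g \<in> G" for g
    proof -
      have "open g"
        using g B(2) unfolding G_def by (auto intro!: open_Inter simp: topological_basis_open)
      then show ?thesis unfolding sB[symmetric] by simp
    qed
  qed
  ultimately show ?thesis using that sB by metis
qed

lemma Cauchy_of_tendsto_diff:
  fixes X :: "nat \<Rightarrow> real"
  assumes "((\<lambda>(m, n). X m - X n) \<longlongrightarrow> 0) (sequentially \<times>\<^sub>F sequentially)"
  shows "Cauchy X"
proof (rule metric_CauchyI)
  fix e :: real assume "e > 0"
  then have "eventually (\<lambda>(m, n). dist (X m) (X n) < e) (sequentially \<times>\<^sub>F sequentially)"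
    using tendstoD[OF assms, of e] by (simp add: dist_real_def case_prod_unfold)
  then obtain N where "\<forall>m\<ge>N. \<forall>n\<ge>N. dist (X m) (X n) < e"
    unfolding eventually_prod_sequentially by auto
  then show "\<exists>M. \<forall>m\<ge>M. \<forall>n\<ge>M. dist (X m) (X n) < e" by blast
qed

text \<open>
  Bounded test functions define weak convergence in \<open>L\<^sup>1\<close>. On a finite measure space, a sequence that
  is bounded in \<open>L\<^sup>p\<close> with \<open>p > 1\<close> converges in this sense exactly if it converges weakly in \<open>L\<^sup>p\<close>.
\<close>

definition weakly_tendsto :: "'a measure \<Rightarrow> (nat \<Rightarrow> 'a \<Rightarrow> real) \<Rightarrow> ('a \<Rightarrow> real) \<Rightarrow> bool" where
  "weakly_tendsto M f v \<longleftrightarrow> (\<forall>s\<in>borel_measurable M. (\<exists>c. \<forall>x. \<bar>s x\<bar> \<le> c) \<longrightarrow>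
     (\<lambda>n. LINT x|M. s x * f n x) \<longlonglongrightarrow> (LINT x|M. s x * v x))"

lemma weakly_tendstoD:
  assumes "weakly_tendsto M f v" "s \<in> borel_measurable M" "\<And>x. \<bar>s x\<bar> \<le> c"
  shows "(\<lambda>n. LINT x|M. s x * f n x) \<longlonglongrightarrow> (LINT x|M. s x * v x)"
  using assms unfolding weakly_tendsto_def by blast

lemma weakly_tendsto_subseq:
  assumes "weakly_tendsto M f v" "strict_mono r"
  shows "weakly_tendsto M (\<lambda>n. f (r n)) v"
  unfolding weakly_tendsto_def
proof (intro ballI impI)
  fix s :: "_ \<Rightarrow> real" assume "s \<in> borel_measurable M" "\<exists>c. \<forall>x. \<bar>s x\<bar> \<le> c"
  then have "(\<lambda>n. LINT x|M. s x * f n x) \<longlonglongrightarrow> (LINT x|M. s x * v x)"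
    using assms(1) unfolding weakly_tendsto_def by blast
  from LIMSEQ_subseq_LIMSEQ[OF this assms(2)]
  show "(\<lambda>n. LINT x|M. s x * f (r n) x) \<longlonglongrightarrow> (LINT x|M. s x * v x)"
    by (simp add: o_def)
qed

text \<open>
  A diagonal subsequence makes the integrals over the sets of a countable generator converge. By
  equi-integrability they then converge over every measurable set, and the limits form a measure that
  is absolutely continuous. Its Radon-Nikodym density is the weak limit. Nonnegativity lets the
  limit be an ordinary measure.
\<close>

lemma weakly_convergent_subsequence_nonneg:
  fixes w :: "nat \<Rightarrow> 'a::second_countable_topology \<Rightarrow> real"
  assumes "finite_measure M" and M: "sets M = sets borel" and p: "1 < p"
    and w[measurable]: "\<And>n. w n \<in> borel_measurable M" and w0: "\<And>n x. 0 \<le> w n x"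
    and i: "\<And>n. integrable M (\<lambda>x. \<bar>w n x\<bar> powr p)" and C: "\<And>n. (LINT x|M. \<bar>w n x\<bar> powr p) \<le> C"
  obtains r v where "strict_mono (r :: nat \<Rightarrow> nat)" "v \<in> borel_measurable M" "integrable M (\<lambda>x. \<bar>v x\<bar> powr p)"
    "\<And>x. 0 \<le> v x"
    "weakly_tendsto M (\<lambda>n. w (r n)) v"
proof -
  interpret finite_measure M by fact
  have spM: "space M = UNIV" using sets_eq_imp_space_eq[OF M] by simp
  have wi[simp]: "integrable M (w n)" for n by (rule integrable_of_powr[OF _ p i]) measurable
  have ei: "equi_integrable M w" by (rule equi_integrable_powr[OF _ p i C]) measurable
  obtain G :: "'a set set" where G: "countable G" "Int_stable G" "UNIV \<in> G" "sets borel = sigma_sets UNIV G"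
    by (rule countable_Int_stable_borel_generator)
  \<comment> \<open>An \<open>L\<^sup>1\<close> bound, from splitting at the level \<open>k = 1\<close>.\<close>
  define D where "D = measure M UNIV + C"
  have Db: "(LINT x|M. \<bar>w n x\<bar>) \<le> D" for n
    using integral_indicator_powr_bound[OF w[of n] sets.top p i[of n] C[of n], of 1] by (simp add: D_def spM)
  define X where "X n A = (LINT x|M. indicator A x * w n x)" for n A
  have X0: "0 \<le> X n A" for n A unfolding X_def using w0 by (intro integral_nonneg_AE) auto
  have XD: "norm (X n A) \<le> D" if "A \<in> sets M" for n A
  proof -
    have "\<bar>X n A\<bar> \<le> (LINT x|M. \<bar>indicator A x * w n x\<bar>)" unfolding X_def by (rule integral_abs_bound)
    also have "\<dots> \<le> (LINT x|M. \<bar>w n x\<bar>)"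
      using that by (intro integral_mono integrable_abs integrable_indicator_mult) (auto simp: indicator_def)
    finally show ?thesis using Db[of n] by simp
  qed
  have GM: "A \<in> sets M" if "A \<in> G" for A using that unfolding M G(4) by (rule sigma_sets.Basic)
  obtain r where r: "strict_mono r" and conv: "\<And>A. A \<in> G \<Longrightarrow> \<exists>l. (\<lambda>n. X (r n) A) \<longlonglongrightarrow> l"
  proof (rule function_convergent_subsequence[OF G(1), of X D])
    show "norm (X n A) \<le> D" if "A \<in> G" for n A by (rule XD[OF GM[OF that]])
  qed (rule that)
  have eir: "equi_integrable M (\<lambda>n. w (r n))"
    using ei unfolding equi_integrable_def by blast
  \<comment> \<open>The differences of two members of the subsequence are equi-integrable, so being Cauchy carries over
    from the generator to all measurable sets.\<close>
  have "convergent (\<lambda>n. X (r n) A)" if A: "A \<in> sets M" for A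
  proof -
    have "((\<lambda>ij. LINT x|M. indicator A x * (case ij of (i, j) \<Rightarrow> \<lambda>x. w (r i) x - w (r j) x) x) \<longlongrightarrow> 0)
        (sequentially \<times>\<^sub>F sequentially)"
    proof (rule equi_integrable_tendsto_sets[OF equi_integrable_diff[OF eir eir] G(2) _ _ _ _ A])
      fix A assume A: "A \<in> G"
      then obtain l where l: "(\<lambda>n. X (r n) A) \<longlonglongrightarrow> l" using conv by blast
      have [measurable]: "A \<in> sets M" using A by (simp add: M G(4) sigma_sets.Basic)
      have "((\<lambda>ij. X (r (fst ij)) A - X (r (snd ij)) A) \<longlongrightarrow> l - l) (sequentially \<times>\<^sub>F sequentially)"
        by (intro tendsto_diff filterlim_compose[OF l] filterlim_fst filterlim_snd)
      moreover have "(LINT x|M. indicator A x * (case ij of (i, j) \<Rightarrow> \<lambda>x. w (r i) x - w (r j) x) x)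
         = X (r (fst ij)) A - X (r (snd ij)) A" for ij
        unfolding X_def case_prod_beta right_diff_distrib
        by (rule Bochner_Integration.integral_diff) (auto intro!: integrable_indicator_mult)
      ultimately show "((\<lambda>ij. LINT x|M. indicator A x * (case ij of (i, j) \<Rightarrow> \<lambda>x. w (r i) x - w (r j) x) x) \<longlongrightarrow> 0)
        (sequentially \<times>\<^sub>F sequentially)" by simp
    qed (use M G spM in auto)
    moreover have "(LINT x|M. indicator A x * (case ij of (i, j) \<Rightarrow> \<lambda>x. w (r i) x - w (r j) x) x)
         = (case ij of (m, n) \<Rightarrow> X (r m) A - X (r n) A)" for ij
      unfolding X_def case_prod_beta right_diff_distrib
      by (rule Bochner_Integration.integral_diff) (auto intro!: integrable_indicator_mult A)
    ultimately have "((\<lambda>(m, n). X (r m) A - X (r n) A) \<longlongrightarrow> 0) (sequentially \<times>\<^sub>F sequentially)"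
      by (simp only:)
    then show ?thesis by (intro Cauchy_convergent Cauchy_of_tendsto_diff)
  qed
  then obtain \<nu> where \<nu>: "\<And>A. A \<in> sets M \<Longrightarrow> (\<lambda>n. X (r n) A) \<longlonglongrightarrow> \<nu> A"
    unfolding convergent_def by metis
  have \<nu>0: "0 \<le> \<nu> A" if "A \<in> sets M" for A
    by (rule LIMSEQ_le_const[OF \<nu>[OF that]]) (use X0 in auto)
  have \<nu>small: "\<exists>\<eta>>0. \<forall>A\<in>sets M. measure M A < \<eta> \<longrightarrow> \<nu> A \<le> e" if "e > 0" for e
  proof -
    obtain \<eta> where \<eta>: "\<eta> > 0" "\<And>A i. A \<in> sets M \<Longrightarrow> measure M A < \<eta> \<Longrightarrow> (LINT x|M. indicator A x * \<bar>w i x\<bar>) \<le> e"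
      by (rule equi_integrableE[OF ei \<open>e > 0\<close>]) blast
    show ?thesis
      using \<eta> w0 by (intro exI[of _ \<eta>] conjI ballI impI LIMSEQ_le_const2[OF \<nu>]) (auto simp: X_def)
  qed
  have \<nu>add: "\<nu> (A \<union> B) = \<nu> A + \<nu> B" if A: "A \<in> sets M" and B: "B \<in> sets M" and "A \<inter> B = {}" for A B
  proof -
    have "X n (A \<union> B) = X n A + X n B" for n
    proof -
      have "indicator (A \<union> B) x = (indicator A x + indicator B x :: real)" for x
        using \<open>A \<inter> B = {}\<close> by (auto simp: indicator_def)
      then show ?thesis
        unfolding X_def by (simp add: distrib_right integrable_indicator_mult A B)
    qed
    then have "(\<lambda>n. X (r n) (A \<union> B)) \<longlonglongrightarrow> \<nu> A + \<nu> B"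
      using tendsto_add[OF \<nu>[OF A] \<nu>[OF B]] by simp
    then show ?thesis using \<nu>[of "A \<union> B"] A B LIMSEQ_unique by blast
  qed
  have \<nu>null: "\<nu> A = 0" if A: "A \<in> sets M" and "measure M A = 0" for A
  proof -
    have "\<nu> A \<le> e" if "e > 0" for e
      using \<nu>small[OF that] A \<open>measure M A = 0\<close> by auto
    then show ?thesis using \<nu>0[OF A] by (metis dense_ge antisym)
  qed
  define \<nu>' where "\<nu>' A = ennreal (\<nu> A)" for A
  have pos: "positive (sets M) \<nu>'"
    using \<nu>null[of "{}"] by (simp add: positive_def \<nu>'_def)
  have ca: "countably_additive (sets M) \<nu>'"
  proof (rule sets.empty_continuous_imp_countably_additive[OF pos])
    show "additive (sets M) \<nu>'"
      unfolding additive_def \<nu>'_def using \<nu>add \<nu>0 by (auto simp: ennreal_plus[symmetric] simp del: ennreal_plus)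
    show "\<forall>A\<in>sets M. \<nu>' A \<noteq> \<infinity>" by (simp add: \<nu>'_def)
    fix A :: "nat \<Rightarrow> 'a set" assume A: "range A \<subseteq> sets M" "decseq A" "(\<Inter>i. A i) = {}"
    have mA: "(\<lambda>n. measure M (A n)) \<longlonglongrightarrow> 0"
      using finite_Lim_measure_decseq[OF A(1,2)] A(3) by simp
    have "(\<lambda>n. \<nu> (A n)) \<longlonglongrightarrow> 0"
    proof (rule tendstoI)
      fix e :: real assume "e > 0"
      then obtain \<eta> where \<eta>: "\<eta> > 0" "\<And>A. A \<in> sets M \<Longrightarrow> measure M A < \<eta> \<Longrightarrow> \<nu> A \<le> e/2"
        using \<nu>small[of "e/2"] by auto
      have "eventually (\<lambda>n. measure M (A n) < \<eta>) sequentially"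
        using mA \<eta>(1) by (rule order_tendstoD)
      then show "eventually (\<lambda>n. dist (\<nu> (A n)) 0 < e) sequentially"
      proof eventually_elim
        case (elim n)
        then have "\<nu> (A n) \<le> e/2" "0 \<le> \<nu> (A n)" using \<eta>(2)[of "A n"] \<nu>0[of "A n"] A(1) by auto
        then show ?case using \<open>e > 0\<close> by simp
      qed
    qed
    then show "(\<lambda>n. \<nu>' (A n)) \<longlonglongrightarrow> 0"
      unfolding \<nu>'_def using tendsto_ennrealI by fastforce
  qed
  define N where "N = measure_of (space M) (sets M) \<nu>'"
  have sN[simp]: "sets N = sets M" by (simp add: N_def)
  have N: "emeasure N A = ennreal (\<nu> A)" if "A \<in> sets M" for A
    unfolding N_def \<nu>'_def[symmetric]
    by (rule emeasure_measure_of_sigma) (use that pos ca sets.sigma_algebra_axioms in auto)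
  have "absolutely_continuous M N"
    unfolding absolutely_continuous_def
    using \<nu>null by (auto simp: null_sets_def N measure_def)
  then obtain h where h[measurable]: "h \<in> borel_measurable M" and hN: "density M h = N"
    using Radon_Nikodym[of N] by auto
  have hint: "(\<integral>\<^sup>+x. h x * indicator A x \<partial>M) = ennreal (\<nu> A)" if "A \<in> sets M" for A
    using emeasure_density[OF h that] N[OF that] hN by simp
  have "(\<integral>\<^sup>+x. h x \<partial>M) \<noteq> \<infinity>"
    using hint[OF sets.top] spM by simp
  then have hfin: "AE x in M. h x \<noteq> \<infinity>"
    by (intro nn_integral_PInf_AE) auto
  define v where "v x = enn2real (h x)" for x
  have [measurable]: "v \<in> borel_measurable M" unfolding v_def by measurable
  have v0: "0 \<le> v x" for x by (simp add: v_def)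
  have vint: "(\<integral>\<^sup>+x. ennreal (indicator A x * v x) \<partial>M) = ennreal (\<nu> A)" if "A \<in> sets M" for A
    unfolding hint[OF that, symmetric]
    by (intro nn_integral_cong_AE) (use hfin in eventually_elim, auto simp: v_def indicator_def less_top)
  have vi: "integrable M v"
    by (rule integrableI_nn_integral_finite[of _ _ "\<nu> UNIV"]) (use v0 vint[OF sets.top] spM \<nu>0[OF sets.top] in auto)
  have vA: "(LINT x|M. indicator A x * v x) = \<nu> A" if "A \<in> sets M" for A
  proof -
    note [measurable] = that
    have "(LINT x|M. indicator A x * v x) = enn2real (\<integral>\<^sup>+x. ennreal (indicator A x * v x) \<partial>M)"
      by (rule integral_eq_nn_integral) (use v0 in auto)
    then show ?thesis using vint[OF that] \<nu>0[OF that] by simp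
  qed
  have di: "integrable M (\<lambda>x. w (r n) x - v x)" for n using vi by simp
  have dD: "(LINT x|M. \<bar>w (r n) x - v x\<bar>) \<le> D + (LINT x|M. \<bar>v x\<bar>)" for n
  proof -
    have "(LINT x|M. \<bar>w (r n) x - v x\<bar>) \<le> (LINT x|M. \<bar>w (r n) x\<bar> + \<bar>v x\<bar>)"
      using vi by (intro integral_mono) auto
    then show ?thesis using Db[of "r n"] vi by simp
  qed
  have sets0: "(\<lambda>n. LINT x|M. indicator A x * (w (r n) x - v x)) \<longlonglongrightarrow> 0" if A: "A \<in> sets M" for A
  proof -
    have "(LINT x|M. indicator A x * (w (r n) x - v x)) = X (r n) A - \<nu> A" for n
      unfolding right_diff_distrib X_def vA[OF A, symmetric]
      by (rule Bochner_Integration.integral_diff) (auto intro!: integrable_indicator_mult A vi)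
    then show ?thesis using \<nu>[OF A] by (simp add: LIM_zero)
  qed
  have main: "(\<lambda>n. LINT x|M. s x * w (r n) x) \<longlonglongrightarrow> (LINT x|M. s x * v x)"
    if s[measurable]: "s \<in> borel_measurable M" and c: "\<And>x. \<bar>s x\<bar> \<le> c" for s c
  proof -
    have lim: "(\<lambda>n. LINT x|M. s x * (w (r n) x - v x)) \<longlonglongrightarrow> 0"
      by (rule tendsto_integral_bounded_mult[OF di dD sets0 s c])
    have si: "integrable M (\<lambda>x. s x * f x)" if "integrable M f" for f
      by (rule Bochner_Integration.integrable_bound[OF integrable_mult_right[OF that, of c]])
        (use c that in \<open>auto simp: abs_mult intro!: mult_right_mono order_trans[OF c abs_ge_self]\<close>)
    have "(LINT x|M. s x * (w (r n) x - v x)) = (LINT x|M. s x * w (r n) x) - (LINT x|M. s x * v x)" for n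
      unfolding right_diff_distrib by (rule Bochner_Integration.integral_diff) (auto intro!: si vi)
    then show ?thesis using lim by (simp add: LIM_zero_iff)
  qed
  have "integrable M (\<lambda>x. \<bar>v x\<bar> powr p)"
  proof -
    \<comment> \<open>Lower semicontinuity of the norm: testing with the bounded function \<open>s = (min v k) powr (p - 1)\<close>
      and using Young's inequality bounds the integral of \<open>(min v k) powr p\<close> by \<open>C\<close>, uniformly in \<open>k\<close>.\<close>
    define m where "m k x = min (v x) (real k)" for k :: nat and x
    have [measurable]: "m k \<in> borel_measurable M" for k unfolding m_def by measurable
    have m0: "0 \<le> m k x" "m k x \<le> k" "m k x \<le> v x" for k x using v0 by (auto simp: m_def)
    define q where "q = p / (p - 1)"
    have q: "1 < q" "1/p + 1/q = 1" using p by (auto simp: q_def field_simps)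
    have mp: "integrable M (\<lambda>x. m k x powr p)" for k
      by (rule integrable_const_bound[where B = "real k powr p"]) (use m0 p in \<open>auto intro!: powr_mono2\<close>)
    have bound: "(LINT x|M. m k x powr p) \<le> C" for k
    proof -
      define s where "s x = m k x powr (p - 1)" for x
      have [measurable]: "s \<in> borel_measurable M" unfolding s_def by measurable
      have sb: "\<bar>s x\<bar> \<le> real k powr (p - 1)" for x
        unfolding s_def using m0 p by (auto intro!: powr_mono2)
      have sq: "s x powr q = m k x powr p" for x
        unfolding s_def using p by (simp add: powr_powr q_def)
      have si: "integrable M (\<lambda>x. s x * f x)" if "integrable M f" for f
        by (rule Bochner_Integration.integrable_bound[OF integrable_mult_right[OF that, of "real k powr (p - 1)"]])
          (use sb that in \<open>auto simp: abs_mult intro!: mult_right_mono\<close>)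
      have "(LINT x|M. s x * w (r n) x) \<le> C / p + (LINT x|M. m k x powr p) / q" for n
      proof -
        have "(LINT x|M. s x * w (r n) x) \<le> (LINT x|M. \<bar>w (r n) x\<bar> powr p / p + m k x powr p / q)"
        proof (rule integral_mono)
          show "s x * w (r n) x \<le> \<bar>w (r n) x\<bar> powr p / p + m k x powr p / q" for x
            using Youngs_inequality[of p q "w (r n) x" "s x"] p q w0 sq[of x]
            by (simp add: s_def mult.commute)
        qed (use si mp i in auto)
        also have "\<dots> = (LINT x|M. \<bar>w (r n) x\<bar> powr p) / p + (LINT x|M. m k x powr p) / q"
          using i mp by simp
        also have "\<dots> \<le> C / p + (LINT x|M. m k x powr p) / q"
          using C[of "r n"] p by (simp add: divide_right_mono)
        finally show ?thesis .
      qed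
      then have "(LINT x|M. s x * v x) \<le> C / p + (LINT x|M. m k x powr p) / q"
        by (intro LIMSEQ_le_const2[OF main[OF _ sb]]) auto
      moreover have "(LINT x|M. m k x powr p) \<le> (LINT x|M. s x * v x)"
      proof (rule integral_mono)
        show "m k x powr p \<le> s x * v x" for x
        proof -
          have "m k x powr p = s x * m k x"
            unfolding s_def using powr_mult_base[OF m0(1)[of k x], of "p - 1"] by (simp add: mult.commute)
          then show ?thesis using m0[of k x] by (simp add: s_def mult_left_mono)
        qed
      qed (use si vi mp in auto)
      ultimately have "(LINT x|M. m k x powr p) * (1 - 1/q) \<le> C / p" by (simp add: algebra_simps)
      also have "1 - 1/q = 1/p" using q by linarith
      finally show ?thesis using p by (simp add: field_simps)
    qed
    have "(\<integral>\<^sup>+x. ennreal (v x powr p) \<partial>M) = (\<integral>\<^sup>+x. (SUP k. ennreal (m k x powr p)) \<partial>M)"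
    proof (rule nn_integral_cong)
      fix x
      obtain k :: nat where k: "v x \<le> k" using real_arch_simple by blast
      have "m l x powr p \<le> v x powr p" for l using m0 p by (intro powr_mono2) auto
      moreover have "m k x = v x" using k by (simp add: m_def)
      ultimately show "ennreal (v x powr p) = (SUP k. ennreal (m k x powr p))"
        by (intro antisym SUP_least SUP_upper2[of k]) (auto intro!: ennreal_leI)
    qed
    also have "\<dots> = (SUP k. \<integral>\<^sup>+x. ennreal (m k x powr p) \<partial>M)"
      by (rule nn_integral_monotone_convergence_SUP)
        (use p v0 in \<open>auto simp: incseq_def le_fun_def m_def intro!: ennreal_leI powr_mono2\<close>)
    also have "\<dots> \<le> ennreal C"
      using bound mp by (intro SUP_least) (simp add: nn_integral_eq_integral ennreal_leI)
    finally have "(\<integral>\<^sup>+x. ennreal (v x powr p) \<partial>M) < \<infinity>" by (simp add: le_less_trans[OF _ ennreal_less_top])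
    then show ?thesis
      using v0 by (intro integrableI_bounded) auto
  qed
  note vp = this
  show ?thesis
  proof (rule that[OF r])
    show "v \<in> borel_measurable M" "integrable M (\<lambda>x. \<bar>v x\<bar> powr p)" by (measurable, rule vp)
    show "0 \<le> v x" for x by (rule v0)
    show "weakly_tendsto M (\<lambda>n. w (r n)) v"
      unfolding weakly_tendsto_def using main by blast
  qed
qed

text \<open>
  Apply the nonnegative case to the positive and the negative parts, one after the other.
\<close>

lemma weakly_convergent_subsequence:
  fixes f :: "nat \<Rightarrow> 'a::second_countable_topology \<Rightarrow> real"
  assumes "finite_measure M" and M: "sets M = sets borel" and p: "1 < p"
    and f[measurable]: "\<And>n. f n \<in> borel_measurable M"
    and i: "\<And>n. integrable M (\<lambda>x. \<bar>f n x\<bar> powr p)" and C: "\<And>n. (LINT x|M. \<bar>f n x\<bar> powr p) \<le> C"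
  obtains r v where "strict_mono (r :: nat \<Rightarrow> nat)" "v \<in> borel_measurable M" "integrable M (\<lambda>x. \<bar>v x\<bar> powr p)"
    "weakly_tendsto M (\<lambda>n. f (r n)) v"
proof -
  interpret finite_measure M by fact
  define P where "P n x = max 0 (f n x)" for n x
  define N where "N n x = max 0 (- f n x)" for n x
  have [measurable]: "P n \<in> borel_measurable M" "N n \<in> borel_measurable M" for n
    unfolding P_def N_def by measurable
  have PN: "0 \<le> P n x" "0 \<le> N n x" "\<bar>P n x\<bar> powr p \<le> \<bar>f n x\<bar> powr p" "\<bar>N n x\<bar> powr p \<le> \<bar>f n x\<bar> powr p"
    "f n x = P n x - N n x" for n x
    using p by (auto simp: P_def N_def intro!: powr_mono2)
  have iPN: "integrable M (\<lambda>x. \<bar>P n x\<bar> powr p)" "integrable M (\<lambda>x. \<bar>N n x\<bar> powr p)" for n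
    by (rule Bochner_Integration.integrable_bound[OF i[of n]]; use PN in auto)+
  have CPN: "(LINT x|M. \<bar>P n x\<bar> powr p) \<le> C" "(LINT x|M. \<bar>N n x\<bar> powr p) \<le> C" for n
    by (rule order_trans[OF integral_mono C[of n]]; use PN i iPN in auto)+
  obtain r1 v1 where r1: "strict_mono r1" and v1[measurable]: "v1 \<in> borel_measurable M"
    and iv1: "integrable M (\<lambda>x. \<bar>v1 x\<bar> powr p)" and v10: "\<And>x. 0 \<le> v1 x"
    and l1: "weakly_tendsto M (\<lambda>n. P (r1 n)) v1"
  proof (rule weakly_convergent_subsequence_nonneg[OF \<open>finite_measure M\<close> M p, of P C])
    show "P n \<in> borel_measurable M" for n by measurable
    show "0 \<le> P n x" for n x by (rule PN(1))
    show "integrable M (\<lambda>x. \<bar>P n x\<bar> powr p)" "(LINT x|M. \<bar>P n x\<bar> powr p) \<le> C" for n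
      by (rule iPN(1), rule CPN(1))
  qed (rule that)
  obtain r2 v2 where r2: "strict_mono r2" and v2[measurable]: "v2 \<in> borel_measurable M"
    and iv2: "integrable M (\<lambda>x. \<bar>v2 x\<bar> powr p)" and v20: "\<And>x. 0 \<le> v2 x"
    and l2: "weakly_tendsto M (\<lambda>n. N (r1 (r2 n))) v2"
  proof (rule weakly_convergent_subsequence_nonneg[OF \<open>finite_measure M\<close> M p, of "\<lambda>n. N (r1 n)" C])
    show "N (r1 n) \<in> borel_measurable M" for n by measurable
    show "0 \<le> N (r1 n) x" for n x by (rule PN(2))
    show "integrable M (\<lambda>x. \<bar>N (r1 n) x\<bar> powr p)" "(LINT x|M. \<bar>N (r1 n) x\<bar> powr p) \<le> C" for n
      by (rule iPN(2), rule CPN(2))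
  qed (rule that)
  show ?thesis
  proof (rule that)
    show "strict_mono (r1 \<circ> r2)" using r1 r2 by (rule strict_mono_o)
    show "(\<lambda>x. v1 x - v2 x) \<in> borel_measurable M" by measurable
    show "integrable M (\<lambda>x. \<bar>v1 x - v2 x\<bar> powr p)"
    proof (rule Bochner_Integration.integrable_bound)
      show "integrable M (\<lambda>x. \<bar>v1 x\<bar> powr p + \<bar>v2 x\<bar> powr p)" using iv1 iv2 by simp
      show "AE x in M. norm (\<bar>v1 x - v2 x\<bar> powr p) \<le> norm (\<bar>v1 x\<bar> powr p + \<bar>v2 x\<bar> powr p)"
      proof (rule AE_I2)
        fix x
        have "\<bar>v1 x - v2 x\<bar> powr p \<le> (max \<bar>v1 x\<bar> \<bar>v2 x\<bar>) powr p"
          using v10[of x] v20[of x] p by (intro powr_mono2) auto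
        also have "\<dots> \<le> \<bar>v1 x\<bar> powr p + \<bar>v2 x\<bar> powr p" by (simp add: max_def)
        finally show "norm (\<bar>v1 x - v2 x\<bar> powr p) \<le> norm (\<bar>v1 x\<bar> powr p + \<bar>v2 x\<bar> powr p)" by simp
      qed
    qed simp
    show "weakly_tendsto M (\<lambda>n. f ((r1 \<circ> r2) n)) (\<lambda>x. v1 x - v2 x)"
      unfolding weakly_tendsto_def
    proof (intro ballI impI)
    fix s :: "_ \<Rightarrow> real" assume s[measurable]: "s \<in> borel_measurable M" and "\<exists>c. \<forall>x. \<bar>s x\<bar> \<le> (c::real)"
    then obtain c where c: "\<And>x. \<bar>s x\<bar> \<le> c" by blast
    have si: "integrable M (\<lambda>x. s x * g x)" if "integrable M g" for g
      by (rule Bochner_Integration.integrable_bound[OF integrable_mult_right[OF that, of c]])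
        (use c that in \<open>auto simp: abs_mult intro!: mult_right_mono order_trans[OF c abs_ge_self]\<close>)
    have iP: "integrable M (P n)" and iN: "integrable M (N n)" for n
      by (rule integrable_of_powr[OF _ p]; use iPN in simp)+
    have iv: "integrable M v1" "integrable M v2"
      by (rule integrable_of_powr[OF _ p]; use iv1 iv2 in simp)+
    have "(\<lambda>n. (LINT x|M. s x * P (r1 (r2 n)) x) - (LINT x|M. s x * N (r1 (r2 n)) x))
       \<longlonglongrightarrow> (LINT x|M. s x * v1 x) - (LINT x|M. s x * v2 x)"
      by (intro tendsto_diff weakly_tendstoD[OF l2 s c] weakly_tendstoD[OF weakly_tendsto_subseq[OF l1 r2] s c])
    moreover have "(LINT x|M. s x * P n x) - (LINT x|M. s x * N n x) = (LINT x|M. s x * f n x)" for n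
      unfolding PN(5) right_diff_distrib
      by (rule Bochner_Integration.integral_diff[symmetric]) (intro si iP iN)+
    moreover have "(LINT x|M. s x * v1 x) - (LINT x|M. s x * v2 x) = (LINT x|M. s x * (v1 x - v2 x))"
      unfolding right_diff_distrib
      by (rule Bochner_Integration.integral_diff[symmetric]) (intro si iv)+
    ultimately show "(\<lambda>n. LINT x|M. s x * f ((r1 \<circ> r2) n) x) \<longlonglongrightarrow> (LINT x|M. s x * (v1 x - v2 x))"
      by simp
    qed
  qed
qed

section \<open>Periodic test functions\<close>

text \<open>
  Lipschitz continuity in both variables makes \<open>x \<mapsto> F(x, \<cdot>)\<close> continuous for the supremum norm, and it
  bounds the effect of small changes of the arguments.
\<close>

definition periodic_test :: "((real^'n) \<times> (real^'n) \<Rightarrow> real) \<Rightarrow> bool" where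
  "periodic_test F \<longleftrightarrow> (\<forall>z. 0 \<le> F z \<and> F z \<le> 1) \<and> (\<exists>L. L-lipschitz_on UNIV F) \<and> (\<forall>x. Y_periodic (\<lambda>y. F (x, y)))"

lemma periodic_test_continuous: "periodic_test F \<Longrightarrow> continuous_on UNIV F"
  unfolding periodic_test_def by (auto intro: lipschitz_on_continuous_on)

lemma periodic_test_measurable: "periodic_test F \<Longrightarrow> F \<in> borel_measurable borel"
  by (simp add: borel_measurable_continuous_onI periodic_test_continuous)

lemma periodic_test_bounds: "periodic_test F \<Longrightarrow> 0 \<le> F z" "periodic_test F \<Longrightarrow> F z \<le> 1" "periodic_test F \<Longrightarrow> \<bar>F z\<bar> \<le> 1"
  unfolding periodic_test_def by (auto simp del: split_paired_All)

text \<open>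
  The function \<open>min 1 (j dist(z, N))\<close>, where \<open>N\<close> is the complement of the periodic extension of \<open>A\<close>,
  increases to the indicator function of that extension. On the closed cell the extension is \<open>A\<close>
  itself, because \<open>A\<close> stays away from the faces.
\<close>

lemma periodic_test_approx_open:
  fixes A :: "((real^'n) \<times> (real^'n)) set"
  assumes "open A" and A: "A \<subseteq> UNIV \<times> box 0 1"
  obtains F :: "nat \<Rightarrow> (real^'n) \<times> (real^'n) \<Rightarrow> real"
  where "\<And>j. periodic_test (F j)" "\<And>z. snd z \<in> unit_cell \<Longrightarrow> (\<lambda>j. F j z) \<longlonglongrightarrow> indicator A z"
proof -
  define N where "N = - (\<Union>k\<in>int_lattice. (\<lambda>z. z + (0, k)) -` A)"
  have "open ((\<lambda>z. z + (0, k)) -` A)" for k :: "real^'n"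
    by (rule open_vimage[OF \<open>open A\<close>]) (intro continuous_intros)
  then have "closed N" unfolding N_def by (auto simp: closed_def)
  have N_iff: "z \<in> N \<longleftrightarrow> z \<notin> A" if "snd z \<in> unit_cell" for z
  proof -
    have "k = 0" if "k \<in> int_lattice" "z + (0, k) \<in> A" for k
      using int_lattice_cell_shift[of k "snd z"] that A \<open>snd z \<in> unit_cell\<close> by (auto simp: prod_eq_iff)
    moreover have "z + (0, 0) = z" by (simp add: prod_eq_iff)
    ultimately show ?thesis using int_lattice_0 unfolding N_def by fastforce
  qed
  have "(0, 0) \<in> N"
    using N_iff[of "(0,0)"] A by (auto simp: unit_cell_iff open_unit_cell_iff)
  then have N0: "N \<noteq> {}" by blast
  have N_shift: "z + (0, k) \<in> N" if "z \<in> N" "k \<in> int_lattice" for z k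
  proof (rule ccontr)
    assume "z + (0, k) \<notin> N"
    then obtain l where l: "l \<in> int_lattice" "z + (0, k) + (0, l) \<in> A" by (auto simp: N_def)
    then have "z + (0, k + l) \<in> A" by (simp add: add.assoc)
    then show False using that int_lattice_add[OF that(2) l(1)] by (auto simp: N_def)
  qed
  have inf_shift: "infdist (z + (0, k)) N = infdist z N" if k: "k \<in> int_lattice" for z k
  proof -
    have "(\<lambda>a. dist (z + (0, k)) a) ` N = (\<lambda>a. dist z a) ` N"
    proof safe
      fix a assume "a \<in> N"
      then show "dist (z + (0, k)) a \<in> dist z ` N"
        using N_shift[OF _ int_lattice_uminus[OF k], of a]
        by (intro image_eqI[of _ _ "a + (0, - k)"]) (auto simp: dist_norm algebra_simps prod_eq_iff intro!: arg_cong[where f = norm])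
      show "dist z a \<in> dist (z + (0, k)) ` N"
        using N_shift[OF \<open>a \<in> N\<close> k]
        by (intro image_eqI[of _ _ "a + (0, k)"]) (auto simp: dist_norm)
    qed
    then show ?thesis using N0 by (simp add: infdist_notempty)
  qed
  define F where "F j z = min 1 (real j * infdist z N)" for j z
  show ?thesis
  proof (rule that)
    fix j
    have "(real j)-lipschitz_on UNIV (F j)"
    proof (rule lipschitz_onI)
      fix x y
      have "dist (F j x) (F j y) \<le> \<bar>real j * infdist x N - real j * infdist y N\<bar>"
        by (auto simp: F_def dist_real_def min_def)
      also have "\<dots> = real j * \<bar>infdist x N - infdist y N\<bar>"
        by (simp add: abs_mult right_diff_distrib[symmetric])
      also have "\<dots> \<le> real j * dist x y"
        by (intro mult_left_mono infdist_triangle_abs) auto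
      finally show "dist (F j x) (F j y) \<le> real j * dist x y" .
    qed simp
    moreover have "Y_periodic (\<lambda>y. F j (x, y))" for x
      using inf_shift[of _ "(x, _)"] by (simp add: Y_periodic_def F_def)
    ultimately show "periodic_test (F j)"
      unfolding periodic_test_def by (auto simp: F_def infdist_nonneg)
  next
    fix z :: "(real^'n) \<times> (real^'n)" assume z: "snd z \<in> unit_cell"
    show "(\<lambda>j. F j z) \<longlonglongrightarrow> indicator A z"
    proof (cases "z \<in> A")
      case True
      then have "z \<notin> N" using N_iff[OF z] by simp
      then have pos: "infdist z N > 0"
        using infdist_pos_not_in_closed[OF \<open>closed N\<close> N0] by simp
      obtain m :: nat where m: "1 / infdist z N < m" using reals_Archimedean2 by blast
      have "F j z = 1" if "j \<ge> m" for j
      proof -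
        have "1 < real m * infdist z N" using m pos by (simp add: field_simps)
        also have "\<dots> \<le> real j * infdist z N" using that pos by (intro mult_right_mono) auto
        finally show ?thesis by (simp add: F_def)
      qed
      then show ?thesis
        using True by (intro tendsto_eventually) (auto simp: eventually_sequentially)
    next
      case False
      then show ?thesis using N_iff[OF z] by (simp add: F_def)
    qed
  qed
qed

text \<open>
  Approximation by test functions gives the inequality for open sets, and outer regularity extends it
  to Borel sets.
\<close>

lemma measure_le_of_periodic_test:
  fixes m1 m2 :: "((real^'n) \<times> (real^'n)) measure"
  assumes fin: "finite_measure m1" "finite_measure m2" and sets: "sets m1 = sets borel" "sets m2 = sets borel"
    and cell: "AE z in m1. snd z \<in> unit_cell" "AE z in m2. snd z \<in> unit_cell" and c: "0 \<le> c"
    and test: "\<And>F. periodic_test F \<Longrightarrow> (LINT z|m1. F z) \<le> c * (LINT z|m2. F z)"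
    and A: "A \<in> sets borel" "A \<subseteq> UNIV \<times> box 0 1"
  shows "measure m1 A \<le> c * measure m2 A"
proof -
  interpret m1: finite_measure m1 by fact
  interpret m2: finite_measure m2 by fact
  have lim: "(\<lambda>j. LINT z|m. F j z) \<longlonglongrightarrow> measure m U"
    if m: "finite_measure m" "sets m = sets borel" "AE z in m. snd z \<in> unit_cell"
      and F: "\<And>j. periodic_test (F j)" "\<And>z. snd z \<in> unit_cell \<Longrightarrow> (\<lambda>j. F j z) \<longlonglongrightarrow> indicator U z"
      and "open U"
    for m U and F :: "nat \<Rightarrow> (real^'n) \<times> (real^'n) \<Rightarrow> real"
  proof -
    interpret finite_measure m by fact
    have U[measurable]: "U \<in> sets m" using \<open>open U\<close> m by simp
    have "(\<lambda>j. LINT z|m. F j z) \<longlonglongrightarrow> (LINT z|m. indicator U z)"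
    proof (rule integral_dominated_convergence[where w = "\<lambda>_. 1"])
      show "F j \<in> borel_measurable m" for j
        using periodic_test_measurable[OF F(1)[of j]] by (simp add: measurable_cong_sets[OF m(2) refl])
      show "AE z in m. (\<lambda>j. F j z) \<longlonglongrightarrow> indicator U z" using m(3) by eventually_elim (rule F(2))
      show "AE z in m. norm (F j z) \<le> 1" for j
        using F(1)[of j] by (auto simp: periodic_test_def)
    qed auto
    then show ?thesis using U by simp
  qed
  have op: "measure m1 U \<le> c * measure m2 U" if U: "open U" "U \<subseteq> UNIV \<times> box 0 1" for U
  proof -
    obtain F :: "nat \<Rightarrow> (real^'n) \<times> (real^'n) \<Rightarrow> real"
      where F: "\<And>j. periodic_test (F j)" "\<And>z. snd z \<in> unit_cell \<Longrightarrow> (\<lambda>j. F j z) \<longlonglongrightarrow> indicator U z"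
      using periodic_test_approx_open[OF U] by blast
    show ?thesis
      by (rule LIMSEQ_le[OF lim[OF fin(1) sets(1) cell(1) F U(1)]
            tendsto_mult_left[OF lim[OF fin(2) sets(2) cell(2) F U(1)], of c]])
        (use test F in auto)
  qed
  show ?thesis
  proof (rule field_le_epsilon)
    fix e :: real assume e: "e > 0"
    define d where "d = e / (c + 1)"
    have d: "d > 0" "c * d \<le> e" using e c by (auto simp: d_def field_simps)
    have fA: "emeasure m2 A = ennreal (measure m2 A)" by (simp add: m2.emeasure_eq_measure)
    have "(INF U\<in>{U. A \<subseteq> U \<and> open U}. emeasure m2 U) = emeasure m2 A"
      by (rule outer_regular[symmetric]) (use A sets in auto)
    also have "\<dots> < ennreal (measure m2 A + d)" unfolding fA using d by (simp add: ennreal_less_iff)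
    finally obtain U where U: "A \<subseteq> U" "open U" "emeasure m2 U < ennreal (measure m2 A + d)"
      by (auto simp: INF_less_iff)
    define V where "V = U \<inter> (UNIV \<times> box 0 1)"
    have V: "open V" "V \<subseteq> UNIV \<times> box 0 1" "A \<subseteq> V" "V \<subseteq> U"
      using U A by (auto simp: V_def intro!: open_Int open_Times)
    have "measure m2 U < measure m2 A + d"
      using U(3) by (simp add: m2.emeasure_eq_measure ennreal_less_iff)
    then have "measure m2 V \<le> measure m2 A + d"
      using m2.finite_measure_mono[OF V(4)] U sets by simp
    have "measure m1 A \<le> measure m1 V" by (rule m1.finite_measure_mono) (use V sets in auto)
    also have "\<dots> \<le> c * measure m2 V" by (rule op) (use V in auto)
    also have "\<dots> \<le> c * (measure m2 A + d)" using \<open>measure m2 V \<le> _\<close> c by (rule mult_left_mono)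
    finally show "measure m1 A \<le> c * measure m2 A + e" using d by (simp add: distrib_left)
  qed
qed

text \<open>
  After unfolding, the first integrand is \<open>f(S(z)) F(S(z), y)\<close> with \<open>z = (x, y)\<close>, by periodicity.
  As \<open>S(z)\<close> is within \<open>\<epsilon> N\<close> of \<open>x\<close>, uniform continuity of \<open>F\<close> on a compact set replaces it by \<open>F(z)\<close>.
\<close>

lemma unfolded_pairing_tendsto:
  fixes f :: "nat \<Rightarrow> real^'n \<Rightarrow> real"
  assumes \<epsilon>: "\<And>n. 0 < \<epsilon> n" "\<epsilon> \<longlonglongrightarrow> 0" and K[measurable]: "K \<in> sets borel" and "bounded K"
    and f[measurable]: "\<And>n. f n \<in> borel_measurable borel" and fi: "\<And>n. integrable lborel (f n)"
    and C: "\<And>n. (LINT x|lborel. \<bar>f n x\<bar>) \<le> C"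
    and supp: "\<And>n z. snd z \<in> unit_cell \<Longrightarrow> f n (unfold_map (\<epsilon> n) z) \<noteq> 0 \<Longrightarrow> fst z \<in> K"
    and F: "continuous_on UNIV F" and B: "\<And>z. \<bar>F z\<bar> \<le> B" and per: "\<And>x. Y_periodic (\<lambda>y. F (x, y))"
  shows "(\<lambda>n. (LINT x|lborel. f n x * F (x, x /\<^sub>R \<epsilon> n))
            - (LINT z|slab_measure K. f n (unfold_map (\<epsilon> n) z) * F z)) \<longlonglongrightarrow> 0"
proof (rule tendstoI)
  fix e :: real assume e: "e > 0"
  have Fm[measurable]: "F \<in> borel_measurable borel" by (rule borel_measurable_continuous_onI[OF F])
  have C0: "0 \<le> C" using order_trans[OF integral_nonneg_AE C[of 0]] by simp
  define d where "d = e / (C + 1)"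
  have d: "d > 0" "C * d < e" using e C0 by (auto simp: d_def field_simps)
  obtain R where R: "\<And>x. x \<in> K \<Longrightarrow> norm x \<le> R" using \<open>bounded K\<close> by (auto simp: bounded_iff)
  \<comment> \<open>For \<open>\<epsilon> n \<le> 1\<close> unfolding moves points of \<open>K\<close> by at most \<open>CARD('n)\<close>, so \<open>Q\<close> contains all arguments.\<close>
  define Q where "Q = cball (0 :: real^'n) (R + CARD('n)) \<times> (unit_cell :: (real^'n) set)"
  have "compact Q" unfolding Q_def unit_cell_def by (intro compact_Times) auto
  then have "uniformly_continuous_on Q F"
    by (intro compact_uniformly_continuous continuous_on_subset[OF F]) auto
  then obtain \<eta> where \<eta>: "\<eta> > 0" "\<And>z z'. z \<in> Q \<Longrightarrow> z' \<in> Q \<Longrightarrow> dist z' z < \<eta> \<Longrightarrow> dist (F z') (F z) < d"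
    unfolding uniformly_continuous_on_def using d(1) by blast
  have "eventually (\<lambda>n. \<epsilon> n < min 1 (\<eta> / CARD('n))) sequentially"
    using \<eta>(1) by (intro order_tendstoD(2)[OF \<epsilon>(2)]) auto
  then show "eventually (\<lambda>n. dist ((LINT x|lborel. f n x * F (x, x /\<^sub>R \<epsilon> n))
            - (LINT z|slab_measure K. f n (unfold_map (\<epsilon> n) z) * F z)) 0 < e) sequentially"
  proof eventually_elim
    case (elim n)
    let ?S = "unfold_map (\<epsilon> n) :: (real^'n) \<times> (real^'n) \<Rightarrow> real^'n"
    let ?M = "slab_measure K"
    have e1: "\<epsilon> n * CARD('n) \<le> CARD('n)" "\<epsilon> n * CARD('n) < \<eta>"
      using elim \<epsilon>(1)[of n] by (auto simp: field_simps)
    have close: "\<bar>F (?S z, snd z) - F z\<bar> \<le> d" if "fst z \<in> K" "snd z \<in> unit_cell" for z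
    proof -
      have cl: "norm (?S z - fst z) \<le> \<epsilon> n * CARD('n)" by (rule unfold_map_close[OF that(2) \<epsilon>(1)])
      then have "norm (?S z) \<le> R + CARD('n)"
        using R[OF that(1)] e1(1) norm_triangle_sub[of "?S z" "fst z"] by linarith
      moreover have "norm (fst z) \<le> R + CARD('n)" using R[OF that(1)] by simp
      ultimately have "(?S z, snd z) \<in> Q" "z \<in> Q" using that by (auto simp: Q_def mem_Times_iff)
      moreover have "dist (?S z, snd z) z < \<eta>"
        using cl e1(2) by (cases z) (simp add: dist_Pair_Pair dist_norm)
      ultimately show ?thesis using \<eta>(2)[of z "(?S z, snd z)"] by (simp add: dist_real_def)
    qed
    have fS: "integrable ?M (\<lambda>z. f n (?S z))" by (rule integrable_unfold_slab[OF fi _ _ \<epsilon>(1)]) auto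
    have bint: "integrable ?M (\<lambda>z. f n (?S z) * g z)" if [measurable]: "g \<in> borel_measurable borel" and "\<And>z. \<bar>g z\<bar> \<le> B" for g
      by (rule Bochner_Integration.integrable_bound[OF integrable_mult_left[OF fS, of B]])
        (use that in \<open>auto simp: abs_mult intro!: mult_left_mono order_trans[OF that(2) abs_ge_self]\<close>)
    have m2: "(\<lambda>z. F (?S z, snd z)) \<in> borel_measurable borel"
      by (rule measurable_compose[OF _ Fm], intro borel_measurable_Pair measurable_unfold_map)
        (intro borel_measurable_continuous_onI continuous_intros)
    have "(LINT x|lborel. f n x * F (x, x /\<^sub>R \<epsilon> n)) = (LINT z|?M. f n (?S z) * F (?S z, ?S z /\<^sub>R \<epsilon> n))"
    proof (rule integral_eq_slab[OF _ K \<epsilon>(1)])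
      have "(\<lambda>x. F (x, x /\<^sub>R \<epsilon> n)) \<in> borel_measurable borel"
        by (rule measurable_compose[OF _ Fm], intro borel_measurable_continuous_onI continuous_intros)
      then show "(\<lambda>x. f n x * F (x, x /\<^sub>R \<epsilon> n)) \<in> borel_measurable borel" by measurable
    qed (use supp in auto)
    also have "\<dots> = (LINT z|?M. f n (?S z) * F (?S z, snd z))"
      using Y_periodic_unfold_map[OF per \<epsilon>(1)] by simp
    finally have "(LINT x|lborel. f n x * F (x, x /\<^sub>R \<epsilon> n)) - (LINT z|?M. f n (?S z) * F z)
        = (LINT z|?M. f n (?S z) * F (?S z, snd z) - f n (?S z) * F z)"
      using bint[OF Fm B] bint[OF m2 B] by simp
    also have "\<bar>\<dots>\<bar> \<le> (LINT z|?M. \<bar>f n (?S z) * F (?S z, snd z) - f n (?S z) * F z\<bar>)"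
      by (rule integral_abs_bound)
    also have "\<dots> \<le> (LINT z|?M. \<bar>f n (?S z)\<bar> * d)"
    proof (rule integral_mono_AE)
      show "integrable ?M (\<lambda>z. \<bar>f n (?S z) * F (?S z, snd z) - f n (?S z) * F z\<bar>)"
        by (intro integrable_abs Bochner_Integration.integrable_diff bint[OF Fm B] bint[OF m2 B])
      show "integrable ?M (\<lambda>z. \<bar>f n (?S z)\<bar> * d)" using fS by simp
      have "AE z in ?M. z \<in> K \<times> unit_cell" by (simp add: AE_slab_measure_iff)
      then show "AE z in ?M. \<bar>f n (?S z) * F (?S z, snd z) - f n (?S z) * F z\<bar> \<le> \<bar>f n (?S z)\<bar> * d"
        by eventually_elim
          (auto simp: abs_mult right_diff_distrib[symmetric] intro!: mult_left_mono close)
    qed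
    also have "\<dots> = (LINT x|lborel. \<bar>f n x\<bar>) * d"
      using integral_eq_slab[of "\<lambda>x. \<bar>f n x\<bar>" K "\<epsilon> n"] supp \<epsilon>(1)[of n] by simp
    also have "\<dots> \<le> C * d" using C[of n] d by (intro mult_right_mono) auto
    also have "\<dots> < e" by fact
    finally show ?case by simp
  qed
qed

section \<open>Change of variables\<close>

text \<open>
  The change of variables theorem with determinants holds for coordinates indexed by a well-ordered
  type. An arbitrary finite index type has a copy that inherits a well-order from an enumeration, and
  neither Lebesgue measure nor the determinant changes under this relabelling of the coordinates.
\<close>

typedef 'a ordered_copy = "UNIV :: 'a set" by simp

instance ordered_copy :: (finite) finite
proof
  have "finite (range (Abs_ordered_copy :: 'a \<Rightarrow> 'a ordered_copy))"
    by (rule finite_imageI) simp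
  also have "range (Abs_ordered_copy :: 'a \<Rightarrow> 'a ordered_copy) = UNIV"
    using Rep_ordered_copy_inverse by (intro surjI)
  finally show "finite (UNIV :: 'a ordered_copy set)" .
qed

instantiation ordered_copy :: (finite) wellorder
begin

definition "x \<le> y \<longleftrightarrow> to_nat (Rep_ordered_copy x) \<le> to_nat (Rep_ordered_copy y)"
definition "x < y \<longleftrightarrow> to_nat (Rep_ordered_copy x) < to_nat (Rep_ordered_copy y)"

instance
proof
  fix x y z :: "'a ordered_copy"
  show "x < y \<longleftrightarrow> x \<le> y \<and> \<not> y \<le> x"
    by (auto simp: less_eq_ordered_copy_def less_ordered_copy_def)
  show "x \<le> x"
    by (simp add: less_eq_ordered_copy_def)
  show "x \<le> y \<Longrightarrow> y \<le> z \<Longrightarrow> x \<le> z"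
    by (simp add: less_eq_ordered_copy_def)
  show "x \<le> y \<Longrightarrow> y \<le> x \<Longrightarrow> x = y"
    by (simp add: less_eq_ordered_copy_def Rep_ordered_copy_inject)
  show "x \<le> y \<or> y \<le> x"
    by (auto simp: less_eq_ordered_copy_def)
next
  fix P :: "'a ordered_copy \<Rightarrow> bool" and a
  assume *: "\<And>x. (\<And>y. y < x \<Longrightarrow> P y) \<Longrightarrow> P x"
  show "P a"
  proof (induct a rule: measure_induct_rule[of "\<lambda>x. to_nat (Rep_ordered_copy x)"])
    case (less x)
    show ?case by (rule *) (rule less, simp add: less_ordered_copy_def)
  qed
qed

end

lemma Rep_Abs_copy [simp]: "Rep_ordered_copy (Abs_ordered_copy x) = x"
  by (simp add: Abs_ordered_copy_inverse)

lemmas Abs_Rep_copy [simp] = Rep_ordered_copy_inverse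

lemma bij_Rep_copy: "bij Rep_ordered_copy"
  by (metis Rep_Abs_copy Abs_Rep_copy bijI')

definition to_copy :: "real^'n \<Rightarrow> real^('n ordered_copy)" where
  "to_copy x = (\<chi> i. x $ Rep_ordered_copy i)"

definition of_copy :: "real^('n ordered_copy) \<Rightarrow> real^'n" where
  "of_copy y = (\<chi> i. y $ Abs_ordered_copy i)"

lemma to_of_copy [simp]: "to_copy (of_copy y) = y" "of_copy (to_copy x) = x"
  by (simp_all add: to_copy_def of_copy_def vec_eq_iff)

lemma linear_to_copy: "linear to_copy" and linear_of_copy: "linear of_copy"
  by (auto intro!: linearI simp: to_copy_def of_copy_def vec_eq_iff)

lemma continuous_to_copy: "continuous_on S to_copy" and continuous_of_copy: "continuous_on T of_copy"
  by (auto intro: linear_continuous_on linear_conv_bounded_linear[THEN iffD1] linear_to_copy linear_of_copy)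

lemma measurable_to_copy [measurable]: "to_copy \<in> borel_measurable borel"
  and measurable_of_copy [measurable]: "of_copy \<in> borel_measurable borel"
  by (auto intro: borel_measurable_continuous_onI continuous_to_copy continuous_of_copy)

lemma emeasure_box_cart:
  fixes l u :: "real^'n"
  assumes "\<And>i. l $ i \<le> u $ i"
  shows "emeasure lborel (box l u) = ennreal (\<Prod>i\<in>UNIV. u $ i - l $ i)"
proof -
  have ne: "cbox l u \<noteq> {}" using assms by (auto simp: interval_ne_empty_cart)
  have "emeasure lborel (box l u) = emeasure lborel (cbox l u)"
    by (simp add: emeasure_lborel_box_eq emeasure_lborel_cbox_eq)
  also have "\<dots> = ennreal (measure lborel (cbox l u))"
    by (rule emeasure_eq_ennreal_measure) (simp add: emeasure_lborel_cbox_eq)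
  also have "measure lborel (cbox l u) = (\<Prod>i\<in>UNIV. u $ i - l $ i)"
    using content_cbox_cart[OF ne] by simp
  finally show ?thesis .
qed

text \<open>
  Relabelling of the coordinates maps boxes to boxes of the same volume.
\<close>

lemma distr_to_copy: "distr lborel borel to_copy = (lborel :: (real^('n::finite ordered_copy)) measure)"
proof (rule lborel_eqI[symmetric])
  fix l u :: "real^('n ordered_copy)" assume "\<And>b. b \<in> Basis \<Longrightarrow> l \<bullet> b \<le> u \<bullet> b"
  then have lu: "l $ i \<le> u $ i" for i
    by (metis axis_in_Basis_iff cart_eq_inner_axis one_neq_zero Basis_real_def insertI1)
  have "to_copy -` box l u = box (of_copy l) (of_copy u)"
    unfolding set_eq_iff vimage_eq mem_box_cart
  proof (intro allI iffI)
    fix x i assume "\<forall>i. l $ i < to_copy x $ i \<and> to_copy x $ i < u $ i"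
    then show "of_copy l $ i < x $ i \<and> x $ i < of_copy u $ i"
      by (auto simp: to_copy_def of_copy_def dest: spec[of _ "Abs_ordered_copy i"])
  next
    fix x i assume "\<forall>i. of_copy l $ i < x $ i \<and> x $ i < of_copy u $ i"
    then show "l $ i < to_copy x $ i \<and> to_copy x $ i < u $ i"
      by (auto simp: to_copy_def of_copy_def dest: spec[of _ "Rep_ordered_copy i"])
  qed
  then have "emeasure (distr lborel borel to_copy) (box l u) = emeasure lborel (box (of_copy l) (of_copy u))"
    by (simp add: emeasure_distr)
  also have "\<dots> = ennreal (\<Prod>i\<in>UNIV. of_copy u $ i - of_copy l $ i)"
    by (rule emeasure_box_cart) (simp add: of_copy_def lu)
  also have "(\<Prod>i\<in>UNIV. of_copy u $ i - of_copy l $ i) = (\<Prod>i\<in>UNIV. u $ i - l $ i)"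
    unfolding of_copy_def vec_lambda_beta
    by (rule prod.reindex_bij_witness[of _ Rep_ordered_copy Abs_ordered_copy]) auto
  also have "ennreal \<dots> = emeasure lborel (box l u)"
    by (rule emeasure_box_cart[OF lu, symmetric])
  also have "\<dots> = (\<Prod>b\<in>Basis. (u - l) \<bullet> b)"
    by (rule emeasure_lborel_box) fact
  finally show "emeasure (distr lborel borel to_copy) (box l u) = (\<Prod>b\<in>Basis. (u - l) \<bullet> b)" .
qed simp

lemma integral_to_copy:
  fixes f :: "real^('n::finite ordered_copy) \<Rightarrow> real"
  assumes [measurable]: "f \<in> borel_measurable borel"
  shows "(LINT y|lborel. f y) = (LINT x|lborel. f (to_copy x))"
  unfolding distr_to_copy[symmetric] by (rule integral_distr) auto

text \<open>
  Conjugation with the relabelling is a bijection of the permutations that preserves signs.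
\<close>

lemma det_reindex_copy:
  fixes A :: "real^'n^'n"
  shows "det (\<chi> i j. A $ Rep_ordered_copy i $ Rep_ordered_copy j) = det A"
proof -
  let ?R = Rep_ordered_copy and ?A = Abs_ordered_copy
  have "det A = (\<Sum>p | p permutes UNIV. of_int (sign p) * (\<Prod>i\<in>UNIV. A $ i $ p i))"
    by (simp add: det_def)
  also have "\<dots> = (\<Sum>q | q permutes UNIV. of_int (sign q) * (\<Prod>i\<in>UNIV. A $ ?R i $ ?R (q i)))"
  proof (rule sum.reindex_bij_witness[of _ "\<lambda>q. ?R \<circ> q \<circ> ?A" "\<lambda>p. ?A \<circ> p \<circ> ?R"])
    fix p :: "'n \<Rightarrow> 'n" assume p: "p \<in> {p. p permutes UNIV}"
    then have "bij p" by (simp add: permutes_bij)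
    have bA: "bij ?A" by (metis Rep_Abs_copy Abs_Rep_copy bijI')
    show "?R \<circ> (?A \<circ> p \<circ> ?R) \<circ> ?A = p" by (auto simp: fun_eq_iff)
    show "?A \<circ> p \<circ> ?R \<in> {q. q permutes UNIV}"
      using \<open>bij p\<close> bA bij_Rep_copy by (auto intro!: bij_imp_permutes bij_comp)
    have "map_permutation UNIV ?A p = ?A \<circ> p \<circ> ?R"
    proof
      fix i :: "'n ordered_copy"
      have "surj ?A" using bA by (rule bij_is_surj)
      moreover have "inv ?A = ?R" by (rule inv_equality) auto
      ultimately show "map_permutation UNIV ?A p i = (?A \<circ> p \<circ> ?R) i"
        unfolding map_permutation_def restrict_id_def by (metis UNIV_I comp_apply)
    qed
    then have "sign (?A \<circ> p \<circ> ?R) = sign p"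
      using sign_map_permutation[of ?A UNIV p] p bij_is_inj[OF bA] by simp
    moreover have "(\<Prod>i\<in>UNIV. A $ ?R i $ ?R ((?A \<circ> p \<circ> ?R) i)) = (\<Prod>i\<in>UNIV. A $ i $ p i)"
      by (rule prod.reindex_bij_witness[of _ ?A ?R]) auto
    ultimately show "of_int (sign (?A \<circ> p \<circ> ?R)) * (\<Prod>i\<in>UNIV. A $ ?R i $ ?R ((?A \<circ> p \<circ> ?R) i))
      = of_int (sign p) * (\<Prod>i\<in>UNIV. A $ i $ p i)" by simp
  next
    fix q :: "'n ordered_copy \<Rightarrow> 'n ordered_copy" assume q: "q \<in> {q. q permutes UNIV}"
    have bA: "bij (?A :: 'n \<Rightarrow> _)" by (metis Rep_Abs_copy Abs_Rep_copy bijI')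
    show "?A \<circ> (?R \<circ> q \<circ> ?A) \<circ> ?R = q" by (auto simp: fun_eq_iff)
    show "?R \<circ> q \<circ> ?A \<in> {p. p permutes UNIV}"
      using q bA bij_Rep_copy by (auto intro!: bij_imp_permutes bij_comp simp: permutes_bij)
  qed
  finally show ?thesis by (simp add: det_def)
qed

text \<open>
  In the change of variables formula, the determinant in the integrand is replaced by its lower and
  upper bounds.
\<close>

lemma integral_image_bounds_wellorder:
  fixes g :: "real^'m::{finite,wellorder} \<Rightarrow> real^'m::_"
  assumes S: "open S" "bounded S" and gS: "open (g ` S)" "bounded (g ` S)"
    and inj: "inj_on g S" and der: "\<And>x. x \<in> S \<Longrightarrow> (g has_derivative g' x) (at x)"
    and ab: "\<And>x. x \<in> S \<Longrightarrow> a \<le> \<bar>det (matrix (g' x))\<bar> \<and> \<bar>det (matrix (g' x))\<bar> \<le> b"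
    and F[measurable]: "F \<in> borel_measurable borel" and F01: "\<And>y. 0 \<le> F y \<and> F y \<le> (1::real)"
  shows "a * (LINT x|lborel. indicator S x * F (g x)) \<le> (LINT y|lborel. indicator (g ` S) y * F y)"
    and "(LINT y|lborel. indicator (g ` S) y * F y) \<le> b * (LINT x|lborel. indicator S x * F (g x))"
proof -
  have fin: "emeasure lborel T < \<infinity>" if "open T" "bounded T" for T :: "(real^'m::_) set"
    using that by (intro emeasure_bounded_finite)
  have bint: "set_integrable lborel T f" if "open T" "bounded T" "(\<lambda>x. indicator T x *\<^sub>R f x) \<in> borel_measurable borel" "\<And>x. \<bar>f x\<bar> \<le> 1"
    for T and f :: "real^'m::_ \<Rightarrow> real"
    unfolding set_integrable_def
    by (rule integrableI_bounded_set[of T _ _ 1])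
      (use that fin[OF that(1,2)] in \<open>auto simp: indicator_def\<close>)
  have iF: "set_integrable lborel (g ` S) F" by (rule bint) (use gS F01 in auto)
  have "continuous_on S g"
    using der by (meson continuous_at_imp_continuous_on has_derivative_continuous)
  then have gm: "(\<lambda>x. indicator S x *\<^sub>R g x) \<in> borel_measurable borel"
    using S(1) by (intro borel_measurable_continuous_on_indicator) auto
  note [measurable] = measurable_compose[OF gm F]
  have [measurable]: "S \<in> sets borel" using S(1) by simp
  have "(\<lambda>x. indicator S x *\<^sub>R F (g x)) = (\<lambda>x. indicator S x *\<^sub>R F (indicator S x *\<^sub>R g x))"
    by (auto simp: fun_eq_iff indicator_def)
  moreover have "(\<lambda>x. indicator S x *\<^sub>R F (indicator S x *\<^sub>R g x)) \<in> borel_measurable borel"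
    by measurable
  ultimately have iG: "set_integrable lborel S (\<lambda>x. F (g x))" by (intro bint) (use S F01 in auto)
  have "(\<lambda>y. indicator (g ` S) y *\<^sub>R F y) \<in> borel_measurable lborel"
    using gS(1) F by (intro borel_measurable_scaleR) (auto intro: borel_measurable_indicator)
  then have "F absolutely_integrable_on (g ` S)"
    using iF unfolding set_integrable_def by (simp add: integrable_completion)
  \<comment> \<open>The change of variables theorem is about vector-valued functions; \<open>vec\<close> makes \<open>F\<close> one.\<close>
  then have "(\<lambda>y. vec (F y) :: real^1) absolutely_integrable_on (g ` S)"
    by (simp add: absolutely_integrable_on_1_iff)
  moreover have "S \<in> sets lebesgue" using S(1) by simp
  moreover have "(g has_derivative g' x) (at x within S)" if "x \<in> S" for x
    using der[OF that] by (rule has_derivative_at_withinI)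
  ultimately have cov: "(\<lambda>x. \<bar>det (matrix (g' x))\<bar> *\<^sub>R (vec (F (g x)) :: real^1)) absolutely_integrable_on S"
    "integral S (\<lambda>x. \<bar>det (matrix (g' x))\<bar> *\<^sub>R (vec (F (g x)) :: real^1)) = integral (g ` S) (\<lambda>y. vec (F y) :: real^1)"
    using has_absolute_integral_change_of_variables[of S g g' "\<lambda>y. vec (F y) :: real^1" "integral (g ` S) (\<lambda>y. vec (F y) :: real^1)"] inj
    by blast+
  have D: "(\<lambda>x. \<bar>det (matrix (g' x))\<bar> * F (g x)) integrable_on S"
    using cov(1) by (simp add: absolutely_integrable_on_1_iff set_lebesgue_integral_eq_integral(1))
  have eq: "integral S (\<lambda>x. \<bar>det (matrix (g' x))\<bar> * F (g x)) = integral (g ` S) F"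
    using cov(2) by (simp add: integral_on_1_eq vec_eq_iff)
  have G: "(\<lambda>x. F (g x)) integrable_on S" using set_borel_integral_eq_integral(1)[OF iG] .
  have lS: "(LINT x|lborel. indicator S x * F (g x)) = integral S (\<lambda>x. F (g x))"
    using set_borel_integral_eq_integral(2)[OF iG] by (simp add: set_lebesgue_integral_def)
  have lT: "(LINT y|lborel. indicator (g ` S) y * F y) = integral (g ` S) F"
    using set_borel_integral_eq_integral(2)[OF iF] by (simp add: set_lebesgue_integral_def)
  have "a * integral S (\<lambda>x. F (g x)) = integral S (\<lambda>x. a * F (g x))" by simp
  also have "\<dots> \<le> integral S (\<lambda>x. \<bar>det (matrix (g' x))\<bar> * F (g x))"
    by (rule integral_le) (use G D ab F01 in \<open>auto intro!: mult_right_mono integrable_on_mult_right\<close>)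
  finally show "a * (LINT x|lborel. indicator S x * F (g x)) \<le> (LINT y|lborel. indicator (g ` S) y * F y)"
    by (simp add: lS lT eq)
  have "integral S (\<lambda>x. \<bar>det (matrix (g' x))\<bar> * F (g x)) \<le> integral S (\<lambda>x. b * F (g x))"
    by (rule integral_le) (use G D ab F01 in \<open>auto intro!: mult_right_mono integrable_on_mult_right\<close>)
  also have "\<dots> = b * integral S (\<lambda>x. F (g x))" by simp
  finally show "(LINT y|lborel. indicator (g ` S) y * F y) \<le> b * (LINT x|lborel. indicator S x * F (g x))"
    by (simp add: lS lT eq)
qed

text \<open>
  The previous estimate, transported by the relabelling of the coordinates.
\<close>

lemma integral_image_bounds:
  fixes g :: "real^'n \<Rightarrow> real^'n"
  assumes S: "open S" "bounded S" and gS: "open (g ` S)" "bounded (g ` S)"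
    and inj: "inj_on g S" and der: "\<And>x. x \<in> S \<Longrightarrow> g differentiable (at x)"
    and ab: "\<And>x. x \<in> S \<Longrightarrow> a \<le> \<bar>det (jac g x)\<bar> \<and> \<bar>det (jac g x)\<bar> \<le> b"
    and F[measurable]: "F \<in> borel_measurable borel" and F01: "\<And>y. 0 \<le> F y \<and> F y \<le> (1::real)"
  shows "a * (LINT x|lborel. indicator S x * F (g x)) \<le> (LINT y|lborel. indicator (g ` S) y * F y)"
    and "(LINT y|lborel. indicator (g ` S) y * F y) \<le> b * (LINT x|lborel. indicator S x * F (g x))"
proof -
  define G where "G = to_copy \<circ> g \<circ> of_copy"
  define T where "T = to_copy ` S"
  define F' where "F' = F \<circ> of_copy"
  have inj_to: "inj to_copy" by (rule inj_on_inverseI[of _ of_copy]) simp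
  have vim: "to_copy ` A = of_copy -` A" for A :: "(real^'n) set"
    by (auto simp: image_iff) (metis to_of_copy(1))
  have open_to: "open (to_copy ` A)" if "open A" for A :: "(real^'n) set"
    unfolding vim using that continuous_of_copy by (rule open_vimage)
  have bdd_to: "bounded (to_copy ` A)" if "bounded A" for A :: "(real^'n) set"
    using that linear_to_copy by (rule bounded_linear_image[OF _ linear_conv_bounded_linear[THEN iffD1]])
  have GT: "G ` T = to_copy ` g ` S" by (auto simp: G_def T_def image_iff)
  define D where "D x = frechet_derivative g (at x)" for x
  have D: "(g has_derivative D x) (at x)" if "x \<in> S" for x
    using der[OF that] by (simp add: D_def frechet_derivative_works)
  have bl: "bounded_linear to_copy" "bounded_linear of_copy"
    using linear_to_copy linear_of_copy by (simp_all add: linear_conv_bounded_linear)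
  have derG: "(G has_derivative (to_copy \<circ> D (of_copy y) \<circ> of_copy)) (at y)" if "y \<in> T" for y
  proof -
    have yS: "of_copy y \<in> S" using that by (auto simp: T_def)
    have "((g \<circ> of_copy) has_derivative (D (of_copy y) \<circ> of_copy)) (at y)"
      by (rule diff_chain_at[OF bounded_linear_imp_has_derivative[OF bl(2)] D[OF yS]])
    from diff_chain_at[OF this bounded_linear_imp_has_derivative[OF bl(1)]]
    show ?thesis by (simp add: G_def o_assoc)
  qed
  have matG: "det (matrix (to_copy \<circ> D x \<circ> of_copy)) = det (jac g x)" for x
  proof -
    have ax: "of_copy (axis j 1) = axis (Rep_ordered_copy j) (1::real)" for j
      by (auto simp: of_copy_def axis_def vec_eq_iff)
    have "matrix (to_copy \<circ> D x \<circ> of_copy)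
        = (\<chi> i j. jac g x $ Rep_ordered_copy i $ Rep_ordered_copy j)"
      by (simp add: matrix_def jacobian_def D_def vec_eq_iff ax) (simp add: to_copy_def)
    then show ?thesis by (simp add: det_reindex_copy)
  qed
  have opn: "open T" "bounded T" "open (G ` T)" "bounded (G ` T)"
    using open_to[OF S(1)] bdd_to[OF S(2)] open_to[OF gS(1)] bdd_to[OF gS(2)]
    unfolding GT by (simp_all add: T_def)
  have injG: "inj_on G T"
  proof (rule inj_onI)
    fix x y assume xy: "x \<in> T" "y \<in> T" "G x = G y"
    then have "g (of_copy x) = g (of_copy y)" using injD[OF inj_to] by (simp add: G_def)
    then have "of_copy x = of_copy y" using inj xy by (auto simp: T_def dest: inj_onD)
    then show "x = y" by (metis to_of_copy(1))
  qed
  have F'm: "F' \<in> borel_measurable borel" unfolding F'_def comp_def by measurable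
  have abG: "a \<le> \<bar>det (matrix (to_copy \<circ> D (of_copy y) \<circ> of_copy))\<bar> \<and>
     \<bar>det (matrix (to_copy \<circ> D (of_copy y) \<circ> of_copy))\<bar> \<le> b" if "y \<in> T" for y
    unfolding matG using that ab by (auto simp: T_def)
  have "continuous_on S g"
    using D by (meson continuous_at_imp_continuous_on has_derivative_continuous)
  then have gm: "(\<lambda>x. indicator S x *\<^sub>R g x) \<in> borel_measurable borel"
    using S(1) by (intro borel_measurable_continuous_on_indicator) auto
  have ind: "indicator (to_copy ` A) (to_copy x) = (indicator A x :: real)" for A :: "(real^'n) set" and x
    using inj_image_mem_iff[OF inj_to, of x A] by (simp only: indicator_def)
  have [measurable]: "S \<in> sets borel" "T \<in> sets borel" "g ` S \<in> sets borel" "G ` T \<in> sets borel" using S gS opn by auto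
  have 1: "(LINT y|lborel. indicator (G ` T) y * F' y) = (LINT x|lborel. indicator (g ` S) x * F x)"
  proof -
    have "(\<lambda>y. indicator (G ` T) y * F' y) \<in> borel_measurable borel" using F'm by measurable
    from integral_to_copy[OF this] show ?thesis by (simp add: GT ind F'_def)
  qed
  have "(\<lambda>x. indicator S x * F (g x)) = (\<lambda>x. indicator S x * F (indicator S x *\<^sub>R g x))"
    by (auto simp: fun_eq_iff indicator_def)
  moreover note [measurable] = measurable_compose[OF gm F]
  have "(\<lambda>x. indicator S x * F (indicator S x *\<^sub>R g x)) \<in> borel_measurable borel" by measurable
  ultimately have m: "(\<lambda>x. indicator S x * F (g x)) \<in> borel_measurable borel" by (simp only:)
  have eqT: "(\<lambda>y. indicator T y * F' (G y)) = (\<lambda>y. (\<lambda>x. indicator S x * F (g x)) (of_copy y))"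
    by (auto simp: fun_eq_iff indicator_def T_def F'_def G_def image_iff) (metis to_of_copy)
  have 2: "(LINT y|lborel. indicator T y * F' (G y)) = (LINT x|lborel. indicator S x * F (g x))"
    unfolding eqT by (subst integral_to_copy) (use m in \<open>auto intro: measurable_compose[OF measurable_of_copy]\<close>)
  have F'01: "0 \<le> F' y \<and> F' y \<le> 1" for y using F01 by (simp add: F'_def)
  show "a * (LINT x|lborel. indicator S x * F (g x)) \<le> (LINT y|lborel. indicator (g ` S) y * F y)"
    "(LINT y|lborel. indicator (g ` S) y * F y) \<le> b * (LINT x|lborel. indicator S x * F (g x))"
    using integral_image_bounds_wellorder[OF opn injG derG abG F'm F'01] unfolding 1 2 by auto
qed

lemma det_bounded:
  obtains C :: real where "C > 0" "\<And>A :: real^'n^'n. norm A \<le> R \<Longrightarrow> \<bar>det A\<bar> \<le> C"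
proof -
  have "continuous_on (cball 0 R) (det :: real^'n^'n \<Rightarrow> real)"
    unfolding det_def by (intro continuous_intros)
  then have "bounded (det ` cball (0 :: real^'n^'n) R)"
    by (intro compact_imp_bounded compact_continuous_image) auto
  then obtain C where "C > 0" "\<And>x. x \<in> det ` cball (0 :: real^'n^'n) R \<Longrightarrow> norm x \<le> C"
    unfolding bounded_pos by blast
  then show ?thesis by (intro that[of C]) auto
qed

section \<open>Borel representatives\<close>

lemma measurable_vec_nth [measurable (raw)]:
  fixes f :: "'a \<Rightarrow> real^'n"
  assumes "f \<in> borel_measurable M"
  shows "(\<lambda>x. f x $ i) \<in> borel_measurable M"
  by (rule measurable_compose[OF assms]) (intro borel_measurable_continuous_onI continuous_intros)

text \<open>
  A Lebesgue measurable function agrees almost everywhere with a Borel function. Composition with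
  measurable maps and Fubini's theorem are available for the latter only.
\<close>

lemma borel_representative:
  fixes f :: "'a::euclidean_space \<Rightarrow> 'b::euclidean_space"
  assumes f: "f \<in> borel_measurable (lebesgue_on S)" and S[measurable]: "S \<in> sets borel"
  obtains g where "g \<in> borel_measurable borel" "AE x in lborel. x \<in> S \<longrightarrow> g x = f x" "\<And>x. x \<notin> S \<Longrightarrow> g x = 0"
proof -
  have S': "S \<inter> space lebesgue \<in> sets lebesgue" using S by (simp add: sets_completionI_sets)
  have f': "(\<lambda>x. indicator S x *\<^sub>R f x) \<in> borel_measurable lebesgue"
    using f unfolding borel_measurable_restrict_space_iff[OF S'] .
  have "\<exists>g\<in>borel_measurable lborel. AE x in lborel. (indicator S x *\<^sub>R f x) \<bullet> b = g x" for b
    by (rule completion_ex_borel_measurable_real) (use f' in measurable)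
  then obtain h where h: "\<And>b. h b \<in> borel_measurable lborel"
    "\<And>b. AE x in lborel. (indicator S x *\<^sub>R f x) \<bullet> b = h b x" by metis
  define g where "g x = indicator S x *\<^sub>R (\<Sum>b\<in>Basis. h b x *\<^sub>R b)" for x
  show ?thesis
  proof (rule that)
    have [measurable]: "h b \<in> borel_measurable borel" for b using h(1)[of b] by simp
    show "g \<in> borel_measurable borel" unfolding g_def by measurable
    have "AE x in lborel. \<forall>b\<in>Basis. (indicator S x *\<^sub>R f x) \<bullet> b = h b x"
      using h(2) by (intro AE_finite_allI) auto
    then show "AE x in lborel. x \<in> S \<longrightarrow> g x = f x"
    proof eventually_elim
      case (elim x)
      show ?case
      proof
        assume "x \<in> S"
        then have "g x = (\<Sum>b\<in>Basis. (f x \<bullet> b) *\<^sub>R b)" using elim by (simp add: g_def)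
        then show "g x = f x" by (simp add: euclidean_representation)
      qed
    qed
    show "g x = 0" if "x \<notin> S" for x using that by (simp add: g_def)
  qed
qed

lemma lebesgue_on_AE_eq:
  fixes f h :: "'a::euclidean_space \<Rightarrow> 'b::euclidean_space"
  assumes h[measurable]: "h \<in> borel_measurable borel" and S[measurable]: "S \<in> sets borel"
    and ae: "AE x in lborel. x \<in> S \<longrightarrow> f x = h x"
  shows "f \<in> borel_measurable (lebesgue_on S)"
    and "(LINT x|lebesgue_on S. f x) = (LINT x|lborel. indicator S x *\<^sub>R h x)"
    and "integrable (lebesgue_on S) f \<longleftrightarrow> integrable lborel (\<lambda>x. indicator S x *\<^sub>R h x)"
proof -
  have S': "S \<inter> space lebesgue \<in> sets lebesgue" using S by (simp add: sets_completionI_sets)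
  have hb: "(\<lambda>x. indicator S x *\<^sub>R h x) \<in> borel_measurable lborel" by measurable
  then have hl: "(\<lambda>x. indicator S x *\<^sub>R h x) \<in> borel_measurable lebesgue" by (rule measurable_completion)
  have "AE x in lborel. indicator S x *\<^sub>R h x = indicator S x *\<^sub>R f x"
    using ae by eventually_elim (auto simp: indicator_def)
  then have ae': "AE x in lebesgue. indicator S x *\<^sub>R h x = indicator S x *\<^sub>R f x" by (rule AE_completion)
  have ae'': "AE x in lebesgue. indicator S x *\<^sub>R f x = indicator S x *\<^sub>R h x"
    using ae' by eventually_elim (rule sym)
  have fl: "(\<lambda>x. indicator S x *\<^sub>R f x) \<in> borel_measurable lebesgue"
    by (rule borel_measurable_AE[OF hl ae'])
  then show "f \<in> borel_measurable (lebesgue_on S)"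
    unfolding borel_measurable_restrict_space_iff[OF S'] .
  have "(LINT x|lebesgue_on S. f x) = (LINT x|lebesgue. indicator S x *\<^sub>R f x)"
    by (rule integral_restrict_space[OF S'])
  also have "\<dots> = (LINT x|lebesgue. indicator S x *\<^sub>R h x)"
    by (rule integral_cong_AE[OF fl hl ae''])
  also have "\<dots> = (LINT x|lborel. indicator S x *\<^sub>R h x)" by (rule integral_completion[OF hb])
  finally show "(LINT x|lebesgue_on S. f x) = (LINT x|lborel. indicator S x *\<^sub>R h x)" .
  have "integrable (lebesgue_on S) f \<longleftrightarrow> integrable lebesgue (\<lambda>x. indicator S x *\<^sub>R f x)"
    by (rule integrable_restrict_space[OF S'])
  also have "\<dots> \<longleftrightarrow> integrable lebesgue (\<lambda>x. indicator S x *\<^sub>R h x)"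
    by (rule integrable_cong_AE[OF fl hl ae''])
  also have "\<dots> \<longleftrightarrow> integrable lborel (\<lambda>x. indicator S x *\<^sub>R h x)" by (rule integrable_completion[OF hb])
  finally show "integrable (lebesgue_on S) f \<longleftrightarrow> integrable lborel (\<lambda>x. indicator S x *\<^sub>R h x)" .
qed

text \<open>
  The iterated integral in the definition of two-scale convergence, as an integral over the product
  space.
\<close>

lemma iterated_integral_eq_lborel:
  fixes g b :: "(real^'n) \<times> (real^'n) \<Rightarrow> 'b::euclidean_space"
  assumes b: "b \<in> borel_measurable borel" "integrable lborel b" and U[measurable]: "U \<in> sets borel"
    and ae: "AE z in lborel. z \<in> U \<times> unit_cell \<longrightarrow> g z = b z" and b0: "\<And>z. z \<notin> U \<times> unit_cell \<Longrightarrow> b z = 0"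
  shows "(LINT x|lebesgue_on U. LINT y|lebesgue_on unit_cell. g (x, y)) = (LINT z|lborel. b z)"
proof -
  have bi: "integrable (lborel \<Otimes>\<^sub>M lborel) b" using b(2) by (simp add: lborel_prod)
  have bm: "b \<in> borel_measurable (lborel \<Otimes>\<^sub>M lborel)" using bi by (rule borel_measurable_integrable)
  have "AE z in (lborel \<Otimes>\<^sub>M lborel). z \<in> U \<times> unit_cell \<longrightarrow> g z = b z" using ae by (subst lborel_prod)
  from lborel_pair.AE_pair[OF this]
  have "AE x in lborel. AE y in lborel. (x, y) \<in> U \<times> unit_cell \<longrightarrow> g (x, y) = b (x, y)" .
  then have inner: "AE x in lborel. x \<in> U \<longrightarrow> (LINT y|lebesgue_on unit_cell. g (x, y)) = (LINT y|lborel. b (x, y))"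
  proof eventually_elim
    case (elim x)
    show ?case
    proof
      assume "x \<in> U"
      have m: "(\<lambda>y. b (x, y)) \<in> borel_measurable borel"
        by (rule measurable_compose[OF _ b(1)]) (intro borel_measurable_continuous_onI continuous_intros)
      have "(LINT y|lebesgue_on unit_cell. g (x, y)) = (LINT y|lborel. indicator unit_cell y *\<^sub>R b (x, y))"
        by (rule lebesgue_on_AE_eq(2)[OF m]) (use elim \<open>x \<in> U\<close> in auto)
      also have "\<dots> = (LINT y|lborel. b (x, y))"
        by (rule Bochner_Integration.integral_cong) (auto simp: indicator_def b0)
      finally show "(LINT y|lebesgue_on unit_cell. g (x, y)) = (LINT y|lborel. b (x, y))" .
    qed
  qed
  have im: "(\<lambda>x. LINT y|lborel. b (x, y)) \<in> borel_measurable borel"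
    using lborel.borel_measurable_lebesgue_integral[of "\<lambda>x y. b (x, y)" lborel] bm by simp
  have "(LINT x|lebesgue_on U. LINT y|lebesgue_on unit_cell. g (x, y))
      = (LINT x|lborel. indicator U x *\<^sub>R (LINT y|lborel. b (x, y)))"
    by (rule lebesgue_on_AE_eq(2)[OF im U inner])
  also have "\<dots> = (LINT x|lborel. LINT y|lborel. b (x, y))"
    by (rule Bochner_Integration.integral_cong) (auto simp: indicator_def b0)
  also have "\<dots> = (LINT z|lborel. b z)"
    using lborel_pair.integral_fst'[OF bi] by (simp add: lborel_prod)
  finally show ?thesis .
qed

section \<open>Strong two-scale convergence of the displacements\<close>

lemma periodic_test_Lq_C_per:
  fixes U :: "(real^'n) set"
  assumes F: "periodic_test F" and U: "U \<in> sets borel" "bounded U" and "0 \<le> q"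
  shows "(\<lambda>x. Bcontfun (\<lambda>y. F (x, y))) \<in> Lq_C_per q U"
    and "apply_bcontfun (Bcontfun (\<lambda>y. F (x, y))) y = F (x, y)"
proof -
  obtain L where L: "L-lipschitz_on UNIV F" and F01: "\<And>z. 0 \<le> F z" "\<And>z. F z \<le> 1"
    and per: "\<And>x. Y_periodic (\<lambda>y. F (x, y))"
    using F unfolding periodic_test_def by blast
  have cont: "continuous_on UNIV F" by (rule periodic_test_continuous[OF F])
  have bc: "(\<lambda>y. F (x, y)) \<in> bcontfun" for x
    by (rule bcontfun_normI[of _ 1]) (auto simp: F01 intro!: continuous_intros continuous_on_compose2[OF cont])
  have app: "apply_bcontfun (Bcontfun (\<lambda>y. F (x, y))) y = F (x, y)" for x y
    using Bcontfun_inverse[OF bc[of x]] by simp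
  then show "apply_bcontfun (Bcontfun (\<lambda>y. F (x, y))) y = F (x, y)" .
  define \<phi> where "\<phi> x = Bcontfun (\<lambda>y. F (x, y))" for x
  have "L-lipschitz_on UNIV \<phi>"
  proof (rule lipschitz_onI)
    fix x x' :: "real^'n"
    show "dist (\<phi> x) (\<phi> x') \<le> L * dist x x'"
    proof (rule dist_bound)
      fix y
      show "dist (apply_bcontfun (\<phi> x) y) (apply_bcontfun (\<phi> x') y) \<le> L * dist x x'"
        using lipschitz_onD[OF L, of "(x, y)" "(x', y)"] by (simp add: \<phi>_def app dist_Pair_Pair)
    qed
  qed (rule lipschitz_on_nonneg[OF L])
  then have "continuous_on UNIV \<phi>" by (rule lipschitz_on_continuous_on)
  then have \<phi>b: "\<phi> \<in> borel_measurable borel" by (rule borel_measurable_continuous_onI)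
  have \<phi>m: "\<phi> \<in> borel_measurable (lebesgue_on U)"
    using \<phi>b by (intro measurable_restrict_space1 measurable_completion) simp
  have n1: "norm (\<phi> x) \<le> 1" for x
    by (rule norm_bound) (simp add: \<phi>_def app F01)
  have "finite_measure (lebesgue_on U)"
  proof
    have "emeasure lebesgue U < \<infinity>"
      using emeasure_bounded_finite[OF U(2)] U(1) by simp
    then show "emeasure (lebesgue_on U) (space (lebesgue_on U)) \<noteq> \<infinity>"
      using U by (simp add: emeasure_restrict_space)
  qed
  then have "integrable (lebesgue_on U) (\<lambda>x. norm (\<phi> x) powr q)"
  proof (rule finite_measure.integrable_const_bound[where B = 1])
    show "AE x in lebesgue_on U. norm (norm (\<phi> x) powr q) \<le> 1"
      using n1 \<open>0 \<le> q\<close> by (auto intro!: AE_I2 powr_le1)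
  qed (use \<phi>m in measurable)
  then show "(\<lambda>x. Bcontfun (\<lambda>y. F (x, y))) \<in> Lq_C_per q U"
  proof -
    have "apply_bcontfun (\<phi> x) = (\<lambda>y. F (x, y))" for x by (rule ext) (simp add: \<phi>_def app)
    then have "\<phi> \<in> Lq_C_per q U"
      using \<phi>m per \<open>integrable _ _\<close> by (simp add: Lq_C_per_def)
    then show ?thesis by (simp add: \<phi>_def[abs_def])
  qed
qed

lemma tendsto_zero_of_approx:
  fixes X :: "nat \<Rightarrow> real"
  assumes "\<And>e. e > 0 \<Longrightarrow> \<exists>Y. Y \<longlonglongrightarrow> 0 \<and> (\<forall>n. \<bar>X n - Y n\<bar> \<le> e)"
  shows "X \<longlonglongrightarrow> 0"
proof (rule tendstoI)
  fix e :: real assume e: "e > 0"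
  then obtain Y where Y: "Y \<longlonglongrightarrow> 0" "\<And>n. \<bar>X n - Y n\<bar> \<le> e/2" using assms[of "e/2"] by auto
  have "eventually (\<lambda>n. dist (Y n) 0 < e/2) sequentially" using tendstoD[OF Y(1), of "e/2"] e by simp
  then show "eventually (\<lambda>n. dist (X n) 0 < e) sequentially"
    by eventually_elim (use Y(2) in \<open>smt (verit) dist_real_def field_sum_of_halves\<close>)
qed

text \<open>
  Open sets form an intersection-stable generator, and their indicator functions are limits of test
  functions on the open cell. The Dynkin argument for equi-integrable families does the rest.
\<close>

lemma tendsto_sets_of_periodic_test:
  fixes d :: "nat \<Rightarrow> (real^'n) \<times> (real^'n) \<Rightarrow> real"
  assumes "finite_measure M" and M: "sets M = sets borel" and cell: "AE z in M. snd z \<in> box 0 1"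
    and d[measurable]: "\<And>n. d n \<in> borel_measurable M" and C: "\<And>n z. \<bar>d n z\<bar> \<le> C"
    and test: "\<And>F. periodic_test F \<Longrightarrow> (\<lambda>n. LINT z|M. F z * d n z) \<longlonglongrightarrow> 0"
    and A: "A \<in> sets M"
  shows "(\<lambda>n. LINT z|M. indicator A z * d n z) \<longlonglongrightarrow> 0"
proof -
  interpret finite_measure M by fact
  have spM: "space M = UNIV" using sets_eq_imp_space_eq[OF M] by simp
  have bint: "integrable M g" if "g \<in> borel_measurable M" "\<And>z. \<bar>g z\<bar> \<le> B" for g :: "_ \<Rightarrow> real" and B
    by (rule integrable_const_bound[of _ B]) (use that in auto)
  have C0: "0 \<le> C" using C[of 0 0] by simp
  have "(LINT z|M. \<bar>d n z\<bar> powr 2) \<le> C\<^sup>2 * measure M UNIV" for n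
  proof -
    have sq: "\<bar>\<bar>d n z\<bar> powr 2\<bar> \<le> C\<^sup>2" for z using order_trans[OF C abs_ge_self] by (auto simp: abs_le_square_iff[symmetric])
    have "(LINT z|M. \<bar>d n z\<bar> powr 2) \<le> (LINT z|M. C\<^sup>2)"
      by (rule integral_mono) (use sq in \<open>auto intro!: bint[of _ "C\<^sup>2"]\<close>)
    then show ?thesis by (simp add: spM mult.commute)
  qed
  then have ei: "equi_integrable M d"
  proof (intro equi_integrable_powr[of d 2])
    show "integrable M (\<lambda>z. \<bar>d n z\<bar> powr 2)" for n
      by (rule bint[of _ "C\<^sup>2"]) (use order_trans[OF C abs_ge_self] in \<open>auto simp: abs_le_square_iff[symmetric]\<close>)
  qed auto
  show ?thesis
  proof (rule equi_integrable_tendsto_sets[OF ei _ _ _ _ _ A])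
    show "Int_stable {U :: ((real^'n) \<times> (real^'n)) set. open U}" by (auto simp: Int_stable_def)
    show "{U :: ((real^'n) \<times> (real^'n)) set. open U} \<subseteq> Pow (space M)" "space M \<in> {U. open U}"
      by (auto simp: spM)
    show "sets M = sigma_sets (space M) {U. open U}" by (simp add: M spM borel_def)
    fix U :: "((real^'n) \<times> (real^'n)) set" assume "U \<in> {U. open U}"
    then have "open U" by simp
    define V where "V = U \<inter> (UNIV \<times> box 0 1)"
    have V: "open V" "V \<subseteq> UNIV \<times> box 0 1"
      using \<open>open U\<close> by (auto simp: V_def intro!: open_Int open_Times)
    have [measurable]: "U \<in> sets M" "V \<in> sets M" using V \<open>open U\<close> M by auto
    obtain F :: "nat \<Rightarrow> (real^'n) \<times> (real^'n) \<Rightarrow> real"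
      where F: "\<And>j. periodic_test (F j)" "\<And>z. snd z \<in> unit_cell \<Longrightarrow> (\<lambda>j. F j z) \<longlonglongrightarrow> indicator V z"
      using periodic_test_approx_open[OF V] by blast
    have Fm[measurable]: "F j \<in> borel_measurable M" for j
      using periodic_test_measurable[OF F(1)[of j]] by (simp add: measurable_cong_sets[OF M refl])
    have F01: "0 \<le> F j z" "F j z \<le> 1" for j z using periodic_test_bounds[OF F(1)[of j]] by auto
    have Fd: "\<bar>F j z - indicator V z\<bar> \<le> 1" for j z using F01[of j z] by (cases "z \<in> V") auto
    have cell': "AE z in M. snd z \<in> unit_cell"
      using cell by eventually_elim (auto simp: unit_cell_iff open_unit_cell_iff less_imp_le)
    have lim: "(\<lambda>j. LINT z|M. \<bar>F j z - indicator V z\<bar>) \<longlonglongrightarrow> (LINT z|M. 0)"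
    proof (rule integral_dominated_convergence[where w = "\<lambda>_. 1"])
      show "AE z in M. (\<lambda>j. \<bar>F j z - indicator V z\<bar>) \<longlonglongrightarrow> 0"
        using cell' by eventually_elim (use F(2) in \<open>auto intro!: tendsto_rabs_zero simp: LIM_zero_iff\<close>)
      show "AE z in M. norm \<bar>F j z - indicator V z\<bar> \<le> 1" for j
        using Fd by (intro AE_I2) (simp only: real_norm_def abs_abs)
    qed auto
    show "(\<lambda>n. LINT z|M. indicator U z * d n z) \<longlonglongrightarrow> 0"
    proof (rule tendsto_zero_of_approx)
      fix e :: real assume e: "e > 0"
      have "eventually (\<lambda>j. (LINT z|M. \<bar>F j z - indicator V z\<bar>) < e / (C + 1)) sequentially"
        using lim e C0 by (intro order_tendstoD(2)) auto
      then obtain j where j: "(LINT z|M. \<bar>F j z - indicator V z\<bar>) < e / (C + 1)"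
        by (auto simp: eventually_sequentially)
      have "\<bar>(LINT z|M. indicator U z * d n z) - (LINT z|M. F j z * d n z)\<bar> \<le> e" for n
      proof -
        have Fdn: "\<bar>F j z * d n z\<bar> \<le> C" for z
          using mult_mono[of "\<bar>F j z\<bar>" 1 "\<bar>d n z\<bar>" C] C[of n z] F01[of j z] by (simp add: abs_mult)
        have i1: "integrable M (\<lambda>z. indicator V z * d n z)" "integrable M (\<lambda>z. F j z * d n z)"
          by (intro integrable_indicator_mult bint[OF _ C] bint[OF _ Fdn]; measurable)+
        have i2: "integrable M (\<lambda>z. \<bar>F j z - indicator V z\<bar>)"
          by (intro bint[of _ 1]) (use Fd in \<open>simp_all only: abs_abs\<close>, measurable)
        have "(LINT z|M. indicator U z * d n z) = (LINT z|M. indicator V z * d n z)"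
        proof (rule integral_cong_AE)
          show "AE z in M. indicator U z * d n z = indicator V z * d n z"
            using cell by eventually_elim (auto simp: V_def indicator_def mem_Times_iff)
        qed measurable
        then have "\<bar>(LINT z|M. indicator U z * d n z) - (LINT z|M. F j z * d n z)\<bar>
          = \<bar>LINT z|M. indicator V z * d n z - F j z * d n z\<bar>" using i1 by simp
        also have "\<dots> \<le> (LINT z|M. \<bar>indicator V z * d n z - F j z * d n z\<bar>)" by (rule integral_abs_bound)
        also have "\<dots> \<le> (LINT z|M. \<bar>F j z - indicator V z\<bar> * C)"
        proof (rule integral_mono)
          show "\<bar>indicator V z * d n z - F j z * d n z\<bar> \<le> \<bar>F j z - indicator V z\<bar> * C" for z
            unfolding left_diff_distrib[symmetric] abs_mult abs_minus_commute[of "F j z"]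
            by (intro mult_left_mono C) simp
        qed (use i1 i2 in auto)
        also have "\<dots> = (LINT z|M. \<bar>F j z - indicator V z\<bar>) * C" by simp
        also have "\<dots> \<le> e / (C + 1) * C" using j C0 by (intro mult_right_mono) auto
        also have "\<dots> \<le> e" using e C0 by (simp add: field_simps)
        finally show ?thesis .
      qed
      then show "\<exists>Y. Y \<longlonglongrightarrow> 0 \<and> (\<forall>n. \<bar>(LINT z|M. indicator U z * d n z) - Y n\<bar> \<le> e)"
        using test[OF F(1)] by blast
    qed
  qed
qed

text \<open>
  Testing with periodic functions shows that \<open>a \<circ> S\<close> converges weakly to \<open>b0\<close>; unfolding preserves the
  \<open>L\<^sup>2\<close> norms, which converge by hypothesis. In a Hilbert space this implies strong convergence, here
  by the identity \<open>|v - w|\<^sup>2 = |v|\<^sup>2 - |w|\<^sup>2 - 2 w \<bullet> (v - w)\<close>.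
\<close>

lemma two_scale_strong_unfold:
  fixes a :: "nat \<Rightarrow> real^'n \<Rightarrow> real^'n" and a0 b0 :: "(real^'n) \<times> (real^'n) \<Rightarrow> real^'n"
  assumes \<epsilon>: "\<And>n. 0 < \<epsilon> n" "\<epsilon> \<longlonglongrightarrow> 0" and \<Omega>: "open \<Omega>" "bounded \<Omega>"
    and K[measurable]: "K \<in> sets borel" and Kb: "bounded K" and \<Omega>K: "\<Omega> \<subseteq> K"
    and supp: "\<And>n z. snd z \<in> unit_cell \<Longrightarrow> unfold_map (\<epsilon> n) z \<in> \<Omega> \<Longrightarrow> fst z \<in> K"
    and ss: "two_scale_strong 2 \<epsilon> \<Omega> a a0"
    and a[measurable]: "\<And>n. a n \<in> borel_measurable borel" and a0: "\<And>n x. x \<notin> \<Omega> \<Longrightarrow> a n x = 0" and aC: "\<And>n x. norm (a n x) \<le> C"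
    and b[measurable]: "b0 \<in> borel_measurable borel" and b_eq: "AE z in lborel. z \<in> \<Omega> \<times> unit_cell \<longrightarrow> b0 z = a0 z"
    and b0: "\<And>z. z \<notin> \<Omega> \<times> unit_cell \<Longrightarrow> b0 z = 0" and bC: "\<And>z. norm (b0 z) \<le> C"
  shows "(\<lambda>n. LINT z|slab_measure K. norm (a n (unfold_map (\<epsilon> n) z) - b0 z)) \<longlonglongrightarrow> 0"
proof -
  interpret finite_measure "slab_measure K" by (rule finite_slab_measure[OF K Kb])
  let ?M = "slab_measure K"
  let ?S = "\<lambda>n. unfold_map (\<epsilon> n) :: (real^'n) \<times> (real^'n) \<Rightarrow> real^'n"
  have [measurable]: "\<Omega> \<in> sets borel" using \<Omega> by simp
  have C0: "0 \<le> C" using order_trans[OF norm_ge_zero bC[of 0]] .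
  have bint: "integrable ?M g" if "g \<in> borel_measurable borel" "\<And>z. norm (g z) \<le> B" for g :: "_ \<Rightarrow> 'c::{banach,second_countable_topology}" and B
    by (rule integrable_const_bound[of _ B]) (use that in auto)
  have fin\<Omega>: "emeasure lborel \<Omega> < \<infinity>" using \<Omega>(2) by (rule emeasure_bounded_finite)
  have ai: "integrable lborel (a n)" for n
    by (rule integrableI_bounded_set[of \<Omega> _ _ C]) (use fin\<Omega> aC a0 in auto)
  have \<Omega>cell: "bounded (\<Omega> \<times> (unit_cell :: (real^'n) set))"
    using \<Omega> by (simp add: bounded_Times unit_cell_def)
  have bi: "integrable lborel (\<lambda>z. g z *\<^sub>R b0 z)" if [measurable]: "g \<in> borel_measurable borel" and g: "\<And>z. \<bar>g z\<bar> \<le> B" for g :: "_ \<Rightarrow> real" and B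
  proof (rule integrableI_bounded_set[of "\<Omega> \<times> unit_cell" _ _ "\<bar>B\<bar> * C"])
    show "emeasure lborel (\<Omega> \<times> (unit_cell :: (real^'n) set)) < \<infinity>"
      using \<Omega>cell by (rule emeasure_bounded_finite)
    show "AE z in lborel. z \<in> \<Omega> \<times> unit_cell \<longrightarrow> norm (g z *\<^sub>R b0 z) \<le> \<bar>B\<bar> * C"
      by (intro AE_I2 impI) (use order_trans[OF g abs_ge_self] bC C0 in \<open>auto intro!: mult_mono\<close>)
  qed (use b0 in auto)
  have slab_b: "(LINT z|?M. g z *\<^sub>R b0 z) = (LINT z|lborel. g z *\<^sub>R b0 z)" if [measurable]: "g \<in> borel_measurable borel" for g :: "_ \<Rightarrow> real"
  proof -
    have "indicator (K \<times> unit_cell) z *\<^sub>R (g z *\<^sub>R b0 z) = g z *\<^sub>R b0 z" for z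
      by (cases "z \<in> \<Omega> \<times> unit_cell") (use \<Omega>K in \<open>auto simp: indicator_def\<close>, simp add: b0)
    moreover have m: "(\<lambda>z. g z *\<^sub>R b0 z) \<in> borel_measurable borel" by measurable
    ultimately show ?thesis unfolding integral_slab_measure[OF K m] by (simp only:)
  qed
  have nth: "(LINT x|N. g x) $ i = (LINT x|N. g x $ i)" if "integrable N g" for N :: "'c measure" and g :: "'c \<Rightarrow> real^'n" and i
    using integral_bounded_linear[OF bounded_linear_vec_nth that, of i] by simp
  have weak: "(\<lambda>n. LINT z|?M. F z * (a n (?S n z) $ i - b0 z $ i)) \<longlonglongrightarrow> 0" if F: "periodic_test F" for F i
  proof -
    have Fm[measurable]: "F \<in> borel_measurable borel" by (rule periodic_test_measurable[OF F])
    have F1: "\<bar>F z\<bar> \<le> 1" for z using periodic_test_bounds[OF F] by auto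
    have F\<epsilon>[measurable]: "(\<lambda>x. F (x, x /\<^sub>R \<epsilon> n)) \<in> borel_measurable borel" for n
      by (rule measurable_compose[OF _ Fm], intro borel_measurable_continuous_onI continuous_intros)
    have "two_scale_weak 2 \<epsilon> \<Omega> a a0" using ss by (simp add: two_scale_strong_def)
    then have "(\<lambda>n. LINT x|lebesgue_on \<Omega>. apply_bcontfun (Bcontfun (\<lambda>y. F (x, y))) (x /\<^sub>R \<epsilon> n) *\<^sub>R a n x)
        \<longlonglongrightarrow> (LINT x|lebesgue_on \<Omega>. LINT y|lebesgue_on unit_cell. apply_bcontfun (Bcontfun (\<lambda>y. F (x, y))) y *\<^sub>R a0 (x, y))"
      unfolding two_scale_weak_def
      using periodic_test_Lq_C_per(1)[OF F \<open>\<Omega> \<in> sets borel\<close> \<Omega>(2), of 2] by (elim conjE allE[of _ 2]) auto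
    then have lim: "(\<lambda>n. LINT x|lebesgue_on \<Omega>. F (x, x /\<^sub>R \<epsilon> n) *\<^sub>R a n x)
        \<longlonglongrightarrow> (LINT x|lebesgue_on \<Omega>. LINT y|lebesgue_on unit_cell. F (x, y) *\<^sub>R a0 (x, y))"
      using periodic_test_Lq_C_per(2)[OF F \<open>\<Omega> \<in> sets borel\<close> \<Omega>(2), of 2] by simp
    have l: "(LINT x|lebesgue_on \<Omega>. F (x, x /\<^sub>R \<epsilon> n) *\<^sub>R a n x) = (LINT x|lborel. F (x, x /\<^sub>R \<epsilon> n) *\<^sub>R a n x)" for n
    proof -
      have "(LINT x|lebesgue_on \<Omega>. F (x, x /\<^sub>R \<epsilon> n) *\<^sub>R a n x)
          = (LINT x|lborel. indicator \<Omega> x *\<^sub>R (F (x, x /\<^sub>R \<epsilon> n) *\<^sub>R a n x))"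
        by (rule lebesgue_on_AE_eq(2)) auto
      also have "\<dots> = (LINT x|lborel. F (x, x /\<^sub>R \<epsilon> n) *\<^sub>R a n x)"
        by (rule Bochner_Integration.integral_cong) (use a0 in \<open>auto simp: indicator_def\<close>)
      finally show ?thesis .
    qed
    have r: "(LINT x|lebesgue_on \<Omega>. LINT y|lebesgue_on unit_cell. F (x, y) *\<^sub>R a0 (x, y)) = (LINT z|lborel. F z *\<^sub>R b0 z)"
      by (rule iterated_integral_eq_lborel)
        (use bi[OF Fm F1] b_eq b0 in \<open>auto elim!: eventually_mono\<close>)
    have Fai: "integrable lborel (\<lambda>x. F (x, x /\<^sub>R \<epsilon> n) *\<^sub>R a n x)" for n
      by (rule Bochner_Integration.integrable_bound[OF ai[of n]])
        (use F1 in \<open>auto intro!: mult_left_le_one_le\<close>)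
    have "(\<lambda>n. (LINT x|lborel. F (x, x /\<^sub>R \<epsilon> n) *\<^sub>R a n x) $ i) \<longlonglongrightarrow> (LINT z|lborel. F z *\<^sub>R b0 z) $ i"
      using lim unfolding l r by (rule tendsto_vec_nth)
    then have L1: "(\<lambda>n. LINT x|lborel. a n x $ i * F (x, x /\<^sub>R \<epsilon> n)) \<longlonglongrightarrow> (LINT z|?M. F z * b0 z $ i)"
      unfolding nth[OF Fai] slab_b[OF Fm, symmetric]
      by (subst (asm) nth) (auto simp: mult.commute intro!: bint[of _ C] order_trans[OF mult_left_le_one_le bC] F1 C0)
    have L2: "(\<lambda>n. (LINT x|lborel. a n x $ i * F (x, x /\<^sub>R \<epsilon> n)) - (LINT z|?M. a n (?S n z) $ i * F z)) \<longlonglongrightarrow> 0"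
    proof (rule unfolded_pairing_tendsto[OF \<epsilon> K Kb])
      show "(LINT x|lborel. \<bar>a n x $ i\<bar>) \<le> C * measure lborel \<Omega>" for n
      proof -
        have "(LINT x|lborel. \<bar>a n x $ i\<bar>) \<le> (LINT x|lborel. indicator \<Omega> x *\<^sub>R C)"
        proof (rule integral_mono)
          show "integrable lborel (\<lambda>x. \<bar>a n x $ i\<bar>)"
            using integrable_bounded_linear[OF bounded_linear_vec_nth ai[of n], of i] by simp
          show "\<bar>a n x $ i\<bar> \<le> indicator \<Omega> x *\<^sub>R C" for x
            using a0[of x n] order_trans[OF component_le_norm_cart aC, of n x i] by (auto simp: indicator_def)
        qed (use fin\<Omega> in simp)
        then show ?thesis using fin\<Omega> by (simp add: mult.commute)
      qed
      show "integrable lborel (\<lambda>x. a n x $ i)" for n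
        using integrable_bounded_linear[OF bounded_linear_vec_nth ai[of n], of i] by simp
      show "fst z \<in> K" if "snd z \<in> unit_cell" "a n (?S n z) $ i \<noteq> 0" for n z
        using supp[OF that(1), of n] a0[of "?S n z" n] that(2) by fastforce
      show "continuous_on UNIV F" by (rule periodic_test_continuous[OF F])
      show "Y_periodic (\<lambda>y. F (x, y))" for x using F by (simp add: periodic_test_def)
      show "(\<lambda>x. a n x $ i) \<in> borel_measurable borel" for n
        by (rule measurable_compose[OF a]) (intro borel_measurable_continuous_onI continuous_intros)
    qed (use F1 in auto)
    have "(\<lambda>n. LINT z|?M. a n (?S n z) $ i * F z) \<longlonglongrightarrow> (LINT z|?M. F z * b0 z $ i)"
      using tendsto_diff[OF L1 L2] by simp
    then have "(\<lambda>n. (LINT z|?M. a n (?S n z) $ i * F z) - (LINT z|?M. F z * b0 z $ i)) \<longlonglongrightarrow> 0"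
      by (simp add: LIM_zero)
    moreover have "(LINT z|?M. a n (?S n z) $ i * F z) - (LINT z|?M. F z * b0 z $ i)
       = (LINT z|?M. F z * (a n (?S n z) $ i - b0 z $ i))" for n
      unfolding right_diff_distrib
      by (subst Bochner_Integration.integral_diff)
        (auto simp: mult.commute abs_mult intro!: bint[of _ C] order_trans[OF mult_left_le_one_le]
           order_trans[OF component_le_norm_cart aC] order_trans[OF component_le_norm_cart bC] F1)
    ultimately show ?thesis by simp
  qed
  have comp: "\<bar>a n x $ i\<bar> \<le> C" "\<bar>b0 z $ i\<bar> \<le> C" for n x z i
    using order_trans[OF component_le_norm_cart aC] order_trans[OF component_le_norm_cart bC] by auto
  have d2: "\<bar>a n x $ i - b0 z $ i\<bar> \<le> 2 * C" for n x z i
    using comp(1)[of n x i] comp(2)[of z i] by linarith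
  \<comment> \<open>The cross term of the identity: \<open>b0\<close> itself is an admissible bounded multiplier.\<close>
  have cross: "(\<lambda>n. LINT z|?M. b0 z $ i * (a n (?S n z) $ i - b0 z $ i)) \<longlonglongrightarrow> 0" for i
  proof (rule tendsto_integral_bounded_mult)
    show "integrable ?M (\<lambda>z. a n (?S n z) $ i - b0 z $ i)" for n
      by (rule bint[of _ "2 * C"]) (use d2 in auto)
    show "(LINT z|?M. \<bar>a n (?S n z) $ i - b0 z $ i\<bar>) \<le> 2 * C * measure ?M UNIV" for n
    proof -
      have "(LINT z|?M. \<bar>a n (?S n z) $ i - b0 z $ i\<bar>) \<le> (LINT z|?M. 2 * C)"
        by (rule integral_mono) (use d2 in \<open>auto intro!: bint[of _ "2 * C"]\<close>)
      then show ?thesis by (simp add: algebra_simps)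
    qed
    show "(\<lambda>n. LINT z|?M. indicator A z * (a n (?S n z) $ i - b0 z $ i)) \<longlonglongrightarrow> 0" if "A \<in> sets ?M" for A
    proof (rule tendsto_sets_of_periodic_test[OF _ _ AE_slab_open_cell[OF K] _ d2 weak that])
      show "finite_measure ?M" by (rule finite_slab_measure[OF K Kb])
    qed auto
    show "\<bar>b0 z $ i\<bar> \<le> C" for z by (rule comp)
  qed auto
  have nn: "(LINT z|?M. (norm (a n (?S n z) - b0 z))\<^sup>2)
     = (LINT z|?M. (norm (a n (?S n z)))\<^sup>2) - (LINT z|?M. (norm (b0 z))\<^sup>2) - 2 * (\<Sum>i\<in>UNIV. LINT z|?M. b0 z $ i * (a n (?S n z) $ i - b0 z $ i))" for n
  proof -
    have id: "(norm (v - w))\<^sup>2 = (norm v)\<^sup>2 - (norm w)\<^sup>2 - 2 * (\<Sum>i\<in>UNIV. w $ i * (v $ i - w $ i))" for v w :: "real^'n"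
      by (simp add: power2_norm_eq_inner inner_vec_def sum_subtractf[symmetric] sum_distrib_left algebra_simps)
    have i1: "integrable ?M (\<lambda>z. (norm (a n (?S n z)))\<^sup>2)" "integrable ?M (\<lambda>z. (norm (b0 z))\<^sup>2)"
      by (rule bint[of _ "C\<^sup>2"]; use aC bC in \<open>auto intro!: power_mono\<close>)+
    have i2: "integrable ?M (\<lambda>z. b0 z $ i * (a n (?S n z) $ i - b0 z $ i))" for i
      by (rule bint[of _ "C * (2 * C)"]) (use comp d2 C0 in \<open>auto simp: abs_mult intro!: mult_mono\<close>)
    have i3: "integrable ?M (\<lambda>z. \<Sum>i\<in>UNIV. b0 z $ i * (a n (?S n z) $ i - b0 z $ i))"
      by (intro Bochner_Integration.integrable_sum i2)
    show ?thesis unfolding id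
      by (simp only: Bochner_Integration.integral_diff integral_mult_right_zero Bochner_Integration.integral_sum[OF i2]
        Bochner_Integration.integrable_diff integrable_mult_right i1 i3)
  qed
  have na: "(Lp_norm 2 \<Omega> (a n))\<^sup>2 = (LINT z|?M. (norm (a n (?S n z)))\<^sup>2)" for n
  proof -
    have "(LINT x|lebesgue_on \<Omega>. (norm (a n x))\<^sup>2) = (LINT x|lborel. indicator \<Omega> x *\<^sub>R (norm (a n x))\<^sup>2)"
      by (rule lebesgue_on_AE_eq(2)) auto
    also have "\<dots> = (LINT x|lborel. (norm (a n x))\<^sup>2)"
      by (rule Bochner_Integration.integral_cong) (use a0 in \<open>auto simp: indicator_def\<close>)
    also have "\<dots> = (LINT z|?M. (norm (a n (?S n z)))\<^sup>2)"
      by (rule integral_eq_slab[OF _ K \<epsilon>(1)]) (use supp a0 in \<open>auto, fastforce\<close>)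
    finally have eq: "(LINT x|lebesgue_on \<Omega>. (norm (a n x))\<^sup>2) = (LINT z|?M. (norm (a n (?S n z)))\<^sup>2)" .
    have "0 \<le> (LINT x|lebesgue_on \<Omega>. (norm (a n x))\<^sup>2)" by simp
    then show ?thesis unfolding Lp_norm_def eq[symmetric]
      by (simp add: powr_half_sqrt)
  qed
  have nb: "(Lp_norm 2 (\<Omega> \<times> unit_cell) a0)\<^sup>2 = (LINT z|?M. (norm (b0 z))\<^sup>2)"
  proof -
    have "(LINT z|lebesgue_on (\<Omega> \<times> unit_cell). (norm (a0 z))\<^sup>2) = (LINT z|lborel. indicator (\<Omega> \<times> unit_cell) z *\<^sub>R (norm (b0 z))\<^sup>2)"
      by (rule lebesgue_on_AE_eq(2)) (use b_eq in \<open>auto elim!: eventually_mono\<close>)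
    also have "\<dots> = (LINT z|lborel. indicator (K \<times> unit_cell) z *\<^sub>R (norm (b0 z))\<^sup>2)"
      by (rule Bochner_Integration.integral_cong) (use b0 \<Omega>K in \<open>auto simp: indicator_def\<close>)
    also have "\<dots> = (LINT z|?M. (norm (b0 z))\<^sup>2)" by (rule integral_slab_measure[symmetric]) auto
    finally have eq: "(LINT z|lebesgue_on (\<Omega> \<times> unit_cell). (norm (a0 z))\<^sup>2) = (LINT z|?M. (norm (b0 z))\<^sup>2)" .
    have "0 \<le> (LINT z|lebesgue_on (\<Omega> \<times> unit_cell). (norm (a0 z))\<^sup>2)" by simp
    then show ?thesis unfolding Lp_norm_def eq[symmetric]
      by (simp add: powr_half_sqrt)
  qed
  have "(\<lambda>n. (Lp_norm 2 \<Omega> (a n))\<^sup>2) \<longlonglongrightarrow> (Lp_norm 2 (\<Omega> \<times> unit_cell) a0)\<^sup>2"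
    using ss by (intro tendsto_power) (simp add: two_scale_strong_def)
  then have "(\<lambda>n. LINT z|?M. (norm (a n (?S n z) - b0 z))\<^sup>2) \<longlonglongrightarrow>
     (LINT z|?M. (norm (b0 z))\<^sup>2) - (LINT z|?M. (norm (b0 z))\<^sup>2) - 2 * (\<Sum>i\<in>(UNIV::'n set). 0)"
    unfolding nn na nb by (intro tendsto_diff tendsto_mult tendsto_const tendsto_sum cross)
  then have L2: "(\<lambda>n. LINT z|?M. (norm (a n (?S n z) - b0 z))\<^sup>2) \<longlonglongrightarrow> 0" by simp
  show ?thesis
  proof (rule tendsto_zero_of_approx)
    fix e :: real assume e: "e > 0"
    define m where "m = measure ?M UNIV"
    have m: "0 \<le> m" by (simp add: m_def)
    define k where "k = e / (m + 1)"
    have k: "k > 0" "k * m \<le> e" using e m by (auto simp: k_def field_simps)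
    \<comment> \<open>On a finite measure space \<open>t \<le> k + t\<^sup>2 / k\<close> turns convergence in \<open>L\<^sup>2\<close> into convergence in \<open>L\<^sup>1\<close>; the
      minimum in \<open>Y\<close> keeps its distance from the \<open>L\<^sup>1\<close> norm below \<open>e\<close>.\<close>
    define Y where "Y n = min (LINT z|?M. norm (a n (?S n z) - b0 z)) (inverse k * (LINT z|?M. (norm (a n (?S n z) - b0 z))\<^sup>2))" for n
    have X0: "0 \<le> (LINT z|?M. norm (a n (?S n z) - b0 z))" for n by simp
    have nb2: "norm (a n x - b0 z) \<le> 2 * C" for n x z
      using norm_triangle_ineq4[of "a n x" "b0 z"] aC[of n x] bC[of z] by linarith
    have i: "integrable ?M (\<lambda>z. norm (a n (?S n z) - b0 z))" "integrable ?M (\<lambda>z. (norm (a n (?S n z) - b0 z))\<^sup>2)" for n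
    proof -
      show "integrable ?M (\<lambda>z. norm (a n (?S n z) - b0 z))"
        by (rule bint[of _ "2 * C"]) (use nb2 in auto)
      have "norm ((norm (a n (?S n z) - b0 z))\<^sup>2) \<le> (2 * C)\<^sup>2" for z
        using power_mono[OF nb2 norm_ge_zero, of n "?S n z" z 2] by simp
      then show "integrable ?M (\<lambda>z. (norm (a n (?S n z) - b0 z))\<^sup>2)"
        by (intro bint[of _ "(2 * C)\<^sup>2"]) measurable
    qed
    have X: "(LINT z|?M. norm (a n (?S n z) - b0 z)) \<le> e + inverse k * (LINT z|?M. (norm (a n (?S n z) - b0 z))\<^sup>2)" for n
    proof -
      have "(LINT z|?M. norm (a n (?S n z) - b0 z)) \<le> (LINT z|?M. k + inverse k * (norm (a n (?S n z) - b0 z))\<^sup>2)"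
      proof (rule integral_mono)
        show "norm (a n (?S n z) - b0 z) \<le> k + inverse k * (norm (a n (?S n z) - b0 z))\<^sup>2" for z
          using powr_split_bound[of "norm (a n (?S n z) - b0 z)" k 2] k by (simp add: powr_minus)
      qed (use i in auto)
      also have "\<dots> = k * m + inverse k * (LINT z|?M. (norm (a n (?S n z) - b0 z))\<^sup>2)"
        using i by (simp add: m_def mult.commute)
      finally show ?thesis using k by linarith
    qed
    have "Y \<longlonglongrightarrow> 0"
    proof (rule tendsto_sandwich[of "\<lambda>_. 0"])
      show "(\<lambda>n. inverse k * (LINT z|?M. (norm (a n (?S n z) - b0 z))\<^sup>2)) \<longlonglongrightarrow> 0"
        using tendsto_mult_left[OF L2, of "inverse k"] by simp
    qed (use k X0 in \<open>auto simp: Y_def\<close>)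
    moreover have "\<bar>(LINT z|?M. norm (a n (?S n z) - b0 z)) - Y n\<bar> \<le> e" for n
      using X[of n] e by (auto simp: Y_def min_def)
    ultimately show "\<exists>Y. Y \<longlonglongrightarrow> 0 \<and> (\<forall>n. \<bar>(LINT z|?M. norm (a n (?S n z) - b0 z)) - Y n\<bar> \<le> e)" by blast
  qed
qed

section \<open>Unfolding the reference domains\<close>

lemma Y_periodic_periodic_cell: "Y_periodic (\<lambda>y. y \<in> periodic_cell Ystar)"
proof -
  have shift: "y + k \<in> periodic_cell Ystar" if "y \<in> periodic_cell Ystar" "k \<in> int_lattice" for y k
  proof -
    define U where "U = (\<Union>k\<in>int_lattice. (\<lambda>y. k + y) ` closure Ystar)"
    have "(\<lambda>y. k + y) ` U \<subseteq> U"
    proof safe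
      fix y assume "y \<in> U"
      then obtain l w where "l \<in> int_lattice" "w \<in> closure Ystar" "y = l + w" by (auto simp: U_def)
      then show "k + y \<in> U"
        unfolding U_def using int_lattice_add[OF that(2)]
        by (intro UN_I[of "k + l"] image_eqI[of _ _ w]) (auto simp: add.assoc)
    qed
    then have "interior ((\<lambda>y. k + y) ` U) \<subseteq> interior U" by (rule interior_mono)
    then have "(\<lambda>y. k + y) ` interior U \<subseteq> interior U" by (simp add: interior_translation)
    moreover have "periodic_cell Ystar = interior U" by (simp add: periodic_cell_def U_def)
    ultimately show ?thesis using that(1) by (auto simp: add.commute image_subset_iff)
  qed
  have "y + k \<in> periodic_cell Ystar \<longleftrightarrow> y \<in> periodic_cell Ystar" if "k \<in> int_lattice" for y k
    using shift[of y k] shift[of "y + k" "- k"] that int_lattice_uminus[OF that] by auto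
  then show ?thesis by (simp add: Y_periodic_def)
qed

lemma open_periodic_cell: "open (periodic_cell Ystar)"
  by (simp add: periodic_cell_def)

lemma subset_periodic_cell:
  assumes "open Ystar"
  shows "Ystar \<subseteq> periodic_cell Ystar"
  unfolding periodic_cell_def
proof (rule interior_maximal[OF _ assms])
  have "Ystar \<subseteq> (\<lambda>y. 0 + y) ` closure Ystar" using closure_subset by auto
  then show "Ystar \<subseteq> (\<Union>k\<in>int_lattice. (\<lambda>y. k + y) ` closure Ystar)" using int_lattice_0 by blast
qed

text \<open>
  Inside the open cell no translate of the closure by a nonzero lattice vector contributes, so the
  periodic cell can exceed \<open>Ystar\<close> only by points of its frontier.
\<close>

lemma AE_periodic_cell:
  assumes "open Ystar" "Ystar \<subseteq> unit_cell" "negligible (frontier Ystar)"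
  shows "AE y in lborel. y \<in> unit_cell \<longrightarrow> (y \<in> periodic_cell Ystar \<longleftrightarrow> y \<in> Ystar)"
proof -
  have "frontier Ystar \<in> null_sets lebesgue" using assms(3) by (simp add: negligible_iff_null_sets)
  moreover have "frontier Ystar \<in> sets lborel" by simp
  ultimately have "frontier Ystar \<in> null_sets lborel" by (simp only: null_sets_completion_iff)
  then have "AE y in lborel. y \<notin> frontier Ystar" by (rule AE_not_in)
  then show ?thesis using AE_unit_cell_open
  proof eventually_elim
    case (elim y)
    show ?case
    proof (intro impI iffI)
      assume y: "y \<in> unit_cell" "y \<in> periodic_cell Ystar"
      then have box: "y \<in> box 0 1" using elim by simp
      obtain k w where k: "k \<in> int_lattice" "w \<in> closure Ystar" "y = k + w"
        using y(2) interior_subset unfolding periodic_cell_def by blast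
      have "closure Ystar \<subseteq> unit_cell"
        using assms(2) by (intro closure_minimal) (auto simp: unit_cell_def closed_cbox)
      then have "k = 0" using int_lattice_cell_shift[OF k(1), of w] k box by (auto simp: add.commute)
      then have "y \<in> closure Ystar" using k by simp
      then show "y \<in> Ystar" using elim(1) assms(1) by (auto simp: frontier_def interior_open)
    next
      assume "y \<in> Ystar" then show "y \<in> periodic_cell Ystar" using subset_periodic_cell[OF assms(1)] by blast
    qed
  qed
qed

text \<open>
  As the domain is open, its indicator function at \<open>S(z)\<close> is eventually one whenever it is one at
  \<open>x\<close>. This controls one half of the difference; the other half is equal in integral, because both functions
  have the integral \<open>measure lborel \<Omega>\<close>.
\<close>

lemma unfold_indicator_tendsto:
  fixes \<Omega> :: "(real^'n) set"
  assumes \<epsilon>: "\<And>n. 0 < \<epsilon> n" "\<epsilon> \<longlonglongrightarrow> 0" and \<Omega>: "open \<Omega>"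
    and K[measurable]: "K \<in> sets borel" and Kb: "bounded K" and \<Omega>K: "\<Omega> \<subseteq> K"
    and supp: "\<And>n z. snd z \<in> unit_cell \<Longrightarrow> unfold_map (\<epsilon> n) z \<in> \<Omega> \<Longrightarrow> fst z \<in> K"
  shows "(\<lambda>n. LINT z|slab_measure K. \<bar>indicator \<Omega> (unfold_map (\<epsilon> n) z) - indicator \<Omega> (fst z)\<bar> :: real) \<longlonglongrightarrow> 0"
proof -
  let ?M = "slab_measure K"
  let ?S = "\<lambda>n. unfold_map (\<epsilon> n) :: (real^'n) \<times> (real^'n) \<Rightarrow> real^'n"
  interpret finite_measure ?M by (rule finite_slab_measure[OF K Kb])
  have [measurable]: "\<Omega> \<in> sets borel" using \<Omega> by simp
  have fm[measurable]: "fst \<in> borel_measurable (borel :: ((real^'n) \<times> (real^'n)) measure)"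
    by (intro borel_measurable_continuous_onI continuous_intros)
  have [measurable]: "(\<lambda>z :: (real^'n) \<times> (real^'n). indicator \<Omega> (fst z) :: real) \<in> borel_measurable borel"
    by (rule measurable_compose[OF fm]) measurable
  have bint: "integrable ?M g" if "g \<in> borel_measurable borel" "\<And>z. \<bar>g z\<bar> \<le> 1" for g :: "_ \<Rightarrow> real"
    by (rule integrable_const_bound[of _ 1]) (use that in auto)
  have i1: "integrable ?M (\<lambda>z. indicator \<Omega> (?S n z) :: real)" for n by (rule bint) (auto simp: indicator_def)
  have i2: "integrable ?M (\<lambda>z. indicator \<Omega> (fst z) :: real)" by (rule bint) (auto simp: indicator_def)
  have i3: "integrable ?M (\<lambda>z. max 0 (indicator \<Omega> (fst z) - indicator \<Omega> (?S n z) :: real))" for n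
    by (rule bint) (auto simp: indicator_def)
  have e1: "(LINT z|?M. indicator \<Omega> (?S n z)) = measure lborel \<Omega>" for n
  proof -
    have "(LINT x|lborel. indicator \<Omega> x :: real) = (LINT z|?M. indicator \<Omega> (?S n z))"
      by (rule integral_eq_slab[OF _ K \<epsilon>(1)]) (use supp in \<open>auto simp: indicator_def split: if_splits\<close>)
    then show ?thesis by simp
  qed
  have e2: "(LINT z|?M. indicator \<Omega> (fst z)) = measure lborel \<Omega>"
  proof -
    have "(LINT z|?M. indicator \<Omega> (fst z) :: real) = (LINT z|lborel. indicator (K \<times> (unit_cell :: (real^'n) set)) z *\<^sub>R indicator \<Omega> (fst z))"
      by (rule integral_slab_measure) measurable
    also have "\<dots> = (LINT z|lborel. indicator (\<Omega> \<times> (unit_cell :: (real^'n) set)) z)"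
      by (rule Bochner_Integration.integral_cong) (use \<Omega>K in \<open>auto simp: indicator_def\<close>)
    also have "\<dots> = measure (lborel \<Otimes>\<^sub>M lborel) (\<Omega> \<times> (unit_cell :: (real^'n) set))"
      by (simp add: lborel_prod)
    also have "\<dots> = measure lborel \<Omega>"
      by (simp add: measure_def lborel.emeasure_pair_measure_Times emeasure_unit_cell)
    finally show ?thesis .
  qed
  have id: "\<bar>u - v\<bar> = (u - v) + 2 * max 0 (v - u)" for u v :: real by (simp add: max_def abs_if)
  have "(LINT z|?M. \<bar>indicator \<Omega> (?S n z) - indicator \<Omega> (fst z)\<bar>)
      = 2 * (LINT z|?M. max 0 (indicator \<Omega> (fst z) - indicator \<Omega> (?S n z) :: real))" for n
    unfolding id
    by (simp only: Bochner_Integration.integral_add Bochner_Integration.integrable_diff Bochner_Integration.integral_diff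
        integrable_mult_right i1 i2 i3 e1 e2 integral_mult_right_zero)
  moreover have "(\<lambda>n. LINT z|?M. max 0 (indicator \<Omega> (fst z) - indicator \<Omega> (?S n z) :: real)) \<longlonglongrightarrow> (LINT z|?M. 0)"
  proof (rule integral_dominated_convergence[where w = "\<lambda>_. 1"])
    have "AE z in ?M. snd z \<in> unit_cell"
      using AE_slab_open_cell[OF K] by eventually_elim (auto simp: unit_cell_iff open_unit_cell_iff less_imp_le)
    then show "AE z in ?M. (\<lambda>n. max 0 (indicator \<Omega> (fst z) - indicator \<Omega> (?S n z) :: real)) \<longlonglongrightarrow> 0"
    proof eventually_elim
      case (elim z)
      show ?case
      proof (cases "fst z \<in> \<Omega>")
        case True
        have "(\<lambda>n. ?S n z - fst z) \<longlonglongrightarrow> 0"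
        proof (rule Lim_null_comparison)
          show "eventually (\<lambda>n. norm (?S n z - fst z) \<le> \<epsilon> n * CARD('n)) sequentially"
            by (intro always_eventually allI unfold_map_close elim \<epsilon>)
          show "(\<lambda>n. \<epsilon> n * CARD('n)) \<longlonglongrightarrow> 0" using tendsto_mult_right[OF \<epsilon>(2)] by simp
        qed
        then have "(\<lambda>n. ?S n z) \<longlonglongrightarrow> fst z" by (simp add: LIM_zero_iff)
        then have "eventually (\<lambda>n. ?S n z \<in> \<Omega>) sequentially" by (rule topological_tendstoD[OF _ \<Omega> True])
        then have "eventually (\<lambda>n. max 0 (indicator \<Omega> (fst z) - indicator \<Omega> (?S n z) :: real) = 0) sequentially"
          by eventually_elim (simp add: True)
        then show ?thesis by (rule tendsto_eventually)
      next
        case False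
        then have "max 0 (indicator \<Omega> (fst z) - indicator \<Omega> (?S n z) :: real) = 0" for n
          by (auto simp: indicator_def)
        then show ?thesis by (simp only: tendsto_const)
      qed
    qed
    show "AE z in ?M. norm (max 0 (indicator \<Omega> (fst z) - indicator \<Omega> (?S n z)) :: real) \<le> 1" for n
      by (intro AE_I2) (auto simp: indicator_def)
  qed auto
  ultimately show ?thesis using tendsto_mult_right_zero by fastforce
qed

text \<open>
  Here \<open>x + \<epsilon> a(x)\<close> plays the role of \<open>\<psi>\<^sub>\<epsilon>(x)\<close>. Unfolding splits the indicator function of the reference
  domain into one factor for the domain and one for the cell, and turns the argument of \<open>F\<close> into
  \<open>(S(z) + \<epsilon> a(S(z)), y + a(S(z)))\<close>. The Lipschitz bound then compares this with the limit.
\<close>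

lemma pulled_back_test_tendsto:
  fixes a :: "nat \<Rightarrow> real^'n \<Rightarrow> real^'n" and b0 :: "(real^'n) \<times> (real^'n) \<Rightarrow> real^'n"
  assumes \<epsilon>: "\<And>n. 0 < \<epsilon> n" "\<epsilon> \<longlonglongrightarrow> 0" and \<Omega>: "open \<Omega>"
    and K[measurable]: "K \<in> sets borel" and Kb: "bounded K" and \<Omega>K: "\<Omega> \<subseteq> K"
    and supp: "\<And>n z. snd z \<in> unit_cell \<Longrightarrow> unfold_map (\<epsilon> n) z \<in> \<Omega> \<Longrightarrow> fst z \<in> K"
    and Y: "open Ystar" "Ystar \<subseteq> unit_cell" "negligible (frontier Ystar)"
    and a[measurable]: "\<And>n. a n \<in> borel_measurable borel" and aC: "\<And>n x. norm (a n x) \<le> C"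
    and b[measurable]: "b0 \<in> borel_measurable borel" and bC: "\<And>z. norm (b0 z) \<le> C"
    and lim: "(\<lambda>n. LINT z|slab_measure K. norm (a n (unfold_map (\<epsilon> n) z) - b0 z)) \<longlonglongrightarrow> 0"
    and F: "periodic_test F"
  shows "(\<lambda>n. LINT x|lborel. indicator (ref_domain \<Omega> Ystar (\<epsilon> n)) x * F (x + \<epsilon> n *\<^sub>R a n x, x /\<^sub>R \<epsilon> n + a n x))
     \<longlonglongrightarrow> (LINT z|slab_measure K. indicator (\<Omega> \<times> Ystar) z * F (fst z, snd z + b0 z))"
proof -
  let ?M = "slab_measure K" and ?P = "periodic_cell Ystar"
  let ?S = "\<lambda>n. unfold_map (\<epsilon> n) :: (real^'n) \<times> (real^'n) \<Rightarrow> real^'n"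
  interpret finite_measure ?M by (rule finite_slab_measure[OF K Kb])
  have \<Omega>m[measurable]: "\<Omega> \<in> sets borel" using \<Omega> by simp
  have Ym[measurable]: "Ystar \<in> sets borel" "?P \<in> sets borel"
    using Y(1) open_periodic_cell[of Ystar] by (intro borel_open; simp)+
  have fm[measurable]: "fst \<in> borel_measurable (borel :: ((real^'n) \<times> (real^'n)) measure)"
    and sm[measurable]: "snd \<in> borel_measurable (borel :: ((real^'n) \<times> (real^'n)) measure)"
    by (intro borel_measurable_continuous_onI continuous_intros)+
  have Fm: "F \<in> borel_measurable borel" by (rule periodic_test_measurable[OF F])
  have F1: "\<bar>F z\<bar> \<le> 1" for z using periodic_test_bounds[OF F] by auto
  obtain L where L: "L-lipschitz_on UNIV F" using F by (auto simp: periodic_test_def)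
  have L0: "0 \<le> L" by (rule lipschitz_on_nonneg[OF L])
  have C0: "0 \<le> C" using order_trans[OF norm_ge_zero bC[of 0]] .
  have per: "Y_periodic (\<lambda>y. F (x, y))" for x using F by (simp add: periodic_test_def)
  have E_iff: "x \<in> ref_domain \<Omega> Ystar (\<epsilon> n) \<longleftrightarrow> x \<in> \<Omega> \<and> x /\<^sub>R \<epsilon> n \<in> ?P" for n x
  proof -
    have "x \<in> (\<lambda>y. \<epsilon> n *\<^sub>R y) ` ?P \<longleftrightarrow> x /\<^sub>R \<epsilon> n \<in> ?P"
    proof
      assume "x /\<^sub>R \<epsilon> n \<in> ?P"
      then show "x \<in> (\<lambda>y. \<epsilon> n *\<^sub>R y) ` ?P" using \<epsilon>(1)[of n] by (intro image_eqI[of _ _ "x /\<^sub>R \<epsilon> n"]) auto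
    qed (use \<epsilon>(1)[of n] in auto)
    then show ?thesis by (simp add: ref_domain_def)
  qed
  have ind_m: "(\<lambda>x. indicator (ref_domain \<Omega> Ystar (\<epsilon> n)) x :: real) \<in> borel_measurable borel" for n
  proof -
    have "(\<lambda>x. indicator (ref_domain \<Omega> Ystar (\<epsilon> n)) x :: real) = (\<lambda>x. indicator \<Omega> x * indicator ?P (x /\<^sub>R \<epsilon> n))"
      by (auto simp: fun_eq_iff indicator_def E_iff)
    then show ?thesis by simp
  qed
  define G where "G z = indicator (\<Omega> \<times> Ystar) z * F (fst z, snd z + b0 z)" for z
  define g where "g n x = indicator (ref_domain \<Omega> Ystar (\<epsilon> n)) x * F (x + \<epsilon> n *\<^sub>R a n x, x /\<^sub>R \<epsilon> n + a n x)" for n x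
  have gm[measurable]: "g n \<in> borel_measurable borel" for n
    unfolding g_def by (intro borel_measurable_times ind_m measurable_compose[OF _ Fm] borel_measurable_Pair) measurable
  have IOY: "(\<lambda>z. indicator (\<Omega> \<times> Ystar) z :: real) \<in> borel_measurable borel"
    by (intro borel_measurable_indicator borel_Times \<Omega>m Ym)
  have Gm[measurable]: "G \<in> borel_measurable borel"
    unfolding G_def by (intro borel_measurable_times IOY measurable_compose[OF _ Fm] borel_measurable_Pair) measurable
  have bint: "integrable ?M h" if "h \<in> borel_measurable borel" "\<And>z. norm (h z) \<le> B" for h :: "_ \<Rightarrow> 'c::{banach,second_countable_topology}" and B
    by (rule integrable_const_bound[of _ B]) (use that in auto)
  have gS: "g n (?S n z) = indicator \<Omega> (?S n z) * indicator ?P (snd z) * F (?S n z + \<epsilon> n *\<^sub>R a n (?S n z), snd z + a n (?S n z))"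
    for n z
  proof -
    have "?S n z /\<^sub>R \<epsilon> n \<in> ?P \<longleftrightarrow> snd z \<in> ?P"
      by (rule Y_periodic_unfold_map[OF Y_periodic_periodic_cell \<epsilon>(1)])
    moreover have "F (u, ?S n z /\<^sub>R \<epsilon> n + w) = F (u, snd z + w)" for u w
    proof -
      have "Y_periodic (\<lambda>y. F (u, y + w))"
        unfolding Y_periodic_def
      proof (intro ballI allI)
        fix k y :: "real^'n" assume "k \<in> int_lattice"
        then have "F (u, (y + w) + k) = F (u, y + w)" using per[of u] by (simp add: Y_periodic_def)
        moreover have "(y + w) + k = y + k + w" by simp
        ultimately show "F (u, y + k + w) = F (u, y + w)" by (simp only:)
      qed
      from Y_periodic_unfold_map[OF this \<epsilon>(1)] show ?thesis .
    qed
    ultimately show ?thesis unfolding g_def by (simp add: indicator_def E_iff)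
  qed
  have gslab: "(LINT x|lborel. g n x) = (LINT z|?M. g n (?S n z))" for n
  proof (rule integral_eq_slab[OF gm K \<epsilon>(1)])
    fix z assume "snd z \<in> unit_cell" "g n (?S n z) \<noteq> 0"
    then show "fst z \<in> K" using supp[of z n] by (auto simp: gS indicator_def split: if_splits)
  qed
  \<comment> \<open>The error: a boundary layer, the distance of the displacements, and the shift of the slow variable.\<close>
  define R where "R n z = \<bar>indicator \<Omega> (?S n z) - indicator \<Omega> (fst z)\<bar> + L * norm (a n (?S n z) - b0 z) + L * (\<epsilon> n * (CARD('n) + C))" for n z
  have pw: "AE z in ?M. \<bar>g n (?S n z) - G z\<bar> \<le> R n z" for n
  proof -
    have c1: "AE z in ?M. snd z \<in> unit_cell"
      using AE_slab_open_cell[OF K] by eventually_elim (auto simp: unit_cell_iff open_unit_cell_iff less_imp_le)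
    have c2: "AE z in ?M. snd z \<in> ?P \<longleftrightarrow> snd z \<in> Ystar"
    proof (rule AE_slab_snd[OF AE_periodic_cell[OF Y] _ K])
      have "{y. y \<in> ?P \<longleftrightarrow> y \<in> Ystar} = (?P \<inter> Ystar) \<union> (- ?P \<inter> - Ystar)" by auto
      also have "\<dots> \<in> sets borel" by (intro sets.Un sets.Int Ym borel_comp)
      finally show "{y. y \<in> ?P \<longleftrightarrow> y \<in> Ystar} \<in> sets borel" .
    qed
    show ?thesis using c1 c2
    proof eventually_elim
      case (elim z)
      let ?u = "F (?S n z + \<epsilon> n *\<^sub>R a n (?S n z), snd z + a n (?S n z))" and ?v = "F (fst z, snd z + b0 z)"
      have uv: "\<bar>?u - ?v\<bar> \<le> L * norm (a n (?S n z) - b0 z) + L * (\<epsilon> n * (CARD('n) + C))"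
      proof -
        have "\<bar>?u - ?v\<bar> \<le> L * dist (?S n z + \<epsilon> n *\<^sub>R a n (?S n z), snd z + a n (?S n z)) (fst z, snd z + b0 z)"
          using lipschitz_onD[OF L] by (auto simp: dist_real_def)
        also have "\<dots> \<le> L * (dist (?S n z + \<epsilon> n *\<^sub>R a n (?S n z)) (fst z) + dist (snd z + a n (?S n z)) (snd z + b0 z))"
          by (intro mult_left_mono L0) (simp add: dist_Pair_Pair sqrt_sum_squares_le_sum)
        also have "dist (?S n z + \<epsilon> n *\<^sub>R a n (?S n z)) (fst z) \<le> norm (?S n z - fst z) + norm (\<epsilon> n *\<^sub>R a n (?S n z))"
          unfolding dist_norm using norm_triangle_ineq[of "?S n z - fst z" "\<epsilon> n *\<^sub>R a n (?S n z)"] by (simp add: algebra_simps)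
        also have "\<dots> \<le> \<epsilon> n * CARD('n) + \<epsilon> n * C"
          using unfold_map_close[OF elim(1) \<epsilon>(1)[of n]] aC[of n "?S n z"] \<epsilon>(1)[of n] by (intro add_mono) auto
        finally have "\<bar>?u - ?v\<bar> \<le> L * (\<epsilon> n * CARD('n) + \<epsilon> n * C + dist (snd z + a n (?S n z)) (snd z + b0 z))"
          using L0 by (simp add: mult_left_mono)
        then show ?thesis by (simp add: dist_norm algebra_simps)
      qed
      have P0: "0 \<le> L * norm (a n (?S n z) - b0 z) + L * (\<epsilon> n * (CARD('n) + C))"
        using L0 C0 \<epsilon>(1)[of n] by simp
      have Gz: "G z = indicator \<Omega> (fst z) * indicator Ystar (snd z) * ?v"
        by (simp add: G_def indicator_def mem_Times_iff)
      have gz: "g n (?S n z) = indicator \<Omega> (?S n z) * indicator Ystar (snd z) * ?u"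
        using elim by (simp add: gS indicator_def)
      show ?case
        unfolding Gz gz R_def using uv P0 F1[of "(?S n z + \<epsilon> n *\<^sub>R a n (?S n z), snd z + a n (?S n z))"] F1[of "(fst z, snd z + b0 z)"]
        by (cases "?S n z \<in> \<Omega>"; cases "fst z \<in> \<Omega>"; cases "snd z \<in> Ystar") auto
    qed
  qed
  have Om: "(\<lambda>z :: (real^'n) \<times> (real^'n). indicator \<Omega> (fst z) :: real) \<in> borel_measurable borel"
    by (rule measurable_compose[OF fm]) measurable
  have I1: "integrable ?M (\<lambda>z. \<bar>indicator \<Omega> (?S n z) - indicator \<Omega> (fst z)\<bar> :: real)" for n
    by (rule bint[of _ 1]) (use Om in \<open>auto simp: indicator_def\<close>)
  have nb2: "norm (norm (a n x - b0 z)) \<le> 2 * C" for n x z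
    using norm_triangle_ineq4[of "a n x" "b0 z"] aC[of n x] bC[of z] by simp
  have I2: "integrable ?M (\<lambda>z. norm (a n (?S n z) - b0 z))" for n
    by (rule bint[OF _ nb2]) measurable
  have Ri: "integrable ?M (R n)" for n unfolding R_def using I1 I2 by simp
  have R0: "(\<lambda>n. LINT z|?M. R n z) \<longlonglongrightarrow> 0"
  proof -
    have "(LINT z|?M. R n z) = (LINT z|?M. \<bar>indicator \<Omega> (?S n z) - indicator \<Omega> (fst z)\<bar>)
        + L * (LINT z|?M. norm (a n (?S n z) - b0 z)) + L * (\<epsilon> n * (CARD('n) + C)) * measure ?M UNIV" for n
      unfolding R_def using I1 I2 by simp
    moreover have "(\<lambda>n. (LINT z|?M. \<bar>indicator \<Omega> (?S n z) - indicator \<Omega> (fst z)\<bar>)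
        + L * (LINT z|?M. norm (a n (?S n z) - b0 z)) + L * (\<epsilon> n * (CARD('n) + C)) * measure ?M UNIV)
      \<longlonglongrightarrow> 0 + L * 0 + L * (0 * (CARD('n) + C)) * measure ?M UNIV"
      by (intro tendsto_intros lim \<epsilon>(2) unfold_indicator_tendsto[OF \<epsilon> \<Omega> K Kb \<Omega>K supp])
    ultimately show ?thesis by simp
  qed
  have gi: "integrable ?M (\<lambda>z. g n (?S n z))" for n
  proof (rule bint[of _ 1])
    show "norm (g n (?S n z)) \<le> 1" for z
      using F1[of "(?S n z + \<epsilon> n *\<^sub>R a n (?S n z), ?S n z /\<^sub>R \<epsilon> n + a n (?S n z))"]
      by (simp add: g_def indicator_def)
  qed measurable
  have Gi: "integrable ?M G"
  proof (rule bint[of _ 1])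
    show "norm (G z) \<le> 1" for z
      using F1[of "(fst z, snd z + b0 z)"] by (simp add: G_def indicator_def)
  qed measurable
  have "\<bar>(LINT z|?M. g n (?S n z)) - (LINT z|?M. G z)\<bar> \<le> (LINT z|?M. R n z)" for n
  proof -
    have "\<bar>(LINT z|?M. g n (?S n z)) - (LINT z|?M. G z)\<bar> = \<bar>LINT z|?M. g n (?S n z) - G z\<bar>"
      using gi[of n] Gi by simp
    also have "\<dots> \<le> (LINT z|?M. \<bar>g n (?S n z) - G z\<bar>)" by (rule integral_abs_bound)
    also have "\<dots> \<le> (LINT z|?M. R n z)"
      by (rule integral_mono_AE[OF integrable_abs[OF Bochner_Integration.integrable_diff[OF gi[of n] Gi]] Ri pw])
    finally show ?thesis .
  qed
  then have "eventually (\<lambda>n. norm ((LINT z|?M. g n (?S n z)) - (LINT z|?M. G z)) \<le> (LINT z|?M. R n z)) sequentially"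
    by simp
  from Lim_null_comparison[OF this R0]
  have "(\<lambda>n. (LINT z|?M. g n (?S n z)) - (LINT z|?M. G z)) \<longlonglongrightarrow> 0" .
  then have "(\<lambda>n. LINT z|?M. g n (?S n z)) \<longlonglongrightarrow> (LINT z|?M. G z)" by (simp add: LIM_zero_iff)
  then show ?thesis unfolding gslab[symmetric] by (simp only: g_def[abs_def] G_def[abs_def])
qed

section \<open>The weak limit of the indicator functions\<close>

text \<open>
  With \<open>b = \<psi>\<^sub>0(x, y) - y\<close> this is the image of Lebesgue measure under \<open>(x, y) \<mapsto> (x, \<psi>\<^sub>0(x, y))\<close>.
\<close>

definition transported_measure ::
  "(real^'n) set \<Rightarrow> (real^'n) set \<Rightarrow> ((real^'n) \<times> (real^'n) \<Rightarrow> real^'n) \<Rightarrow> ((real^'n) \<times> (real^'n)) measure" where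
  "transported_measure \<Omega> Ystar b =
     distr (density lborel (indicator (\<Omega> \<times> Ystar))) borel (\<lambda>z. (fst z, snd z + b z))"

text \<open>
  The density \<open>\<theta>\<close> is squeezed between multiples of the transported measure: for test functions this is
  the limit of the inequalities \<open>lower\<close> and \<open>upper\<close>, which hold along the sequence by a change of
  variables. The first conclusion also uses that indicator functions, and hence \<open>\<theta>\<close>, do not exceed one.
\<close>

lemma limit_density_bounds:
  fixes a :: "nat \<Rightarrow> real^'n \<Rightarrow> real^'n" and b0 :: "(real^'n) \<times> (real^'n) \<Rightarrow> real^'n"
  assumes \<epsilon>: "\<And>n. 0 < \<epsilon> n" "\<epsilon> \<longlonglongrightarrow> 0" and \<Omega>: "open \<Omega>" "bounded \<Omega>"
    and K[measurable]: "K \<in> sets borel" and Kb: "bounded K" and \<Omega>K: "\<Omega> \<subseteq> K"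
    and supp: "\<And>n z. snd z \<in> unit_cell \<Longrightarrow> unfold_map (\<epsilon> n) z \<in> \<Omega> \<Longrightarrow> fst z \<in> K"
    and Y: "open Ystar" "Ystar \<subseteq> unit_cell" "negligible (frontier Ystar)"
    and a[measurable]: "\<And>n. a n \<in> borel_measurable borel" and aC: "\<And>n x. norm (a n x) \<le> C"
    and b[measurable]: "b0 \<in> borel_measurable borel" and bC: "\<And>z. norm (b0 z) \<le> C"
    and lim: "(\<lambda>n. LINT z|slab_measure K. norm (a n (unfold_map (\<epsilon> n) z) - b0 z)) \<longlonglongrightarrow> 0"
    and cell: "AE z in lborel. z \<in> \<Omega> \<times> Ystar \<longrightarrow> snd z + b0 z \<in> unit_cell"
    and W: "\<And>n. open (W n)" "\<And>n. bounded (W n)"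
    and suppW: "\<And>n z. snd z \<in> unit_cell \<Longrightarrow> unfold_map (\<epsilon> n) z \<in> W n \<Longrightarrow> fst z \<in> K"
    and lower: "\<And>n F. F \<in> borel_measurable borel \<Longrightarrow> (\<And>x. 0 \<le> F x \<and> F x \<le> 1) \<Longrightarrow>
       c * (LINT x|lborel. indicator (ref_domain \<Omega> Ystar (\<epsilon> n)) x * F (x + \<epsilon> n *\<^sub>R a n x)) \<le> (LINT x|lborel. indicator (W n) x * F x)"
    and upper: "\<And>n F. F \<in> borel_measurable borel \<Longrightarrow> (\<And>x. 0 \<le> F x \<and> F x \<le> 1) \<Longrightarrow>
       (LINT x|lborel. indicator (W n) x * F x) \<le> c' * (LINT x|lborel. indicator (ref_domain \<Omega> Ystar (\<epsilon> n)) x * F (x + \<epsilon> n *\<^sub>R a n x))"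
    and c: "0 < c" "0 < c'"
    and \<theta>[measurable]: "\<theta> \<in> borel_measurable borel" and \<theta>0: "\<And>z. 0 \<le> \<theta> z" and \<theta>i: "integrable (slab_measure K) \<theta>"
    and weak: "weakly_tendsto (slab_measure K) (\<lambda>n z. indicator (W n) (unfold_map (\<epsilon> n) z)) \<theta>"
    and A[measurable]: "A \<in> sets borel" and Abox: "A \<subseteq> UNIV \<times> box 0 1"
  shows "c * measure (transported_measure \<Omega> Ystar b0) A \<le> measure (slab_measure K) A"
    and "(LINT z|slab_measure K. indicator A z * \<theta> z) \<le> c' * measure (transported_measure \<Omega> Ystar b0) A"
    and "finite_measure (transported_measure \<Omega> Ystar b0)"
proof -
  let ?M = "slab_measure K" and ?T = "transported_measure \<Omega> Ystar b0"
  let ?S = "\<lambda>n. unfold_map (\<epsilon> n) :: (real^'n) \<times> (real^'n) \<Rightarrow> real^'n"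
  define \<Psi> where "\<Psi> z = (fst z, snd z + b0 z)" for z
  interpret finite_measure ?M by (rule finite_slab_measure[OF K Kb])
  have [measurable]: "\<Omega> \<in> sets borel" "Ystar \<in> sets borel" using \<Omega> Y by auto
  have Wm[measurable]: "W n \<in> sets borel" for n using W(1) by (rule borel_open)
  have WS[measurable]: "(\<lambda>z. indicator (W n) (?S n z) :: real) \<in> borel_measurable borel" for n
    by (rule measurable_compose[OF measurable_unfold_map]) measurable
  have OY[measurable]: "\<Omega> \<times> Ystar \<in> sets borel" by (intro borel_Times) measurable
  have fm[measurable]: "fst \<in> borel_measurable (borel :: ((real^'n) \<times> (real^'n)) measure)"
    and sm[measurable]: "snd \<in> borel_measurable (borel :: ((real^'n) \<times> (real^'n)) measure)"
    by (intro borel_measurable_continuous_onI continuous_intros)+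
  have \<Psi>m[measurable]: "\<Psi> \<in> borel_measurable borel" unfolding \<Psi>_def by (intro borel_measurable_Pair) measurable
  have sub: "\<Omega> \<times> Ystar \<subseteq> K \<times> unit_cell" using \<Omega>K Y(2) by auto
  have T: "?T = distr (density lborel (indicator (\<Omega> \<times> Ystar))) borel \<Psi>"
    by (simp add: transported_measure_def \<Psi>_def[abs_def])
  have finOY: "emeasure lborel (\<Omega> \<times> Ystar) < \<infinity>"
  proof (rule emeasure_bounded_finite)
    show "bounded (\<Omega> \<times> Ystar)"
      using \<Omega>(2) bounded_subset[OF _ Y(2)] by (simp add: bounded_Times unit_cell_def)
  qed
  have sT[simp]: "sets ?T = sets borel" by (simp add: transported_measure_def)
  show finT: "finite_measure ?T"
    unfolding T
  proof (rule finite_measure.finite_measure_distr)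
    show "finite_measure (density lborel (indicator (\<Omega> \<times> Ystar)))"
      by standard (use finOY in \<open>simp add: emeasure_density\<close>)
  qed simp
  have Tint: "(LINT z|?T. F z) = (LINT z|?M. indicator (\<Omega> \<times> Ystar) z * F (\<Psi> z))"
    if [measurable]: "F \<in> borel_measurable borel" for F :: "_ \<Rightarrow> real"
  proof -
    have "(LINT z|?T. F z) = (LINT z|density lborel (indicator (\<Omega> \<times> Ystar)). F (\<Psi> z))"
      unfolding T by (rule integral_distr) auto
    also have "\<dots> = (LINT z|lborel. indicator (\<Omega> \<times> Ystar) z *\<^sub>R F (\<Psi> z))"
      unfolding ennreal_indicator[symmetric] by (rule integral_density) auto
    also have "\<dots> = (LINT z|lborel. indicator (K \<times> unit_cell) z *\<^sub>R (indicator (\<Omega> \<times> Ystar) z * F (\<Psi> z)))"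
      by (rule Bochner_Integration.integral_cong) (use sub in \<open>auto simp: indicator_def\<close>)
    also have "\<dots> = (LINT z|?M. indicator (\<Omega> \<times> Ystar) z * F (\<Psi> z))"
      by (rule integral_slab_measure[symmetric]) auto
    finally show ?thesis .
  qed
  have Tcell: "AE z in ?T. snd z \<in> unit_cell"
  proof -
    have "AE z in lborel. z \<in> \<Omega> \<times> Ystar \<longrightarrow> snd (\<Psi> z) \<in> unit_cell"
      using cell by (simp add: \<Psi>_def)
    then have "AE z in density lborel (indicator (\<Omega> \<times> Ystar)). snd (\<Psi> z) \<in> unit_cell"
      by (subst AE_density) (auto simp: indicator_def elim!: eventually_mono)
    then show ?thesis unfolding T by (subst AE_distr_iff) auto
  qed
  have Mcell: "AE z in ?M. snd z \<in> unit_cell"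
    using AE_slab_open_cell[OF K] by eventually_elim (auto simp: unit_cell_iff open_unit_cell_iff less_imp_le)
  have \<theta>ii: "integrable ?M (\<lambda>z. h z * \<theta> z)" if "h \<in> borel_measurable borel" "\<And>z. \<bar>h z\<bar> \<le> 1" for h :: "_ \<Rightarrow> real"
    by (rule Bochner_Integration.integrable_bound[OF \<theta>i])
      (use that in \<open>auto simp: abs_mult intro!: mult_left_le_one_le\<close>)
  \<comment> \<open>The measure with density \<open>\<theta>\<close>, so that both bounds become comparisons of measures.\<close>
  define N where "N = density ?M (\<lambda>z. ennreal (\<theta> z))"
  have sN[simp]: "sets N = sets borel" by (simp add: N_def)
  have Nint: "(LINT z|N. F z) = (LINT z|?M. F z * \<theta> z)" if "F \<in> borel_measurable borel" for F :: "_ \<Rightarrow> real"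
    unfolding N_def using that \<theta>0 by (subst integral_density) (auto simp: mult.commute)
  have NA: "emeasure N B = ennreal (LINT z|?M. indicator B z * \<theta> z)" if [measurable]: "B \<in> sets borel" for B
  proof -
    have "emeasure N B = (\<integral>\<^sup>+z. ennreal (indicator B z * \<theta> z) \<partial>?M)"
      unfolding N_def by (subst emeasure_density) (auto intro!: nn_integral_cong simp: indicator_def)
    also have "\<dots> = ennreal (LINT z|?M. indicator B z * \<theta> z)"
      by (rule nn_integral_eq_integral) (use \<theta>0 in \<open>auto intro!: \<theta>ii simp: indicator_def\<close>)
    finally show ?thesis .
  qed
  have finN: "finite_measure N"
    by standard (use NA[of UNIV] in \<open>simp add: N_def\<close>)
  have Ncell: "AE z in N. snd z \<in> unit_cell"
    unfolding N_def using Mcell by (subst AE_density) auto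
  have mNA: "measure N A = (LINT z|?M. indicator A z * \<theta> z)"
    using NA[OF A] \<theta>0 by (simp add: measure_def)
  have tests: "c * (LINT z|?T. F z) \<le> (LINT z|N. F z) \<and> (LINT z|N. F z) \<le> c' * (LINT z|?T. F z)" if F: "periodic_test F" for F
  proof -
    have Fm[measurable]: "F \<in> borel_measurable borel" by (rule periodic_test_measurable[OF F])
    have F1: "\<bar>F z\<bar> \<le> 1" for z using periodic_test_bounds[OF F] by auto
    define X where "X n = (LINT x|lborel. indicator (W n) x * F (x, x /\<^sub>R \<epsilon> n))" for n
    define Z where "Z n = (LINT x|lborel. indicator (ref_domain \<Omega> Ystar (\<epsilon> n)) x * F (x + \<epsilon> n *\<^sub>R a n x, x /\<^sub>R \<epsilon> n + a n x))" for n
    have Zlim: "Z \<longlonglongrightarrow> (LINT z|?T. F z)"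
      using pulled_back_test_tendsto[OF \<epsilon> \<Omega>(1) K Kb \<Omega>K supp Y a aC b bC lim F]
      by (simp add: Z_def[abs_def] Tint[OF Fm] \<Psi>_def)
    have Wi: "integrable lborel (indicator (W n) :: _ \<Rightarrow> real)" for n
      using W emeasure_bounded_finite[OF W(2)[of n]] by (simp add: borel_open)
    obtain R where R: "\<And>x. x \<in> K \<Longrightarrow> norm x \<le> R" using Kb by (auto simp: bounded_iff)
    have d0: "(\<lambda>n. X n - (LINT z|?M. indicator (W n) (?S n z) * F z)) \<longlonglongrightarrow> 0"
      unfolding X_def
    proof (rule unfolded_pairing_tendsto[OF \<epsilon> K Kb])
      show "indicator (W n) \<in> borel_measurable borel" for n by measurable
      show "integrable lborel (indicator (W n) :: _ \<Rightarrow> real)" for n by (rule Wi)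
      show "fst z \<in> K" if "snd z \<in> unit_cell" "indicator (W n) (?S n z) \<noteq> (0::real)" for n z
        using suppW[OF that(1), of n] that(2) by (auto simp: indicator_def split: if_splits)
      show "continuous_on UNIV F" by (rule periodic_test_continuous[OF F])
      show "Y_periodic (\<lambda>y. F (x, y))" for x using F by (simp add: periodic_test_def)
      show "\<bar>F z\<bar> \<le> 1" for z by (rule F1)
      show "(LINT x|lborel. \<bar>indicator (W n) x :: real\<bar>) \<le> measure ?M UNIV" for n
      proof -
        have "(LINT x|lborel. \<bar>indicator (W n) x :: real\<bar>) = (LINT z|?M. \<bar>indicator (W n) (?S n z)\<bar>)"
        proof (rule integral_eq_slab[OF _ K \<epsilon>(1)])
          show "fst z \<in> K" if "snd z \<in> unit_cell" "\<bar>indicator (W n) (?S n z) :: real\<bar> \<noteq> 0" for z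
            using suppW[OF that(1), of n] that(2) by (auto simp: indicator_def split: if_splits)
        qed measurable
        also have "\<dots> \<le> (LINT z|?M. 1)"
        proof (rule integral_mono)
          show "integrable ?M (\<lambda>z. \<bar>indicator (W n) (?S n z) :: real\<bar>)"
            by (intro integrable_abs integrable_const_bound[where B = 1]) (auto split: split_indicator)
        qed (auto split: split_indicator)
        finally show ?thesis by simp
      qed
    qed
    have lw: "(\<lambda>n. LINT z|?M. F z * indicator (W n) (?S n z)) \<longlonglongrightarrow> (LINT z|?M. F z * \<theta> z)"
      by (rule weakly_tendstoD[OF weak _ F1]) simp
    have Xlim: "X \<longlonglongrightarrow> (LINT z|N. F z)"
      using tendsto_add[OF d0 lw] by (simp add: Nint[OF Fm] mult.commute[of "F _"])
    have F\<epsilon>: "(\<lambda>x. F (x, x /\<^sub>R \<epsilon> n)) \<in> borel_measurable borel" for n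
      by (rule measurable_compose[OF _ Fm], intro borel_measurable_continuous_onI continuous_intros)
    have eq: "(x + \<epsilon> n *\<^sub>R a n x) /\<^sub>R \<epsilon> n = x /\<^sub>R \<epsilon> n + a n x" for n x
      using \<epsilon>(1)[of n] by (simp add: scaleR_add_right)
    have "c * Z n \<le> X n" "X n \<le> c' * Z n" for n
      using lower[OF F\<epsilon>, of n n] upper[OF F\<epsilon>, of n n] periodic_test_bounds[OF F] by (simp_all add: X_def Z_def eq)
    then show ?thesis
      using LIMSEQ_le[OF tendsto_mult_left[OF Zlim, of c] Xlim] LIMSEQ_le[OF Xlim tendsto_mult_left[OF Zlim, of c']] by blast
  qed
  have "measure ?T A \<le> (1 / c) * measure N A"
  proof (rule measure_le_of_periodic_test[OF finT finN sT sN Tcell Ncell _ _ A Abox])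
    fix F :: "(real^'n) \<times> (real^'n) \<Rightarrow> real" assume "periodic_test F"
    then show "(LINT z|?T. F z) \<le> (1 / c) * (LINT z|N. F z)"
      using tests[of F] c by (simp add: field_simps)
  qed (use c in simp)
  then have 1: "c * measure ?T A \<le> measure N A" using c by (simp add: field_simps)
  show "(LINT z|?M. indicator A z * \<theta> z) \<le> c' * measure ?T A"
    unfolding mNA[symmetric]
    by (rule measure_le_of_periodic_test[OF finN finT sN sT Ncell Tcell _ _ A Abox]) (use c tests in auto)
  have "(LINT z|?M. indicator A z * \<theta> z) \<le> measure ?M A"
  proof (rule LIMSEQ_le_const2)
    show "(\<lambda>n. LINT z|?M. indicator A z * indicator (W n) (?S n z)) \<longlonglongrightarrow> (LINT z|?M. indicator A z * \<theta> z)"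
      by (rule weakly_tendstoD[OF weak, of _ 1]) (auto simp: indicator_def)
    have "(LINT z|?M. indicator A z * indicator (W n) (?S n z)) \<le> measure ?M A" for n
    proof -
      have "(LINT z|?M. indicator A z * indicator (W n) (?S n z)) \<le> (LINT z|?M. indicator A z :: real)"
      proof (rule integral_mono)
        show "integrable ?M (\<lambda>z. indicator A z * indicator (W n) (?S n z) :: real)"
          by (rule integrable_const_bound[where B = 1]) (auto split: split_indicator)
      qed (auto simp: emeasure_finite less_top[symmetric] split: split_indicator)
      then show ?thesis by simp
    qed
    then show "\<exists>N. \<forall>n\<ge>N. (LINT z|?M. indicator A z * indicator (W n) (?S n z)) \<le> measure ?M A" by blast
  qed
  then show "c * measure ?T A \<le> measure ?M A" using 1 mNA by simp
qed

text \<open>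
  Write \<open>Ystar\<close> as a countable union of compact sets \<open>K j\<close> with countable dense subsets \<open>D j\<close>. For
  continuous \<open>\<psi>\<close>, a point lies in the compact image of \<open>K j\<close> if and only if it is approximated by
  values of \<open>\<psi>\<close> on \<open>D j\<close>. So the range is described by countably many functions \<open>x \<mapsto> \<psi>0 x d\<close>, each
  of which has a Borel representative \<open>c d\<close>.
\<close>

lemma Linf_C1_Borel_range:
  fixes \<psi>0 :: "real^'n \<Rightarrow> real^'n \<Rightarrow> real^'n"
  assumes \<psi>: "\<psi>0 \<in> Linf_C1 \<Omega> Ystar (C1_cl Ystar)" and \<Omega>[measurable]: "\<Omega> \<in> sets borel" and Y: "open Ystar"
  obtains Q where "Q \<in> sets borel"
    "AE x in lborel. x \<in> \<Omega> \<longrightarrow> (\<forall>y. (x, y) \<in> Q \<longleftrightarrow> y \<in> \<psi>0 x ` Ystar)"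
proof -
  have \<Omega>l: "\<Omega> \<inter> space lebesgue \<in> sets lebesgue" using \<Omega> by (simp add: sets_completionI_sets)
  obtain s where s: "\<And>k. simple_function (lebesgue_on \<Omega>) (s k)"
    and sl: "AE x in lebesgue_on \<Omega>. \<psi>0 x \<in> C1_cl Ystar \<and> uniform_limit Ystar (\<lambda>k. s k x) (\<psi>0 x) sequentially"
    using \<psi> unfolding Linf_C1_def by (auto elim!: eventually_mono)
  then have good: "AE x in lborel. x \<in> \<Omega> \<longrightarrow> (continuous_on Ystar (\<psi>0 x) \<and> (\<forall>y\<in>Ystar. (\<lambda>k. s k x y) \<longlonglongrightarrow> \<psi>0 x y))"
  proof -
    have "AE x in lebesgue. x \<in> \<Omega> \<longrightarrow> \<psi>0 x \<in> C1_cl Ystar \<and> uniform_limit Ystar (\<lambda>k. s k x) (\<psi>0 x) sequentially"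
      using sl by (simp only: AE_restrict_space_iff[OF \<Omega>l])
    then have "AE x in lborel. x \<in> \<Omega> \<longrightarrow> \<psi>0 x \<in> C1_cl Ystar \<and> uniform_limit Ystar (\<lambda>k. s k x) (\<psi>0 x) sequentially"
      by (simp only: AE_completion_iff)
    then show ?thesis
    proof eventually_elim
      case (elim x)
      show ?case
      proof (intro impI conjI ballI)
        assume "x \<in> \<Omega>"
        then show "continuous_on Ystar (\<psi>0 x)"
          using elim continuous_on_subset[OF _ closure_subset] by (auto simp: C1_cl_def)
        show "(\<lambda>k. s k x y) \<longlonglongrightarrow> \<psi>0 x y" if "y \<in> Ystar" for y
          using elim \<open>x \<in> \<Omega>\<close> that by (auto intro: tendsto_uniform_limitI)
      qed
    qed
  qed
  have "\<exists>c. c \<in> borel_measurable borel \<and> (AE x in lborel. x \<in> \<Omega> \<longrightarrow> c x = lim (\<lambda>k. s k x y))" for y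
  proof -
    have "(\<lambda>x. s k x y) \<in> borel_measurable (lebesgue_on \<Omega>)" for k
      using simple_function_compose[OF s[of k], of "\<lambda>f. f y"] by (simp add: comp_def borel_measurable_simple_function)
    then have "(\<lambda>x. lim (\<lambda>k. s k x y)) \<in> borel_measurable (lebesgue_on \<Omega>)"
      by (rule borel_measurable_lim_metric)
    from borel_representative[OF this \<Omega>]
    obtain g where "g \<in> borel_measurable borel" "AE x in lborel. x \<in> \<Omega> \<longrightarrow> g x = lim (\<lambda>k. s k x y)" .
    then show ?thesis by blast
  qed
  then have "\<exists>c. \<forall>y. c y \<in> borel_measurable borel \<and> (AE x in lborel. x \<in> \<Omega> \<longrightarrow> c y x = lim (\<lambda>k. s k x y))"
    by (intro choice allI)
  then obtain c where "\<forall>y. c y \<in> borel_measurable borel \<and> (AE x in lborel. x \<in> \<Omega> \<longrightarrow> c y x = lim (\<lambda>k. s k x y))" ..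
  then have c[measurable]: "c y \<in> borel_measurable borel"
    and ce: "AE x in lborel. x \<in> \<Omega> \<longrightarrow> c y x = lim (\<lambda>k. s k x y)" for y by blast+
  obtain K where K: "\<And>j::nat. compact (K j)" "\<And>j. K j \<subseteq> Ystar" "(\<Union>j. K j) = Ystar"
    by (rule open_Union_compact_subsets[OF Y]) blast
  have "\<exists>D. countable D \<and> D \<subseteq> K j \<and> K j \<subseteq> closure D" for j
    using separable[of "K j"] by metis
  then obtain D where D: "\<And>j. countable (D j)" "\<And>j. D j \<subseteq> K j" "\<And>j. K j \<subseteq> closure (D j)" by metis
  have clD: "closure (D j) = K j" for j
    using D(3)[of j] closure_minimal[OF D(2)[of j] compact_imp_closed[OF K(1)]] by auto
  define Q where "Q = (\<Union>j. \<Inter>m::nat. \<Union>d\<in>D j. {z. dist (c d (fst z)) (snd z) < 1 / Suc m})"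
  have fm[measurable]: "fst \<in> borel_measurable (borel :: ((real^'n) \<times> (real^'n)) measure)"
    and sm[measurable]: "snd \<in> borel_measurable (borel :: ((real^'n) \<times> (real^'n)) measure)"
    by (intro borel_measurable_continuous_onI continuous_intros)+
  have "{z :: (real^'n) \<times> (real^'n). dist (c d (fst z)) (snd z) < 1 / Suc m} \<in> sets borel" for d and m :: nat
    by measurable
  then have "(\<Union>d\<in>D j. {z :: (real^'n) \<times> (real^'n). dist (c d (fst z)) (snd z) < 1 / Suc m}) \<in> sets borel" for j and m :: nat
    by (intro sets.countable_UN'[OF D(1)]) auto
  then have "(\<Inter>m::nat. \<Union>d\<in>D j. {z :: (real^'n) \<times> (real^'n). dist (c d (fst z)) (snd z) < 1 / Suc m}) \<in> sets borel" for j
    by (intro sets.countable_INT; (rule image_subsetI)?) auto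
  then have Qb: "Q \<in> sets borel"
    unfolding Q_def by (intro sets.countable_UN) auto
  have "AE x in lborel. \<forall>d\<in>(\<Union>j. D j). x \<in> \<Omega> \<longrightarrow> c d x = lim (\<lambda>k. s k x d)"
    by (rule AE_ball_countable'[OF ce]) (use D(1) in auto)
  then have "AE x in lborel. x \<in> \<Omega> \<longrightarrow> (\<forall>y. (x, y) \<in> Q \<longleftrightarrow> y \<in> \<psi>0 x ` Ystar)"
    using good
  proof eventually_elim
    case (elim x)
    show ?case
    proof (intro impI allI)
      fix y assume x: "x \<in> \<Omega>"
      have cd: "c d x = \<psi>0 x d" if "d \<in> D j" for d j
      proof -
        have "d \<in> Ystar" using that D(2)[of j] K(2)[of j] by blast
        then have "(\<lambda>k. s k x d) \<longlonglongrightarrow> \<psi>0 x d" using elim x by blast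
        then have "lim (\<lambda>k. s k x d) = \<psi>0 x d" by (rule limI)
        then show ?thesis using elim(1) that x by auto
      qed
      have cont: "continuous_on (K j) (\<psi>0 x)" for j
        using elim x K(2)[of j] by (auto intro: continuous_on_subset)
      have "closure (\<psi>0 x ` D j) = \<psi>0 x ` K j" for j
      proof
        show "closure (\<psi>0 x ` D j) \<subseteq> \<psi>0 x ` K j"
          using D(2) by (intro closure_minimal image_mono compact_imp_closed compact_continuous_image cont K(1))
        have "\<psi>0 x ` closure (D j) \<subseteq> closure (\<psi>0 x ` D j)"
          by (rule image_closure_subset) (use cont in \<open>auto simp: clD closure_subset\<close>)
        then show "\<psi>0 x ` K j \<subseteq> closure (\<psi>0 x ` D j)" by (simp add: clD)
      qed
      then have "y \<in> \<psi>0 x ` K j \<longleftrightarrow> (\<forall>m::nat. \<exists>d\<in>D j. dist (\<psi>0 x d) y < 1 / Suc m)" for j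
      proof -
        assume eq: "\<And>j. closure (\<psi>0 x ` D j) = \<psi>0 x ` K j"
        have "y \<in> closure (\<psi>0 x ` D j) \<longleftrightarrow> (\<forall>e>0. \<exists>d\<in>D j. dist (\<psi>0 x d) y < e)"
          by (simp add: closure_approachable)
        also have "\<dots> \<longleftrightarrow> (\<forall>m::nat. \<exists>d\<in>D j. dist (\<psi>0 x d) y < 1 / Suc m)"
        proof (intro iffI allI impI)
          fix m :: nat assume "\<forall>e>0. \<exists>d\<in>D j. dist (\<psi>0 x d) y < e"
          then show "\<exists>d\<in>D j. dist (\<psi>0 x d) y < 1 / Suc m" by (elim allE[of _ "1 / Suc m"]) auto
        next
          fix e :: real assume *: "\<forall>m::nat. \<exists>d\<in>D j. dist (\<psi>0 x d) y < 1 / Suc m" and "e > 0"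
          then obtain m :: nat where "1 / Suc m < e" using nat_approx_posE[of e] by blast
          then show "\<exists>d\<in>D j. dist (\<psi>0 x d) y < e" using * less_trans by blast
        qed
        finally show ?thesis by (simp add: eq)
      qed
      then have "(x, y) \<in> Q \<longleftrightarrow> (\<exists>j. y \<in> \<psi>0 x ` K j)"
        unfolding Q_def using cd by auto
      also have "\<dots> \<longleftrightarrow> y \<in> \<psi>0 x ` Ystar" unfolding K(3)[symmetric] by blast
      finally show "(x, y) \<in> Q \<longleftrightarrow> y \<in> \<psi>0 x ` Ystar" .
    qed
  qed
  with Qb show ?thesis by (rule that)
qed

text \<open>
  Test \<open>f\<close> with the sign of \<open>v\<close> on the set where \<open>\<theta> = 0\<close>. Splitting at a level \<open>k\<close>, the integral is at
  most \<open>k\<close> times the integral of \<open>h\<close> over this set, which tends to zero, plus a term that is small for large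
  \<open>k\<close>.
\<close>

lemma weak_limit_zero_where_density_zero:
  fixes f h :: "nat \<Rightarrow> 'a \<Rightarrow> real"
  assumes "finite_measure M" and p: "1 < p"
    and f[measurable]: "\<And>n. f n \<in> borel_measurable M" and fi: "\<And>n. integrable M (\<lambda>z. \<bar>f n z\<bar> powr p)"
    and C: "\<And>n. (LINT z|M. \<bar>f n z\<bar> powr p) \<le> C"
    and h[measurable]: "\<And>n. h n \<in> borel_measurable M" and h01: "\<And>n z. h n z = 0 \<or> h n z = 1"
    and fh: "\<And>n z. h n z = 0 \<Longrightarrow> f n z = 0"
    and v[measurable]: "v \<in> borel_measurable M" and vi: "integrable M v" and \<theta>[measurable]: "\<theta> \<in> borel_measurable M"
    and wf: "weakly_tendsto M f v" and wh: "weakly_tendsto M h \<theta>"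
  shows "AE z in M. \<theta> z = 0 \<longrightarrow> v z = 0"
proof -
  interpret finite_measure M by fact
  define N where "N z = (if \<theta> z = 0 then 1 else 0 :: real)" for z
  define s where "s z = sgn (v z) * N z" for z
  have [measurable]: "N \<in> borel_measurable M" "s \<in> borel_measurable M" unfolding N_def s_def by measurable
  have sb: "\<bar>s z\<bar> \<le> 1" "\<bar>N z\<bar> \<le> 1" "0 \<le> N z" for z by (auto simp: s_def N_def abs_mult sgn_if)
  have fii: "integrable M (f n)" for n by (rule integrable_of_powr[OF _ p fi]) measurable
  have hi: "integrable M (\<lambda>z. N z * h n z)" for n
  proof (rule integrable_const_bound[where B = 1])
    have "norm (N z * h n z) \<le> 1" for z using h01[of n z] sb(2)[of z] by (auto simp: abs_mult)
    then show "AE z in M. norm (N z * h n z) \<le> 1" by simp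
  qed measurable
  have C0: "0 \<le> C" using order_trans[OF integral_nonneg_AE C[of 0]] by simp
  have l1: "(\<lambda>n. LINT z|M. s z * f n z) \<longlonglongrightarrow> (LINT z|M. s z * v z)"
    by (rule weakly_tendstoD[OF wf _ sb(1)]) measurable
  have "(LINT z|M. N z * \<theta> z) = (LINT z|M. 0)" by (rule Bochner_Integration.integral_cong) (auto simp: N_def)
  then have l2: "(\<lambda>n. LINT z|M. N z * h n z) \<longlonglongrightarrow> 0"
    using weakly_tendstoD[OF wh, of N 1] sb(2) by simp
  have bound: "(LINT z|M. s z * v z) \<le> k powr (1 - p) * C" if k: "k > 0" for k
  proof -
    have "(LINT z|M. s z * f n z) \<le> k * (LINT z|M. N z * h n z) + k powr (1 - p) * C" for n
    proof -
      have "(LINT z|M. s z * f n z) \<le> (LINT z|M. k * (N z * h n z) + k powr (1 - p) * \<bar>f n z\<bar> powr p)"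
      proof (rule integral_mono)
        show "integrable M (\<lambda>z. s z * f n z)"
          by (rule Bochner_Integration.integrable_bound[OF fii[of n]])
            (use sb in \<open>auto simp: abs_mult intro!: mult_left_le_one_le\<close>)
        show "integrable M (\<lambda>z. k * (N z * h n z) + k powr (1 - p) * \<bar>f n z\<bar> powr p)"
          using hi fi by simp
        show "s z * f n z \<le> k * (N z * h n z) + k powr (1 - p) * \<bar>f n z\<bar> powr p" for z
        proof (cases "\<theta> z = 0 \<and> h n z \<noteq> 0")
          case True
          then have "h n z = 1" "N z = 1" using h01[of n z] by (auto simp: N_def)
          moreover have "s z * f n z \<le> \<bar>f n z\<bar>"
            using sb(1)[of z] abs_ge_self[of "s z * f n z"] mult_right_mono[OF sb(1)[of z], of "\<bar>f n z\<bar>"] by (simp add: abs_mult)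
          ultimately show ?thesis using powr_split_bound[of "\<bar>f n z\<bar>" k p] k p by simp
        next
          case False
          then have eq: "s z * f n z = 0" using fh[of n z] by (auto simp: s_def N_def)
          have "0 \<le> k * (N z * h n z)" using h01[of n z] sb(3)[of z] k by auto
          then show ?thesis unfolding eq by simp
        qed
      qed
      also have "\<dots> = k * (LINT z|M. N z * h n z) + k powr (1 - p) * (LINT z|M. \<bar>f n z\<bar> powr p)"
        using hi fi by simp
      also have "\<dots> \<le> k * (LINT z|M. N z * h n z) + k powr (1 - p) * C"
        using C[of n] by (intro add_left_mono mult_left_mono) auto
      finally show ?thesis .
    qed
    moreover have "(\<lambda>n. k * (LINT z|M. N z * h n z) + k powr (1 - p) * C) \<longlonglongrightarrow> k * 0 + k powr (1 - p) * C"
      by (intro tendsto_intros l2)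
    ultimately show ?thesis using LIMSEQ_le[OF l1] by fastforce
  qed
  have "(LINT z|M. s z * v z) \<le> e" if "e > 0" for e
  proof -
    obtain k where "k > 0" "k powr (1 - p) * C < e" by (rule powr_neg_small[OF p \<open>e > 0\<close> C0])
    then show ?thesis using bound[of k] by linarith
  qed
  then have "(LINT z|M. s z * v z) \<le> 0" by (rule dense_ge)
  moreover have sv: "s z * v z = N z * \<bar>v z\<bar>" for z by (simp add: s_def sgn_if)
  moreover have iN: "integrable M (\<lambda>z. N z * \<bar>v z\<bar>)"
    by (rule Bochner_Integration.integrable_bound[OF vi]) (use sb in \<open>auto simp: abs_mult intro!: mult_left_le_one_le\<close>)
  moreover have "0 \<le> (LINT z|M. N z * \<bar>v z\<bar>)" by (rule integral_nonneg_AE) (use sb in auto)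
  ultimately have "(LINT z|M. N z * \<bar>v z\<bar>) = 0" by simp
  then have "AE z in M. N z * \<bar>v z\<bar> = 0"
    using integral_nonneg_eq_0_iff_AE[OF iN] sb(3) by simp
  then show ?thesis by eventually_elim (auto simp: N_def split: if_splits)
qed

lemma nn_integral_le_of_measure_le:
  fixes m1 m2 :: "'a measure"
  assumes fin: "finite_measure m1" "finite_measure m2" and s: "sets m1 = sets m2" and c: "0 \<le> c" and V: "V \<in> sets m2"
    and le: "\<And>A. A \<in> sets m2 \<Longrightarrow> A \<subseteq> V \<Longrightarrow> measure m1 A \<le> c * measure m2 A"
    and g: "g \<in> borel_measurable m2"
  shows "(\<integral>\<^sup>+z. g z * indicator V z \<partial>m1) \<le> ennreal c * (\<integral>\<^sup>+z. g z \<partial>m2)"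
proof -
  interpret m1: finite_measure m1 by fact
  interpret m2: finite_measure m2 by fact
  have g1[measurable]: "g \<in> borel_measurable m1" using g by (simp add: measurable_cong_sets[OF s refl])
  have V1[measurable]: "V \<in> sets m1" using V s by simp
  have "(\<integral>\<^sup>+z. g z * indicator V z \<partial>m1) = (\<integral>\<^sup>+z. g z \<partial>density m1 (indicator V))"
    by (subst nn_integral_density) (auto simp: mult.commute)
  also have "\<dots> \<le> (\<integral>\<^sup>+z. g z \<partial>scale_measure (ennreal c) m2)"
  proof (rule nn_integral_mono_measure)
    show "sets (density m1 (indicator V)) = sets (scale_measure (ennreal c) m2)" using s by simp
    show "density m1 (indicator V) \<le> scale_measure (ennreal c) m2"
    proof (subst le_measure)
      show "\<forall>A\<in>sets (density m1 (indicator V)). emeasure (density m1 (indicator V)) A \<le> emeasure (scale_measure (ennreal c) m2) A"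
      proof
        fix A assume "A \<in> sets (density m1 (indicator V))"
        then have A[measurable]: "A \<in> sets m1" by simp
        have "emeasure (density m1 (indicator V)) A = emeasure m1 (A \<inter> V)"
          by (subst emeasure_density) (auto simp: nn_integral_indicator[symmetric] simp del: nn_integral_indicator intro!: nn_integral_cong split: split_indicator)
        also have "\<dots> = ennreal (measure m1 (A \<inter> V))" by (simp add: m1.emeasure_eq_measure)
        also have "\<dots> \<le> ennreal (c * measure m2 (A \<inter> V))" using le[of "A \<inter> V"] A V s by (intro ennreal_leI) auto
        also have "\<dots> \<le> ennreal (c * measure m2 A)"
          using A s c V by (intro ennreal_leI mult_left_mono m2.finite_measure_mono) auto
        also have "\<dots> = emeasure (scale_measure (ennreal c) m2) A"
          using c by (simp add: m2.emeasure_eq_measure ennreal_mult')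
        finally show "emeasure (density m1 (indicator V)) A \<le> emeasure (scale_measure (ennreal c) m2) A" .
      qed
    qed (use s in simp)
  qed
  also have "\<dots> = ennreal c * (\<integral>\<^sup>+z. g z \<partial>m2)" by (rule nn_integral_scale_measure) (use g in simp)
  finally show ?thesis .
qed

section \<open>General test functions\<close>

lemma norm_diff_vfloor: "norm (y - vfloor y) \<le> CARD('n)" for y :: "real^'n"
  using unfold_map_close[of "(y, 0)" 1] by (simp add: unfold_map_def norm_minus_commute unit_cell_iff)

lemma Y_periodic_uniformly_continuous:
  fixes f :: "real^'n \<Rightarrow> real"
  assumes per: "Y_periodic f" and cont: "continuous_on UNIV f" and e: "e > 0"
  obtains \<eta> where "\<eta> > 0" "\<And>x y. dist x y < \<eta> \<Longrightarrow> \<bar>f x - f y\<bar> < e"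
proof -
  let ?B = "cball (0 :: real^'n) (CARD('n) + 1)"
  have "uniformly_continuous_on ?B f"
    by (intro compact_uniformly_continuous continuous_on_subset[OF cont]) auto
  then obtain d where d: "d > 0" "\<And>x y. x \<in> ?B \<Longrightarrow> y \<in> ?B \<Longrightarrow> dist y x < d \<Longrightarrow> dist (f y) (f x) < e"
    unfolding uniformly_continuous_on_def using e by blast
  show ?thesis
  proof (rule that[of "min d 1"])
    fix x y :: "real^'n" assume xy: "dist x y < min d 1"
    define k where "k = - vfloor x"
    have k: "k \<in> int_lattice" unfolding k_def by (intro int_lattice_uminus vfloor_in_int_lattice)
    have "norm (x + k) \<le> CARD('n)" using norm_diff_vfloor[of x] by (simp add: k_def)
    moreover have "dist (x + k) (y + k) < min d 1" using xy by simp
    moreover have "norm (y + k) \<le> norm (x + k) + dist (x + k) (y + k)"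
      using norm_triangle_sub[of "y + k" "x + k"] by (simp add: dist_norm norm_minus_commute)
    ultimately have "dist (f (x + k)) (f (y + k)) < e" by (intro d(2)) auto
    moreover have "f (x + k) = f x" "f (y + k) = f y" using per k by (auto simp: Y_periodic_def)
    ultimately show "\<bar>f x - f y\<bar> < e" by (simp add: dist_real_def)
  qed (use d in simp)
qed

text \<open>
  Finitely many balls of radius \<open>\<eta>\<close> cover the cell. The periodic bumps
  \<open>max 0 (\<eta> - dist(y, j + \<int>\<^sup>N))\<close> around their centres have a positive sum, by which they are divided.
\<close>

lemma periodic_partition_of_unity:
  fixes \<eta> :: real
  assumes \<eta>: "\<eta> > 0"
  obtains J :: "(real^'n) set" and H :: "real^'n \<Rightarrow> (real^'n) \<Rightarrow>\<^sub>C real"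
  where "finite J" "\<And>j. j \<in> J \<Longrightarrow> Y_periodic (H j)" "\<And>j y. j \<in> J \<Longrightarrow> 0 \<le> H j y" "\<And>y. (\<Sum>j\<in>J. H j y) = 1"
    "\<And>j y. j \<in> J \<Longrightarrow> H j y \<noteq> 0 \<Longrightarrow> \<exists>k\<in>int_lattice. dist y (j + k) < \<eta>"
proof -
  have "compact (unit_cell :: (real^'n) set)" by (simp add: unit_cell_def)
  then obtain J :: "(real^'n) set" where J: "finite J" "unit_cell \<subseteq> (\<Union>j\<in>J. ball j \<eta>)"
    by (rule compactE_image[of unit_cell unit_cell "\<lambda>j. ball j \<eta>"]) (use \<eta> in auto)
  define \<Lambda> where "\<Lambda> j = (\<lambda>k. j + k) ` int_lattice" for j :: "real^'n"
  have \<Lambda>0: "\<Lambda> j \<noteq> {}" for j using int_lattice_0 by (auto simp: \<Lambda>_def)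
  define b where "b j y = max 0 (\<eta> - infdist y (\<Lambda> j))" for j y
  have b0: "0 \<le> b j y" for j y by (simp add: b_def)
  have near: "\<exists>k\<in>int_lattice. dist y (j + k) < \<eta>" if "b j y \<noteq> 0" for j y
  proof -
    have "infdist y (\<Lambda> j) < \<eta>" using that by (auto simp: b_def max_def split: if_splits)
    then have "\<exists>a\<in>\<Lambda> j. dist y a < \<eta>"
      using \<Lambda>0[of j] by (simp add: infdist_notempty cINF_less_iff)
    then show ?thesis by (auto simp: \<Lambda>_def)
  qed
  have \<Lambda>_shift: "a + k \<in> \<Lambda> j" if "a \<in> \<Lambda> j" "k \<in> int_lattice" for a k j
    using that int_lattice_add by (force simp: \<Lambda>_def add.assoc)
  have inf_shift: "infdist (y + k) (\<Lambda> j) = infdist y (\<Lambda> j)" if k: "k \<in> int_lattice" for y k j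
  proof -
    have "(\<lambda>a. dist (y + k) a) ` \<Lambda> j = (\<lambda>a. dist y a) ` \<Lambda> j"
    proof (intro equalityI image_subsetI)
      fix a assume a: "a \<in> \<Lambda> j"
      have "dist (y + k) a = dist y (a + - k)" by (simp add: dist_norm algebra_simps)
      then show "dist (y + k) a \<in> dist y ` \<Lambda> j" using \<Lambda>_shift[OF a int_lattice_uminus[OF k]] by blast
      have "dist y a = dist (y + k) (a + k)" by simp
      then show "dist y a \<in> dist (y + k) ` \<Lambda> j" using \<Lambda>_shift[OF a k] by blast
    qed
    then show ?thesis using \<Lambda>0[of j] by (simp add: infdist_notempty)
  qed
  have b_per: "Y_periodic (b j)" for j using inf_shift by (simp add: Y_periodic_def b_def)
  have b_cont: "continuous_on UNIV (b j)" for j unfolding b_def by (intro continuous_intros)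
  define B where "B y = (\<Sum>j\<in>J. b j y)" for y
  have Bpos: "0 < B y" for y
  proof -
    have "y - vfloor y \<in> unit_cell" using vfloor_eq_iff[of y y]
      by (auto simp: half_open_cell_def unit_cell_iff less_imp_le)
    then obtain j where j: "j \<in> J" "dist j (y - vfloor y) < \<eta>" using J(2) by auto
    have "infdist y (\<Lambda> j) \<le> dist y (j + vfloor y)"
      by (rule infdist_le) (auto simp: \<Lambda>_def vfloor_in_int_lattice)
    also have "\<dots> = dist j (y - vfloor y)" by (simp add: dist_norm norm_minus_commute algebra_simps)
    finally have "0 < b j y" using j by (simp add: b_def)
    then show ?thesis unfolding B_def by (rule sum_pos2[OF J(1) j(1)]) (rule b0)
  qed
  have B_cont: "continuous_on UNIV B" unfolding B_def by (intro continuous_intros b_cont)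
  define H where "H j = Bcontfun (\<lambda>y. b j y / B y)" for j
  have le1: "b j y / B y \<le> 1" if "j \<in> J" for j y
  proof -
    have "b j y \<le> B y" unfolding B_def by (rule member_le_sum) (use that J b0 in auto)
    then show ?thesis using Bpos[of y] by simp
  qed
  have H: "apply_bcontfun (H j) y = b j y / B y" if "j \<in> J" for j y
  proof -
    have "(\<lambda>y. b j y / B y) \<in> bcontfun"
    proof (rule bcontfun_normI[of _ 1])
      have "B y \<noteq> 0" for y using Bpos[of y] by simp
      then show "continuous_on UNIV (\<lambda>y. b j y / B y)" by (intro continuous_intros b_cont B_cont) simp
      show "norm (b j y / B y) \<le> 1" for y using le1[OF that, of y] b0[of j y] Bpos[of y] by simp
    qed
    then show ?thesis by (simp add: H_def Bcontfun_inverse)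
  qed
  have B_per: "Y_periodic B" using b_per unfolding Y_periodic_def B_def by (intro ballI allI sum.cong) auto
  show ?thesis
  proof (rule that[OF J(1), of H])
    show "Y_periodic (H j)" if "j \<in> J" for j
      using b_per[of j] B_per unfolding Y_periodic_def by (simp add: H[OF that])
    show "0 \<le> H j y" if "j \<in> J" for j y using b0[of j y] Bpos[of y] by (simp add: H[OF that])
    show "(\<Sum>j\<in>J. H j y) = 1" for y
    proof -
      have "(\<Sum>j\<in>J. H j y) = (\<Sum>j\<in>J. b j y / B y)" by (rule sum.cong) (auto simp: H)
      also have "\<dots> = B y / B y" unfolding B_def by (rule sum_divide_distrib[symmetric])
      finally show ?thesis using Bpos[of y] by simp
    qed
    show "\<exists>k\<in>int_lattice. dist y (j + k) < \<eta>" if "j \<in> J" "H j y \<noteq> 0" for j y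
      using that near[of j y] by (auto simp: H)
  qed
qed

text \<open>
  Each operator replaces \<open>f\<close> by the average, with the weights of a partition of unity, of its values at
  finitely many nodes. It is a contraction, and converges by uniform continuity. It reduces
  functions with values in \<open>C\<^sub>#(Y)\<close> to sums of products.
\<close>

lemma periodic_interpolation:
  obtains J :: "nat \<Rightarrow> (real^'n) set" and H :: "nat \<Rightarrow> real^'n \<Rightarrow> (real^'n) \<Rightarrow>\<^sub>C real"
  where "\<And>m. finite (J m)" "\<And>m j. j \<in> J m \<Longrightarrow> Y_periodic (H m j)"
    "\<And>m f. norm (\<Sum>j\<in>J m. apply_bcontfun f j *\<^sub>R H m j) \<le> norm (f :: (real^'n) \<Rightarrow>\<^sub>C real)"
    "\<And>f. Y_periodic (apply_bcontfun f) \<Longrightarrow> (\<lambda>m. \<Sum>j\<in>J m. apply_bcontfun f j *\<^sub>R H m j) \<longlonglongrightarrow> f"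
proof -
  define good :: "nat \<Rightarrow> (real^'n) set \<Rightarrow> (real^'n \<Rightarrow> (real^'n) \<Rightarrow>\<^sub>C real) \<Rightarrow> bool"
    where "good m J H \<longleftrightarrow> finite J \<and> (\<forall>j\<in>J. Y_periodic (apply_bcontfun (H j))) \<and>
      (\<forall>j\<in>J. \<forall>y. 0 \<le> apply_bcontfun (H j) y) \<and> (\<forall>y. (\<Sum>j\<in>J. apply_bcontfun (H j) y) = 1) \<and>
      (\<forall>j\<in>J. \<forall>y. apply_bcontfun (H j) y \<noteq> 0 \<longrightarrow> (\<exists>k\<in>int_lattice. dist y (j + k) < 1 / real (Suc m)))" for m J H
  have "\<exists>J H. good m J H" for m
  proof -
    have "0 < 1 / real (Suc m)" by simp
    then obtain J :: "(real^'n) set" and H :: "real^'n \<Rightarrow> (real^'n) \<Rightarrow>\<^sub>C real"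
      where "finite J" "\<And>j. j \<in> J \<Longrightarrow> Y_periodic (H j)" "\<And>j y. j \<in> J \<Longrightarrow> 0 \<le> H j y" "\<And>y. (\<Sum>j\<in>J. H j y) = 1"
        "\<And>j y. j \<in> J \<Longrightarrow> H j y \<noteq> 0 \<Longrightarrow> \<exists>k\<in>int_lattice. dist y (j + k) < 1 / real (Suc m)"
      by (rule periodic_partition_of_unity) blast
    then show ?thesis unfolding good_def by (intro exI[of _ J] exI[of _ H]) auto
  qed
  then obtain J H where "\<And>m. good m (J m) (H m)" by metis
  then have fin: "finite (J m)" and per: "j \<in> J m \<Longrightarrow> Y_periodic (apply_bcontfun (H m j))"
    and pos: "j \<in> J m \<Longrightarrow> 0 \<le> apply_bcontfun (H m j) y" and sum1: "(\<Sum>j\<in>J m. apply_bcontfun (H m j) y) = 1"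
    and near: "j \<in> J m \<Longrightarrow> apply_bcontfun (H m j) y \<noteq> 0 \<Longrightarrow> \<exists>k\<in>int_lattice. dist y (j + k) < 1 / real (Suc m)"
    for m j y unfolding good_def by blast+
  have app: "apply_bcontfun (\<Sum>j\<in>A. g j *\<^sub>R G j) y = (\<Sum>j\<in>A. g j * apply_bcontfun (G j) y)"
    if "finite A" for A :: "(real^'n) set" and g :: "real^'n \<Rightarrow> real" and G :: "real^'n \<Rightarrow> (real^'n) \<Rightarrow>\<^sub>C real" and y
    using that by (induction A rule: finite_induct) (auto simp: plus_bcontfun.rep_eq scaleR_bcontfun.rep_eq zero_bcontfun.rep_eq)
  show ?thesis
  proof (rule that[of J H])
    show "finite (J m)" for m by (rule fin)
    show "Y_periodic (H m j)" if "j \<in> J m" for m j by (rule per[OF that])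
    show "norm (\<Sum>j\<in>J m. apply_bcontfun f j *\<^sub>R H m j) \<le> norm f" for m and f :: "(real^'n) \<Rightarrow>\<^sub>C real"
    proof (rule norm_bound)
      fix y
      have "norm (apply_bcontfun (\<Sum>j\<in>J m. apply_bcontfun f j *\<^sub>R H m j) y) \<le> (\<Sum>j\<in>J m. \<bar>apply_bcontfun f j\<bar> * apply_bcontfun (H m j) y)"
        unfolding app[OF fin] real_norm_def
        by (rule order_trans[OF sum_abs]) (auto intro!: sum_mono simp: abs_mult pos)
      also have "\<dots> \<le> (\<Sum>j\<in>J m. norm f * apply_bcontfun (H m j) y)"
        using norm_bounded[of f] by (intro sum_mono mult_right_mono) (auto simp: pos)
      also have "\<dots> = norm f" using sum1[of m y] by (simp add: sum_distrib_left[symmetric])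
      finally show "norm (apply_bcontfun (\<Sum>j\<in>J m. apply_bcontfun f j *\<^sub>R H m j) y) \<le> norm f" .
    qed
    show "(\<lambda>m. \<Sum>j\<in>J m. apply_bcontfun f j *\<^sub>R H m j) \<longlonglongrightarrow> f" if f: "Y_periodic (apply_bcontfun f)" for f :: "(real^'n) \<Rightarrow>\<^sub>C real"
    proof (rule tendstoI)
      fix e :: real assume "e > 0"
      then have "e / 2 > 0" by simp
      obtain \<eta> where \<eta>: "\<eta> > 0" "\<And>x y. dist x y < \<eta> \<Longrightarrow> \<bar>apply_bcontfun f x - apply_bcontfun f y\<bar> < e / 2"
        by (rule Y_periodic_uniformly_continuous[OF f _ \<open>e / 2 > 0\<close>]) auto
      have "eventually (\<lambda>m. 1 / real (Suc m) < \<eta>) sequentially"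
        using order_tendstoD(2)[OF LIMSEQ_inverse_real_of_nat \<eta>(1)] by (simp add: inverse_eq_divide)
      then show "eventually (\<lambda>m. dist (\<Sum>j\<in>J m. apply_bcontfun f j *\<^sub>R H m j) f < e) sequentially"
      proof eventually_elim
        case (elim m)
        have "dist (\<Sum>j\<in>J m. apply_bcontfun f j *\<^sub>R H m j) f \<le> e / 2"
        proof (rule dist_bound)
          fix y
          have "(\<Sum>j\<in>J m. apply_bcontfun f j * apply_bcontfun (H m j) y) - apply_bcontfun f y
              = (\<Sum>j\<in>J m. (apply_bcontfun f j - apply_bcontfun f y) * apply_bcontfun (H m j) y)"
            using sum1[of m y] by (simp add: left_diff_distrib sum_subtractf sum_distrib_left[symmetric])
          also have "\<bar>\<dots>\<bar> \<le> (\<Sum>j\<in>J m. \<bar>apply_bcontfun f j - apply_bcontfun f y\<bar> * apply_bcontfun (H m j) y)"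
            by (rule order_trans[OF sum_abs]) (auto intro!: sum_mono simp: abs_mult pos)
          also have "\<dots> \<le> (\<Sum>j\<in>J m. e / 2 * apply_bcontfun (H m j) y)"
          proof (rule sum_mono)
            fix j assume j: "j \<in> J m"
            show "\<bar>apply_bcontfun f j - apply_bcontfun f y\<bar> * apply_bcontfun (H m j) y \<le> e / 2 * apply_bcontfun (H m j) y"
            proof (cases "apply_bcontfun (H m j) y = 0")
              case False
              then obtain k where k: "k \<in> int_lattice" "dist y (j + k) < 1 / real (Suc m)" using near[OF j] by blast
              have "apply_bcontfun f (j + k) = apply_bcontfun f j" using f k(1) by (simp add: Y_periodic_def)
              moreover have "\<bar>apply_bcontfun f (j + k) - apply_bcontfun f y\<bar> < e / 2"
                using k(2) elim by (intro \<eta>(2)) (simp add: dist_commute)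
              ultimately show ?thesis using pos[OF j, of y] by (intro mult_right_mono) auto
            qed simp
          qed
          also have "\<dots> = e / 2" unfolding sum_distrib_left[symmetric] sum1 by simp
          finally show "dist (apply_bcontfun (\<Sum>j\<in>J m. apply_bcontfun f j *\<^sub>R H m j) y) (apply_bcontfun f y) \<le> e / 2"
            by (simp add: app[OF fin] dist_real_def)
        qed
        then show ?case using \<open>e > 0\<close> by simp
      qed
    qed
  qed
qed

text \<open>
  The scaling parameter makes the term with the bounded sequence small before the approximation error
  of the test function is chosen.
\<close>

lemma scaled_Young_bound:
  fixes s t p q d :: real
  assumes "1 < p" "1 < q" "1/p + 1/q = 1" "0 < d"
  shows "\<bar>t * s\<bar> \<le> d powr p * \<bar>s\<bar> powr p + d powr (- q) * \<bar>t\<bar> powr q"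
proof -
  have "(d * \<bar>s\<bar>) * (inverse d * \<bar>t\<bar>) \<le> (d * \<bar>s\<bar>) powr p / p + (inverse d * \<bar>t\<bar>) powr q / q"
    by (rule Youngs_inequality) (use assms in auto)
  also have "\<dots> \<le> (d * \<bar>s\<bar>) powr p / 1 + (inverse d * \<bar>t\<bar>) powr q / 1"
    using assms by (intro add_mono divide_left_mono) auto
  also have "\<dots> = d powr p * \<bar>s\<bar> powr p + d powr (- q) * \<bar>t\<bar> powr q"
    using assms by (simp add: powr_mult powr_minus inverse_powr)
  finally show ?thesis using assms by (simp add: abs_mult mult.commute field_simps)
qed

text \<open>
  A sequence that is bounded in \<open>L\<^sup>p\<close> and whose unfolded functions converge weakly. The bound \<open>C\<close> is
  also a bound for the limit, so that sequence and limit obey the same estimate.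
\<close>

locale unfolded_limit =
  fixes \<epsilon> :: "nat \<Rightarrow> real" and U K :: "(real^'n) set" and p q C :: real
    and f :: "nat \<Rightarrow> real^'n \<Rightarrow> real" and b :: "(real^'n) \<times> (real^'n) \<Rightarrow> real"
  assumes \<epsilon>: "\<And>n. 0 < \<epsilon> n" "\<epsilon> \<longlonglongrightarrow> 0"
    and U: "open U" "bounded U" and K: "K \<in> sets borel" "bounded K" "U \<subseteq> K"
    and supp: "\<And>n z. snd z \<in> unit_cell \<Longrightarrow> unfold_map (\<epsilon> n) z \<in> U \<Longrightarrow> fst z \<in> K"
    and pq: "1 < p" "1 < q" "1/p + 1/q = 1"
    and f: "\<And>n. f n \<in> borel_measurable borel" and f0: "\<And>n x. x \<notin> U \<Longrightarrow> f n x = 0"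
    and fi: "\<And>n. integrable lborel (\<lambda>x. \<bar>f n x\<bar> powr p)" and fC: "\<And>n. (LINT x|lborel. \<bar>f n x\<bar> powr p) \<le> C"
    and b: "b \<in> borel_measurable borel" and b0: "\<And>z. z \<notin> U \<times> unit_cell \<Longrightarrow> b z = 0"
    and bi: "integrable (slab_measure K) (\<lambda>z. \<bar>b z\<bar> powr p)" and bC: "(LINT z|slab_measure K. \<bar>b z\<bar> powr p) \<le> C"
    and weak: "weakly_tendsto (slab_measure K) (\<lambda>n z. f n (unfold_map (\<epsilon> n) z)) b"
begin

text \<open>
  The norm of \<open>\<Phi>\<close> in \<open>L\<^sup>q(U; L\<^sup>\<infinity>)\<close> is bounded by the norm of \<open>N\<close> in \<open>L\<^sup>q\<close>. The supremum over all
  \<open>y\<close> is essential, as \<open>\<Phi>\<close> is evaluated on the null set \<open>{(x, x/\<epsilon>)}\<close>.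
\<close>

definition dominates :: "(real^'n \<Rightarrow> real) \<Rightarrow> ((real^'n) \<times> (real^'n) \<Rightarrow> real) \<Rightarrow> bool" where
  "dominates N \<Phi> \<longleftrightarrow> \<Phi> \<in> borel_measurable borel \<and> N \<in> borel_measurable borel \<and> (\<forall>x. 0 \<le> N x) \<and>
     integrable lborel (\<lambda>x. N x powr q) \<and> (AE x in lborel. x \<in> U \<longrightarrow> (\<forall>y. \<bar>\<Phi> (x, y)\<bar> \<le> N x))"

definition pairing_converges :: "((real^'n) \<times> (real^'n) \<Rightarrow> real) \<Rightarrow> bool" where
  "pairing_converges \<Phi> \<longleftrightarrow>
     (\<lambda>n. LINT x|lborel. \<Phi> (x, x /\<^sub>R \<epsilon> n) * f n x) \<longlonglongrightarrow> (LINT z|slab_measure K. \<Phi> z * b z)"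

lemma C_nonneg: "0 \<le> C"
  using order_trans[OF integral_nonneg_AE fC[of 0]] by simp

lemma measurable_diagonal:
  fixes \<Phi> :: "(real^'n) \<times> (real^'n) \<Rightarrow> real"
  assumes "\<Phi> \<in> borel_measurable borel"
  shows "(\<lambda>x. \<Phi> (x, x /\<^sub>R \<epsilon> n)) \<in> borel_measurable borel"
  by (rule measurable_compose[OF _ assms]) (auto intro!: borel_measurable_continuous_onI continuous_intros)

lemma sequence_pairing_bound:
  assumes D: "dominates N \<Phi>" and d: "0 < d"
  shows "integrable lborel (\<lambda>x. \<Phi> (x, x /\<^sub>R \<epsilon> n) * f n x)"
    and "\<bar>LINT x|lborel. \<Phi> (x, x /\<^sub>R \<epsilon> n) * f n x\<bar> \<le> d powr p * C + d powr (- q) * (LINT x|lborel. N x powr q)"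
proof -
  note [measurable] = measurable_diagonal[of \<Phi>] f[of n]
  have [measurable]: "\<Phi> \<in> borel_measurable borel" "N \<in> borel_measurable borel" and Ni: "integrable lborel (\<lambda>x. N x powr q)"
    and N0: "\<And>x. 0 \<le> N x" and ae: "AE x in lborel. x \<in> U \<longrightarrow> (\<forall>y. \<bar>\<Phi> (x, y)\<bar> \<le> N x)"
    using D by (auto simp: dominates_def)
  have bound: "AE x in lborel. \<bar>\<Phi> (x, x /\<^sub>R \<epsilon> n) * f n x\<bar> \<le> d powr p * \<bar>f n x\<bar> powr p + d powr (- q) * N x powr q"
    using ae
  proof eventually_elim
    case (elim x)
    show ?case
    proof (cases "x \<in> U")
      case True
      then have "\<bar>\<Phi> (x, x /\<^sub>R \<epsilon> n) * f n x\<bar> \<le> \<bar>N x * f n x\<bar>"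
        using elim N0[of x] by (auto simp: abs_mult intro!: mult_right_mono)
      also have "\<dots> \<le> d powr p * \<bar>f n x\<bar> powr p + d powr (- q) * \<bar>N x\<bar> powr q"
        by (rule scaled_Young_bound[OF pq d])
      finally show ?thesis using N0[of x] by simp
    qed (simp add: f0)
  qed
  have i: "integrable lborel (\<lambda>x. d powr p * \<bar>f n x\<bar> powr p + d powr (- q) * N x powr q)"
    using fi[of n] Ni by simp
  show int: "integrable lborel (\<lambda>x. \<Phi> (x, x /\<^sub>R \<epsilon> n) * f n x)"
    by (rule Bochner_Integration.integrable_bound[OF i]) (use bound in \<open>auto elim!: eventually_mono\<close>)
  have "\<bar>LINT x|lborel. \<Phi> (x, x /\<^sub>R \<epsilon> n) * f n x\<bar> \<le> (LINT x|lborel. \<bar>\<Phi> (x, x /\<^sub>R \<epsilon> n) * f n x\<bar>)"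
    by (rule integral_abs_bound)
  also have "\<dots> \<le> (LINT x|lborel. d powr p * \<bar>f n x\<bar> powr p + d powr (- q) * N x powr q)"
    by (rule integral_mono_AE[OF integrable_abs[OF int] i bound])
  also have "\<dots> = d powr p * (LINT x|lborel. \<bar>f n x\<bar> powr p) + d powr (- q) * (LINT x|lborel. N x powr q)"
    using fi[of n] Ni by simp
  also have "\<dots> \<le> d powr p * C + d powr (- q) * (LINT x|lborel. N x powr q)"
    using fC[of n] by (intro add_right_mono mult_left_mono) auto
  finally show "\<bar>LINT x|lborel. \<Phi> (x, x /\<^sub>R \<epsilon> n) * f n x\<bar> \<le> d powr p * C + d powr (- q) * (LINT x|lborel. N x powr q)" .
qed

lemma limit_pairing_bound:
  assumes D: "dominates N \<Phi>" and d: "0 < d"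
  shows "integrable (slab_measure K) (\<lambda>z. \<Phi> z * b z)"
    and "\<bar>LINT z|slab_measure K. \<Phi> z * b z\<bar> \<le> d powr p * C + d powr (- q) * (LINT x|lborel. N x powr q)"
proof -
  let ?M = "slab_measure K"
  note [measurable] = b K(1)
  have [measurable]: "\<Phi> \<in> borel_measurable borel" and Nm[measurable]: "N \<in> borel_measurable borel" and Ni: "integrable lborel (\<lambda>x. N x powr q)"
    and N0: "\<And>x. 0 \<le> N x" and ae: "AE x in lborel. x \<in> U \<longrightarrow> (\<forall>y. \<bar>\<Phi> (x, y)\<bar> \<le> N x)"
    using D by (auto simp: dominates_def)
  have bound: "AE z in ?M. \<bar>\<Phi> z * b z\<bar> \<le> d powr p * \<bar>b z\<bar> powr p + d powr (- q) * N (fst z) powr q"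
    using AE_slab_fst[OF ae K(1)]
  proof eventually_elim
    case (elim z)
    show ?case
    proof (cases "fst z \<in> U")
      case True
      then have "\<bar>\<Phi> z\<bar> \<le> N (fst z)" using elim by (metis prod.collapse)
      then have "\<bar>\<Phi> z * b z\<bar> \<le> \<bar>N (fst z) * b z\<bar>"
        using N0[of "fst z"] by (auto simp: abs_mult intro!: mult_right_mono)
      also have "\<dots> \<le> d powr p * \<bar>b z\<bar> powr p + d powr (- q) * \<bar>N (fst z)\<bar> powr q"
        by (rule scaled_Young_bound[OF pq d])
      finally show ?thesis using N0[of "fst z"] by simp
    next
      case False
      then have "b z = 0" by (intro b0) auto
      then show ?thesis by simp
    qed
  qed
  have Nf: "(\<lambda>z :: (real^'n) \<times> (real^'n). N (fst z) powr q) \<in> borel_measurable borel"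
  proof -
    have [measurable]: "(\<lambda>z :: (real^'n) \<times> (real^'n). N (fst z)) \<in> borel_measurable borel"
      by (intro measurable_compose[OF _ Nm] borel_measurable_continuous_onI continuous_intros)
    show ?thesis by measurable
  qed
  have le: "(\<integral>\<^sup>+z. ennreal (N (fst z) powr q) \<partial>?M) \<le> ennreal (LINT x|lborel. N x powr q)"
  proof -
    have "(\<integral>\<^sup>+z. ennreal (N (fst z) powr q) \<partial>?M) = (\<integral>\<^sup>+x. indicator K x * ennreal (N x powr q) \<partial>lborel)"
      by (rule nn_integral_slab_fst) auto
    also have "\<dots> \<le> (\<integral>\<^sup>+x. ennreal (N x powr q) \<partial>lborel)"
      by (rule nn_integral_mono) (auto simp: indicator_def)
    also have "\<dots> = ennreal (LINT x|lborel. N x powr q)" by (rule nn_integral_eq_integral[OF Ni]) simp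
    finally show ?thesis .
  qed
  have Nfi: "integrable ?M (\<lambda>z. N (fst z) powr q)"
    by (rule integrableI_bounded) (use Nf le in \<open>auto intro: le_less_trans\<close>)
  have "ennreal (LINT z|?M. N (fst z) powr q) = (\<integral>\<^sup>+z. ennreal (N (fst z) powr q) \<partial>?M)"
    by (rule nn_integral_eq_integral[OF Nfi, symmetric]) simp
  then have Nle: "(LINT z|?M. N (fst z) powr q) \<le> (LINT x|lborel. N x powr q)"
  proof -
    assume "ennreal (LINT z|?M. N (fst z) powr q) = (\<integral>\<^sup>+z. ennreal (N (fst z) powr q) \<partial>?M)"
    then have "ennreal (LINT z|?M. N (fst z) powr q) \<le> ennreal (LINT x|lborel. N x powr q)" using le by simp
    then show ?thesis by (subst (asm) ennreal_le_iff) simp_all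
  qed
  have i: "integrable ?M (\<lambda>z. d powr p * \<bar>b z\<bar> powr p + d powr (- q) * N (fst z) powr q)"
    using bi Nfi by simp
  show int: "integrable ?M (\<lambda>z. \<Phi> z * b z)"
    by (rule Bochner_Integration.integrable_bound[OF i]) (use bound in \<open>auto elim!: eventually_mono\<close>)
  have "\<bar>LINT z|?M. \<Phi> z * b z\<bar> \<le> (LINT z|?M. \<bar>\<Phi> z * b z\<bar>)" by (rule integral_abs_bound)
  also have "\<dots> \<le> (LINT z|?M. d powr p * \<bar>b z\<bar> powr p + d powr (- q) * N (fst z) powr q)"
    by (rule integral_mono_AE[OF integrable_abs[OF int] i bound])
  also have "\<dots> = d powr p * (LINT z|?M. \<bar>b z\<bar> powr p) + d powr (- q) * (LINT z|?M. N (fst z) powr q)"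
    using bi Nfi by simp
  also have "\<dots> \<le> d powr p * C + d powr (- q) * (LINT x|lborel. N x powr q)"
    using bC Nle by (intro add_mono mult_left_mono) auto
  finally show "\<bar>LINT z|?M. \<Phi> z * b z\<bar> \<le> d powr p * C + d powr (- q) * (LINT x|lborel. N x powr q)" .
qed

text \<open>
  Both pairings depend continuously on the test function, uniformly in \<open>n\<close>.
\<close>

lemma pairing_converges_closure:
  assumes D: "dominates N \<Phi>"
    and approx: "\<And>\<eta>. \<eta> > 0 \<Longrightarrow> \<exists>\<Phi>' N' E. pairing_converges \<Phi>' \<and> dominates N' \<Phi>' \<and>
      dominates E (\<lambda>z. \<Phi> z - \<Phi>' z) \<and> (LINT x|lborel. E x powr q) \<le> \<eta>"
  shows "pairing_converges \<Phi>"
  unfolding pairing_converges_def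
proof (rule tendstoI)
  fix e :: real assume e: "e > 0"
  \<comment> \<open>With this scaling the term with \<open>C\<close> is at most \<open>e / 6\<close>; then \<open>\<eta>\<close> does the same for the term with \<open>E\<close>.\<close>
  define d where "d = (e / (6 * (C + 1))) powr (1 / p)"
  have d: "d > 0" using e C_nonneg by (simp add: d_def)
  have "d powr p = e / (6 * (C + 1))" using e C_nonneg pq(1) by (simp add: d_def powr_powr)
  then have "6 * (d powr p * C) + 6 * d powr p = e" using e C_nonneg by (simp add: field_simps)
  then have dp: "d powr p * C \<le> e / 6" using powr_ge_zero[of d p] by linarith
  define \<eta> where "\<eta> = d powr q * (e / 6)"
  have "\<eta> > 0" using d e by (simp add: \<eta>_def)
  then obtain \<Phi>' N' E where conv: "pairing_converges \<Phi>'" and D': "dominates N' \<Phi>'"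
    and DE: "dominates E (\<lambda>z. \<Phi> z - \<Phi>' z)" and E: "(LINT x|lborel. E x powr q) \<le> \<eta>"
    using approx by blast
  have "d powr (- q) * (LINT x|lborel. E x powr q) \<le> d powr (- q) * \<eta>"
    using E by (intro mult_left_mono) auto
  also have "\<dots> = e / 6" using d by (simp add: \<eta>_def powr_minus)
  finally have dq: "d powr p * C + d powr (- q) * (LINT x|lborel. E x powr q) \<le> e / 3" using dp by simp
  have c1: "\<bar>(LINT x|lborel. \<Phi> (x, x /\<^sub>R \<epsilon> n) * f n x) - (LINT x|lborel. \<Phi>' (x, x /\<^sub>R \<epsilon> n) * f n x)\<bar> \<le> e / 3" for n
    using sequence_pairing_bound(2)[OF DE d, of n] dq sequence_pairing_bound(1)[OF D d, of n] sequence_pairing_bound(1)[OF D' d, of n]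
    by (simp add: left_diff_distrib)
  have c2: "\<bar>(LINT z|slab_measure K. \<Phi> z * b z) - (LINT z|slab_measure K. \<Phi>' z * b z)\<bar> \<le> e / 3"
    using limit_pairing_bound(2)[OF DE d] dq limit_pairing_bound(1)[OF D d] limit_pairing_bound(1)[OF D' d]
    by (simp add: left_diff_distrib)
  have "eventually (\<lambda>n. dist (LINT x|lborel. \<Phi>' (x, x /\<^sub>R \<epsilon> n) * f n x) (LINT z|slab_measure K. \<Phi>' z * b z) < e / 3) sequentially"
    using conv e unfolding pairing_converges_def by (intro tendstoD) auto
  then show "eventually (\<lambda>n. dist (LINT x|lborel. \<Phi> (x, x /\<^sub>R \<epsilon> n) * f n x) (LINT z|slab_measure K. \<Phi> z * b z) < e) sequentially"
  proof eventually_elim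
    case (elim n)
    then show ?case using c1[of n] c2 unfolding dist_real_def by linarith
  qed
qed

lemma pairing_converges_sum:
  assumes "finite J" "\<And>j. j \<in> J \<Longrightarrow> pairing_converges (\<Phi> j)" "\<And>j. j \<in> J \<Longrightarrow> \<exists>N. dominates N (\<Phi> j)"
  shows "pairing_converges (\<lambda>z. \<Sum>j\<in>J. \<Phi> j z)"
proof -
  have i: "integrable lborel (\<lambda>x. \<Phi> j (x, x /\<^sub>R \<epsilon> n) * f n x)" "integrable (slab_measure K) (\<lambda>z. \<Phi> j z * b z)" if "j \<in> J" for j n
    using assms(3)[OF that] sequence_pairing_bound(1)[OF _ zero_less_one] limit_pairing_bound(1)[OF _ zero_less_one] by blast+
  have "(LINT x|lborel. (\<Sum>j\<in>J. \<Phi> j (x, x /\<^sub>R \<epsilon> n)) * f n x) = (\<Sum>j\<in>J. LINT x|lborel. \<Phi> j (x, x /\<^sub>R \<epsilon> n) * f n x)" for n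
    unfolding sum_distrib_right by (rule Bochner_Integration.integral_sum) (rule i)
  moreover have "(LINT z|slab_measure K. (\<Sum>j\<in>J. \<Phi> j z) * b z) = (\<Sum>j\<in>J. LINT z|slab_measure K. \<Phi> j z * b z)"
    unfolding sum_distrib_right by (rule Bochner_Integration.integral_sum) (rule i)
  ultimately show ?thesis
    using assms(2) unfolding pairing_converges_def by (simp add: tendsto_sum)
qed

text \<open>
  For continuous products, unfolding the pairing and the weak convergence of the unfolded
  sequence give the limit directly.
\<close>

lemma pairing_converges_continuous:
  fixes g :: "real^'n \<Rightarrow> real" and h :: "(real^'n) \<Rightarrow>\<^sub>C real"
  assumes g: "continuous_on UNIV g" and M: "\<And>x. \<bar>g x\<bar> \<le> M" and h: "Y_periodic (apply_bcontfun h)"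
  shows "pairing_converges (\<lambda>z. g (fst z) * apply_bcontfun h (snd z))"
proof -
  define F where "F z = g (fst z) * apply_bcontfun h (snd z)" for z :: "(real^'n) \<times> (real^'n)"
  have F: "continuous_on UNIV F"
    unfolding F_def by (intro continuous_intros continuous_on_compose2[OF g] continuous_on_compose2[OF continuous_on_apply_bcontfun]) auto
  have Fm: "F \<in> borel_measurable borel" by (rule borel_measurable_continuous_onI[OF F])
  have M0: "0 \<le> M" using order_trans[OF abs_ge_zero M] .
  have B: "\<bar>F z\<bar> \<le> M * norm h" for z
    unfolding F_def abs_mult using M norm_bounded[of h] M0 by (intro mult_mono) auto
  have fin: "emeasure lborel U < \<infinity>" using U(2) by (rule emeasure_bounded_finite)
  have Um[measurable]: "U \<in> sets borel" using U(1) by simp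
  note [measurable] = f
  have bound: "\<bar>f n x\<bar> \<le> indicator U x + \<bar>f n x\<bar> powr p" for n x
    using powr_split_bound[of "\<bar>f n x\<bar>" 1 p] pq(1) f0[of x n] by (cases "x \<in> U") auto
  have Ui: "integrable lborel (indicator U :: _ \<Rightarrow> real)" using fin by simp
  have i: "integrable lborel (\<lambda>x. indicator U x + \<bar>f n x\<bar> powr p)" for n
    using Ui fi[of n] by (rule Bochner_Integration.integrable_add)
  have fint: "integrable lborel (f n)" for n
    by (rule Bochner_Integration.integrable_bound[OF i[of n]]) (use bound[of n] in \<open>auto intro!: AE_I2 order_trans[OF bound]\<close>)
  have d0: "(\<lambda>n. (LINT x|lborel. f n x * F (x, x /\<^sub>R \<epsilon> n)) - (LINT z|slab_measure K. f n (unfold_map (\<epsilon> n) z) * F z)) \<longlonglongrightarrow> 0"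
  proof (rule unfolded_pairing_tendsto[OF \<epsilon> K(1,2) f fint])
    show "(LINT x|lborel. \<bar>f n x\<bar>) \<le> measure lborel U + C" for n
    proof -
      have "(LINT x|lborel. \<bar>f n x\<bar>) \<le> (LINT x|lborel. indicator U x + \<bar>f n x\<bar> powr p)"
        by (rule integral_mono[OF integrable_abs[OF fint] i bound])
      also have "\<dots> = measure lborel U + (LINT x|lborel. \<bar>f n x\<bar> powr p)"
        using Ui fi[of n] by simp
      finally show ?thesis using fC[of n] by simp
    qed
    show "fst z \<in> K" if "snd z \<in> unit_cell" "f n (unfold_map (\<epsilon> n) z) \<noteq> 0" for n z
      using supp[OF that(1), of n] f0[of "unfold_map (\<epsilon> n) z" n] that(2) by blast
    show "Y_periodic (\<lambda>y. F (x, y))" for x using h by (simp add: F_def Y_periodic_def)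
  qed (rule F, rule B)
  have lw: "(\<lambda>n. LINT z|slab_measure K. F z * f n (unfold_map (\<epsilon> n) z)) \<longlonglongrightarrow> (LINT z|slab_measure K. F z * b z)"
    by (rule weakly_tendstoD[OF weak _ B]) (use Fm in simp)
  have "(\<lambda>n. LINT x|lborel. F (x, x /\<^sub>R \<epsilon> n) * f n x) \<longlonglongrightarrow> (LINT z|slab_measure K. F z * b z)"
    using tendsto_add[OF d0 lw] by (simp add: mult.commute[of "F _"])
  then show ?thesis by (simp add: pairing_converges_def F_def)
qed

lemma dominates_product:
  fixes g E :: "real^'n \<Rightarrow> real" and h :: "(real^'n) \<Rightarrow>\<^sub>C real"
  assumes g[measurable]: "g \<in> borel_measurable borel" and M: "\<And>x. x \<in> U \<Longrightarrow> \<bar>g x\<bar> \<le> M" and E[measurable]: "E \<in> borel_measurable borel"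
    and E0: "\<And>x. 0 \<le> E x \<and> E x \<le> M * norm h * indicator U x" and gE: "AE x in lborel. x \<in> U \<longrightarrow> \<bar>g x\<bar> * norm h \<le> E x"
  shows "dominates E (\<lambda>z. g (fst z) * apply_bcontfun h (snd z))"
  unfolding dominates_def
proof (intro conjI allI)
  have hm: "apply_bcontfun h \<in> borel_measurable borel" by (intro borel_measurable_continuous_onI) simp
  show "(\<lambda>z. g (fst z) * apply_bcontfun h (snd z)) \<in> borel_measurable borel"
    by (intro borel_measurable_times measurable_compose[OF _ g] measurable_compose[OF _ hm] borel_measurable_continuous_onI continuous_intros)
  show "E \<in> borel_measurable borel" by fact
  show "0 \<le> E x" for x using E0 by blast
  have Um: "U \<in> sets lborel" using U(1) by simp
  have fin: "emeasure lborel U < \<infinity>" using U(2) by (rule emeasure_bounded_finite)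
  show "integrable lborel (\<lambda>x. E x powr q)"
  proof (rule integrableI_bounded_set[OF Um _ fin])
    show "AE x in lborel. x \<in> U \<longrightarrow> norm (E x powr q) \<le> (M * norm h) powr q"
    proof (intro AE_I2 impI)
      fix x assume "x \<in> U"
      then have "0 \<le> E x" "E x \<le> M * norm h" using E0[of x] by auto
      then show "norm (E x powr q) \<le> (M * norm h) powr q" using pq(2) by (auto intro!: powr_mono2)
    qed
    show "AE x in lborel. x \<notin> U \<longrightarrow> E x powr q = 0"
    proof (intro AE_I2 impI)
      fix x assume "x \<notin> U"
      then have "E x = 0" using E0[of x] by simp
      then show "E x powr q = 0" by simp
    qed
  qed measurable
  show "AE x in lborel. x \<in> U \<longrightarrow> (\<forall>y. \<bar>g (fst (x, y)) * apply_bcontfun h (snd (x, y))\<bar> \<le> E x)"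
    using gE
  proof eventually_elim
    case (elim x)
    show ?case
    proof (intro impI allI)
      fix y assume "x \<in> U"
      have "\<bar>g x * apply_bcontfun h y\<bar> \<le> \<bar>g x\<bar> * norm h"
        unfolding abs_mult using norm_bounded[of h y] by (intro mult_left_mono) auto
      then show "\<bar>g (fst (x, y)) * apply_bcontfun h (snd (x, y))\<bar> \<le> E x" using elim \<open>x \<in> U\<close> by simp
    qed
  qed
qed

lemma dominates_bounded_product:
  fixes g :: "real^'n \<Rightarrow> real" and h :: "(real^'n) \<Rightarrow>\<^sub>C real"
  assumes g: "g \<in> borel_measurable borel" and M: "\<And>x. \<bar>g x\<bar> \<le> M"
  shows "dominates (\<lambda>x. M * norm h * indicator U x) (\<lambda>z. g (fst z) * apply_bcontfun h (snd z))"
proof (rule dominates_product[OF g M])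
  have M0: "0 \<le> M" using order_trans[OF abs_ge_zero M] .
  show "(\<lambda>x. M * norm h * indicator U x) \<in> borel_measurable borel"
    using U(1) by (intro borel_measurable_times borel_measurable_indicator) auto
  show "0 \<le> M * norm h * indicator U x \<and> M * norm h * indicator U x \<le> M * norm h * indicator U x" for x
    using M0 by simp
  show "AE x in lborel. x \<in> U \<longrightarrow> \<bar>g x\<bar> * norm h \<le> M * norm h * indicator U x"
    using M by (intro AE_I2) (auto intro!: mult_right_mono)
qed

text \<open>
  A bounded measurable factor is an almost everywhere limit of continuous functions, which may be
  truncated to the same bound, so that dominated convergence applies.
\<close>

lemma pairing_converges_product:
  fixes a :: "real^'n \<Rightarrow> real" and h :: "(real^'n) \<Rightarrow>\<^sub>C real"
  assumes a[measurable]: "a \<in> borel_measurable borel" and M: "\<And>x. \<bar>a x\<bar> \<le> M" and h: "Y_periodic (apply_bcontfun h)"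
  shows "pairing_converges (\<lambda>z. a (fst z) * apply_bcontfun h (snd z))"
proof (rule pairing_converges_closure[OF dominates_bounded_product[OF a M]])
  fix \<eta> :: real assume \<eta>: "\<eta> > 0"
  have M0: "0 \<le> M" using order_trans[OF abs_ge_zero M] .
  have Um[measurable]: "U \<in> sets borel" using U(1) by simp
  have fin: "emeasure lborel U < \<infinity>" using U(2) by (rule emeasure_bounded_finite)
  have "a \<in> borel_measurable (lebesgue_on U)"
    by (intro measurable_restrict_space1 measurable_completion) simp
  then have "a measurable_on U" using Um by (simp add: measurable_on_iff_borel_measurable)
  then obtain N g where N: "negligible N" and g: "\<And>k :: nat. continuous_on UNIV (g k)"
    and lim: "\<And>x. x \<notin> N \<Longrightarrow> (\<lambda>k. g k x) \<longlonglongrightarrow> (if x \<in> U then a x else 0)"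
    unfolding measurable_on_def by blast
  have "N \<in> null_sets lebesgue" using N by (simp add: negligible_iff_null_sets)
  then have "AE x in lebesgue. x \<notin> N" by (rule AE_not_in)
  then have aeN: "AE x in lborel. x \<notin> N" by (simp only: AE_completion_iff)
  define c where "c k x = max (- M) (min M (g k x))" for k x
  have c_cont: "continuous_on UNIV (c k)" for k unfolding c_def by (intro continuous_intros g)
  have c_meas[measurable]: "c k \<in> borel_measurable borel" for k by (rule borel_measurable_continuous_onI[OF c_cont])
  have cM: "\<bar>c k x\<bar> \<le> M" for k x using M0 by (auto simp: c_def)
  define E where "E k x = \<bar>a x - c k x\<bar> * norm h * indicator U x" for k x
  have E_meas[measurable]: "E k \<in> borel_measurable borel" for k unfolding E_def by measurable
  have ac: "\<bar>a x - c k x\<bar> \<le> 2 * M" for k x using M[of x] cM[of k x] by linarith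
  have E0: "0 \<le> E k x \<and> E k x \<le> 2 * M * norm h * indicator U x" for k x
    unfolding E_def using ac[of x k] by (auto simp: indicator_def intro!: mult_right_mono)
  have DE: "dominates (E k) (\<lambda>z. (a (fst z) - c k (fst z)) * apply_bcontfun h (snd z))" for k
    by (rule dominates_product[where g = "\<lambda>x. a x - c k x" and M = "2 * M"]) (use E0 ac in \<open>auto simp: E_def\<close>)
  have "(\<lambda>k. LINT x|lborel. E k x powr q) \<longlonglongrightarrow> (LINT x|(lborel :: (real^'n) measure). (0::real))"
  proof (rule integral_dominated_convergence[where w = "\<lambda>x. (2 * M * norm h) powr q * indicator U x"])
    show "AE x in lborel. (\<lambda>k. E k x powr q) \<longlonglongrightarrow> 0"
      using aeN
    proof eventually_elim
      case (elim x)
      show ?case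
      proof (cases "x \<in> U")
        case True
        have "(\<lambda>k. c k x) \<longlonglongrightarrow> max (- M) (min M (a x))"
          unfolding c_def using lim[OF elim] True by (intro tendsto_max tendsto_min tendsto_const) auto
        also have "max (- M) (min M (a x)) = a x" using M[of x] by auto
        finally have "(\<lambda>k. \<bar>a x - c k x\<bar> * norm h * indicator U x) \<longlonglongrightarrow> \<bar>a x - a x\<bar> * norm h * indicator U x"
          by (intro tendsto_intros)
        then have "(\<lambda>k. E k x) \<longlonglongrightarrow> 0" by (simp add: E_def)
        then show ?thesis using pq(2) E0 by (intro tendsto_zero_powrI[of _ _ "\<lambda>_. q" q]) auto
      next
        case False then show ?thesis by (simp add: E_def)
      qed
    qed
    show "AE x in lborel. norm (E k x powr q) \<le> (2 * M * norm h) powr q * indicator U x" for k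
    proof (rule AE_I2)
      fix x
      show "norm (E k x powr q) \<le> (2 * M * norm h) powr q * indicator U x"
        using E0[of k x] pq(2) by (cases "x \<in> U") (auto intro!: powr_mono2)
    qed
    show "integrable lborel (\<lambda>x. (2 * M * norm h) powr q * indicator U x)" using fin by simp
  qed measurable
  then have "eventually (\<lambda>k. (LINT x|lborel. E k x powr q) < \<eta>) sequentially"
    using \<eta> by (intro order_tendstoD(2)) auto
  then obtain k where k: "(LINT x|lborel. E k x powr q) < \<eta>" by (auto simp: eventually_sequentially)
  show "\<exists>\<Phi>' N' E. pairing_converges \<Phi>' \<and> dominates N' \<Phi>' \<and>
      dominates E (\<lambda>z. a (fst z) * apply_bcontfun h (snd z) - \<Phi>' z) \<and> (LINT x|lborel. E x powr q) \<le> \<eta>"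
  proof (intro exI conjI)
    show "pairing_converges (\<lambda>z. c k (fst z) * apply_bcontfun h (snd z))"
      by (rule pairing_converges_continuous[OF c_cont cM h])
    show "dominates (\<lambda>x. M * norm h * indicator U x) (\<lambda>z. c k (fst z) * apply_bcontfun h (snd z))"
      by (rule dominates_bounded_product[OF c_meas cM])
    show "dominates (E k) (\<lambda>z. a (fst z) * apply_bcontfun h (snd z) - c k (fst z) * apply_bcontfun h (snd z))"
      using DE[of k] by (simp add: left_diff_distrib)
    show "(LINT x|lborel. E k x powr q) \<le> \<eta>" using k by simp
  qed
qed

text \<open>
  Truncate \<open>\<phi>\<close> at norm \<open>m\<close> and interpolate it with the partition of unity; the result is a finite sum
  of products with bounded coefficients, and it converges to \<open>\<phi>\<close> in \<open>L\<^sup>q(U; C\<^sub>#(Y))\<close>. The function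
  \<open>\<phi>\<close> itself is replaced by a jointly Borel function \<open>\<Phi>\<close> that has the same values for almost every \<open>x\<close> and
  every \<open>y\<close>.
\<close>

lemma Lq_C_per_pairing:
  assumes \<phi>: "\<phi> \<in> Lq_C_per q U"
  obtains \<Phi> N where "pairing_converges \<Phi>" "dominates N \<Phi>"
    "AE x in lborel. x \<in> U \<longrightarrow> (\<forall>y. \<Phi> (x, y) = apply_bcontfun (\<phi> x) y)"
proof -
  let ?L = "lebesgue_on U"
  have Um[measurable]: "U \<in> sets borel" using U(1) by simp
  have \<phi>m: "\<phi> \<in> borel_measurable ?L" and per: "\<And>x. x \<in> U \<Longrightarrow> Y_periodic (apply_bcontfun (\<phi> x))"
    and \<phi>i: "integrable ?L (\<lambda>x. norm (\<phi> x) powr q)"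
    using \<phi> by (auto simp: Lq_C_per_def)
  obtain J :: "nat \<Rightarrow> (real^'n) set" and H :: "nat \<Rightarrow> real^'n \<Rightarrow> (real^'n) \<Rightarrow>\<^sub>C real"
    where fin: "\<And>m. finite (J m)" and Hper: "\<And>m j. j \<in> J m \<Longrightarrow> Y_periodic (H m j)"
    and Hle: "\<And>m f. norm (\<Sum>j\<in>J m. apply_bcontfun f j *\<^sub>R H m j) \<le> norm (f :: (real^'n) \<Rightarrow>\<^sub>C real)"
    and Hlim: "\<And>f. Y_periodic (apply_bcontfun f) \<Longrightarrow> (\<lambda>m. \<Sum>j\<in>J m. apply_bcontfun f j *\<^sub>R H m j) \<longlonglongrightarrow> f"
    by (rule periodic_interpolation) blast
  define P where "P m f = (\<Sum>j\<in>J m. apply_bcontfun f j *\<^sub>R H m j)" for m f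
  define T where "T m x = (if norm (\<phi> x) \<le> real m then P m (\<phi> x) else 0)" for m x
  have ev_cont: "continuous_on UNIV (\<lambda>f :: (real^'n) \<Rightarrow>\<^sub>C real. apply_bcontfun f y)" for y
  proof (rule lipschitz_on_continuous_on)
    show "1-lipschitz_on UNIV (\<lambda>f :: (real^'n) \<Rightarrow>\<^sub>C real. apply_bcontfun f y)"
      by (rule lipschitz_onI) (auto simp: dist_bounded)
  qed
  have P_cont: "continuous_on UNIV (P m)" for m
    unfolding P_def by (intro continuous_intros ev_cont)
  have comp: "(\<lambda>x. G (\<phi> x)) \<in> borel_measurable ?L" if "continuous_on UNIV G" for G :: "((real^'n) \<Rightarrow>\<^sub>C real) \<Rightarrow> real"
    by (rule measurable_compose[OF \<phi>m borel_measurable_continuous_onI[OF that]])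
  have nm[measurable]: "(\<lambda>x. norm (\<phi> x)) \<in> borel_measurable ?L" by (rule comp) (intro continuous_intros)
  have am: "(\<lambda>x. if norm (\<phi> x) \<le> real m then apply_bcontfun (\<phi> x) j else 0) \<in> borel_measurable ?L" for m j
  proof -
    have [measurable]: "(\<lambda>x. apply_bcontfun (\<phi> x) j) \<in> borel_measurable ?L" by (rule comp[OF ev_cont])
    show ?thesis by measurable
  qed
  have em: "(\<lambda>x. norm (\<phi> x - T m x)) \<in> borel_measurable ?L" for m
  proof -
    have [measurable]: "(\<lambda>x. norm (\<phi> x - P m (\<phi> x))) \<in> borel_measurable ?L"
      by (rule comp) (intro continuous_intros P_cont)
    have "(\<lambda>x. norm (\<phi> x - T m x)) = (\<lambda>x. if norm (\<phi> x) \<le> real m then norm (\<phi> x - P m (\<phi> x)) else norm (\<phi> x))"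
      by (auto simp: T_def fun_eq_iff)
    also have "\<dots> \<in> borel_measurable ?L" by measurable
    finally show ?thesis .
  qed
  obtain N0 where N0m[measurable]: "N0 \<in> borel_measurable borel" and N0: "AE x in lborel. x \<in> U \<longrightarrow> N0 x = norm (\<phi> x)"
    and N00: "\<And>x. x \<notin> U \<Longrightarrow> N0 x = 0"
    by (rule borel_representative[OF nm Um]) blast
  define N where "N x = \<bar>N0 x\<bar>" for x
  have Nm[measurable]: "N \<in> borel_measurable borel" unfolding N_def by measurable
  define sample where "sample m j a' \<longleftrightarrow> a' \<in> borel_measurable borel \<and>
      (AE x in lborel. x \<in> U \<longrightarrow> a' x = (if norm (\<phi> x) \<le> real m then apply_bcontfun (\<phi> x) j else 0))" for m j a'
  have "\<exists>a'. sample m j a'" for m j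
  proof -
    obtain a' where "a' \<in> borel_measurable borel" "AE x in lborel. x \<in> U \<longrightarrow> a' x = (if norm (\<phi> x) \<le> real m then apply_bcontfun (\<phi> x) j else 0)"
      by (rule borel_representative[OF am Um]) blast
    then show ?thesis unfolding sample_def by blast
  qed
  then obtain a' where "\<And>m j. sample m j (a' m j)" by metis
  then have a'm: "a' m j \<in> borel_measurable borel"
    and a': "AE x in lborel. x \<in> U \<longrightarrow> a' m j x = (if norm (\<phi> x) \<le> real m then apply_bcontfun (\<phi> x) j else 0)" for m j
    unfolding sample_def by blast+
  \<comment> \<open>The representative has the bound \<open>m\<close> almost everywhere only; truncation makes it hold everywhere.\<close>
  define a where "a m j x = max (- real m) (min (real m) (a' m j x))" for m j x
  have a_m[measurable]: "a m j \<in> borel_measurable borel" for m j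
    using a'm[of m j] unfolding a_def by measurable
  have a_le: "\<bar>a m j x\<bar> \<le> real m" for m j x by (auto simp: a_def)
  define defect where "defect m E \<longleftrightarrow> E \<in> borel_measurable borel \<and>
      (AE x in lborel. x \<in> U \<longrightarrow> E x = norm (\<phi> x - T m x)) \<and> (\<forall>x. x \<notin> U \<longrightarrow> E x = 0)" for m E
  have "\<exists>E. defect m E" for m
  proof -
    obtain E where "E \<in> borel_measurable borel" "AE x in lborel. x \<in> U \<longrightarrow> E x = norm (\<phi> x - T m x)" "\<And>x. x \<notin> U \<Longrightarrow> E x = 0"
      by (rule borel_representative[OF em Um]) blast
    then show ?thesis unfolding defect_def by blast
  qed
  then obtain E' where "\<And>m. defect m (E' m)" by metis
  then have E'm: "E' m \<in> borel_measurable borel"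
    and E': "AE x in lborel. x \<in> U \<longrightarrow> E' m x = norm (\<phi> x - T m x)" and E'0: "x \<notin> U \<Longrightarrow> E' m x = 0" for m x
    unfolding defect_def by blast+
  define E where "E m x = \<bar>E' m x\<bar>" for m x
  have Em[measurable]: "E m \<in> borel_measurable borel" for m using E'm[of m] unfolding E_def by measurable
  define \<Phi>m where "\<Phi>m m z = (\<Sum>j\<in>J m. a m j (fst z) * apply_bcontfun (H m j) (snd z))" for m z
  \<comment> \<open>The limit of Borel functions is Borel, whatever its value is where the sequence diverges.\<close>
  define \<Phi> where "\<Phi> z = lim (\<lambda>m. \<Phi>m m z)" for z
  have H_m: "apply_bcontfun h \<in> borel_measurable borel" for h :: "(real^'n) \<Rightarrow>\<^sub>C real"
    by (intro borel_measurable_continuous_onI) simp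
  have \<Phi>mm[measurable]: "\<Phi>m m \<in> borel_measurable borel" for m
    unfolding \<Phi>m_def
    by (intro borel_measurable_sum borel_measurable_times measurable_compose[OF _ a_m] measurable_compose[OF _ H_m]
      borel_measurable_continuous_onI continuous_intros)
  have \<Phi>_m[measurable]: "\<Phi> \<in> borel_measurable borel" unfolding \<Phi>_def by (rule borel_measurable_lim_metric) (rule \<Phi>mm)
  have "AE x in lborel. \<forall>m. \<forall>j\<in>J m. x \<in> U \<longrightarrow> a' m j x = (if norm (\<phi> x) \<le> real m then apply_bcontfun (\<phi> x) j else 0)"
    unfolding AE_all_countable using fin by (intro allI AE_finite_allI a') 
  moreover have "AE x in lborel. \<forall>m. x \<in> U \<longrightarrow> E' m x = norm (\<phi> x - T m x)"
    unfolding AE_all_countable using E' by blast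
  ultimately have good: "AE x in lborel. x \<in> U \<longrightarrow> N x = norm (\<phi> x) \<and> (\<forall>m. E m x = norm (\<phi> x - T m x)) \<and>
      (\<forall>m y. \<Phi>m m (x, y) = apply_bcontfun (T m x) y) \<and> (\<lambda>m. T m x) \<longlonglongrightarrow> \<phi> x \<and> (\<forall>y. \<Phi> (x, y) = apply_bcontfun (\<phi> x) y)"
    using N0
  proof eventually_elim
    case (elim x)
    show ?case
    proof (intro impI conjI allI)
      assume x: "x \<in> U"
      show "N x = norm (\<phi> x)" using elim x by (simp add: N_def)
      show "E m x = norm (\<phi> x - T m x)" for m using elim x by (simp add: E_def)
      have aeq: "a m j x = (if norm (\<phi> x) \<le> real m then apply_bcontfun (\<phi> x) j else 0)" if "j \<in> J m" for m j
      proof -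
        have "a' m j x = (if norm (\<phi> x) \<le> real m then apply_bcontfun (\<phi> x) j else 0)" using elim x that by blast
        moreover have "\<bar>apply_bcontfun (\<phi> x) j\<bar> \<le> norm (\<phi> x)" using norm_bounded[of "\<phi> x" j] by simp
        ultimately show ?thesis by (auto simp: a_def)
      qed
      have app: "apply_bcontfun (\<Sum>j\<in>A. g j *\<^sub>R G j) y = (\<Sum>j\<in>A. g j * apply_bcontfun (G j) y)"
        if "finite A" for A :: "(real^'n) set" and g :: "real^'n \<Rightarrow> real" and G :: "real^'n \<Rightarrow> (real^'n) \<Rightarrow>\<^sub>C real" and y
        using that by (induction A rule: finite_induct) (auto simp: plus_bcontfun.rep_eq scaleR_bcontfun.rep_eq zero_bcontfun.rep_eq)
      show Teq: "\<Phi>m m (x, y) = apply_bcontfun (T m x) y" for m y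
      proof -
        have "\<Phi>m m (x, y) = (\<Sum>j\<in>J m. (if norm (\<phi> x) \<le> real m then apply_bcontfun (\<phi> x) j else 0) * apply_bcontfun (H m j) y)"
          unfolding \<Phi>m_def by (rule sum.cong) (auto simp: aeq)
        also have "\<dots> = apply_bcontfun (T m x) y"
          by (simp add: T_def P_def app[OF fin] zero_bcontfun.rep_eq)
        finally show ?thesis .
      qed
      show Tlim: "(\<lambda>m. T m x) \<longlonglongrightarrow> \<phi> x"
      proof (rule Lim_transform_eventually)
        show "(\<lambda>m. P m (\<phi> x)) \<longlonglongrightarrow> \<phi> x" unfolding P_def by (rule Hlim[OF per[OF x]])
        have "eventually (\<lambda>m. norm (\<phi> x) \<le> real m) sequentially"
          using real_arch_simple[of "norm (\<phi> x)"] by (meson eventually_sequentiallyI of_nat_le_iff order_trans)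
        then show "eventually (\<lambda>m. P m (\<phi> x) = T m x) sequentially" by eventually_elim (simp add: T_def)
      qed
      show "\<Phi> (x, y) = apply_bcontfun (\<phi> x) y" for y
      proof -
        have "(\<lambda>m. apply_bcontfun (T m x) y) \<longlonglongrightarrow> apply_bcontfun (\<phi> x) y"
          using tendsto_bcontfun_uniform_limit[OF Tlim] by (rule tendsto_uniform_limitI) simp
        then show ?thesis unfolding \<Phi>_def Teq by (rule limI)
      qed
    qed
  qed
  have T_le: "norm (T m x) \<le> norm (\<phi> x)" for m x using Hle[where f = "\<phi> x" and m = m] by (simp add: T_def P_def)
  have Nq: "integrable lborel (\<lambda>x. N x powr q)"
  proof -
    have "AE x in lborel. x \<in> U \<longrightarrow> norm (\<phi> x) powr q = N x powr q"
      using good by eventually_elim auto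
    then have "integrable lborel (\<lambda>x. indicator U x *\<^sub>R N x powr q)"
      using lebesgue_on_AE_eq(3)[of "\<lambda>x. N x powr q" U "\<lambda>x. norm (\<phi> x) powr q"] \<phi>i by simp
    moreover have "indicator U x *\<^sub>R N x powr q = N x powr q" for x
      using N00[of x] by (auto simp: N_def indicator_def)
    ultimately show ?thesis by (simp only:)
  qed
  have domN: "dominates N \<Psi>" if "\<Psi> \<in> borel_measurable borel" "AE x in lborel. x \<in> U \<longrightarrow> (\<forall>y. \<bar>\<Psi> (x, y)\<bar> \<le> N x)" for \<Psi>
    using that Nq by (auto simp: dominates_def N_def)
  have D: "dominates N \<Phi>"
  proof (rule domN[OF \<Phi>_m])
    show "AE x in lborel. x \<in> U \<longrightarrow> (\<forall>y. \<bar>\<Phi> (x, y)\<bar> \<le> N x)"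
      using good by eventually_elim (use norm_bounded in \<open>auto simp: real_norm_def[symmetric] simp del: real_norm_def\<close>)
  qed
  have Dm: "dominates N (\<Phi>m m)" for m
  proof (rule domN[OF \<Phi>mm])
    show "AE x in lborel. x \<in> U \<longrightarrow> (\<forall>y. \<bar>\<Phi>m m (x, y)\<bar> \<le> N x)"
      using good
    proof eventually_elim
      case (elim x)
      show ?case
      proof (intro impI allI)
        fix y assume "x \<in> U"
        then have "\<bar>\<Phi>m m (x, y)\<bar> = norm (apply_bcontfun (T m x) y)" "N x = norm (\<phi> x)" using elim by auto
        then show "\<bar>\<Phi>m m (x, y)\<bar> \<le> N x" using norm_bounded[of "T m x" y] T_le[of m x] by linarith
      qed
    qed
  qed
  have E_le: "AE x in lborel. norm (E m x powr q) \<le> 2 powr q * N x powr q" for m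
    using good
  proof eventually_elim
    case (elim x)
    show ?case
    proof (cases "x \<in> U")
      case True
      then have "E m x \<le> 2 * N x" using elim norm_triangle_ineq4[of "\<phi> x" "T m x"] T_le[of m x] by auto
      then have "E m x powr q \<le> (2 * N x) powr q" using pq(2) by (intro powr_mono2) (auto simp: E_def)
      then show ?thesis by (simp add: powr_mult N_def)
    qed (simp add: E_def E'0)
  qed
  have Ei: "integrable lborel (\<lambda>x. E m x powr q)" for m
    by (rule Bochner_Integration.integrable_bound[OF integrable_mult_right[OF Nq, of "2 powr q"]])
      (use E_le[of m] in \<open>auto elim!: eventually_mono\<close>)
  have DE: "dominates (E m) (\<lambda>z. \<Phi> z - \<Phi>m m z)" for m
    unfolding dominates_def
  proof (intro conjI allI)
    show "AE x in lborel. x \<in> U \<longrightarrow> (\<forall>y. \<bar>\<Phi> (x, y) - \<Phi>m m (x, y)\<bar> \<le> E m x)"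
      using good
    proof eventually_elim
      case (elim x)
      show ?case
      proof (intro impI allI)
        fix y assume x: "x \<in> U"
        then have "\<Phi> (x, y) - \<Phi>m m (x, y) = apply_bcontfun (\<phi> x - T m x) y"
          using elim by (simp add: minus_bcontfun.rep_eq)
        then show "\<bar>\<Phi> (x, y) - \<Phi>m m (x, y)\<bar> \<le> E m x"
          using norm_bounded[of "\<phi> x - T m x" y] elim x by simp
      qed
    qed
  qed (use Ei in \<open>auto simp: E_def\<close>)
  have conv_m: "pairing_converges (\<Phi>m m)" for m
    unfolding \<Phi>m_def
  proof (rule pairing_converges_sum[OF fin])
    fix j assume j: "j \<in> J m"
    show "pairing_converges (\<lambda>z. a m j (fst z) * apply_bcontfun (H m j) (snd z))"
      by (rule pairing_converges_product[OF a_m a_le Hper[OF j]])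
    show "\<exists>N. dominates N (\<lambda>z. a m j (fst z) * apply_bcontfun (H m j) (snd z))"
      using dominates_bounded_product[OF a_m a_le] by blast
  qed
  have "(\<lambda>m. LINT x|lborel. E m x powr q) \<longlonglongrightarrow> (LINT x|(lborel :: (real^'n) measure). (0::real))"
  proof (rule integral_dominated_convergence[where w = "\<lambda>x. 2 powr q * N x powr q"])
    show "AE x in lborel. (\<lambda>m. E m x powr q) \<longlonglongrightarrow> 0"
      using good
    proof eventually_elim
      case (elim x)
      show ?case
      proof (cases "x \<in> U")
        case True
        then have "(\<lambda>m. norm (\<phi> x - T m x)) \<longlonglongrightarrow> norm (\<phi> x - \<phi> x)" using elim by (intro tendsto_intros) auto
        then have "(\<lambda>m. E m x) \<longlonglongrightarrow> 0" using elim True by simp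
        then show ?thesis using pq(2) by (intro tendsto_zero_powrI[of _ _ "\<lambda>_. q" q]) (auto simp: E_def)
      qed (simp add: E_def E'0)
    qed
  qed (use E_le Nq in auto)
  then have small: "(\<lambda>m. LINT x|lborel. E m x powr q) \<longlonglongrightarrow> 0" by simp
  have "pairing_converges \<Phi>"
  proof (rule pairing_converges_closure[OF D])
    fix \<eta> :: real assume "\<eta> > 0"
    then obtain m where m: "(LINT x|lborel. E m x powr q) < \<eta>"
      using order_tendstoD(2)[OF small] by (auto simp: eventually_sequentially)
    then show "\<exists>\<Phi>' N' E. pairing_converges \<Phi>' \<and> dominates N' \<Phi>' \<and>
      dominates E (\<lambda>z. \<Phi> z - \<Phi>' z) \<and> (LINT x|lborel. E x powr q) \<le> \<eta>"
      using conv_m[of m] Dm[of m] DE[of m] less_imp_le[OF m] by blast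
  qed
  moreover have "AE x in lborel. x \<in> U \<longrightarrow> (\<forall>y. \<Phi> (x, y) = apply_bcontfun (\<phi> x) y)"
    using good by eventually_elim auto
  ultimately show ?thesis using that[of \<Phi> N] D by blast
qed

end

lemma two_scale_weak_of_unfolded:
  fixes v :: "nat \<Rightarrow> real^'n \<Rightarrow> real" and v0 b :: "(real^'n) \<times> (real^'n) \<Rightarrow> real"
  assumes \<epsilon>: "\<And>n. 0 < \<epsilon> n" "\<epsilon> \<longlonglongrightarrow> 0"
    and U: "open U" "bounded U" and K: "K \<in> sets borel" "bounded K" "U \<subseteq> K"
    and supp: "\<And>n z. snd z \<in> unit_cell \<Longrightarrow> unfold_map (\<epsilon> n) z \<in> U \<Longrightarrow> fst z \<in> K"
    and p: "1 < p"
    and f: "\<And>n. f n \<in> borel_measurable borel" and f0: "\<And>n x. x \<notin> U \<Longrightarrow> f n x = 0"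
    and fi: "\<And>n. integrable lborel (\<lambda>x. \<bar>f n x\<bar> powr p)" and fC: "\<And>n. (LINT x|lborel. \<bar>f n x\<bar> powr p) \<le> C"
    and fv: "\<And>n. AE x in lborel. x \<in> U \<longrightarrow> v n x = f n x"
    and b: "b \<in> borel_measurable borel" and b0: "\<And>z. z \<notin> U \<times> unit_cell \<Longrightarrow> b z = 0"
    and bi: "integrable (slab_measure K) (\<lambda>z. \<bar>b z\<bar> powr p)"
    and bv: "AE z in lborel. z \<in> U \<times> unit_cell \<longrightarrow> v0 z = b z"
    and weak: "weakly_tendsto (slab_measure K) (\<lambda>n z. f n (unfold_map (\<epsilon> n) z)) b"
  shows "two_scale_weak p \<epsilon> U v v0"
proof -
  have Um[measurable]: "U \<in> sets borel" using U(1) by simp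
  have UYm[measurable]: "U \<times> (unit_cell :: (real^'n) set) \<in> sets borel" by measurable
  note [measurable] = f b K(1)
  have sub: "U \<times> (unit_cell :: (real^'n) set) \<subseteq> K \<times> unit_cell" using K(3) by auto
  have bK: "indicator (K \<times> unit_cell) z *\<^sub>R (g z * b z) = g z * b z" for g :: "_ \<Rightarrow> real" and z
    using b0[of z] sub by (cases "z \<in> U \<times> unit_cell") (auto simp: indicator_def)
  have "v n \<in> Lp p U" for n
  proof -
    have "AE x in lborel. x \<in> U \<longrightarrow> norm (v n x) powr p = \<bar>f n x\<bar> powr p" using fv[of n] by eventually_elim auto
    moreover have "integrable lborel (\<lambda>x. indicator U x *\<^sub>R \<bar>f n x\<bar> powr p)"
    proof -
      have "indicator U x *\<^sub>R \<bar>f n x\<bar> powr p = \<bar>f n x\<bar> powr p" for x using f0[of x n] by (cases "x \<in> U") auto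
      then show ?thesis using fi[of n] by (simp only:)
    qed
    ultimately have "integrable (lebesgue_on U) (\<lambda>x. norm (v n x) powr p)"
      using lebesgue_on_AE_eq(3)[of "\<lambda>x. \<bar>f n x\<bar> powr p" U "\<lambda>x. norm (v n x) powr p"] by simp
    moreover have "v n \<in> borel_measurable (lebesgue_on U)"
      by (rule lebesgue_on_AE_eq(1)[OF f Um fv])
    ultimately show ?thesis by (simp add: Lp_def)
  qed
  moreover have "v0 \<in> Lp p (U \<times> unit_cell)"
  proof -
    have "AE z in lborel. z \<in> U \<times> unit_cell \<longrightarrow> norm (v0 z) powr p = \<bar>b z\<bar> powr p" using bv by eventually_elim auto
    moreover have "integrable lborel (\<lambda>z. indicator (U \<times> unit_cell) z *\<^sub>R \<bar>b z\<bar> powr p)"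
    proof -
      have "integrable lborel (\<lambda>z. indicator (K \<times> unit_cell) z *\<^sub>R \<bar>b z\<bar> powr p)"
        using bi by (subst (asm) integrable_slab_measure_iff) auto
      moreover have "indicator (K \<times> unit_cell) z *\<^sub>R \<bar>b z\<bar> powr p = indicator (U \<times> unit_cell) z *\<^sub>R \<bar>b z\<bar> powr p" for z
        using b0[of z] sub by (cases "z \<in> U \<times> unit_cell") (auto simp: indicator_def)
      ultimately show ?thesis by (simp only:)
    qed
    ultimately have "integrable (lebesgue_on (U \<times> unit_cell)) (\<lambda>z. norm (v0 z) powr p)"
      using lebesgue_on_AE_eq(3)[of "\<lambda>z. \<bar>b z\<bar> powr p" "U \<times> unit_cell" "\<lambda>z. norm (v0 z) powr p"] by simp
    moreover have "v0 \<in> borel_measurable (lebesgue_on (U \<times> unit_cell))"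
      by (rule lebesgue_on_AE_eq(1)[OF b UYm bv])
    ultimately show ?thesis by (simp add: Lp_def)
  qed
  moreover have "(\<lambda>n. LINT x|lebesgue_on U. apply_bcontfun (\<phi> x) (x /\<^sub>R \<epsilon> n) *\<^sub>R v n x)
        \<longlonglongrightarrow> (LINT x|lebesgue_on U. LINT y|lebesgue_on unit_cell. apply_bcontfun (\<phi> x) y *\<^sub>R v0 (x, y))"
    if q: "1 / p + 1 / q = 1" and \<phi>: "\<phi> \<in> Lq_C_per q U" for q \<phi>
  proof -
    define C' where "C' = max C (LINT z|slab_measure K. \<bar>b z\<bar> powr p)"
    have "1 / q = (p - 1) / p" using q p by (simp add: field_simps)
    then have "q = p / (p - 1)" using p by (metis divide_divide_eq_right inverse_eq_divide inverse_inverse_eq mult_1 inverse_divide)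
    then have q1: "1 < q" using p by simp
    interpret unfolded_limit \<epsilon> U K p q C' f b
      by unfold_locales (use \<epsilon> U K supp p q1 q f f0 fi fC b b0 bi weak in \<open>auto simp: C'_def intro: order_trans[OF fC]\<close>)
    obtain \<Phi> N where conv: "pairing_converges \<Phi>" and D: "dominates N \<Phi>"
      and eq: "AE x in lborel. x \<in> U \<longrightarrow> (\<forall>y. \<Phi> (x, y) = apply_bcontfun (\<phi> x) y)"
      by (rule Lq_C_per_pairing[OF \<phi>])
    have \<Phi>m[measurable]: "\<Phi> \<in> borel_measurable borel" using D by (simp add: dominates_def)
    have l: "(LINT x|lebesgue_on U. apply_bcontfun (\<phi> x) (x /\<^sub>R \<epsilon> n) *\<^sub>R v n x) = (LINT x|lborel. \<Phi> (x, x /\<^sub>R \<epsilon> n) * f n x)" for n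
    proof -
      note [measurable] = measurable_diagonal[OF \<Phi>m, of n]
      have "AE x in lborel. x \<in> U \<longrightarrow> apply_bcontfun (\<phi> x) (x /\<^sub>R \<epsilon> n) *\<^sub>R v n x = \<Phi> (x, x /\<^sub>R \<epsilon> n) * f n x"
        using eq fv[of n] by eventually_elim auto
      then have "(LINT x|lebesgue_on U. apply_bcontfun (\<phi> x) (x /\<^sub>R \<epsilon> n) *\<^sub>R v n x)
          = (LINT x|lborel. indicator U x *\<^sub>R (\<Phi> (x, x /\<^sub>R \<epsilon> n) * f n x))"
        by (intro lebesgue_on_AE_eq(2)) measurable
      also have "\<dots> = (LINT x|lborel. \<Phi> (x, x /\<^sub>R \<epsilon> n) * f n x)"
        by (rule Bochner_Integration.integral_cong) (use f0 in \<open>auto simp: indicator_def\<close>)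
      finally show ?thesis .
    qed
    have int: "integrable (slab_measure K) (\<lambda>z. \<Phi> z * b z)" by (rule limit_pairing_bound(1)[OF D zero_less_one])
    have r: "(LINT x|lebesgue_on U. LINT y|lebesgue_on unit_cell. apply_bcontfun (\<phi> x) y *\<^sub>R v0 (x, y)) = (LINT z|slab_measure K. \<Phi> z * b z)"
    proof -
      have li: "integrable lborel (\<lambda>z. \<Phi> z * b z)"
        using int by (subst (asm) integrable_slab_measure_iff) (auto simp only: bK, measurable)
      have ae1: "AE z in lborel. z \<in> U \<times> unit_cell \<longrightarrow> \<Phi> z = apply_bcontfun (\<phi> (fst z)) (snd z)"
      proof -
        have "AE z in slab_measure K. fst z \<in> U \<longrightarrow> (\<forall>y. \<Phi> (fst z, y) = apply_bcontfun (\<phi> (fst z)) y)"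
          by (rule AE_slab_fst[OF eq K(1)])
        then have "AE z in lborel. z \<in> K \<times> (unit_cell :: (real^'n) set) \<longrightarrow> fst z \<in> U \<longrightarrow> (\<forall>y. \<Phi> (fst z, y) = apply_bcontfun (\<phi> (fst z)) y)"
          by (simp only: AE_slab_measure_iff[OF K(1)])
        then show ?thesis
        proof eventually_elim
          case (elim z)
          show ?case
          proof
            assume "z \<in> U \<times> unit_cell"
            then have "\<Phi> (fst z, snd z) = apply_bcontfun (\<phi> (fst z)) (snd z)" using elim sub by (auto simp: mem_Times_iff)
            then show "\<Phi> z = apply_bcontfun (\<phi> (fst z)) (snd z)" by simp
          qed
        qed
      qed
      have ae: "AE z in lborel. z \<in> U \<times> unit_cell \<longrightarrow> (\<lambda>z. apply_bcontfun (\<phi> (fst z)) (snd z) *\<^sub>R v0 z) z = \<Phi> z * b z"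
        using ae1 bv by eventually_elim auto
      have "(LINT x|lebesgue_on U. LINT y|lebesgue_on unit_cell. (\<lambda>z. apply_bcontfun (\<phi> (fst z)) (snd z) *\<^sub>R v0 z) (x, y))
          = (LINT z|lborel. \<Phi> z * b z)"
        by (rule iterated_integral_eq_lborel[OF _ li Um ae]) (use b0 in auto)
      also have "\<dots> = (LINT z|slab_measure K. \<Phi> z * b z)"
        by (subst integral_slab_measure) (auto simp only: bK, measurable)
      finally show ?thesis by simp
    qed
    show ?thesis using conv unfolding l r pairing_converges_def .
  qed
  ultimately show ?thesis unfolding two_scale_weak_def by blast
qed

section \<open>The transformed domains and the limit displacement\<close>

lemma open_ref_domain:
  assumes "open \<Omega>" "0 < e"
  shows "open (ref_domain \<Omega> Ystar e)"
  unfolding ref_domain_def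
  using assms open_scaling[of e "periodic_cell Ystar"] open_periodic_cell by (intro open_Int) auto

lemma norm_diff_unit_cell: "norm (w - y) \<le> CARD('n)" if "w \<in> unit_cell" "y \<in> unit_cell" for w y :: "real^'n"
proof -
  have "norm (w - y) \<le> (\<Sum>i\<in>UNIV. \<bar>(w - y) $ i\<bar>)" by (rule norm_le_l1_cart)
  also have "\<dots> \<le> (\<Sum>i\<in>(UNIV::'n set). 1)"
    using that by (intro sum_mono) (auto simp: unit_cell_iff abs_le_iff; smt (verit))
  finally show ?thesis by simp
qed

text \<open>
  The bound on the gradient of the displacement bounds the Jacobian matrix, and thus its determinant, from
  above. The image is open by invariance of domain.
\<close>

lemma C1_diffeo_cl_image_bounds:
  fixes \<psi> :: "real^'n \<Rightarrow> real^'n"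
  assumes diffeo: "C1_diffeo_cl E (\<psi> ` E) \<psi>" and E: "open E" "bounded E"
    and det: "\<And>x. x \<in> E \<Longrightarrow> c \<le> det (jac \<psi> x)" and c: "0 < c"
    and C: "\<And>x. x \<in> E \<Longrightarrow> norm (\<psi> x - x) \<le> C" "\<And>x. x \<in> E \<Longrightarrow> norm (jac (\<lambda>z. \<psi> z - z) x) \<le> C"
    and d: "\<And>A :: real^'n^'n. norm A \<le> C + norm (mat 1 :: real^'n^'n) \<Longrightarrow> \<bar>det A\<bar> \<le> d"
  shows "open (\<psi> ` E)" "bounded (\<psi> ` E)" "continuous_on E \<psi>"
    "F \<in> borel_measurable borel \<Longrightarrow> (\<And>x. 0 \<le> F x \<and> F x \<le> 1) \<Longrightarrow>
       c * (LINT x|lborel. indicator E x * F (\<psi> x)) \<le> (LINT x|lborel. indicator (\<psi> ` E) x * F x)"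
    "F \<in> borel_measurable borel \<Longrightarrow> (\<And>x. 0 \<le> F x \<and> F x \<le> (1::real)) \<Longrightarrow>
       (LINT x|lborel. indicator (\<psi> ` E) x * F x) \<le> d * (LINT x|lborel. indicator E x * F (\<psi> x))"
proof -
  have diff: "\<psi> differentiable (at x)" if "x \<in> E" for x
    using diffeo that by (auto simp: C1_diffeo_cl_def C1_cl_def)
  have inj: "inj_on \<psi> E"
    using diffeo closure_subset[of E] by (auto simp: C1_diffeo_cl_def bij_betw_def intro: inj_on_subset)
  show cont: "continuous_on E \<psi>"
    using diff by (meson continuous_at_imp_continuous_on differentiable_imp_continuous_within)
  show op: "open (\<psi> ` E)" by (rule invariance_of_domain[OF cont E(1) inj])
  obtain R where R: "\<And>x. x \<in> E \<Longrightarrow> norm x \<le> R" using E(2) by (auto simp: bounded_iff)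
  show bd: "bounded (\<psi> ` E)"
    unfolding bounded_iff
  proof (intro exI ballI)
    fix y assume "y \<in> \<psi> ` E"
    then obtain x where x: "x \<in> E" "y = \<psi> x" by blast
    have "norm (\<psi> x) \<le> norm x + norm (\<psi> x - x)" using norm_triangle_sub[of "\<psi> x" x] by simp
    then show "norm y \<le> R + C" unfolding x(2) using R[OF x(1)] C(1)[OF x(1)] by linarith
  qed
  have bounds: "c \<le> \<bar>det (jac \<psi> x)\<bar> \<and> \<bar>det (jac \<psi> x)\<bar> \<le> d" if x: "x \<in> E" for x
  proof -
    define D where "D = frechet_derivative \<psi> (at x)"
    have D: "(\<psi> has_derivative D) (at x)" using diff[OF x] by (simp add: D_def frechet_derivative_works)
    have "((\<lambda>z. \<psi> z - z) has_derivative (\<lambda>h. D h - h)) (at x)" by (intro derivative_intros D)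
    then have "frechet_derivative (\<lambda>z. \<psi> z - z) (at x) = (\<lambda>h. D h - h)" by (rule frechet_derivative_at[symmetric])
    then have "jac \<psi> x = jac (\<lambda>z. \<psi> z - z) x + mat 1"
      by (simp add: jacobian_def D_def[symmetric] matrix_def mat_def vec_eq_iff axis_def)
    then have "norm (jac \<psi> x) \<le> C + norm (mat 1 :: real^'n^'n)"
      using norm_triangle_ineq[of "jac (\<lambda>z. \<psi> z - z) x" "mat 1"] C(2)[OF x] by simp
    then show ?thesis using d[of "jac \<psi> x"] det[OF x] c by auto
  qed
  show "c * (LINT x|lborel. indicator E x * F (\<psi> x)) \<le> (LINT x|lborel. indicator (\<psi> ` E) x * F x)"
    if "F \<in> borel_measurable borel" "\<And>x. 0 \<le> F x \<and> F x \<le> 1"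
    by (rule integral_image_bounds(1)[OF E op bd inj diff bounds that])
  show "(LINT x|lborel. indicator (\<psi> ` E) x * F x) \<le> d * (LINT x|lborel. indicator E x * F (\<psi> x))"
    if "F \<in> borel_measurable borel" "\<And>x. 0 \<le> F x \<and> F x \<le> 1"
    by (rule integral_image_bounds(2)[OF E op bd inj diff bounds that])
qed

text \<open>
  The points \<open>y\<close> and \<open>\<psi>\<^sub>0(x, y)\<close> both lie in the cell, so the displacement is bounded almost everywhere;
  truncation makes the bound hold everywhere.
\<close>

lemma limit_displacement_representative:
  fixes \<psi>0 :: "real^'n \<Rightarrow> real^'n \<Rightarrow> real^'n" and \<Omega> Ystar :: "(real^'n) set"
  defines "a0 \<equiv> ext0 (\<Omega> \<times> Ystar) (\<lambda>(x, y). \<psi>0 x y - y)"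
  assumes \<Omega>: "open \<Omega>" "bounded \<Omega>" and Y: "Ystar \<subseteq> unit_cell"
    and ae: "AE x in lebesgue_on \<Omega>. \<psi>0 x ` Ystar \<subseteq> unit_cell"
    and meas: "a0 \<in> borel_measurable (lebesgue_on (\<Omega> \<times> unit_cell))"
  obtains b where "b \<in> borel_measurable borel" "AE z in lborel. z \<in> \<Omega> \<times> unit_cell \<longrightarrow> b z = a0 z"
    "\<And>z. z \<notin> \<Omega> \<times> unit_cell \<Longrightarrow> b z = 0" "\<And>z. norm (b z) \<le> CARD('n)"
    "AE z in lborel. z \<in> \<Omega> \<times> Ystar \<longrightarrow> snd z + b z = \<psi>0 (fst z) (snd z)"
    "AE z in lborel. z \<in> \<Omega> \<times> Ystar \<longrightarrow> snd z + b z \<in> unit_cell"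
proof -
  have \<Omega>m[measurable]: "\<Omega> \<in> sets borel" using \<Omega> by simp
  have \<Omega>l: "\<Omega> \<inter> space lebesgue \<in> sets lebesgue" using \<Omega>m by (simp add: sets_completionI_sets)
  have cell: "\<Omega> \<times> (unit_cell :: (real^'n) set) \<in> sets borel" by measurable
  obtain b1 where b1[measurable]: "b1 \<in> borel_measurable borel" and b1e: "AE z in lborel. z \<in> \<Omega> \<times> unit_cell \<longrightarrow> b1 z = a0 z"
    and b10: "\<And>z. z \<notin> \<Omega> \<times> unit_cell \<Longrightarrow> b1 z = 0"
    by (rule borel_representative[OF meas cell]) blast
  have "AE x in lebesgue. x \<in> \<Omega> \<longrightarrow> \<psi>0 x ` Ystar \<subseteq> unit_cell"
    using ae by (simp only: AE_restrict_space_iff[OF \<Omega>l])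
  then have "AE x in lborel. x \<in> \<Omega> \<longrightarrow> \<psi>0 x ` Ystar \<subseteq> unit_cell" by (simp only: AE_completion_iff)
  from AE_slab_fst[OF this \<Omega>m]
  have good: "AE z in lborel. z \<in> \<Omega> \<times> (unit_cell :: (real^'n) set) \<longrightarrow> fst z \<in> \<Omega> \<longrightarrow> \<psi>0 (fst z) ` Ystar \<subseteq> unit_cell"
    by (simp only: AE_slab_measure_iff[OF \<Omega>m])
  define b where "b z = (if norm (b1 z) \<le> CARD('n) then b1 z else 0)" for z
  have be: "AE z in lborel. z \<in> \<Omega> \<times> unit_cell \<longrightarrow> b z = a0 z \<and> (z \<in> \<Omega> \<times> Ystar \<longrightarrow> \<psi>0 (fst z) (snd z) \<in> unit_cell)"
    using b1e good
  proof eventually_elim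
    case (elim z)
    show ?case
    proof
      assume z: "z \<in> \<Omega> \<times> unit_cell"
      then have sub: "\<psi>0 (fst z) ` Ystar \<subseteq> unit_cell" using elim(2) by auto
      have "norm (a0 z) \<le> CARD('n)"
      proof (cases "z \<in> \<Omega> \<times> Ystar")
        case True
        then have "a0 z = \<psi>0 (fst z) (snd z) - snd z" by (simp add: a0_def ext0_def case_prod_beta)
        moreover have "\<psi>0 (fst z) (snd z) \<in> unit_cell" "snd z \<in> unit_cell" using True sub Y by auto
        ultimately show ?thesis using norm_diff_unit_cell by simp
      qed (simp add: a0_def ext0_def)
      then show "b z = a0 z \<and> (z \<in> \<Omega> \<times> Ystar \<longrightarrow> \<psi>0 (fst z) (snd z) \<in> unit_cell)"
        using elim(1) z sub by (auto simp: b_def)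
    qed
  qed
  have be2: "AE z in lborel. z \<in> \<Omega> \<times> Ystar \<longrightarrow> snd z + b z = \<psi>0 (fst z) (snd z) \<and> \<psi>0 (fst z) (snd z) \<in> unit_cell"
    using be
  proof eventually_elim
    case (elim z)
    show ?case
    proof
      assume z: "z \<in> \<Omega> \<times> Ystar"
      then have "z \<in> \<Omega> \<times> unit_cell" using Y by auto
      moreover have "a0 z = \<psi>0 (fst z) (snd z) - snd z" using z by (simp add: a0_def ext0_def case_prod_beta)
      ultimately show "snd z + b z = \<psi>0 (fst z) (snd z) \<and> \<psi>0 (fst z) (snd z) \<in> unit_cell" using elim z by simp
    qed
  qed
  show ?thesis
  proof (rule that[of b])
    show "b \<in> borel_measurable borel" unfolding b_def by measurable
    show "AE z in lborel. z \<in> \<Omega> \<times> unit_cell \<longrightarrow> b z = a0 z" using be by eventually_elim blast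
    show "b z = 0" if "z \<notin> \<Omega> \<times> unit_cell" for z using b10[OF that] by (simp add: b_def)
    show "norm (b z) \<le> CARD('n)" for z by (simp add: b_def)
    show "AE z in lborel. z \<in> \<Omega> \<times> Ystar \<longrightarrow> snd z + b z = \<psi>0 (fst z) (snd z)" using be2 by eventually_elim blast
    show "AE z in lborel. z \<in> \<Omega> \<times> Ystar \<longrightarrow> snd z + b z \<in> unit_cell" using be2 by eventually_elim auto
  qed
qed

lemma Lp_norm_bound_imp_integral_bound:
  assumes "1 < p" "Lp_norm p S f \<le> C"
  shows "(LINT x|lebesgue_on S. norm (f x) powr p) \<le> C powr p"
proof -
  define I where "I = (LINT x|lebesgue_on S. norm (f x) powr p)"
  have I0: "0 \<le> I" by (simp add: I_def)
  have "I powr (1 / p) \<le> C" using assms(2) by (simp add: Lp_norm_def I_def)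
  then have "(I powr (1 / p)) powr p \<le> C powr p" using assms(1) by (intro powr_mono2) auto
  moreover have "(I powr (1 / p)) powr p = I" using I0 assms(1) by (simp add: powr_powr)
  ultimately show ?thesis by (simp add: I_def)
qed

section \<open>The support of the weak limit\<close>

lemma transported_measure_null:
  fixes b0 :: "(real^'n) \<times> (real^'n) \<Rightarrow> real^'n"
  assumes \<Omega>: "open \<Omega>" and Y: "open Ystar" and b[measurable]: "b0 \<in> borel_measurable borel" and A[measurable]: "A \<in> sets borel"
    and ae: "AE z in lborel. z \<in> \<Omega> \<times> Ystar \<longrightarrow> (fst z, snd z + b0 z) \<notin> A"
  shows "emeasure (transported_measure \<Omega> Ystar b0) A = 0"
proof -
  have [measurable]: "\<Omega> \<times> Ystar \<in> sets borel" using \<Omega> Y by (intro borel_Times) auto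
  have fm[measurable]: "fst \<in> borel_measurable (borel :: ((real^'n) \<times> (real^'n)) measure)"
    and sm[measurable]: "snd \<in> borel_measurable (borel :: ((real^'n) \<times> (real^'n)) measure)"
    by (intro borel_measurable_continuous_onI continuous_intros)+
  have \<Psi>[measurable]: "(\<lambda>z. (fst z, snd z + b0 z)) \<in> borel_measurable borel" by (intro borel_measurable_Pair) measurable
  have "AE z in density lborel (indicator (\<Omega> \<times> Ystar)). (fst z, snd z + b0 z) \<notin> A"
    using ae by (subst AE_density) (auto simp: indicator_def elim!: eventually_mono)
  moreover have "Measurable.pred borel (\<lambda>w. w \<notin> A)" by measurable
  ultimately have "AE w in transported_measure \<Omega> Ystar b0. w \<notin> A"
    unfolding transported_measure_def by (subst AE_distr_iff) auto
  then show ?thesis by (subst (asm) AE_iff_measurable[of A]) (auto simp: transported_measure_def)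
qed

text \<open>
  The lower bound says that the transported measure is at most \<open>1 / c\<close> times Lebesgue measure on the
  slab, and the integral in question is an integral with respect to the transported measure.
\<close>

lemma transported_integrable:
  fixes b0 :: "(real^'n) \<times> (real^'n) \<Rightarrow> real^'n" and g :: "(real^'n) \<times> (real^'n) \<Rightarrow> real"
  assumes \<Omega>: "open \<Omega>" and Y: "open Ystar" and b[measurable]: "b0 \<in> borel_measurable borel"
    and fin: "finite_measure (transported_measure \<Omega> Ystar b0)" "finite_measure (slab_measure K)" and c: "0 < c"
    and le: "\<And>A. A \<in> sets borel \<Longrightarrow> A \<subseteq> UNIV \<times> box 0 1 \<Longrightarrow>
       c * measure (transported_measure \<Omega> Ystar b0) A \<le> measure (slab_measure K) A"
    and g[measurable]: "g \<in> borel_measurable borel" and g0: "\<And>z. 0 \<le> g z" and gbox: "\<And>z. z \<notin> UNIV \<times> box 0 1 \<Longrightarrow> g z = 0"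
    and gi: "integrable (slab_measure K) g"
  shows "integrable lborel (\<lambda>z. indicator (\<Omega> \<times> Ystar) z *\<^sub>R g (fst z, snd z + b0 z))"
proof (rule integrableI_bounded)
  let ?T = "transported_measure \<Omega> Ystar b0"
  have OY[measurable]: "\<Omega> \<times> Ystar \<in> sets borel" using \<Omega> Y by (intro borel_Times) auto
  have fm[measurable]: "fst \<in> borel_measurable (borel :: ((real^'n) \<times> (real^'n)) measure)"
    and sm[measurable]: "snd \<in> borel_measurable (borel :: ((real^'n) \<times> (real^'n)) measure)"
    by (intro borel_measurable_continuous_onI continuous_intros)+
  have \<Psi>[measurable]: "(\<lambda>z. (fst z, snd z + b0 z)) \<in> borel_measurable borel" by (intro borel_measurable_Pair) measurable
  note [measurable] = measurable_compose[OF \<Psi> g]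
  show "(\<lambda>z. indicator (\<Omega> \<times> Ystar) z *\<^sub>R g (fst z, snd z + b0 z)) \<in> borel_measurable lborel" by measurable
  have box[measurable]: "(UNIV :: (real^'n) set) \<times> box 0 (1 :: real^'n) \<in> sets borel" by (intro borel_Times) auto
  have "(\<integral>\<^sup>+z. ennreal (norm (indicator (\<Omega> \<times> Ystar) z *\<^sub>R g (fst z, snd z + b0 z))) \<partial>lborel)
      = (\<integral>\<^sup>+z. indicator (\<Omega> \<times> Ystar) z * ennreal (g (fst z, snd z + b0 z)) \<partial>lborel)"
    by (rule nn_integral_cong) (auto simp: indicator_def g0)
  also have "\<dots> = (\<integral>\<^sup>+z. ennreal (g (fst z, snd z + b0 z)) \<partial>density lborel (indicator (\<Omega> \<times> Ystar)))"
    by (rule nn_integral_density[symmetric]) auto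
  also have "\<dots> = (\<integral>\<^sup>+w. ennreal (g w) \<partial>?T)"
    unfolding transported_measure_def by (rule nn_integral_distr[symmetric]) auto
  also have "\<dots> = (\<integral>\<^sup>+w. ennreal (g w) * indicator (UNIV \<times> box 0 1) w \<partial>?T)"
    by (rule nn_integral_cong) (use gbox in \<open>auto simp: indicator_def\<close>)
  also have "\<dots> \<le> ennreal (1 / c) * (\<integral>\<^sup>+w. ennreal (g w) \<partial>slab_measure K)"
  proof (rule nn_integral_le_of_measure_le[OF fin])
    show "measure ?T A \<le> 1 / c * measure (slab_measure K) A" if "A \<in> sets (slab_measure K)" "A \<subseteq> UNIV \<times> box 0 1" for A
      using le[of A] that c by (simp add: field_simps)
  qed (use c in \<open>auto simp: transported_measure_def\<close>)
  also have "\<dots> < \<infinity>"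
    using nn_integral_eq_integral[OF gi] g0 by (simp add: ennreal_mult_less_top)
  finally show "(\<integral>\<^sup>+z. ennreal (norm (indicator (\<Omega> \<times> Ystar) z *\<^sub>R g (fst z, snd z + b0 z))) \<partial>lborel) < \<infinity>" .
qed

lemma weakly_tendsto_cong_AE:
  assumes "weakly_tendsto M f v" "AE z in M. v z = w z" "v \<in> borel_measurable M" "w \<in> borel_measurable M"
  shows "weakly_tendsto M f w"
proof -
  have "(LINT z|M. s z * v z) = (LINT z|M. s z * w z)" if "s \<in> borel_measurable M" for s :: "_ \<Rightarrow> real"
    by (rule integral_cong_AE) (use that assms in \<open>auto elim!: eventually_mono\<close>)
  then show ?thesis using assms(1) by (simp add: weakly_tendsto_def)
qed

text \<open>
  The transported measure does not charge the complement \<open>A\<close> of the range of \<open>\<psi>\<^sub>0\<close>, so by the upper bound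
  \<open>\<theta>\<close>, and with it \<open>v\<close>, vanishes almost everywhere on \<open>A\<close>. Setting \<open>v\<close> to zero on \<open>A\<close> gives a
  representative \<open>b\<close> of the limit, and the pulled-back function \<open>b(x, \<psi>\<^sub>0(x, y))\<close> is in \<open>L\<^sup>p\<close> by the
  lower bound.
\<close>

lemma weak_limit_supported_in_limit_domain:
  fixes \<psi>0 :: "real^'n \<Rightarrow> real^'n \<Rightarrow> real^'n" and b0 :: "(real^'n) \<times> (real^'n) \<Rightarrow> real^'n"
    and v \<theta> :: "(real^'n) \<times> (real^'n) \<Rightarrow> real"
  defines "T \<equiv> \<lambda>\<Omega> Ystar. transported_measure \<Omega> Ystar b0"
  assumes \<Omega>: "open \<Omega>" and Y: "open Ystar" "Ystar \<subseteq> unit_cell"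
    and K[measurable]: "K \<in> sets borel" and Kb: "bounded K"
    and \<psi>0: "\<psi>0 \<in> Linf_C1 \<Omega> Ystar (C1_cl Ystar)"
    and b0[measurable]: "b0 \<in> borel_measurable borel"
    and b0_\<psi>: "AE z in lborel. z \<in> \<Omega> \<times> Ystar \<longrightarrow> snd z + b0 z = \<psi>0 (fst z) (snd z)"
    and fin: "finite_measure (T \<Omega> Ystar)" and c: "0 < c"
    and lower: "\<And>A. A \<in> sets borel \<Longrightarrow> A \<subseteq> UNIV \<times> box 0 1 \<Longrightarrow> c * measure (T \<Omega> Ystar) A \<le> measure (slab_measure K) A"
    and upper: "\<And>A. A \<in> sets borel \<Longrightarrow> A \<subseteq> UNIV \<times> box 0 1 \<Longrightarrow>
       (LINT z|slab_measure K. indicator A z * \<theta> z) \<le> c' * measure (T \<Omega> Ystar) A"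
    and \<theta>[measurable]: "\<theta> \<in> borel_measurable borel" and \<theta>0: "\<And>z. 0 \<le> \<theta> z" and \<theta>i: "integrable (slab_measure K) \<theta>"
    and v[measurable]: "v \<in> borel_measurable borel" and vi: "integrable (slab_measure K) (\<lambda>z. \<bar>v z\<bar> powr p)"
    and v\<theta>: "AE z in slab_measure K. \<theta> z = 0 \<longrightarrow> v z = 0"
  obtains b where "b \<in> borel_measurable borel" "AE z in slab_measure K. v z = b z"
    "integrable (slab_measure K) (\<lambda>z. \<bar>b z\<bar> powr p)" "\<And>z. z \<notin> \<Omega> \<times> unit_cell \<Longrightarrow> b z = 0"
    "b \<in> Lp_limit_domain p \<Omega> Ystar \<psi>0" "AE z in lborel. ext0 (limit_domain \<Omega> Ystar \<psi>0) b z = b z"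
proof -
  let ?M = "slab_measure K"
  let ?V = "UNIV \<times> box 0 1 :: ((real^'n) \<times> (real^'n)) set"
  have \<Omega>m[measurable]: "\<Omega> \<in> sets borel" and Ym[measurable]: "Ystar \<in> sets borel" using \<Omega> Y by auto
  have OY[measurable]: "\<Omega> \<times> Ystar \<in> sets borel" by (intro borel_Times) measurable
  have V[measurable]: "?V \<in> sets borel" by (intro borel_Times) auto
  have fm[measurable]: "fst \<in> borel_measurable (borel :: ((real^'n) \<times> (real^'n)) measure)"
    and sm[measurable]: "snd \<in> borel_measurable (borel :: ((real^'n) \<times> (real^'n)) measure)"
    by (intro borel_measurable_continuous_onI continuous_intros)+
  have \<Psi>[measurable]: "(\<lambda>z. (fst z, snd z + b0 z)) \<in> borel_measurable borel" by (intro borel_measurable_Pair) measurable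
  have box_cell: "y \<in> unit_cell" if "y \<in> box 0 1" for y :: "real^'n"
    using that by (auto simp: unit_cell_iff open_unit_cell_iff less_imp_le)
  obtain Q where Qm: "Q \<in> sets borel" and Q: "AE x in lborel. x \<in> \<Omega> \<longrightarrow> (\<forall>y. (x, y) \<in> Q \<longleftrightarrow> y \<in> \<psi>0 x ` Ystar)"
    by (rule Linf_C1_Borel_range[OF \<psi>0 \<Omega>m Y(1)])
  have Qz: "AE z in lborel. z \<in> \<Omega> \<times> (unit_cell :: (real^'n) set) \<longrightarrow> (\<forall>y. (fst z, y) \<in> Q \<longleftrightarrow> y \<in> \<psi>0 (fst z) ` Ystar)"
    using AE_slab_fst[OF Q \<Omega>m] unfolding AE_slab_measure_iff[OF \<Omega>m] by (rule eventually_mono) auto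
  define P where "P = Q \<inter> (\<Omega> \<times> box 0 1)"
  have OB: "\<Omega> \<times> box 0 (1 :: real^'n) \<in> sets borel" by (intro borel_Times) auto
  have Pm[measurable]: "P \<in> sets borel" unfolding P_def using Qm OB by (rule sets.Int)
  have P_sub: "P \<subseteq> \<Omega> \<times> unit_cell" using box_cell by (auto simp: P_def)
  define A where "A = ?V - P"
  have Am[measurable]: "A \<in> sets borel" unfolding A_def by measurable
  have AV: "A \<subseteq> ?V" by (auto simp: A_def)
  have "emeasure (transported_measure \<Omega> Ystar b0) A = 0"
  proof (rule transported_measure_null[OF \<Omega> Y(1) b0 Am])
    show "AE z in lborel. z \<in> \<Omega> \<times> Ystar \<longrightarrow> (fst z, snd z + b0 z) \<notin> A"
      using Qz b0_\<psi>
    proof eventually_elim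
      case (elim z)
      show ?case
      proof
        assume z: "z \<in> \<Omega> \<times> Ystar"
        then have "z \<in> \<Omega> \<times> unit_cell" using Y(2) by auto
        then have "(fst z, snd z + b0 z) \<in> Q" using elim z by auto
        then show "(fst z, snd z + b0 z) \<notin> A" using z by (auto simp: A_def P_def)
      qed
    qed
  qed
  then have T0: "measure (T \<Omega> Ystar) A = 0" by (simp add: measure_def T_def)
  have "integrable ?M (\<lambda>z. indicator A z * \<theta> z)"
    using integrable_mult_indicator[OF _ \<theta>i, of A] by simp
  moreover have "(LINT z|?M. indicator A z * \<theta> z) = 0"
  proof (rule antisym)
    show "(LINT z|?M. indicator A z * \<theta> z) \<le> 0" using upper[OF Am AV] T0 by simp
    show "0 \<le> (LINT z|?M. indicator A z * \<theta> z)" by (rule Bochner_Integration.integral_nonneg) (simp add: \<theta>0)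
  qed
  ultimately have "AE z in ?M. indicator A z * \<theta> z = 0"
    using integral_nonneg_eq_0_iff_AE[of ?M "\<lambda>z. indicator A z * \<theta> z"] \<theta>0 by simp
  then have vP: "AE z in ?M. v z = indicator P z * v z"
    using AE_slab_open_cell[OF K] v\<theta> by eventually_elim (auto simp: A_def indicator_def mem_Times_iff split: if_splits)
  define b where "b z = indicator P z * v z" for z
  have bm[measurable]: "b \<in> borel_measurable borel" unfolding b_def by measurable
  have b_zero: "b z = 0" if "z \<notin> \<Omega> \<times> unit_cell" for z
    using that P_sub by (auto simp: b_def indicator_def)
  have b_box: "b z = 0" if "z \<notin> ?V" for z
    using that by (auto simp: b_def indicator_def P_def)
  have bi: "integrable ?M (\<lambda>z. \<bar>b z\<bar> powr p)"
  proof -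
    have "AE z in ?M. \<bar>v z\<bar> powr p = \<bar>b z\<bar> powr p" using vP by eventually_elim (auto simp: b_def)
    from integrable_cong_AE[THEN iffD1, OF _ _ this vi] show ?thesis by simp
  qed
  have bp[measurable]: "(\<lambda>z. \<bar>b z\<bar> powr p) \<in> borel_measurable borel" by measurable
  define f where "f = (\<lambda>z. b (fst z, \<psi>0 (fst z) (snd z)))"
  define h where "h = (\<lambda>z. b (fst z, snd z + b0 z))"
  have hm[measurable]: "h \<in> borel_measurable borel" unfolding h_def by (rule measurable_compose[OF \<Psi> bm])
  have fh: "AE z in lborel. z \<in> \<Omega> \<times> Ystar \<longrightarrow> f z = h z"
    using b0_\<psi> by eventually_elim (simp add: f_def h_def)
  then have fh': "AE z in lborel. z \<in> \<Omega> \<times> Ystar \<longrightarrow> norm (f z) powr p = \<bar>h z\<bar> powr p"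
    by eventually_elim auto
  have "integrable lborel (\<lambda>z. indicator (\<Omega> \<times> Ystar) z *\<^sub>R \<bar>b (fst z, snd z + b0 z)\<bar> powr p)"
  proof (rule transported_integrable[OF \<Omega> Y(1) b0 _ finite_slab_measure[OF K Kb] c _ bp])
    show "c * measure (transported_measure \<Omega> Ystar b0) B \<le> measure ?M B"
      if "B \<in> sets borel" "B \<subseteq> ?V" for B using lower[OF that] by (simp add: T_def)
  qed (use fin bi b_box in \<open>auto simp: T_def\<close>)
  then have "integrable (lebesgue_on (\<Omega> \<times> Ystar)) (\<lambda>z. norm (f z) powr p)"
    using lebesgue_on_AE_eq(3)[OF _ OY fh'] by (simp add: h_def)
  moreover have "f \<in> borel_measurable (lebesgue_on (\<Omega> \<times> Ystar))" by (rule lebesgue_on_AE_eq(1)[OF hm OY fh])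
  ultimately have "f \<in> Lp p (\<Omega> \<times> Ystar)" by (simp add: Lp_def)
  moreover have "b (x, y) = f (x, inv_into (closure Ystar) (\<psi>0 x) y)" if "(x, y) \<in> limit_domain \<Omega> Ystar \<psi>0" for x y
  proof -
    have "y \<in> \<psi>0 x ` closure Ystar" using that closure_subset by (auto simp: limit_domain_def)
    then show ?thesis by (simp add: f_def f_inv_into_f)
  qed
  ultimately have "b \<in> Lp_limit_domain p \<Omega> Ystar \<psi>0" unfolding Lp_limit_domain_def by blast
  moreover have "AE z in lborel. ext0 (limit_domain \<Omega> Ystar \<psi>0) b z = b z"
    using Qz
  proof eventually_elim
    case (elim z)
    show ?case
    proof (cases "z \<in> P")
      case True
      then have "z \<in> limit_domain \<Omega> Ystar \<psi>0"
        using elim P_sub by (cases z) (auto simp: limit_domain_def P_def)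
      then show ?thesis by (simp add: ext0_def)
    qed (simp add: ext0_def b_def)
  qed
  ultimately show ?thesis
    using bm vP bi b_zero by (intro that[of b]) (auto simp: b_def)
qed

section \<open>Compactness for two-scale convergence on transformed domains\<close>

theorem theorem3p11:
  fixes p \<delta> :: real
    and \<epsilon> :: "nat \<Rightarrow> real"
    and \<Omega> Ystar :: "(real^'n) set"
    and \<psi> :: "nat \<Rightarrow> real^'n \<Rightarrow> real^'n"
    and \<psi>0 :: "real^'n \<Rightarrow> real^'n \<Rightarrow> real^'n"
    and u :: "nat \<Rightarrow> real^'n \<Rightarrow> real"
  assumes "1 < p" and "0 < \<delta>"
    and "\<And>n. 0 < \<epsilon> n" and "\<epsilon> \<longlonglongrightarrow> 0"
    and "open Ystar" and "Ystar \<subseteq> unit_cell" and "negligible (frontier Ystar)"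
    and "lipschitz_boundary (periodic_cell Ystar)"
    and "bounded \<Omega>" and "open \<Omega>" and "lipschitz_boundary \<Omega>"
    and "locally_periodic_transformations \<epsilon> \<Omega> Ystar \<psi> \<psi>0"
    and "\<And>n. u n \<in> Lp p (\<psi> n ` ref_domain \<Omega> Ystar (\<epsilon> n))"
    and "\<exists>C. \<forall>n. Lp_norm p (\<psi> n ` ref_domain \<Omega> Ystar (\<epsilon> n)) (u n) \<le> C"
  shows "\<exists>u0 r. u0 \<in> Lp_limit_domain p \<Omega> Ystar \<psi>0 \<and> strict_mono r \<and>
           two_scale_weak p (\<epsilon> \<circ> r) (nbhd \<delta> \<Omega>)
             (\<lambda>n. ext0 (\<psi> (r n) ` ref_domain \<Omega> Ystar (\<epsilon> (r n))) (u (r n)))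
             (ext0 (limit_domain \<Omega> Ystar \<psi>0) u0)"
proof -
  note p = assms(1) and \<epsilon> = assms(3,4) and Y = assms(5,6,7) and \<Omega> = assms(10,9)
  define E where "E n = ref_domain \<Omega> Ystar (\<epsilon> n)" for n
  define W where "W n = \<psi> n ` E n" for n
  obtain cJ where cJ: "cJ > 0" "\<And>n x. x \<in> E n \<Longrightarrow> cJ \<le> det (jac (\<psi> n) x)"
    using assms(12) unfolding locally_periodic_transformations_def E_def by blast
  obtain C0 where C0: "C0 > 0" "\<And>n x. x \<in> E n \<Longrightarrow> norm (\<psi> n x - x) / \<epsilon> n \<le> C0"
    "\<And>n x. x \<in> E n \<Longrightarrow> norm (jac (\<lambda>z. \<psi> n z - z) x) \<le> C0"
    using assms(12) unfolding locally_periodic_transformations_def E_def by blast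
  have diffeo: "C1_diffeo_cl (E n) (\<psi> n ` E n) (\<psi> n)" for n
    using assms(12) unfolding locally_periodic_transformations_def E_def by blast
  have \<psi>0: "\<psi>0 \<in> Linf_C1 \<Omega> Ystar (C1_cl Ystar)"
    and \<psi>0cell: "AE x in lebesgue_on \<Omega>. \<psi>0 x ` Ystar \<subseteq> unit_cell"
    using assms(12) unfolding locally_periodic_transformations_def by (auto elim!: eventually_mono)
  define a where "a n = ext0 (E n) (\<lambda>x. (\<psi> n x - x) /\<^sub>R \<epsilon> n)" for n
  define a0 where "a0 = ext0 (\<Omega> \<times> Ystar) (\<lambda>(x, y). \<psi>0 x y - y)"
  have strong: "two_scale_strong 2 \<epsilon> \<Omega> a a0"
    using assms(12) unfolding locally_periodic_transformations_def a_def[abs_def] a0_def E_def by simp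
  have \<Omega>m[measurable]: "\<Omega> \<in> sets borel" using \<Omega> by simp
  have E_open: "open (E n)" for n unfolding E_def by (rule open_ref_domain[OF \<Omega>(1) \<epsilon>(1)])
  have E_sub: "E n \<subseteq> \<Omega>" for n by (auto simp: E_def ref_domain_def)
  have E_bdd: "bounded (E n)" for n by (rule bounded_subset[OF \<Omega>(2) E_sub])
  obtain e0 where e0: "e0 > 0" "\<And>n. \<epsilon> n \<le> e0"
  proof -
    have "Bseq \<epsilon>" using \<epsilon>(2) by (intro convergent_imp_Bseq) (auto simp: convergent_def)
    then obtain B where "B > 0" "\<And>n. norm (\<epsilon> n) \<le> B" by (auto simp: Bseq_def)
    then have "\<epsilon> n \<le> B" for n by (metis abs_le_iff real_norm_def)
    then show ?thesis by (rule that[OF \<open>B > 0\<close>])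
  qed
  have disp: "norm (\<psi> n x - x) \<le> C0 * \<epsilon> n" if "x \<in> E n" for n x
    using C0(2)[OF that] \<epsilon>(1)[of n] by (simp add: field_simps)
  define C1 where "C1 = max (C0 * e0) C0"
  obtain d where d: "d > 0" "\<And>A :: real^'n^'n. norm A \<le> C1 + norm (mat 1 :: real^'n^'n) \<Longrightarrow> \<bar>det A\<bar> \<le> d"
    using det_bounded[of "C1 + norm (mat 1 :: real^'n^'n)"] by blast
  have disp1: "norm (\<psi> n x - x) \<le> C1" "norm (jac (\<lambda>z. \<psi> n z - z) x) \<le> C1" if "x \<in> E n" for n x
  proof -
    have "C0 * \<epsilon> n \<le> C0 * e0" using C0(1) e0(2)[of n] by (intro mult_left_mono) auto
    then show "norm (\<psi> n x - x) \<le> C1" using disp[OF that] by (simp add: C1_def)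
    show "norm (jac (\<lambda>z. \<psi> n z - z) x) \<le> C1" using C0(3)[OF that] by (simp add: C1_def)
  qed
  note image = C1_diffeo_cl_image_bounds[OF diffeo E_open E_bdd cJ(2) cJ(1) disp1 d(2), folded W_def]
  have W_open: "open (W n)" for n by (rule image(1))
  have W_bdd: "bounded (W n)" for n by (rule image(2))
  have Wm[measurable]: "W n \<in> sets borel" for n using W_open by (rule borel_open)
  define U where "U = nbhd \<delta> \<Omega>"
  have U: "open U" "bounded U" "\<Omega> \<subseteq> U"
  proof -
    have eq: "U = (\<Union>z\<in>\<Omega>. ball z \<delta>)" by (auto simp: U_def nbhd_def dist_commute)
    show "open U" unfolding eq by auto
    obtain R where R: "\<And>z. z \<in> \<Omega> \<Longrightarrow> norm z \<le> R" using \<Omega>(2) by (auto simp: bounded_iff)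
    have "norm x \<le> R + \<delta>" if xU: "x \<in> U" for x
    proof -
      obtain z where z: "z \<in> \<Omega>" "dist x z < \<delta>" using xU by (auto simp: U_def nbhd_def)
      have "norm x \<le> norm z + norm (x - z)" by (rule norm_triangle_sub)
      then show ?thesis using R[OF z(1)] z(2) by (simp add: dist_norm)
    qed
    then show "bounded U" unfolding bounded_iff by blast
    show "\<Omega> \<subseteq> U" unfolding eq using assms(2) by auto
  qed
  obtain R where R: "\<And>x. x \<in> U \<Longrightarrow> norm x \<le> R" using U(2) by (auto simp: bounded_iff)
  \<comment> \<open>Points of \<open>U\<close> come from cells whose base point is at most \<open>e0 * CARD('n)\<close> away.\<close>
  define K where "K = cball (0 :: real^'n) (R + e0 * CARD('n))"
  have K: "K \<in> sets borel" "bounded K" "U \<subseteq> K"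
  proof -
    have "norm x \<le> R + e0 * CARD('n)" if "x \<in> U" for x
      using R[OF that] mult_nonneg_nonneg[of e0 "real CARD('n)"] e0(1) by linarith
    then show "U \<subseteq> K" by (auto simp: K_def)
  qed (auto simp: K_def)
  have supp: "fst z \<in> K" if "snd z \<in> unit_cell" "unfold_map (\<epsilon> n) z \<in> U" for n z
  proof -
    have "norm (fst z) \<le> norm (unfold_map (\<epsilon> n) z) + norm (unfold_map (\<epsilon> n) z - fst z)"
      using norm_triangle_sub[of "fst z" "unfold_map (\<epsilon> n) z"] by (simp add: norm_minus_commute)
    also have "\<dots> \<le> R + \<epsilon> n * CARD('n)" by (intro add_mono R that(2) unfold_map_close that(1) \<epsilon>(1))
    also have "\<dots> \<le> R + e0 * CARD('n)" using e0(2)[of n] by (intro add_left_mono mult_right_mono) auto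
    finally show ?thesis by (simp add: K_def)
  qed
  have supp\<Omega>: "fst z \<in> K" if "snd z \<in> unit_cell" "unfold_map (\<epsilon> n) z \<in> \<Omega>" for n z
    using supp[OF that(1)] that(2) U(3) by blast
  have \<Omega>K: "\<Omega> \<subseteq> K" using U(3) K(3) by blast
  interpret finite_measure "slab_measure K" by (rule finite_slab_measure[OF K(1,2)])
  let ?M = "slab_measure K"
  let ?S = "\<lambda>n. unfold_map (\<epsilon> n) :: (real^'n) \<times> (real^'n) \<Rightarrow> real^'n"
  \<comment> \<open>The scaled displacements \<open>a n\<close>, for which \<open>\<psi>\<^sub>n(x) = x + \<epsilon>\<^sub>n a\<^sub>n(x)\<close> on the reference domain. The exponent
    \<open>q = 2\<close> in the strong convergence gives the Hilbert space argument.\<close>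
  have a_meas: "a n \<in> borel_measurable borel" for n
  proof -
    have "continuous_on (E n) (\<lambda>x. (\<psi> n x - x) /\<^sub>R \<epsilon> n)" by (intro continuous_intros image(3))
    then have "(\<lambda>x. indicator (E n) x *\<^sub>R ((\<psi> n x - x) /\<^sub>R \<epsilon> n)) \<in> borel_measurable borel"
      using E_open by (intro borel_measurable_continuous_on_indicator) auto
    moreover have "(\<lambda>x. indicator (E n) x *\<^sub>R ((\<psi> n x - x) /\<^sub>R \<epsilon> n)) = a n"
      by (auto simp: a_def ext0_def indicator_def fun_eq_iff)
    ultimately show ?thesis by simp
  qed
  have a_zero: "a n x = 0" if "x \<notin> \<Omega>" for n x using that E_sub[of n] by (auto simp: a_def ext0_def)
  have a_bound: "norm (a n x) \<le> C0" for n x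
    using C0(1) C0(2)[of x n] \<epsilon>(1)[of n] by (auto simp: a_def ext0_def divide_inverse mult.commute)
  have \<psi>_eq: "x + \<epsilon> n *\<^sub>R a n x = \<psi> n x" if "x \<in> E n" for n x
    using that \<epsilon>(1)[of n] by (simp add: a_def ext0_def)
  have "a0 \<in> borel_measurable (lebesgue_on (\<Omega> \<times> unit_cell))"
    using strong by (simp add: two_scale_strong_def two_scale_weak_def Lp_def)
  then obtain b0 where b0[measurable]: "b0 \<in> borel_measurable borel"
    and b0_eq: "AE z in lborel. z \<in> \<Omega> \<times> unit_cell \<longrightarrow> b0 z = a0 z"
    and b0_zero: "\<And>z. z \<notin> \<Omega> \<times> unit_cell \<Longrightarrow> b0 z = 0" and b0_bound: "\<And>z. norm (b0 z) \<le> CARD('n)"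
    and b0_\<psi>: "AE z in lborel. z \<in> \<Omega> \<times> Ystar \<longrightarrow> snd z + b0 z = \<psi>0 (fst z) (snd z)"
    and b0_cell: "AE z in lborel. z \<in> \<Omega> \<times> Ystar \<longrightarrow> snd z + b0 z \<in> unit_cell"
    using limit_displacement_representative[OF \<Omega> Y(2) \<psi>0cell] unfolding a0_def by blast
  define C where "C = max C0 (real CARD('n))"
  have aC: "norm (a n x) \<le> C" and bC: "norm (b0 z) \<le> C" for n x z
    using a_bound[of n x] b0_bound[of z] by (auto simp: C_def)
  have L1: "(\<lambda>n. LINT z|?M. norm (a n (?S n z) - b0 z)) \<longlonglongrightarrow> 0"
    by (rule two_scale_strong_unfold[OF \<epsilon> \<Omega> K(1,2) \<Omega>K supp\<Omega> strong a_meas a_zero aC b0 b0_eq b0_zero bC])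
  \<comment> \<open>Borel representatives \<open>f n\<close> of the extensions of \<open>u n\<close> by zero.\<close>
  obtain Cu where Cu: "\<And>n. Lp_norm p (W n) (u n) \<le> Cu" using assms(14) by (auto simp: W_def E_def)
  have uLp: "u n \<in> Lp p (W n)" for n using assms(13)[of n] by (simp add: W_def E_def)
  have "\<exists>f. f \<in> borel_measurable borel \<and> (AE x in lborel. x \<in> W n \<longrightarrow> f x = u n x) \<and> (\<forall>x. x \<notin> W n \<longrightarrow> f x = 0)" for n
  proof -
    have um: "u n \<in> borel_measurable (lebesgue_on (W n))" using uLp[of n] by (simp add: Lp_def)
    obtain f where "f \<in> borel_measurable borel" "AE x in lborel. x \<in> W n \<longrightarrow> f x = u n x" "\<And>x. x \<notin> W n \<Longrightarrow> f x = 0"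
      by (rule borel_representative[OF um Wm]) blast
    then show ?thesis by blast
  qed
  then have "\<exists>f. \<forall>n. f n \<in> borel_measurable borel \<and> (AE x in lborel. x \<in> W n \<longrightarrow> f n x = u n x) \<and> (\<forall>x. x \<notin> W n \<longrightarrow> f n x = 0)"
    by (intro choice allI)
  then obtain f where "\<forall>n. f n \<in> borel_measurable borel \<and> (AE x in lborel. x \<in> W n \<longrightarrow> f n x = u n x) \<and> (\<forall>x. x \<notin> W n \<longrightarrow> f n x = 0)" ..
  then have f[measurable]: "f n \<in> borel_measurable borel" and fu: "AE x in lborel. x \<in> W n \<longrightarrow> f n x = u n x"
    and f_zero: "x \<notin> W n \<Longrightarrow> f n x = 0" for n x by blast+
  have fW: "indicator (W n) x *\<^sub>R \<bar>f n x\<bar> powr p = \<bar>f n x\<bar> powr p" for n x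
    using f_zero[of x n] by (cases "x \<in> W n") auto
  have fu': "AE x in lborel. x \<in> W n \<longrightarrow> norm (u n x) powr p = \<bar>f n x\<bar> powr p" for n
    using fu[of n] by eventually_elim auto
  have fi: "integrable lborel (\<lambda>x. \<bar>f n x\<bar> powr p)" for n
    using lebesgue_on_AE_eq(3)[OF _ Wm fu'[of n]] uLp[of n] unfolding fW by (simp add: Lp_def)
  have fC: "(LINT x|lborel. \<bar>f n x\<bar> powr p) \<le> Cu powr p" for n
    using lebesgue_on_AE_eq(2)[OF _ Wm fu'[of n]] Lp_norm_bound_imp_integral_bound[OF p Cu[of n]] unfolding fW by simp
  \<comment> \<open>For large \<open>n\<close> the displacements are smaller than \<open>\<delta>\<close>; the finitely many other indices are dropped.\<close>
  obtain n0 where n0: "\<And>n. n \<ge> n0 \<Longrightarrow> W n \<subseteq> U"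
  proof -
    have "(\<lambda>n. C0 * \<epsilon> n) \<longlonglongrightarrow> C0 * 0" by (intro tendsto_intros \<epsilon>(2))
    then have "eventually (\<lambda>n. C0 * \<epsilon> n < \<delta>) sequentially" using assms(2) by (intro order_tendstoD(2)) auto
    then obtain m where m: "\<And>n. n \<ge> m \<Longrightarrow> C0 * \<epsilon> n < \<delta>" by (auto simp: eventually_sequentially)
    have "W n \<subseteq> U" if "n \<ge> m" for n
    proof
      fix y assume "y \<in> W n"
      then obtain x where x: "x \<in> E n" "y = \<psi> n x" by (auto simp: W_def)
      have "dist y x < \<delta>" using disp[OF x(1)] m[OF that] by (simp add: x(2) dist_norm)
      then show "y \<in> U" using x(1) E_sub[of n] by (auto simp: U_def nbhd_def)
    qed
    then show ?thesis by (rule that)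
  qed
  have WK: "fst z \<in> K" if "n \<ge> n0" "snd z \<in> unit_cell" "?S n z \<in> W n" for n z
    using supp[OF that(2)] n0[OF that(1)] that(3) by blast
  \<comment> \<open>The unfolded functions, and the unfolded indicator functions of the transformed domains.\<close>
  define g where "g k z = f (k + n0) (?S (k + n0) z)" for k z
  define ch where "ch k z = (indicator (W (k + n0)) (?S (k + n0) z) :: real)" for k z
  have gm: "g k \<in> borel_measurable ?M" for k
  proof -
    have "g k \<in> borel_measurable borel" unfolding g_def by measurable
    then show ?thesis by simp
  qed
  have chm: "ch k \<in> borel_measurable ?M" for k
  proof -
    have "ch k \<in> borel_measurable borel" unfolding ch_def by (rule measurable_compose[OF measurable_unfold_map]) measurable
    then show ?thesis by simp
  qed
  have gi: "integrable ?M (\<lambda>z. \<bar>g k z\<bar> powr p)" for k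
    unfolding g_def by (rule integrable_unfold_slab[OF fi _ K(1) \<epsilon>(1)]) measurable
  have gC: "(LINT z|?M. \<bar>g k z\<bar> powr p) \<le> Cu powr p" for k
  proof -
    have "(LINT x|lborel. \<bar>f (k + n0) x\<bar> powr p) = (LINT z|?M. \<bar>g k z\<bar> powr p)"
      unfolding g_def
    proof (rule integral_eq_slab[OF _ K(1) \<epsilon>(1)])
      fix z :: "(real^'n) \<times> (real^'n)" assume z: "snd z \<in> unit_cell" "\<bar>f (k + n0) (?S (k + n0) z)\<bar> powr p \<noteq> 0"
      then have "?S (k + n0) z \<in> W (k + n0)" using f_zero by force
      then show "fst z \<in> K" using WK[of "k + n0" z] z(1) by simp
    qed measurable
    then show ?thesis using fC[of "k + n0"] by simp
  qed
  obtain r1 v where r1: "strict_mono r1" and v: "v \<in> borel_measurable ?M" "integrable ?M (\<lambda>z. \<bar>v z\<bar> powr p)"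
    and wv: "weakly_tendsto ?M (\<lambda>n. g (r1 n)) v"
    by (rule weakly_convergent_subsequence[OF finite_measure_axioms sets_slab_measure p gm gi gC])
  have ch01: "ch k z = 0 \<or> ch k z = 1" for k z by (auto simp: ch_def indicator_def)
  have ch0: "0 \<le> ch k z" for k z by (simp add: ch_def)
  have chi: "integrable ?M (\<lambda>z. \<bar>ch k z\<bar> powr 2)" for k
  proof (rule integrable_const_bound[where B = 1])
    have "norm (\<bar>ch k z\<bar> powr 2) \<le> 1" for z using ch01[of k z] by auto
    then show "AE z in ?M. norm (\<bar>ch k z\<bar> powr 2) \<le> 1" by (intro AE_I2)
  qed (use chm in measurable)
  have chC: "(LINT z|?M. \<bar>ch k z\<bar> powr 2) \<le> measure ?M UNIV" for k
  proof -
    have "(LINT z|?M. \<bar>ch k z\<bar> powr 2) \<le> (LINT z|?M. 1)"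
    proof (rule integral_mono[OF chi])
      show "\<bar>ch k z\<bar> powr 2 \<le> 1" for z using ch01[of k z] by auto
    qed simp
    then show ?thesis by simp
  qed
  have "(1::real) < 2" by simp
  note weakly_convergent_subsequence_nonneg[where w = "\<lambda>k. ch (r1 k)",
    OF finite_measure_axioms sets_slab_measure this chm ch0 chi chC]
  then obtain r2 \<theta> where r2: "strict_mono r2" and \<theta>: "\<theta> \<in> borel_measurable ?M" "integrable ?M (\<lambda>z. \<bar>\<theta> z\<bar> powr 2)" "\<And>z. 0 \<le> \<theta> z"
    and w\<theta>: "weakly_tendsto ?M (\<lambda>n. ch (r1 (r2 n))) \<theta>"
    by blast
  have wv2: "weakly_tendsto ?M (\<lambda>n. g (r1 (r2 n))) v"
    using weakly_tendsto_subseq[OF wv r2] by simp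
  \<comment> \<open>One subsequence for both weak limits.\<close>
  define r where "r n = r1 (r2 n) + n0" for n
  have r: "strict_mono r" using r1 r2 by (auto simp: r_def strict_mono_def)
  have rn0: "n0 \<le> r n" for n by (simp add: r_def)
  have ch_r: "ch (r1 (r2 n)) = (\<lambda>z. indicator (W (r n)) (?S (r n) z))" for n by (simp add: ch_def r_def fun_eq_iff)
  have g_r: "g (r1 (r2 n)) = (\<lambda>z. f (r n) (?S (r n) z))" for n by (simp add: g_def r_def fun_eq_iff)
  have \<epsilon>r: "\<And>n. 0 < \<epsilon> (r n)" "(\<lambda>n. \<epsilon> (r n)) \<longlonglongrightarrow> 0"
    using \<epsilon>(1) LIMSEQ_subseq_LIMSEQ[OF \<epsilon>(2) r] by (auto simp: o_def)
  have \<theta>m: "\<theta> \<in> borel_measurable borel" and vm: "v \<in> borel_measurable borel" using \<theta>(1) v(1) by simp_all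
  have \<theta>i: "integrable ?M \<theta>" using integrable_of_powr[OF \<theta>(1) _ \<theta>(2)] by simp
  have vi: "integrable ?M v" using integrable_of_powr[OF v(1) p v(2)] .
  have L1r: "(\<lambda>n. LINT z|?M. norm (a (r n) (?S (r n) z) - b0 z)) \<longlonglongrightarrow> 0"
    using LIMSEQ_subseq_LIMSEQ[OF L1 r] by (simp add: o_def)
  have E_eq: "indicator (ref_domain \<Omega> Ystar (\<epsilon> n)) x * F (x + \<epsilon> n *\<^sub>R a n x) = indicator (E n) x * (F (\<psi> n x) :: real)" for n x and F :: "real^'n \<Rightarrow> real"
    using \<psi>_eq[of x n] by (cases "x \<in> E n") (auto simp: E_def)
  have lower: "cJ * (LINT x|lborel. indicator (ref_domain \<Omega> Ystar (\<epsilon> (r n))) x * F (x + \<epsilon> (r n) *\<^sub>R a (r n) x))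
      \<le> (LINT x|lborel. indicator (W (r n)) x * F x)"
    if "F \<in> borel_measurable borel" "\<And>x. 0 \<le> F x \<and> F x \<le> 1" for n and F :: "real^'n \<Rightarrow> real"
    unfolding E_eq by (rule image(4)) (use that in auto)
  have upper: "(LINT x|lborel. indicator (W (r n)) x * F x)
      \<le> d * (LINT x|lborel. indicator (ref_domain \<Omega> Ystar (\<epsilon> (r n))) x * F (x + \<epsilon> (r n) *\<^sub>R a (r n) x))"
    if "F \<in> borel_measurable borel" "\<And>x. 0 \<le> F x \<and> F x \<le> 1" for n and F :: "real^'n \<Rightarrow> real"
    unfolding E_eq by (rule image(5)) (use that in auto)
  note raw = limit_density_bounds[where \<epsilon> = "\<lambda>n. \<epsilon> (r n)" and a = "\<lambda>n. a (r n)" and W = "\<lambda>n. W (r n)",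
    OF \<epsilon>r \<Omega> K(1,2) \<Omega>K supp\<Omega> Y a_meas aC b0 bC L1r b0_cell W_open W_bdd WK[OF rn0] lower upper cJ(1) d(1)
      \<theta>m \<theta>(3) \<theta>i w\<theta>[unfolded ch_r]]
  have bounds: "cJ * measure (transported_measure \<Omega> Ystar b0) A \<le> measure ?M A"
    "(LINT z|?M. indicator A z * \<theta> z) \<le> d * measure (transported_measure \<Omega> Ystar b0) A"
    "finite_measure (transported_measure \<Omega> Ystar b0)"
    if A: "A \<in> sets borel" "A \<subseteq> UNIV \<times> box 0 1" for A
    by (rule raw[OF _ _ _ _ _ _ _ _ A]; assumption | fastforce)+
  have fin: "finite_measure (transported_measure \<Omega> Ystar b0)" by (rule bounds(3)[OF sets.empty_sets]) simp
  have v\<theta>: "AE z in ?M. \<theta> z = 0 \<longrightarrow> v z = 0"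
  proof (rule weak_limit_zero_where_density_zero[OF finite_measure_axioms p gm gi gC chm ch01 _ v(1) vi \<theta>(1) wv2 w\<theta>])
    show "g (r1 (r2 n)) z = 0" if "ch (r1 (r2 n)) z = 0" for n z
      using that f_zero by (auto simp: g_def ch_def indicator_def split: if_splits)
  qed
  obtain b where b: "b \<in> borel_measurable borel" "AE z in ?M. v z = b z" "integrable ?M (\<lambda>z. \<bar>b z\<bar> powr p)"
    and b_zero: "\<And>z. z \<notin> \<Omega> \<times> unit_cell \<Longrightarrow> b z = 0" and bLp: "b \<in> Lp_limit_domain p \<Omega> Ystar \<psi>0"
    and b_ext: "AE z in lborel. ext0 (limit_domain \<Omega> Ystar \<psi>0) b z = b z"
    by (rule weak_limit_supported_in_limit_domain[OF \<Omega>(1) Y(1,2) K(1,2) \<psi>0 b0 b0_\<psi> fin cJ(1) bounds(1,2) \<theta>m \<theta>(3) \<theta>i vm v(2) v\<theta>]; (assumption | blast))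
  have wb: "weakly_tendsto ?M (\<lambda>n z. f (r n) (?S (r n) z)) b"
  proof (rule weakly_tendsto_cong_AE[OF _ b(2) v(1)])
    show "weakly_tendsto ?M (\<lambda>n z. f (r n) (?S (r n) z)) v" using wv2 unfolding g_r .
  qed (use b(1) in simp)
  have "two_scale_weak p (\<lambda>n. \<epsilon> (r n)) U (\<lambda>n. ext0 (W (r n)) (u (r n))) (ext0 (limit_domain \<Omega> Ystar \<psi>0) b)"
  proof (rule two_scale_weak_of_unfolded[OF \<epsilon>r U(1,2) K supp p f _ fi fC _ b(1) _ b(3) _ wb])
    show "f (r n) x = 0" if "x \<notin> U" for n x using f_zero n0[OF rn0[of n]] that by blast
    show "AE x in lborel. x \<in> U \<longrightarrow> ext0 (W (r n)) (u (r n)) x = f (r n) x" for n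
      using fu[of "r n"] by eventually_elim (use f_zero in \<open>auto simp: ext0_def\<close>)
    show "b z = 0" if "z \<notin> U \<times> unit_cell" for z using b_zero[of z] that U(3) by blast
    show "AE z in lborel. z \<in> U \<times> unit_cell \<longrightarrow> ext0 (limit_domain \<Omega> Ystar \<psi>0) b z = b z"
      using b_ext by eventually_elim simp
  qed
  then show ?thesis using bLp r by (auto simp: W_def E_def U_def o_def)
qed

end
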